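(* Let $\omega\in\mathcal{E}$, $1<p<\infty$ and $p'=p/(p-1)$. The dual space of $A^p(\omega^{p/2})$ can be identified, with equivalent norms, with $A^{p'}(\omega^{p'/2})$ under the integral pairing $$\langle f,g\rangle_\omega=\int_{\mathbb{D}}f(z)\,\overline{g(z)}\,\omega(z)\,dA(z).$$ That is, for each $g\in A^{p'}(\omega^{p'/2})$ the functional $\Lambda_g(f)=\langle f,g\rangle_\omega$ is bounded on $A^p(\omega^{p/2})$; every bounded linear functional on $A^p(\omega^{p/2})$ is equal to $\Lambda_g$ for a unique $g\in A^{p'}(\omega^{p'/2})$; and $\|\Lambda_g\|\asymp\|g\|_{A^{p'}(\omega^{p'/2})}$ with constants independent of $g$.
   Context: $\mathbb{D}$ is the open unit disk in $\mathbb{C}$, $dA=\frac{dx\,dy}{\pi}$ is normalized area measure, and $H(\mathbb{D})$ is the space of analytic functions on $\mathbb{D}$. A weight is a positive function $\omega\in L^1(\mathbb{D},dA)$. The notation $a\asymp b$ means that $C^{-1}b\le a\le Cb$ for some constant $C>0$ independent of the variables. Class $\mathcal{L}$: a positive function $\tau$ on $\mathbb{D}$ is in $\mathcal{L}$ if (A) there is a constant $c_1$ with $\tau(z)\le c_1(1-|z|)$ for all $z\in\mathbb{D}$, and (B) there is a constant $c_2$ with $|\tau(z)-\tau(\zeta)|\le c_2|z-\zeta|$ for all $z,\zeta\in\mathbb{D}$. Class $\mathcal{L}^*$: a weight $\omega$ is in $\mathcal{L}^*$ if $\omega=e^{-2\varphi}$ with $\varphi\in C^2(\mathbb{D})$,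 $\Delta\varphi>0$ ($\Delta$ is the classical Laplacian), and $(\Delta\varphi(z))^{-1/2}\asymp\tau(z)$ on $\mathbb{D}$ for some $\tau\in\mathcal{L}$, called the associated function of $\omega$. Class $\mathcal{E}$: a weight $\omega$ is in $\mathcal{E}$ if $\omega\in\mathcal{L}^*$ and its associated function $\tau$ satisfies: for each $m\ge1$ there are constants $b_m>0$ and $0<t_m<1/m$ such that $\tau(z)\le\tau(\xi)+t_m|z-\xi|$ for all $z,\xi\in\mathbb{D}$ with $|z-\xi|>b_m\tau(\xi)$. For $1\le q<\infty$, $A^q(\omega^{q/2})$ is the Banach space of $f\in H(\mathbb{D})$ with $\|f\|_{A^q(\omega^{q/2})}^q=\int_{\mathbb{D}}|f|^q\omega^{q/2}\,dA<\infty$. *)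

theory Defs
  imports "HOL-Analysis.Analysis"
begin

abbreviation unit_disk :: "complex set" where
  "unit_disk \<equiv> ball 0 1"

definition disk_area :: "complex measure" where
  "disk_area = density (lebesgue_on unit_disk) (\<lambda>_. ennreal (1 / pi))"

definition comparable_on :: "'a set \<Rightarrow> ('a \<Rightarrow> real) \<Rightarrow> ('a \<Rightarrow> real) \<Rightarrow> bool" where
  "comparable_on S a b \<longleftrightarrow> (\<exists>C>0. \<forall>x\<in>S. inverse C * b x \<le> a x \<and> a x \<le> C * b x)"

text \<open>On \<open>complex\<close> the set \<open>Basis\<close> is \<open>{1, \<i>}\<close>, so the derivatives below are the usual
  partial derivatives in \<open>x\<close> and \<open>y\<close>.\<close>

definition partial_deriv :: "'a::euclidean_space \<Rightarrow> ('a \<Rightarrow> real) \<Rightarrow> 'a \<Rightarrow> real" where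
  "partial_deriv b u z = deriv (\<lambda>t. u (z + t *\<^sub>R b)) 0"

definition C1_on :: "'a::euclidean_space set \<Rightarrow> ('a \<Rightarrow> real) \<Rightarrow> bool" where
  "C1_on S u \<longleftrightarrow> continuous_on S u \<and>
     (\<forall>b\<in>Basis. (\<forall>z\<in>S. (\<lambda>t::real. u (z + t *\<^sub>R b)) differentiable (at 0)) \<and>
                continuous_on S (partial_deriv b u))"

definition C2_on :: "'a::euclidean_space set \<Rightarrow> ('a \<Rightarrow> real) \<Rightarrow> bool" where
  "C2_on S u \<longleftrightarrow> C1_on S u \<and> (\<forall>b\<in>Basis. C1_on S (partial_deriv b u))"

definition laplacian :: "('a::euclidean_space \<Rightarrow> real) \<Rightarrow> 'a \<Rightarrow> real" where
  "laplacian u z = (\<Sum>b\<in>Basis. partial_deriv b (partial_deriv b u) z)"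

text \<open>Weights and their associated functions are total functions on \<open>complex\<close>; their values
  outside the disk are unconstrained and play no role.\<close>

definition weight :: "(complex \<Rightarrow> real) \<Rightarrow> bool" where
  "weight \<omega> \<longleftrightarrow> (\<forall>z\<in>unit_disk. \<omega> z > 0) \<and> integrable disk_area \<omega>"

definition class_L :: "(complex \<Rightarrow> real) set" where
  "class_L = {\<tau>. (\<forall>z\<in>unit_disk. \<tau> z > 0) \<and>
     (\<exists>c\<^sub>1. \<forall>z\<in>unit_disk. \<tau> z \<le> c\<^sub>1 * (1 - cmod z)) \<and>
     (\<exists>c\<^sub>2. \<forall>z\<in>unit_disk. \<forall>\<zeta>\<in>unit_disk. \<bar>\<tau> z - \<tau> \<zeta>\<bar> \<le> c\<^sub>2 * cmod (z - \<zeta>))}"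

text \<open>The relation ``\<open>\<tau>\<close> is an associated function of \<open>\<omega>\<close>''. An associated function is
  determined only up to comparability.\<close>

definition associated_function :: "(complex \<Rightarrow> real) \<Rightarrow> (complex \<Rightarrow> real) \<Rightarrow> bool" where
  "associated_function \<omega> \<tau> \<longleftrightarrow> \<tau> \<in> class_L \<and>
     (\<exists>\<phi>. C2_on unit_disk \<phi> \<and>
          (\<forall>z\<in>unit_disk. \<omega> z = exp (- 2 * \<phi> z)) \<and>
          (\<forall>z\<in>unit_disk. laplacian \<phi> z > 0) \<and>
          comparable_on unit_disk (\<lambda>z. laplacian \<phi> z powr (- 1 / 2)) \<tau>)"

definition class_L_star :: "(complex \<Rightarrow> real) set" where
  "class_L_star = {\<omega>. weight \<omega> \<and> (\<exists>\<tau>. associated_function \<omega> \<tau>)}"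

definition class_E :: "(complex \<Rightarrow> real) set" where
  "class_E = {\<omega>. \<omega> \<in> class_L_star \<and>
     (\<exists>\<tau>. associated_function \<omega> \<tau> \<and>
        (\<forall>m::nat. 1 \<le> m \<longrightarrow>
           (\<exists>b>0. \<exists>t>0. t < 1 / real m \<and>
              (\<forall>z\<in>unit_disk. \<forall>\<xi>\<in>unit_disk.
                 b * \<tau> \<xi> < cmod (z - \<xi>) \<longrightarrow> \<tau> z \<le> \<tau> \<xi> + t * cmod (z - \<xi>)))))}"

text \<open>\<open>bergman q \<omega>\<close> is the space $A^q(\omega^{q/2})$, used for $1 \le q < \infty$. An analytic
  function on the disk is represented by its extension by zero to \<open>complex\<close>, so that equality of
  elements is equality of functions.\<close>

definition bergman :: "real \<Rightarrow> (complex \<Rightarrow> real) \<Rightarrow> (complex \<Rightarrow> complex) set" where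
  "bergman q \<omega> = {f. f holomorphic_on unit_disk \<and> (\<forall>z. z \<notin> unit_disk \<longrightarrow> f z = 0) \<and>
     integrable disk_area (\<lambda>z. cmod (f z) powr q * \<omega> z powr (q / 2))}"

definition bergman_norm :: "real \<Rightarrow> (complex \<Rightarrow> real) \<Rightarrow> (complex \<Rightarrow> complex) \<Rightarrow> real" where
  "bergman_norm q \<omega> f =
     (\<integral>z. cmod (f z) powr q * \<omega> z powr (q / 2) \<partial>disk_area) powr (1 / q)"

definition pairing ::
  "(complex \<Rightarrow> real) \<Rightarrow> (complex \<Rightarrow> complex) \<Rightarrow> (complex \<Rightarrow> complex) \<Rightarrow> complex" where
  "pairing \<omega> f g = (\<integral>z. f z * cnj (g z) * of_real (\<omega> z) \<partial>disk_area)"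

definition bergman_dual :: "real \<Rightarrow> (complex \<Rightarrow> real) \<Rightarrow> ((complex \<Rightarrow> complex) \<Rightarrow> complex) set" where
  "bergman_dual q \<omega> = {\<Lambda>.
     (\<forall>f\<in>bergman q \<omega>. \<forall>h\<in>bergman q \<omega>. \<Lambda> (\<lambda>z. f z + h z) = \<Lambda> f + \<Lambda> h) \<and>
     (\<forall>c. \<forall>f\<in>bergman q \<omega>. \<Lambda> (\<lambda>z. c * f z) = c * \<Lambda> f) \<and>
     (\<exists>C. \<forall>f\<in>bergman q \<omega>. cmod (\<Lambda> f) \<le> C * bergman_norm q \<omega> f)}"

definition dual_norm ::
  "real \<Rightarrow> (complex \<Rightarrow> real) \<Rightarrow> ((complex \<Rightarrow> complex) \<Rightarrow> complex) \<Rightarrow> real" where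
  "dual_norm q \<omega> \<Lambda> = (SUP f \<in> {f \<in> bergman q \<omega>. bergman_norm q \<omega> f \<le> 1}. cmod (\<Lambda> f))"

end

theory Submission
  imports Defs "HOL-Complex_Analysis.Complex_Analysis" "HOL-Real_Asymp.Real_Asymp"
begin

text \<open>On \<open>L\<^sup>2(\<omega> dA)\<close> let \<open>T g = (g\<^sub>x - \<i> g\<^sub>y) / \<omega>\<close> for compactly supported \<open>g\<close>. Integration by parts gives
  \<open>2 \<integral> \<Delta>\<phi> |g|\<^sup>2 / \<omega> \<le> \<parallel>T g\<parallel>\<^sup>2\<close>, and by Weyl's lemma the orthogonal complement of the range of \<open>T\<close> is
  \<open>A\<^sup>2(\<omega>)\<close>. Hence \<open>u - P u\<close> is a limit of functions \<open>T g\<^sub>n\<close>, and the estimate can be conjugated with any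
  \<open>\<rho> > 0\<close> with \<open>4 |\<nabla>\<rho>| \<le> \<rho> (\<Delta>\<phi>)\<^sup>1\<^sup>/\<^sup>2\<close>: this yields \<open>\<parallel>\<rho> P u\<parallel> \<le> 4 \<parallel>\<rho> u\<parallel>\<close>. The growth condition of class
  \<open>\<E>\<close> says that \<open>\<sigma>\<^sub>w(z) = 1 / (L\<^sup>2 \<tau>(w)\<^sup>2 + |z - w|\<^sup>2)\<close> is such a \<open>\<rho>\<close>. Together with a submean value property of
  \<open>|f| \<omega>\<^sup>1\<^sup>/\<^sup>2\<close> on discs of radius \<open>\<delta> \<tau>\<close> this gives \<open>\<integral> |K\<^sub>z| \<omega>\<^sup>1\<^sup>/\<^sup>2 dA \<le> C \<omega>(z)\<^sup>-\<^sup>1\<^sup>/\<^sup>2\<close> for the Bergman kernel, so by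
  Schur's test \<open>P\<close> is bounded on every \<open>L\<^sup>p(\<omega>\<^sup>p\<^sup>/\<^sup>2)\<close>. Averaging the weighted estimates over \<open>w\<close> shows that
  \<open>P f = f\<close> also for \<open>f\<close> in \<open>A\<^sup>p(\<omega>\<^sup>p\<^sup>/\<^sup>2)\<close>.
  The lower bound for \<open>\<parallel>\<Lambda>\<^sub>g\<parallel>\<close> follows by testing with \<open>P\<close> of truncations of \<open>|g|\<^sup>p\<^sup>'\<^sup>-\<^sup>2 g \<omega>\<^sup>p\<^sup>'\<^sup>/\<^sup>2\<^sup>-\<^sup>1\<close> to compact
  discs. A functional \<open>\<Lambda>\<close> is represented by a locally uniform limit, as \<open>R \<rightarrow> 1\<close>, of the Riesz
  representers in \<open>A\<^sup>2(\<omega>)\<close> of \<open>f \<mapsto> \<Lambda> (P f\<^sub>R)\<close>, where \<open>f\<^sub>R\<close> is \<open>f\<close> truncated to \<open>|z| \<le> R\<close>.\<close>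

text \<open>Two obstacles shape the argument. The function \<open>\<phi>\<close> is only of class
  C^2, so derivatives are taken in one real direction at a time (\<open>pd\<close>), and the
  dbar-equation is used in weak form, tested with explicit polynomial bumps. And for p < 2 the space
  A^p need not lie in A^2, so P f = f is not part of the Hilbert space theory. There only f
  omega^(1/2) tau is square integrable; to pair such an f with u - P u, one has to know that (u - P
  u) omega^(1/2) / tau is square integrable, for u of compact support.

  The first power of sigma_w suffices because the dimension is two. On one side |grad sigma_w| is at
  most 2 sigma_w^(3/2), so sigma_w is admissible as soon as 64 sigma_w is below the Laplacian of
  phi, which allows tau to grow linearly with small slope. On the other side the integral of
  sigma_w^2 is of order 1 / (L tau(w))^2, so that Cauchy-Schwarz converts the L^2 decay of the
  kernel into its L^1 bound with all powers of tau cancelling.\<close>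

abbreviation \<mu> :: "complex measure" where "\<mu> \<equiv> disk_area"
abbreviation \<D> :: "complex set" where "\<D> \<equiv> unit_disk"

lemmas lint_cong = Bochner_Integration.integral_cong
  and integrable_transfer = Bochner_Integration.integrable_cong[THEN iffD1, rotated -1]
  and integrable_dominated = Bochner_Integration.integrable_bound

section \<open>Directional derivatives and integration by parts\<close>

text \<open>The direction \<open>b\<close> is fixed and continuity of both functions is part of the
  notion: this is what \<open>C2_on\<close> provides, it is stable under sums, products and
  composition, and it is what integration by parts along \<open>b\<close> uses.\<close>

definition pd :: "complex \<Rightarrow> complex set \<Rightarrow> (complex \<Rightarrow> 'b::real_normed_vector) \<Rightarrow> (complex \<Rightarrow> 'b) \<Rightarrow> bool" where
  "pd b S f f' \<longleftrightarrow> continuous_on S f \<and> continuous_on S f' \<and>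
     (\<forall>z\<in>S. ((\<lambda>t::real. f (z + t *\<^sub>R b)) has_vector_derivative f' z) (at 0))"

lemma pdD: "pd b S f f' \<Longrightarrow> z \<in> S \<Longrightarrow> ((\<lambda>t::real. f (z + t *\<^sub>R b)) has_vector_derivative f' z) (at 0)"
  and pd_cont0: "pd b S f f' \<Longrightarrow> continuous_on S f"
  and pd_cont: "pd b S f f' \<Longrightarrow> continuous_on S f'"
  by (auto simp: pd_def)

lemma pd_shift:
  assumes "pd b S f f'" "z + s *\<^sub>R b \<in> S"
  shows "((\<lambda>t::real. f (z + t *\<^sub>R b)) has_vector_derivative f' (z + s *\<^sub>R b)) (at s)"
proof -
  have 1: "((\<lambda>t::real. f (z + s *\<^sub>R b + t *\<^sub>R b)) has_vector_derivative f' (z + s *\<^sub>R b)) (at (s - s))"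
    using pdD[OF assms] by simp
  have "((\<lambda>t::real. t - s) has_vector_derivative 1) (at s)"
    by (auto intro!: derivative_eq_intros)
  from vector_diff_chain_at[OF this 1]
  have "(((\<lambda>t. f (z + s *\<^sub>R b + t *\<^sub>R b)) \<circ> (\<lambda>t. t - s)) has_vector_derivative f' (z + s *\<^sub>R b)) (at s)" by simp
  moreover have "((\<lambda>t. f (z + s *\<^sub>R b + t *\<^sub>R b)) \<circ> (\<lambda>t. t - s)) = (\<lambda>t. f (z + t *\<^sub>R b))"
    by (auto simp: algebra_simps fun_eq_iff)
  ultimately show ?thesis by simp
qed

lemma has_vector_derivative_iff_quotient:
  "(f has_vector_derivative D) (at x) \<longleftrightarrow> ((\<lambda>h. (1/h) *\<^sub>R (f (x + h) - f x)) \<longlongrightarrow> D) (at 0)"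
proof -
  have "(f has_vector_derivative D) (at x) \<longleftrightarrow> ((\<lambda>h. norm (f (x + h) - f x - h *\<^sub>R D) / norm h) \<longlongrightarrow> 0) (at 0)"
    by (simp add: has_vector_derivative_def has_derivative_at bounded_linear_scaleR_left)
  also have "\<dots> \<longleftrightarrow> ((\<lambda>h. norm ((1/h) *\<^sub>R (f (x + h) - f x) - D)) \<longlongrightarrow> 0) (at 0)"
  proof (rule tendsto_cong)
    have "norm (f (x + h) - f x - h *\<^sub>R D) / norm h = norm ((1/h) *\<^sub>R (f (x + h) - f x) - D)" if "h \<noteq> 0" for h
    proof -
      have "(1/h) *\<^sub>R (f (x + h) - f x) - D = (1/h) *\<^sub>R (f (x + h) - f x - h *\<^sub>R D)"
        using that by (simp add: scaleR_diff_right)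
      thus ?thesis by (simp add: divide_inverse mult.commute)
    qed
    thus "\<forall>\<^sub>F h in at 0. norm (f (x + h) - f x - h *\<^sub>R D) / norm h = norm ((1/h) *\<^sub>R (f (x + h) - f x) - D)"
      by (auto simp: eventually_at intro: exI[of _ 1])
  qed
  finally show ?thesis using tendsto_norm_zero_iff Lim_null by metis
qed

lemma compact_continuous_bound:
  fixes f :: "'a::topological_space \<Rightarrow> 'b::real_normed_vector"
  assumes "compact K" "continuous_on K f"
  obtains B where "B \<ge> 0" "\<And>x. x \<in> K \<Longrightarrow> norm (f x) \<le> B"
proof -
  obtain B where "\<forall>x\<in>K. norm (f x) \<le> B"
    using compact_imp_bounded[OF compact_continuous_image[OF assms(2,1)]] unfolding bounded_iff by auto
  thus ?thesis using that[of "max B 0"] by (auto simp: le_max_iff_disj)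
qed

text \<open>By translation invariance the difference quotients of \<open>F\<close> along
  \<open>b\<close> have integral zero. Since the step lengths are at most 1, they are all supported
  in one larger ball, where the mean value inequality bounds them; dominated convergence passes to
  \<open>F'\<close>.\<close>

lemma integral_pd_lborel:
  fixes F :: "complex \<Rightarrow> 'b::euclidean_space"
  assumes d: "pd b UNIV F F'"
    and z: "\<And>z. cmod z > R \<Longrightarrow> F z = 0" "\<And>z. cmod z > R \<Longrightarrow> F' z = 0" and b: "cmod b = 1"
  shows "integral\<^sup>L lborel F' = 0"
proof -
  have c: "continuous_on UNIV F" and c': "continuous_on UNIV F'" using d by (auto simp: pd_def)
  have mF: "F \<in> borel_measurable borel" and mF': "F' \<in> borel_measurable borel"
    using c c' by (auto intro: borel_measurable_continuous_onI)
  have int: "integrable lborel F"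
  proof -
    have "integrable lborel (\<lambda>x. indicator (cball 0 R) x *\<^sub>R F x)"
      by (rule borel_integrable_compact[of "cball 0 R" F]) (auto intro: continuous_on_subset[OF c])
    also have "(\<lambda>x. indicator (cball 0 R) x *\<^sub>R F x) = F" using z(1) by (auto simp: indicator_def fun_eq_iff)
    finally show ?thesis .
  qed
  have tr: "integrable lborel (\<lambda>z. F (z + w))" "integral\<^sup>L lborel (\<lambda>z. F (z + w)) = integral\<^sup>L lborel F" for w
  proof -
    have e: "integral\<^sup>L (distr lborel borel ((+) w)) F = integral\<^sup>L lborel (\<lambda>z. F (w + z))"
      by (rule integral_distr) (use mF in auto)
    have e': "integrable (distr lborel borel ((+) w)) F = integrable lborel (\<lambda>z. F (w + z))"
      by (rule integrable_distr_eq) (use mF in auto)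
    show "integrable lborel (\<lambda>z. F (z + w))" "integral\<^sup>L lborel (\<lambda>z. F (z + w)) = integral\<^sup>L lborel F"
      using e e' int by (simp_all add: lborel_distr_plus add.commute)
  qed
  obtain B where "B \<ge> 0" and B0: "\<And>z. z \<in> cball 0 R \<Longrightarrow> norm (F' z) \<le> B"
    using compact_continuous_bound[OF compact_cball continuous_on_subset[OF c' subset_UNIV]] by blast
  hence B: "norm (F' z) \<le> B" "B \<ge> 0" for z using z(2)[of z] B0[of z] by (cases "cmod z \<le> R"; simp)+
  define t where "t n = 1 / real (Suc n)" for n
  have tl: "t \<longlonglongrightarrow> 0" unfolding t_def[abs_def] by (rule LIMSEQ_Suc[OF lim_1_over_n])
  have t0: "t n > 0" "t n \<le> 1" for n by (auto simp: t_def)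
  define q where "q n z = (1 / t n) *\<^sub>R (F (z + t n *\<^sub>R b) - F z)" for n z
  have bd: "norm (q n z) \<le> B * indicator (cball 0 (R + 1)) z" for n z
  proof (cases "z \<in> cball 0 (R + 1)")
    case True
    have "norm (F (z + t n *\<^sub>R b) - F (z + 0 *\<^sub>R b)) \<le> B * norm (t n - 0)"
      by (rule differentiable_bound[of UNIV "\<lambda>s. F (z + s *\<^sub>R b)" "\<lambda>s h. h *\<^sub>R F' (z + s *\<^sub>R b)"])
        (use pd_shift[OF d] B in \<open>auto simp: has_vector_derivative_def onorm_scaleR_left onorm_id intro!: onorm_le mult_right_mono simp: mult.commute\<close>)
    hence "norm (F (z + t n *\<^sub>R b) - F z) / t n \<le> B" using t0[of n] by (simp add: divide_le_eq)
    moreover have "norm (q n z) = norm (F (z + t n *\<^sub>R b) - F z) / t n"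
      using t0(1)[of n] by (simp add: q_def del: scaleR_diff_right)
    ultimately show ?thesis using True by simp
  next
    case False
    hence "cmod z > R" "cmod z > R + 1" by auto
    moreover have "cmod (z + t n *\<^sub>R b) > R"
    proof -
      have "cmod z \<le> cmod (z + t n *\<^sub>R b) + cmod (t n *\<^sub>R b)" by (metis add_diff_cancel_right' norm_triangle_ineq4)
      also have "cmod (t n *\<^sub>R b) \<le> 1" using b t0[of n] by simp
      finally show ?thesis using \<open>cmod z > R + 1\<close> by simp
    qed
    ultimately show ?thesis using z False by (simp add: q_def)
  qed
  have "(\<lambda>n. integral\<^sup>L lborel (q n)) \<longlonglongrightarrow> integral\<^sup>L lborel F'"
  proof (rule integral_dominated_convergence[where w="\<lambda>z. B * indicator (cball 0 (R+1)) z"])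
    show "integrable lborel (\<lambda>z::complex. B * indicator (cball 0 (R + 1)) z)"
      by (intro integrable_mult_right integrable_real_indicator) (use emeasure_lborel_cball_finite[of "0::complex" "R + 1"] in \<open>auto simp: top_unique\<close>)
    show "AE x in lborel. (\<lambda>n. q n x) \<longlonglongrightarrow> F' x"
    proof (rule AE_I2)
      fix x :: complex
      have "((\<lambda>t. F (x + t *\<^sub>R b)) has_vector_derivative F' x) (at 0)" using d by (simp add: pd_def)
      hence "((\<lambda>h. (1/h) *\<^sub>R (F (x + h *\<^sub>R b) - F x)) \<longlongrightarrow> F' x) (at 0)"
        using has_vector_derivative_iff_quotient[of "\<lambda>t. F (x + t *\<^sub>R b)" "F' x" 0] by simp
      moreover have "filterlim t (at 0) sequentially"
        unfolding filterlim_at using t0(1) tl by (auto intro!: always_eventually simp: less_imp_neq[THEN not_sym])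
      ultimately show "(\<lambda>n. q n x) \<longlonglongrightarrow> F' x" unfolding q_def by (rule filterlim_compose)
    qed
  qed (use mF mF' bd in \<open>auto simp: q_def[abs_def]\<close>)
  moreover have "integral\<^sup>L lborel (q n) = 0" for n
    unfolding q_def using tr int by (simp add: Bochner_Integration.integral_diff)
  ultimately show ?thesis by (simp add: LIMSEQ_const_iff)
qed

section \<open>Normalised area measure on the disk\<close>

lemma space_disk [simp]: "space \<mu> = \<D>"
  by (simp add: disk_area_def)

lemma sets_disk: "sets \<mu> = sets (lebesgue_on \<D>)"
  by (simp add: disk_area_def)

lemma disk_measurable:
  fixes f :: "complex \<Rightarrow> 'b::euclidean_space"
  assumes "continuous_on \<D> f" shows "f \<in> borel_measurable \<mu>"
proof -
  have "f \<in> borel_measurable (lebesgue_on \<D>)"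
    using assms by (intro continuous_imp_measurable_on_sets_lebesgue) auto
  thus ?thesis using measurable_cong_sets[OF sets_disk refl] by blast
qed

lemma id_meas [measurable]: "(\<lambda>z. z) \<in> borel_measurable \<mu>"
  by (rule disk_measurable) (rule continuous_on_id)

lemma indicator_meas:
  "closed K \<Longrightarrow> (indicator K :: complex \<Rightarrow> 'b :: {second_countable_topology, zero_neq_one}) \<in> borel_measurable \<mu>"
  by (intro measurable_compose[OF id_meas borel_measurable_indicator] borel_closed)

lemma closed_disk_sets: "closed K \<Longrightarrow> K \<inter> \<D> \<in> sets \<mu>"
  unfolding sets_disk by (auto simp: sets_restrict_space_iff)

lemma emeasure_disk_ball:
  assumes "ball z r \<subseteq> \<D>" "r \<ge> 0"
  shows "emeasure \<mu> (ball z r) = ennreal (r\<^sup>2)"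
proof -
  have m: "ball z r \<in> sets (lebesgue_on \<D>)"
    using assms by (auto simp: sets_restrict_space_iff)
  have "emeasure \<mu> (ball z r) = ennreal (1 / pi) * emeasure (lebesgue_on \<D>) (ball z r)"
    unfolding disk_area_def by (rule emeasure_density_const[OF m])
  also have "emeasure (lebesgue_on \<D>) (ball z r) = emeasure lborel (ball z r)"
    using assms by (subst emeasure_restrict_space) auto
  also have "\<dots> = ennreal (pi * r\<^sup>2)"
    using assms by (simp add: emeasure_ball unit_ball_vol_2)
  finally show ?thesis by (simp add: ennreal_mult'[symmetric])
qed

lemma emeasure_disk: "emeasure \<mu> \<D> = 1"
  using emeasure_disk_ball[of 0 1] by simp

lemma finite_measure_disk: "finite_measure \<mu>"
  by (rule finite_measureI) (simp add: emeasure_disk)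

lemma integral_disk_conv:
  fixes f :: "complex \<Rightarrow> 'b::euclidean_space"
  assumes "f \<in> borel_measurable \<mu>"
  shows "integral\<^sup>L \<mu> f = (1 / pi) *\<^sub>R integral\<^sup>L lebesgue (\<lambda>z. indicator \<D> z *\<^sub>R f z)"
proof -
  have m: "f \<in> borel_measurable (lebesgue_on \<D>)"
    using assms measurable_cong_sets[OF sets_disk refl] by blast
  have "integral\<^sup>L \<mu> f = (\<integral>x. (1 / pi) *\<^sub>R f x \<partial>lebesgue_on \<D>)"
    unfolding disk_area_def by (rule integral_density) (use m in auto)
  also have "\<dots> = (1 / pi) *\<^sub>R integral\<^sup>L lebesgue (\<lambda>z. indicator \<D> z *\<^sub>R f z)"
    by (simp add: integral_restrict_space)
  finally show ?thesis .
qed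

lemma integrable_disk_bounded:
  fixes f :: "complex \<Rightarrow> 'b::euclidean_space"
  assumes "f \<in> borel_measurable \<mu>" "\<And>z. z \<in> \<D> \<Longrightarrow> norm (f z) \<le> B"
  shows "integrable \<mu> f"
  using assms by (intro finite_measure.integrable_const_bound[OF finite_measure_disk, of f B] AE_I2) auto

lemma integrable_disk_indicator:
  fixes f :: "complex \<Rightarrow> 'b::{euclidean_space, real_normed_field}"
  assumes f: "continuous_on \<D> f" and K: "compact K" "K \<subseteq> \<D>"
  shows "integrable \<mu> (\<lambda>z. indicator K z * f z)"
proof -
  obtain B where B: "B \<ge> 0" "\<And>z. z \<in> K \<Longrightarrow> norm (f z) \<le> B"
    using compact_continuous_bound[OF K(1) continuous_on_subset[OF f K(2)]] by blast
  have "(\<lambda>z. indicator K z * f z) \<in> borel_measurable \<mu>"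
    by (intro borel_measurable_times indicator_meas compact_imp_closed K disk_measurable f)
  thus ?thesis by (rule integrable_disk_bounded[of _ B]) (use B in \<open>auto simp: indicator_def\<close>)
qed

lemma bounded_disk_compact:
  fixes f :: "complex \<Rightarrow> 'b::euclidean_space"
  assumes c: "continuous_on \<D> f" and r: "r < 1" and z: "\<And>z. r < cmod z \<Longrightarrow> cmod z < 1 \<Longrightarrow> f z = 0"
  obtains B where "\<And>z. z \<in> \<D> \<Longrightarrow> norm (f z) \<le> B"
proof -
  have "cball 0 r \<subseteq> \<D>" using r by auto
  then obtain B where B: "B \<ge> 0" "\<And>z. z \<in> cball 0 r \<Longrightarrow> norm (f z) \<le> B"
    using compact_continuous_bound[OF compact_cball continuous_on_subset[OF c]] by blast
  have "norm (f z) \<le> B" if "z \<in> \<D>" for z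
    using B(1) B(2)[of z] z[of z] that by (cases "cmod z \<le> r") auto
  thus ?thesis by (rule that)
qed

lemma integrable_disk_compact:
  fixes f :: "complex \<Rightarrow> 'b::euclidean_space"
  assumes c: "continuous_on \<D> f" and r: "r < 1" and z: "\<And>z. r < cmod z \<Longrightarrow> cmod z < 1 \<Longrightarrow> f z = 0"
  shows "integrable \<mu> f"
proof -
  obtain B where B: "\<And>z. z \<in> \<D> \<Longrightarrow> norm (f z) \<le> B"
    using bounded_disk_compact[OF assms] by blast
  show ?thesis by (rule integrable_disk_bounded[OF disk_measurable[OF c] B])
qed

lemma pd_transform:
  assumes "pd b S f f'" "open T" "T \<subseteq> S" "\<And>z. z \<in> T \<Longrightarrow> f z = g z" "z \<in> T"
  shows "((\<lambda>t::real. g (z + t *\<^sub>R b)) has_vector_derivative f' z) (at 0)"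
proof (rule has_vector_derivative_transform_within_open)
  show "((\<lambda>t::real. f (z + t *\<^sub>R b)) has_vector_derivative f' z) (at 0)" using assms pdD by blast
  show "open ((\<lambda>t::real. z + t *\<^sub>R b) -` T)" by (intro open_vimage assms continuous_intros)
qed (use assms in auto)

lemma pd_zero:
  assumes p: "pd b S f f'" and "open T" "T \<subseteq> S" "\<And>z. z \<in> T \<Longrightarrow> f z = 0" "z \<in> T"
  shows "f' z = 0"
proof -
  have "((\<lambda>t::real. 0) has_vector_derivative f' z) (at 0)"
    using assms by (intro pd_transform[of b S f f' T "\<lambda>_. 0"]) auto
  thus ?thesis using vector_derivative_unique_at[OF _ has_vector_derivative_const] by blast
qed

lemma open_annulus: "open {z. r < cmod z \<and> cmod z < R}"
  by (intro open_Collect_conj open_Collect_less continuous_intros)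

lemma pd_zero_annulus:
  assumes p: "pd b \<D> f f'" and "\<And>z. r < cmod z \<Longrightarrow> cmod z < 1 \<Longrightarrow> f z = 0" "r < cmod z" "cmod z < 1"
  shows "f' z = 0"
  by (rule pd_zero[OF p open_annulus[of r 1]]) (use assms in auto)

lemma continuous_on_zero_ext:
  assumes c: "continuous_on \<D> f" and r: "r < 1" and z: "\<And>z. r < cmod z \<Longrightarrow> cmod z < 1 \<Longrightarrow> f z = 0"
  shows "continuous_on UNIV (\<lambda>z. if z \<in> \<D> then f z else 0)"
proof -
  let ?f = "\<lambda>z. if z \<in> \<D> then f z else 0"
  have o: "open {z. r < cmod z}" by (intro open_Collect_less continuous_intros)
  have "continuous_on \<D> ?f" using c by (rule continuous_on_eq) auto
  moreover have "continuous_on {z. r < cmod z} ?f"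
    by (rule continuous_on_eq[OF continuous_on_const[of _ 0]]) (use z in auto)
  ultimately have "continuous_on (\<D> \<union> {z. r < cmod z}) ?f"
    by (intro continuous_on_open_Un o) auto
  also have "\<D> \<union> {z. r < cmod z} = UNIV" using r by auto
  finally show ?thesis .
qed

text \<open>\<open>F\<close> vanishes on an annulus next to the unit circle, so its extension by
  zero is again differentiable along \<open>b\<close> on the whole plane and
  \<open>integral_pd_lborel\<close> applies.\<close>

lemma integral_pd_disk:
  fixes F :: "complex \<Rightarrow> 'b::euclidean_space"
  assumes p: "pd b \<D> F F'" and r: "r < 1" and z: "\<And>z. r < cmod z \<Longrightarrow> cmod z < 1 \<Longrightarrow> F z = 0"
    and b: "cmod b = 1"
  shows "integral\<^sup>L \<mu> F' = 0" "integrable \<mu> F'"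
proof -
  have z': "F' z = 0" if "r < cmod z" "cmod z < 1" for z
    using pd_zero_annulus[OF p z] that by blast
  show "integrable \<mu> F'" by (rule integrable_disk_compact[OF pd_cont[OF p] r z'])
  define G where "G z = (if z \<in> \<D> then F z else 0)" for z
  define G' where "G' z = (if z \<in> \<D> then F' z else 0)" for z
  have cG: "continuous_on UNIV G" unfolding G_def by (rule continuous_on_zero_ext[OF pd_cont0[OF p] r z])
  have cG': "continuous_on UNIV G'" unfolding G'_def by (rule continuous_on_zero_ext[OF pd_cont[OF p] r z'])
  have "((\<lambda>t::real. G (w + t *\<^sub>R b)) has_vector_derivative G' w) (at 0)" for w
  proof (cases "w \<in> \<D>")
    case True
    have "((\<lambda>t::real. G (w + t *\<^sub>R b)) has_vector_derivative F' w) (at 0)"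
      by (rule pd_transform[OF p open_ball[of 0 1]]) (use True in \<open>auto simp: G_def\<close>)
    thus ?thesis using True by (simp add: G'_def)
  next
    case False
    let ?T = "{z. r < cmod z}"
    have "((\<lambda>t::real. G (w + t *\<^sub>R b)) has_vector_derivative 0) (at 0)"
    proof (rule has_vector_derivative_transform_within_open[OF has_vector_derivative_const])
      show "open ((\<lambda>t::real. w + t *\<^sub>R b) -` ?T)" by (intro open_vimage open_Collect_less continuous_intros)
      show "0 \<in> ((\<lambda>t::real. w + t *\<^sub>R b) -` ?T)" using False r by auto
    qed (use z in \<open>auto simp: G_def\<close>)
    thus ?thesis using False by (simp add: G'_def)
  qed
  hence "pd b UNIV G G'" using cG cG' by (simp add: pd_def)
  hence "integral\<^sup>L lborel G' = 0"
    by (rule integral_pd_lborel[where R=1]) (use b in \<open>auto simp: G_def G'_def\<close>)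
  moreover have "integral\<^sup>L lebesgue G' = integral\<^sup>L lborel G'"
    by (rule integral_completion) (use cG' borel_measurable_continuous_onI in auto)
  moreover have "(\<lambda>z. indicator \<D> z *\<^sub>R F' z) = G'" by (auto simp: G'_def indicator_def)
  ultimately show "integral\<^sup>L \<mu> F' = 0"
    by (subst integral_disk_conv) (auto intro!: disk_measurable pd_cont[OF p])
qed

section \<open>Rules of calculus for directional derivatives\<close>

lemma pd_const: "pd b S (\<lambda>_. c) (\<lambda>_. 0)"
  by (auto simp: pd_def)

lemma pd_add: "pd b S f f' \<Longrightarrow> pd b S g g' \<Longrightarrow> pd b S (\<lambda>z. f z + g z) (\<lambda>z. f' z + g' z)"
  by (auto simp: pd_def intro!: continuous_intros has_vector_derivative_add)

lemma pd_diff: "pd b S f f' \<Longrightarrow> pd b S g g' \<Longrightarrow> pd b S (\<lambda>z. f z - g z) (\<lambda>z. f' z - g' z)"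
  by (auto simp: pd_def intro!: continuous_intros has_vector_derivative_diff)

lemma pd_minus: "pd b S f f' \<Longrightarrow> pd b S (\<lambda>z. - f z) (\<lambda>z. - f' z)"
  by (auto simp: pd_def intro!: continuous_intros has_vector_derivative_minus)

lemma pd_mult:
  fixes f g :: "complex \<Rightarrow> 'b::real_normed_algebra"
  assumes "pd b S f f'" "pd b S g g'"
  shows "pd b S (\<lambda>z. f z * g z) (\<lambda>z. f z * g' z + f' z * g z)"
  unfolding pd_def
proof (intro conjI ballI)
  show "continuous_on S (\<lambda>z. f z * g z)" "continuous_on S (\<lambda>z. f z * g' z + f' z * g z)"
    using assms unfolding pd_def by (intro continuous_intros; blast)+
  fix z assume "z \<in> S"
  from has_vector_derivative_mult[OF pdD[OF assms(1) this] pdD[OF assms(2) this]]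
  show "((\<lambda>t. f (z + t *\<^sub>R b) * g (z + t *\<^sub>R b)) has_vector_derivative f z * g' z + f' z * g z) (at 0)"
    by simp
qed

lemma pd_linear:
  assumes "bounded_linear h" "pd b S f f'"
  shows "pd b S (\<lambda>z. h (f z)) (\<lambda>z. h (f' z))"
  unfolding pd_def
proof (intro conjI ballI)
  show "continuous_on S (\<lambda>z. h (f z))" "continuous_on S (\<lambda>z. h (f' z))"
    using assms(2) unfolding pd_def by (intro bounded_linear.continuous_on[OF assms(1)]; blast)+
  fix z assume "z \<in> S"
  from bounded_linear.has_vector_derivative[OF assms(1) pdD[OF assms(2) this]]
  show "((\<lambda>t. h (f (z + t *\<^sub>R b))) has_vector_derivative h (f' z)) (at 0)" .
qed

lemmas pd_cnj = pd_linear[OF bounded_linear_cnj]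
  and pd_Re = pd_linear[OF bounded_linear_Re]
  and pd_Im = pd_linear[OF bounded_linear_Im]

lemma pd_compose:
  fixes u :: "complex \<Rightarrow> real"
  assumes "pd b S u u'" "\<And>z. z \<in> S \<Longrightarrow> (k has_real_derivative k' (u z)) (at (u z))" "continuous_on (u ` S) k'"
  shows "pd b S (\<lambda>z. k (u z)) (\<lambda>z. k' (u z) * u' z)"
  unfolding pd_def
proof (intro conjI ballI)
  have "continuous_on (u ` S) k"
    using assms(2) by (intro continuous_at_imp_continuous_on) (auto intro: DERIV_isCont)
  with pd_cont0[OF assms(1)] show "continuous_on S (\<lambda>z. k (u z))"
    using continuous_on_compose2[of "u ` S" k S u] by simp
  have "continuous_on S (\<lambda>z. k' (u z))"
    using continuous_on_compose2[OF assms(3) pd_cont0[OF assms(1)]] by simp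
  thus "continuous_on S (\<lambda>z. k' (u z) * u' z)" by (rule continuous_on_mult[OF _ pd_cont[OF assms(1)]])
  fix z assume z: "z \<in> S"
  have 1: "((\<lambda>t. u (z + t *\<^sub>R b)) has_vector_derivative u' z) (at 0)" using z assms(1) by (simp add: pd_def)
  have 2: "(k has_real_derivative k' (u z)) (at (u (z + 0 *\<^sub>R b)))" using assms(2)[OF z] by simp
  show "((\<lambda>t. k (u (z + t *\<^sub>R b))) has_vector_derivative k' (u z) * u' z) (at 0)"
    using DERIV_chain2[where f=k and g="\<lambda>t. u (z + t *\<^sub>R b)" and x=0 and s=UNIV, OF 2] 1 by (simp add: has_real_derivative_iff_has_vector_derivative[symmetric])
qed

lemma pd_field:
  assumes "continuous_on S f'" "\<And>z. z \<in> S \<Longrightarrow> (f has_field_derivative f' z) (at z)"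
  shows "pd b S f (\<lambda>z. b * f' z)"
  unfolding pd_def
proof (intro conjI ballI)
  show "continuous_on S f" by (intro continuous_at_imp_continuous_on) (use assms(2) in \<open>auto intro: DERIV_isCont\<close>)
  show "continuous_on S (\<lambda>z. b * f' z)" using assms by (auto intro!: continuous_intros)
  fix z assume z: "z \<in> S"
  have "((\<lambda>t::real. z + t *\<^sub>R b) has_vector_derivative b) (at 0)"
    by (auto intro!: derivative_eq_intros)
  from field_vector_diff_chain_at[OF this, of f "f' z"] assms(2)[OF z]
  show "((\<lambda>t. f (z + t *\<^sub>R b)) has_vector_derivative b * f' z) (at 0)" by (simp add: o_def)
qed

lemma pd_holomorphic:
  assumes "open S" "f holomorphic_on S"
  shows "pd b S f (\<lambda>z. b * deriv f z)"
  by (rule pd_field) (use assms in \<open>auto intro!: holomorphic_on_imp_continuous_on holomorphic_deriv holomorphic_derivI\<close>)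

lemma pd_dist2:
  "pd b S (\<lambda>z. (cmod (z - w))\<^sup>2) (\<lambda>z. 2 * (Re b * Re (z - w) + Im b * Im (z - w)))"
  unfolding pd_def
proof (intro conjI ballI)
  fix z
  have "((\<lambda>t::real. (Re z + t * Re b - Re w)\<^sup>2 + (Im z + t * Im b - Im w)\<^sup>2) has_real_derivative
      2 * (Re b * Re (z - w) + Im b * Im (z - w))) (at 0)"
    by (rule derivative_eq_intros refl)+ (simp add: algebra_simps)
  thus "((\<lambda>t. (cmod (z + t *\<^sub>R b - w))\<^sup>2) has_vector_derivative 2 * (Re b * Re (z - w) + Im b * Im (z - w))) (at 0)"
    by (simp add: has_real_derivative_iff_has_vector_derivative cmod_power2)
qed (intro continuous_intros)+

section \<open>Square-integrable functions\<close>

text \<open>Square integrable functions are kept as functions, not as classes: \<open>n2\<close> is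
  only a seminorm, and limits are later replaced by a holomorphic representative that agrees with
  them almost everywhere.\<close>

definition L2 :: "'a measure \<Rightarrow> ('a \<Rightarrow> complex) set" where
  "L2 M = {f \<in> borel_measurable M. integrable M (\<lambda>x. (cmod (f x))\<^sup>2)}"

definition ip :: "'a measure \<Rightarrow> ('a \<Rightarrow> complex) \<Rightarrow> ('a \<Rightarrow> complex) \<Rightarrow> complex" where
  "ip M f g = (\<integral>x. f x * cnj (g x) \<partial>M)"

definition n2 :: "'a measure \<Rightarrow> ('a \<Rightarrow> complex) \<Rightarrow> real" where
  "n2 M f = sqrt (\<integral>x. (cmod (f x))\<^sup>2 \<partial>M)"

lemma borel_measurable_cnj' [measurable (raw)]:
  "f \<in> borel_measurable M \<Longrightarrow> (\<lambda>x. cnj (f x)) \<in> borel_measurable M"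
  by (rule measurable_compose[where g=cnj and N=borel]) (auto intro!: borel_measurable_continuous_onI continuous_intros)

lemma L2_integrable: "f \<in> L2 M \<Longrightarrow> integrable M (\<lambda>x. (cmod (f x))\<^sup>2)"
  by (auto simp: L2_def)

lemma n2_nonneg [simp]: "n2 M f \<ge> 0"
  by (simp add: n2_def)

lemma n2_sq: "(n2 M f)\<^sup>2 = (\<integral>x. (cmod (f x))\<^sup>2 \<partial>M)"
  by (simp add: n2_def)

lemma L2_prod_integrable:
  assumes "f \<in> L2 M" "g \<in> L2 M"
  shows "integrable M (\<lambda>x. f x * cnj (g x))"
proof (rule integrable_dominated)
  show "integrable M (\<lambda>x. (cmod (f x))\<^sup>2 + (cmod (g x))\<^sup>2)"
    using assms by (auto simp: L2_def)
  show "AE x in M. norm (f x * cnj (g x)) \<le> norm ((cmod (f x))\<^sup>2 + (cmod (g x))\<^sup>2)"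
  proof (rule AE_I2)
    fix x
    have "0 \<le> (cmod (f x) - cmod (g x))\<^sup>2" "0 \<le> cmod (f x) * cmod (g x)" by simp_all
    hence "cmod (f x) * cmod (g x) \<le> (cmod (f x))\<^sup>2 + (cmod (g x))\<^sup>2"
      unfolding power2_diff by linarith
    thus "norm (f x * cnj (g x)) \<le> norm ((cmod (f x))\<^sup>2 + (cmod (g x))\<^sup>2)"
      by (simp add: norm_mult)
  qed
qed (use assms in \<open>auto simp: L2_def intro!: borel_measurable_times borel_measurable_cnj'\<close>)

lemma L2_bmult:
  assumes f: "f \<in> L2 M" and h: "h \<in> borel_measurable M" "\<And>x. x \<in> space M \<Longrightarrow> cmod (h x) \<le> B"
  shows "(\<lambda>x. h x * f x) \<in> L2 M"
proof -
  have m: "(\<lambda>x. h x * f x) \<in> borel_measurable M" using assms by (auto simp: L2_def)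
  have "integrable M (\<lambda>x. (cmod (h x * f x))\<^sup>2)"
  proof (rule integrable_dominated)
    show "integrable M (\<lambda>x. B\<^sup>2 * (cmod (f x))\<^sup>2)" using f by (auto simp: L2_def)
    show "AE x in M. norm ((cmod (h x * f x))\<^sup>2) \<le> norm (B\<^sup>2 * (cmod (f x))\<^sup>2)"
      using h(2) by (intro AE_I2) (auto simp: norm_mult power_mult_distrib intro!: mult_right_mono power_mono)
  qed (use m in measurable)
  thus ?thesis using m by (simp add: L2_def)
qed

lemma L2_cmult: "f \<in> L2 M \<Longrightarrow> (\<lambda>x. c * f x) \<in> L2 M"
  by (rule L2_bmult[where B="cmod c"]) auto

lemma L2_add:
  assumes f: "f \<in> L2 M" and g: "g \<in> L2 M"
  shows "(\<lambda>x. f x + g x) \<in> L2 M"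
proof -
  have m: "(\<lambda>x. f x + g x) \<in> borel_measurable M" using assms by (auto simp: L2_def)
  have "integrable M (\<lambda>x. (cmod (f x + g x))\<^sup>2)"
  proof (rule integrable_dominated)
    show "integrable M (\<lambda>x. 2 * (cmod (f x))\<^sup>2 + 2 * (cmod (g x))\<^sup>2)" using f g by (auto simp: L2_def)
    show "AE x in M. norm ((cmod (f x + g x))\<^sup>2) \<le> norm (2 * (cmod (f x))\<^sup>2 + 2 * (cmod (g x))\<^sup>2)"
    proof (rule AE_I2)
      fix x
      have "(cmod (f x + g x))\<^sup>2 \<le> (cmod (f x) + cmod (g x))\<^sup>2"
        by (intro power_mono norm_triangle_ineq) simp
      also have "\<dots> \<le> 2 * (cmod (f x))\<^sup>2 + 2 * (cmod (g x))\<^sup>2"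
        using zero_le_power2[of "cmod (f x) - cmod (g x)"] by (simp add: power2_sum power2_diff)
      finally show "norm ((cmod (f x + g x))\<^sup>2) \<le> norm (2 * (cmod (f x))\<^sup>2 + 2 * (cmod (g x))\<^sup>2)" by simp
    qed
  qed (use m in measurable)
  thus ?thesis using m by (simp add: L2_def)
qed

lemma L2_diff: "f \<in> L2 M \<Longrightarrow> g \<in> L2 M \<Longrightarrow> (\<lambda>x. f x - g x) \<in> L2 M"
  using L2_add[OF _ L2_cmult[of g M "-1"]] by simp

lemma L2_zero: "(\<lambda>_. 0) \<in> L2 M"
  by (simp add: L2_def)

lemma ip_add_left:
  assumes "f \<in> L2 M" "g \<in> L2 M" "h \<in> L2 M"
  shows "ip M (\<lambda>x. f x + g x) h = ip M f h + ip M g h"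
  using L2_prod_integrable[OF assms(1,3)] L2_prod_integrable[OF assms(2,3)]
  by (simp add: ip_def distrib_right)

lemma ip_diff_left:
  assumes "f \<in> L2 M" "g \<in> L2 M" "h \<in> L2 M"
  shows "ip M (\<lambda>x. f x - g x) h = ip M f h - ip M g h"
  using L2_prod_integrable[OF assms(1,3)] L2_prod_integrable[OF assms(2,3)]
  by (simp add: ip_def left_diff_distrib)

lemma ip_cmult_left: "ip M (\<lambda>x. c * f x) h = c * ip M f h"
  by (simp add: ip_def mult.assoc)

lemma ip_commute: "ip M g f = cnj (ip M f g)"
proof -
  have "cnj (ip M f g) = (\<integral>x. cnj (f x * cnj (g x)) \<partial>M)"
    unfolding ip_def by (subst Bochner_Integration.integral_cnj) (rule refl)
  thus ?thesis by (simp add: ip_def mult.commute)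
qed

lemma ip_add_right:
  assumes "f \<in> L2 M" "g \<in> L2 M" "h \<in> L2 M"
  shows "ip M h (\<lambda>x. f x + g x) = ip M h f + ip M h g"
  using ip_add_left[OF assms] by (metis ip_commute complex_cnj_add)

lemma ip_diff_right:
  assumes "f \<in> L2 M" "g \<in> L2 M" "h \<in> L2 M"
  shows "ip M h (\<lambda>x. f x - g x) = ip M h f - ip M h g"
  using ip_diff_left[OF assms] by (metis ip_commute complex_cnj_diff)

lemma ip_cmult_right: "ip M h (\<lambda>x. c * f x) = cnj c * ip M h f"
  using ip_cmult_left[of M c f h] by (metis ip_commute complex_cnj_mult)

lemma ip_self: "ip M f f = of_real ((n2 M f)\<^sup>2)"
  unfolding n2_sq ip_def by (subst integral_complex_of_real[symmetric]) (simp only: complex_norm_square)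

lemma n2_cmult: "n2 M (\<lambda>x. c * f x) = cmod c * n2 M f"
  by (simp add: n2_def norm_mult power_mult_distrib real_sqrt_mult)

lemma n2_diff_sq:
  assumes "f \<in> L2 M" "g \<in> L2 M"
  shows "(n2 M (\<lambda>x. f x - g x))\<^sup>2 = (n2 M f)\<^sup>2 - 2 * Re (ip M f g) + (n2 M g)\<^sup>2"
proof -
  have "complex_of_real ((n2 M (\<lambda>x. f x - g x))\<^sup>2) = ip M (\<lambda>x. f x - g x) (\<lambda>x. f x - g x)"
    by (simp add: ip_self)
  also have "\<dots> = ip M f f - ip M f g - (ip M g f - ip M g g)"
    using assms by (simp add: ip_diff_left ip_diff_right L2_diff)
  finally have "Re (complex_of_real ((n2 M (\<lambda>x. f x - g x))\<^sup>2)) = Re (ip M f f - ip M f g - (ip M g f - ip M g g))" by simp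
  moreover have "Re (ip M g f) = Re (ip M f g)" using ip_commute[of M g f] by simp
  ultimately show ?thesis by (simp add: ip_self)
qed

lemma n2_0_ip:
  assumes "f \<in> L2 M" "g \<in> L2 M" "n2 M g = 0" shows "ip M f g = 0"
proof -
  have "(\<integral>x. (cmod (g x))\<^sup>2 \<partial>M) = 0" using assms n2_sq[of M g] by simp
  hence "AE x in M. (cmod (g x))\<^sup>2 = 0"
    using integral_nonneg_eq_0_iff_AE[of M "\<lambda>x. (cmod (g x))\<^sup>2"] assms by (auto simp: L2_def)
  hence "AE x in M. f x * cnj (g x) = 0" by eventually_elim auto
  thus ?thesis unfolding ip_def by (rule integral_eq_zero_AE)
qed

text \<open>The coefficient \<open>c = <f, g> / |g|^2\<close> minimises the norm of
  \<open>f - c g\<close>. With \<open>d = 0\<close> this is the Cauchy-Schwarz inequality; with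
  \<open>d\<close> the squared distance of \<open>f\<close> from a subspace containing
  \<open>g\<close> it says that a near minimiser is nearly orthogonal to \<open>g\<close>.\<close>

lemma ip_bound_opt:
  assumes f: "f \<in> L2 M" and g: "g \<in> L2 M" and d: "\<And>c. d \<le> (n2 M (\<lambda>x. f x - c * g x))\<^sup>2"
  shows "(cmod (ip M f g))\<^sup>2 \<le> ((n2 M f)\<^sup>2 - d) * (n2 M g)\<^sup>2"
proof (cases "n2 M g = 0")
  case True thus ?thesis using n2_0_ip[OF f g] by simp
next
  case False
  define c where "c = ip M f g / of_real ((n2 M g)\<^sup>2)"
  have "d \<le> (n2 M f)\<^sup>2 - 2 * Re (ip M f (\<lambda>x. c * g x)) + (n2 M (\<lambda>x. c * g x))\<^sup>2"
    using d[of c] n2_diff_sq[OF f L2_cmult[OF g]] by simp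
  also have "ip M f (\<lambda>x. c * g x) = of_real ((cmod (ip M f g))\<^sup>2 / (n2 M g)\<^sup>2)"
    unfolding ip_cmult_right c_def
    by (simp add: complex_norm_square mult.commute del: of_real_power)
  also have "(n2 M (\<lambda>x. c * g x))\<^sup>2 = (cmod (ip M f g))\<^sup>2 / (n2 M g)\<^sup>2"
    unfolding n2_cmult c_def using False by (simp add: norm_divide norm_power power_divide power_mult_distrib norm_mult power2_eq_square field_simps)
  finally have "(cmod (ip M f g))\<^sup>2 / (n2 M g)\<^sup>2 \<le> (n2 M f)\<^sup>2 - d" by simp
  thus ?thesis using False by (simp add: pos_divide_le_eq)
qed

lemma ip_Cauchy_Schwarz:
  assumes "f \<in> L2 M" "g \<in> L2 M" shows "cmod (ip M f g) \<le> n2 M f * n2 M g"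
proof (rule power2_le_imp_le)
  show "(cmod (ip M f g))\<^sup>2 \<le> (n2 M f * n2 M g)\<^sup>2"
    using ip_bound_opt[OF assms, of 0] by (simp add: power_mult_distrib)
qed simp

lemma n2_triangle_diff:
  assumes "f \<in> L2 M" "g \<in> L2 M" shows "n2 M (\<lambda>x. f x - g x) \<le> n2 M f + n2 M g"
proof (rule power2_le_imp_le)
  have "\<bar>Re (ip M f g)\<bar> \<le> n2 M f * n2 M g"
    using ip_Cauchy_Schwarz[OF assms] abs_Re_le_cmod order_trans by blast
  thus "(n2 M (\<lambda>x. f x - g x))\<^sup>2 \<le> (n2 M f + n2 M g)\<^sup>2"
    unfolding n2_diff_sq[OF assms] by (simp add: power2_sum)
qed simp

lemma n2_minus: "n2 M (\<lambda>x. - f x) = n2 M f"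
  by (simp add: n2_def)

lemma n2_triangle:
  assumes "f \<in> L2 M" "g \<in> L2 M" shows "n2 M (\<lambda>x. f x + g x) \<le> n2 M f + n2 M g"
  using n2_triangle_diff[OF assms(1) L2_cmult[OF assms(2), of "-1"]] by (simp add: n2_minus)

lemma n2_commute: "n2 M (\<lambda>x. f x - g x) = n2 M (\<lambda>x. g x - f x)"
  by (simp add: n2_def norm_minus_commute)

lemma n2_bmult:
  assumes "f \<in> L2 M" "h \<in> borel_measurable M" "\<And>x. x \<in> space M \<Longrightarrow> cmod (h x) \<le> B" "B \<ge> 0"
  shows "n2 M (\<lambda>x. h x * f x) \<le> B * n2 M f"
proof (rule power2_le_imp_le)
  have "(n2 M (\<lambda>x. h x * f x))\<^sup>2 \<le> (\<integral>x. B\<^sup>2 * (cmod (f x))\<^sup>2 \<partial>M)"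
    unfolding n2_sq using assms L2_integrable[OF assms(1)] L2_integrable[OF L2_bmult[OF assms(1-3)]]
    by (intro integral_mono) (auto simp: norm_mult power_mult_distrib intro!: mult_right_mono power_mono)
  thus "(n2 M (\<lambda>x. h x * f x))\<^sup>2 \<le> (B * n2 M f)\<^sup>2" by (simp add: power_mult_distrib n2_sq)
qed (use assms in simp)

lemma ip_tendsto_left:
  assumes f: "\<And>n. f n \<in> L2 M" "g \<in> L2 M" "h \<in> L2 M" and l: "(\<lambda>n. n2 M (\<lambda>x. f n x - g x)) \<longlonglongrightarrow> 0"
  shows "(\<lambda>n. ip M (f n) h) \<longlonglongrightarrow> ip M g h"
proof -
  have "(\<lambda>n. ip M (f n) h - ip M g h) \<longlonglongrightarrow> 0"
  proof (rule Lim_null_comparison)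
    show "\<forall>\<^sub>F n in sequentially. norm (ip M (f n) h - ip M g h) \<le> n2 M (\<lambda>x. f n x - g x) * n2 M h"
    proof (rule always_eventually, rule allI)
      fix n
      show "norm (ip M (f n) h - ip M g h) \<le> n2 M (\<lambda>x. f n x - g x) * n2 M h"
        using ip_Cauchy_Schwarz[OF L2_diff[OF f(1) f(2)] f(3), of n] ip_diff_left[OF f(1) f(2) f(3), of n] by simp
    qed
    show "(\<lambda>n. n2 M (\<lambda>x. f n x - g x) * n2 M h) \<longlonglongrightarrow> 0" using tendsto_mult_left_zero[OF l] by simp
  qed
  thus ?thesis using Lim_null by blast
qed

lemma Fatou_bound:
  fixes v :: "'a \<Rightarrow> real"
  assumes m: "\<And>n. u n \<in> borel_measurable M" and l: "AE x in M. (\<lambda>n::nat. u n x) \<longlonglongrightarrow> v x"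
    and le: "\<forall>\<^sub>F n in sequentially. (\<integral>\<^sup>+x. ennreal (u n x) \<partial>M) \<le> C"
  shows "(\<integral>\<^sup>+x. ennreal (v x) \<partial>M) \<le> C"
proof -
  have "(\<integral>\<^sup>+x. ennreal (v x) \<partial>M) = (\<integral>\<^sup>+x. liminf (\<lambda>n. ennreal (u n x)) \<partial>M)"
  proof (rule nn_integral_cong_AE)
    show "AE x in M. ennreal (v x) = liminf (\<lambda>n. ennreal (u n x))"
      using l by eventually_elim (simp add: lim_imp_Liminf[OF sequentially_bot tendsto_ennrealI])
  qed
  also have "\<dots> \<le> liminf (\<lambda>n. \<integral>\<^sup>+x. ennreal (u n x) \<partial>M)" by (rule nn_integral_liminf) (use m in measurable)
  also have "\<dots> \<le> liminf (\<lambda>_::nat. C)" by (rule Liminf_mono[OF le])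
  also have "\<dots> = C" by (simp add: Liminf_const)
  finally show ?thesis .
qed

lemma L2_Fatou:
  assumes f: "\<And>k. f k \<in> L2 M" and g: "g \<in> borel_measurable M" and ae: "AE x in M. (\<lambda>k. f k x) \<longlonglongrightarrow> g x"
    and b: "\<forall>\<^sub>F k in sequentially. n2 M (f k) \<le> e"
  shows "g \<in> L2 M" "n2 M g \<le> e"
proof -
  have [measurable]: "f k \<in> borel_measurable M" for k using f by (auto simp: L2_def)
  have e: "e \<ge> 0" using b n2_nonneg order_trans by (metis (mono_tags) eventually_happens' sequentially_bot)
  have 1: "(\<integral>\<^sup>+x. ennreal ((cmod (g x))\<^sup>2) \<partial>M) \<le> ennreal (e\<^sup>2)"
  proof (rule Fatou_bound[of "\<lambda>k x. (cmod (f k x))\<^sup>2"])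
    show "AE x in M. (\<lambda>k. (cmod (f k x))\<^sup>2) \<longlonglongrightarrow> (cmod (g x))\<^sup>2"
      using ae by eventually_elim (intro tendsto_intros)
    have "(\<integral>\<^sup>+x. ennreal ((cmod (f k x))\<^sup>2) \<partial>M) = ennreal ((n2 M (f k))\<^sup>2)" for k
      unfolding n2_sq by (rule nn_integral_eq_integral[OF L2_integrable[OF f]]) simp
    moreover have "\<forall>\<^sub>F k in sequentially. ennreal ((n2 M (f k))\<^sup>2) \<le> ennreal (e\<^sup>2)"
      using b by eventually_elim (auto intro!: ennreal_leI power_mono)
    ultimately show "\<forall>\<^sub>F k in sequentially. (\<integral>\<^sup>+x. ennreal ((cmod (f k x))\<^sup>2) \<partial>M) \<le> ennreal (e\<^sup>2)"
      by (simp only:)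
  qed measurable
  have "integrable M (\<lambda>x. (cmod (g x))\<^sup>2)"
    using 1 g by (intro integrableI_bounded) (auto simp: le_less_trans[OF _ ennreal_less_top])
  thus gL: "g \<in> L2 M" using g by (simp add: L2_def)
  have "ennreal ((n2 M g)\<^sup>2) \<le> ennreal (e\<^sup>2)"
    unfolding n2_sq using 1 nn_integral_eq_integral[OF L2_integrable[OF gL]] by simp
  thus "n2 M g \<le> e" using e by (simp add: power2_le_iff_abs_le)
qed

text \<open>Riesz-Fischer: a rapidly Cauchy subsequence converges almost everywhere, and
  \<open>L2_Fatou\<close> carries the Cauchy bounds over to the limit.\<close>

lemma L2_complete:
  assumes f: "\<And>n. f n \<in> L2 M" and C: "\<And>e. e > 0 \<Longrightarrow> \<exists>N. \<forall>m\<ge>N. \<forall>n\<ge>N. n2 M (\<lambda>x. f m x - f n x) \<le> e"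
  shows "\<exists>g\<in>L2 M. (\<lambda>n. n2 M (\<lambda>x. f n x - g x)) \<longlonglongrightarrow> 0"
proof -
  have [measurable]: "f k \<in> borel_measurable M" for k using f by (auto simp: L2_def)
  \<comment> \<open>The rate 4^(-k) survives multiplication of the differences by 2^k; finiteness of
    the sum of these squares at a point then forces geometric decay of the differences
    there.\<close>
  have "\<exists>N. \<forall>m\<ge>N. \<forall>n\<ge>N. n2 M (\<lambda>x. f m x - f n x) \<le> (1/4)^k" for k
    by (rule C) simp
  then obtain N where N: "\<And>k m n. m \<ge> N k \<Longrightarrow> n \<ge> N k \<Longrightarrow> n2 M (\<lambda>x. f m x - f n x) \<le> (1/4)^k" by metis
  define r where "r k = (\<Sum>i\<le>k. N i) + k" for k
  have rN: "r k \<ge> N k" for k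
    unfolding r_def using member_le_sum[of k "{..k}" N] by simp
  have rS: "r (Suc k) \<ge> N k" for k using rN[of k] by (simp add: r_def)
  have rk: "r k \<ge> k" for k by (simp add: r_def)
  define d where "d k x = f (r (Suc k)) x - f (r k) x" for k x
  have [measurable]: "d k \<in> borel_measurable M" for k unfolding d_def by measurable
  have dL: "d k \<in> L2 M" for k unfolding d_def by (intro L2_diff f)
  have dn: "n2 M (d k) \<le> (1/4)^k" for k unfolding d_def by (rule N[OF rS rN])
  have "(\<integral>\<^sup>+x. (\<Sum>k. ennreal ((2^k * cmod (d k x))\<^sup>2)) \<partial>M) = (\<Sum>k. \<integral>\<^sup>+x. ennreal ((2^k * cmod (d k x))\<^sup>2) \<partial>M)"
    by (rule nn_integral_suminf) measurable
  also have "\<dots> \<le> (\<Sum>k. ennreal ((1/4)^k))"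
  proof (intro suminf_le allI)
    fix k
    have "(\<integral>\<^sup>+x. ennreal ((2^k * cmod (d k x))\<^sup>2) \<partial>M) = ennreal (\<integral>x. (2^k * cmod (d k x))\<^sup>2 \<partial>M)"
      using L2_integrable[OF dL, of k] by (intro nn_integral_eq_integral) (auto simp: power_mult_distrib)
    also have "(\<integral>x. (2^k * cmod (d k x))\<^sup>2 \<partial>M) = 4^k * (n2 M (d k))\<^sup>2"
      by (simp add: power_mult_distrib n2_sq flip: power_mult) (simp add: power_mult mult.commute[of k])
    also have "\<dots> \<le> 4^k * ((1/4)^k)\<^sup>2" by (intro mult_left_mono power_mono dn) auto
    also have "\<dots> = (1/4)^k" by (simp add: power2_eq_square power_divide)
    finally show "(\<integral>\<^sup>+x. ennreal ((2^k * cmod (d k x))\<^sup>2) \<partial>M) \<le> ennreal ((1/4)^k)" by (simp add: ennreal_leI)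
  qed auto
  also have "\<dots> = ennreal (\<Sum>k. (1/4)^k)" by (rule suminf_ennreal_eq) (auto intro!: sums_unique summable_sums summable_geometric)
  finally have "(\<integral>\<^sup>+x. (\<Sum>k. ennreal ((2^k * cmod (d k x))\<^sup>2)) \<partial>M) \<noteq> \<infinity>"
    by (auto simp: top_unique)
  hence "AE x in M. (\<Sum>k. ennreal ((2^k * cmod (d k x))\<^sup>2)) \<noteq> \<infinity>"
    by (intro nn_integral_PInf_AE) measurable
  hence ae: "AE x in M. convergent (\<lambda>k. f (r k) x)"
  proof eventually_elim
    case (elim x)
    then obtain S where S: "S \<ge> 0" "(\<Sum>k. ennreal ((2^k * cmod (d k x))\<^sup>2)) = ennreal S"
      by (metis ennreal_cases infinity_ennreal_def)
    have b: "cmod (d k x) \<le> (S + 1) * (1/2)^k" for k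
    proof -
      have "(\<Sum>i\<in>{k}. ennreal ((2^i * cmod (d i x))\<^sup>2)) \<le> ennreal S"
        unfolding S(2)[symmetric] by (rule sum_le_suminf) auto
      hence "(2^k * cmod (d k x))\<^sup>2 \<le> S" using S by simp
      also have "S \<le> (S + 1)\<^sup>2" using S by (simp add: power2_eq_square algebra_simps)
      finally have "2^k * cmod (d k x) \<le> S + 1" using S by (simp add: power2_le_iff_abs_le abs_mult)
      thus ?thesis by (simp add: power_divide field_simps)
    qed
    have "summable (\<lambda>k. d k x)"
      by (rule summable_comparison_test'[where g="\<lambda>k. (S+1) * (1/2)^k" and N=0]) (use b in \<open>auto intro!: summable_mult summable_geometric\<close>)
    hence "convergent (\<lambda>n. \<Sum>k<n. d k x)" by (simp add: summable_iff_convergent)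
    moreover have "(\<lambda>n. \<Sum>k<n. d k x) = (\<lambda>n. f (r n) x - f (r 0) x)"
      unfolding d_def by (simp add: sum_lessThan_telescope[of "\<lambda>k. f (r k) x"])
    ultimately have "convergent (\<lambda>n. (f (r n) x - f (r 0) x) + f (r 0) x)"
      by (intro convergent_add) (auto intro: convergent_const)
    thus ?case by simp
  qed
  define g where "g x = lim (\<lambda>k. f (r k) x)" for x
  have g: "g \<in> borel_measurable M" unfolding g_def[abs_def] by (rule borel_measurable_lim_metric) measurable
  have ae': "AE x in M. (\<lambda>k. f (r k) x) \<longlonglongrightarrow> g x"
    using ae by eventually_elim (simp add: g_def convergent_LIMSEQ_iff)
  have key: "(\<lambda>x. f n x - g x) \<in> L2 M \<and> n2 M (\<lambda>x. f n x - g x) \<le> e"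
    if M: "\<forall>m\<ge>K. \<forall>n\<ge>K. n2 M (\<lambda>x. f m x - f n x) \<le> e" and n: "n \<ge> K" for K n e
  proof -
    have 1: "AE x in M. (\<lambda>k. f n x - f (r k) x) \<longlonglongrightarrow> f n x - g x"
      using ae' by eventually_elim (auto intro!: tendsto_intros)
    have 2: "\<forall>\<^sub>F k in sequentially. n2 M (\<lambda>x. f n x - f (r k) x) \<le> e"
      using eventually_ge_at_top[of K]
    proof eventually_elim
      case (elim k) thus ?case using M n rk[of k] by auto
    qed
    have 3: "(\<lambda>x. f n x - g x) \<in> borel_measurable M" using g by measurable
    show ?thesis using L2_Fatou[OF L2_diff[OF f f] 3 1 2] by blast
  qed
  obtain K1 where "\<forall>m\<ge>K1. \<forall>n\<ge>K1. n2 M (\<lambda>x. f m x - f n x) \<le> 1" using C[of 1] by auto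
  hence "(\<lambda>x. f K1 x - g x) \<in> L2 M" using key by blast
  from L2_diff[OF f[of K1] this] have gL: "g \<in> L2 M" by simp
  have "(\<lambda>n. n2 M (\<lambda>x. f n x - g x)) \<longlonglongrightarrow> 0"
  proof (rule LIMSEQ_I)
    fix e :: real assume "e > 0"
    then obtain K where K: "\<forall>m\<ge>K. \<forall>n\<ge>K. n2 M (\<lambda>x. f m x - f n x) \<le> e/2" using C[of "e/2"] by auto
    have "norm (n2 M (\<lambda>x. f n x - g x) - 0) < e" if "n \<ge> K" for n
      using key[OF K that] \<open>e > 0\<close> by simp
    thus "\<exists>no. \<forall>n\<ge>no. norm (n2 M (\<lambda>x. f n x - g x) - 0) < e" by blast
  qed
  thus ?thesis using gL by blast
qed

text \<open>The subspace is not assumed closed, so a nearest point in it need not exist. A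
  minimising sequence is Cauchy by the parallelogram law; its limit defines \<open>v\<close>, and
  \<open>ip_bound_opt\<close> gives the orthogonality. The sequence itself is returned as well,
  because later estimates hold for members of the subspace.\<close>

lemma L2_projection:
  assumes S: "S \<subseteq> L2 M" "(\<lambda>_. 0) \<in> S" "\<And>f g. f \<in> S \<Longrightarrow> g \<in> S \<Longrightarrow> (\<lambda>x. f x + g x) \<in> S"
      "\<And>c f. f \<in> S \<Longrightarrow> (\<lambda>x. c * f x) \<in> S"
    and u: "u \<in> L2 M"
  obtains s v where "\<And>n. s n \<in> S" "v \<in> L2 M" "\<And>h. h \<in> S \<Longrightarrow> ip M v h = 0"
    "(\<lambda>n::nat. n2 M (\<lambda>x. s n x - (u x - v x))) \<longlonglongrightarrow> 0"
proof -
  define D where "D = (\<lambda>s. (n2 M (\<lambda>x. u x - s x))\<^sup>2) ` S"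
  define d where "d = Inf D"
  have ne: "D \<noteq> {}" using S(2) by (auto simp: D_def)
  have bb: "bdd_below D" by (rule bdd_belowI[of _ 0]) (auto simp: D_def)
  have dle: "d \<le> (n2 M (\<lambda>x. u x - s x))\<^sup>2" if "s \<in> S" for s
    unfolding d_def by (rule cInf_lower[OF _ bb]) (use that in \<open>auto simp: D_def\<close>)
  have "\<exists>s\<in>S. (n2 M (\<lambda>x. u x - s x))\<^sup>2 < d + 1 / Suc n" for n
  proof -
    have "Inf D < d + 1 / Suc n" by (simp add: d_def)
    then obtain y where "y \<in> D" "y < d + 1 / Suc n" using cInf_less_iff[OF ne bb] by blast
    thus ?thesis by (auto simp: D_def)
  qed
  then obtain s where s: "\<And>n. s n \<in> S" "\<And>n. (n2 M (\<lambda>x. u x - s n x))\<^sup>2 < d + 1 / Suc n" by metis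
  have sL: "s n \<in> L2 M" for n using s S by blast
  have uL: "(\<lambda>x. u x - s n x) \<in> L2 M" for n by (intro L2_diff u sL)
  have par: "(n2 M (\<lambda>x. s m x - s n x))\<^sup>2 \<le> 2 / Suc m + 2 / Suc n" for m n
  proof -
    let ?a = "\<lambda>x. u x - s m x" and ?b = "\<lambda>x. u x - s n x"
    let ?h = "\<lambda>x. (1/2) * (s m x + s n x)"
    have hS: "?h \<in> S" using S(3,4) s(1) by blast
    have 1: "(n2 M (\<lambda>x. ?a x - ?b x))\<^sup>2 = (n2 M ?a)\<^sup>2 - 2 * Re (ip M ?a ?b) + (n2 M ?b)\<^sup>2"
      by (rule n2_diff_sq[OF uL uL])
    have 2: "(n2 M (\<lambda>x. ?a x - (- 1) * ?b x))\<^sup>2 = (n2 M ?a)\<^sup>2 + 2 * Re (ip M ?a ?b) + (n2 M ?b)\<^sup>2"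
      using n2_diff_sq[OF uL[of m] L2_cmult[OF uL[of n], of "-1"]] n2_cmult[of M "-1" ?b]
        ip_cmult_right[of M ?a "-1" ?b] by simp
    have "(\<lambda>x. ?a x - (- 1) * ?b x) = (\<lambda>x. 2 * (u x - ?h x))" by (auto simp: algebra_simps)
    hence "(n2 M (\<lambda>x. ?a x - (- 1) * ?b x))\<^sup>2 = 4 * (n2 M (\<lambda>x. u x - ?h x))\<^sup>2"
      by (simp only: n2_cmult power_mult_distrib) simp
    hence 3: "4 * d \<le> (n2 M (\<lambda>x. ?a x - (- 1) * ?b x))\<^sup>2" using dle[OF hS] by simp
    have "(n2 M (\<lambda>x. s m x - s n x))\<^sup>2 = (n2 M (\<lambda>x. ?a x - ?b x))\<^sup>2"
      by (subst n2_commute) simp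
    thus ?thesis using 1 2 3 s(2)[of m] s(2)[of n] by simp
  qed
  have "\<exists>N. \<forall>m\<ge>N. \<forall>n\<ge>N. n2 M (\<lambda>x. s m x - s n x) \<le> e" if e: "e > 0" for e
  proof -
    obtain N where N: "4 / e\<^sup>2 < real N" using reals_Archimedean2 by blast
    have "n2 M (\<lambda>x. s m x - s n x) \<le> e" if "m \<ge> N" "n \<ge> N" for m n
    proof (rule power2_le_imp_le)
      have k: "2 / Suc k \<le> e\<^sup>2 / 2" if "k \<ge> N" for k
      proof -
        have "4 / e\<^sup>2 \<le> real (Suc k)" using N that by linarith
        thus ?thesis using e by (simp add: field_simps)
      qed
      show "(n2 M (\<lambda>x. s m x - s n x))\<^sup>2 \<le> e\<^sup>2" using par[of m n] k[OF that(1)] k[OF that(2)] by simp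
    qed (use e in simp)
    thus ?thesis by blast
  qed
  from L2_complete[OF sL this] obtain w where w: "w \<in> L2 M" "(\<lambda>n. n2 M (\<lambda>x. s n x - w x)) \<longlonglongrightarrow> 0" by blast
  define v where "v x = u x - w x" for x
  have vL: "v \<in> L2 M" unfolding v_def by (intro L2_diff u w)
  have conv: "(\<lambda>n. n2 M (\<lambda>x. (u x - s n x) - v x)) \<longlonglongrightarrow> 0"
  proof -
    have "n2 M (\<lambda>x. (u x - s n x) - v x) = n2 M (\<lambda>x. s n x - w x)" for n
      using n2_commute[of M "s n" w] by (simp add: v_def)
    thus ?thesis using w by simp
  qed
  have orth: "ip M v h = 0" if h: "h \<in> S" for h
  proof -
    have hL: "h \<in> L2 M" using h S by blast
    have b: "(cmod (ip M (\<lambda>x. u x - s n x) h))\<^sup>2 \<le> (1 / Suc n) * (n2 M h)\<^sup>2" for n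
    proof -
      have "(cmod (ip M (\<lambda>x. u x - s n x) h))\<^sup>2 \<le> ((n2 M (\<lambda>x. u x - s n x))\<^sup>2 - d) * (n2 M h)\<^sup>2"
      proof (rule ip_bound_opt[OF uL hL])
        fix c
        have "(\<lambda>x. s n x + c * h x) \<in> S" using S(3,4) s(1) h by blast
        from dle[OF this] show "d \<le> (n2 M (\<lambda>x. u x - s n x - c * h x))\<^sup>2" by (simp add: algebra_simps)
      qed
      also have "\<dots> \<le> (1 / Suc n) * (n2 M h)\<^sup>2" using s(2)[of n] by (intro mult_right_mono) auto
      finally show ?thesis .
    qed
    have "(\<lambda>n. (cmod (ip M (\<lambda>x. u x - s n x) h))\<^sup>2) \<longlonglongrightarrow> 0"
    proof (rule Lim_null_comparison)
      show "\<forall>\<^sub>F n in sequentially. norm ((cmod (ip M (\<lambda>x. u x - s n x) h))\<^sup>2) \<le> (1 / Suc n) * (n2 M h)\<^sup>2"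
        using b by simp
      have "(\<lambda>n. 1 / real (Suc n)) \<longlonglongrightarrow> 0" by (rule LIMSEQ_Suc[OF lim_1_over_n])
      from tendsto_mult_left_zero[OF this] show "(\<lambda>n. (1 / real (Suc n)) * (n2 M h)\<^sup>2) \<longlonglongrightarrow> 0" .
    qed
    moreover have "(\<lambda>n. (cmod (ip M (\<lambda>x. u x - s n x) h))\<^sup>2) \<longlonglongrightarrow> (cmod (ip M v h))\<^sup>2"
      by (intro tendsto_intros ip_tendsto_left[OF uL vL hL conv])
    ultimately have "(cmod (ip M v h))\<^sup>2 = 0" using LIMSEQ_unique by blast
    thus ?thesis by simp
  qed
  have "(\<lambda>n. n2 M (\<lambda>x. s n x - (u x - v x))) \<longlonglongrightarrow> 0" using w by (simp add: v_def)
  thus ?thesis using that s(1) vL orth by blast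
qed

section \<open>The basic estimate\<close>

text \<open>Of the second derivatives only the mixed one is needed: it cancels in the integration by parts.\<close>

definition smooth2 :: "complex set \<Rightarrow> (complex \<Rightarrow> 'b::real_normed_vector) \<Rightarrow> (complex \<Rightarrow> 'b) \<Rightarrow> (complex \<Rightarrow> 'b) \<Rightarrow> (complex \<Rightarrow> 'b) \<Rightarrow> bool" where
  "smooth2 S f fx fy fxy \<longleftrightarrow> pd 1 S f fx \<and> pd \<i> S f fy \<and> pd \<i> S fx fxy \<and> pd 1 S fy fxy"

lemma smooth2D:
  assumes "smooth2 S f fx fy fxy"
  shows "pd 1 S f fx" "pd \<i> S f fy" "pd \<i> S fx fxy" "pd 1 S fy fxy"
    "continuous_on S f" "continuous_on S fx" "continuous_on S fy"
  using assms by (auto simp: smooth2_def pd_def)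

lemma smooth2_add:
  "smooth2 S f fx fy fxy \<Longrightarrow> smooth2 S g gx gy gxy \<Longrightarrow>
    smooth2 S (\<lambda>z. f z + g z) (\<lambda>z. fx z + gx z) (\<lambda>z. fy z + gy z) (\<lambda>z. fxy z + gxy z)"
  by (auto simp: smooth2_def intro: pd_add)

lemma smooth2_const: "smooth2 S (\<lambda>_. c) (\<lambda>_. 0) (\<lambda>_. 0) (\<lambda>_. 0)"
  by (auto simp: smooth2_def intro: pd_const)

lemma smooth2_mult:
  fixes f g :: "complex \<Rightarrow> 'b::{real_normed_algebra,comm_ring}"
  assumes "smooth2 S f fx fy fxy" "smooth2 S g gx gy gxy"
  shows "smooth2 S (\<lambda>z. f z * g z) (\<lambda>z. f z * gx z + fx z * g z) (\<lambda>z. f z * gy z + fy z * g z)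
    (\<lambda>z. f z * gxy z + fy z * gx z + fx z * gy z + fxy z * g z)"
proof -
  note f = smooth2D[OF assms(1)] and g = smooth2D[OF assms(2)]
  have 1: "pd \<i> S (\<lambda>z. f z * gx z + fx z * g z) (\<lambda>z. (f z * gxy z + fy z * gx z) + (fx z * gy z + fxy z * g z))"
    by (intro pd_add pd_mult f g)
  have 2: "pd 1 S (\<lambda>z. f z * gy z + fy z * g z) (\<lambda>z. (f z * gxy z + fx z * gy z) + (fy z * gx z + fxy z * g z))"
    by (intro pd_add pd_mult f g)
  show ?thesis unfolding smooth2_def
    using 1 2 pd_mult[OF f(1) g(1)] pd_mult[OF f(2) g(2)] by (simp add: add_ac)
qed

lemma smooth2_linear:
  assumes h: "bounded_linear h" and "smooth2 S f fx fy fxy"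
  shows "smooth2 S (\<lambda>z. h (f z)) (\<lambda>z. h (fx z)) (\<lambda>z. h (fy z)) (\<lambda>z. h (fxy z))"
  using assms by (auto simp: smooth2_def intro: pd_linear)

text \<open>The support radius \<open>r\<close> is explicit, and only the behaviour inside the disk
  is prescribed. The mixed derivative stays behind a quantifier because it drops out of every
  result.\<close>

definition testf :: "real \<Rightarrow> (complex \<Rightarrow> complex) \<Rightarrow> (complex \<Rightarrow> complex) \<Rightarrow> (complex \<Rightarrow> complex) \<Rightarrow> bool" where
  "testf r g gx gy \<longleftrightarrow> r < 1 \<and> (\<exists>gxy. smooth2 \<D> g gx gy gxy) \<and> (\<forall>z. r < cmod z \<longrightarrow> cmod z < 1 \<longrightarrow> g z = 0)"

lemma testfD:
  assumes "testf r g gx gy"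
  shows "r < 1" "pd 1 \<D> g gx" "pd \<i> \<D> g gy"
    "continuous_on \<D> g" "continuous_on \<D> gx" "continuous_on \<D> gy"
    "\<And>z. r < cmod z \<Longrightarrow> cmod z < 1 \<Longrightarrow> g z = 0"
    "\<And>z. r < cmod z \<Longrightarrow> cmod z < 1 \<Longrightarrow> gx z = 0"
    "\<And>z. r < cmod z \<Longrightarrow> cmod z < 1 \<Longrightarrow> gy z = 0"
proof -
  obtain gxy where s: "smooth2 \<D> g gx gy gxy" using assms by (auto simp: testf_def)
  show r: "r < 1" using assms by (simp add: testf_def)
  show p: "pd 1 \<D> g gx" and q: "pd \<i> \<D> g gy" by (fact smooth2D[OF s])+
  show "continuous_on \<D> g" "continuous_on \<D> gx" "continuous_on \<D> gy"
    by (fact smooth2D[OF s])+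
  show g: "g z = 0" if "r < cmod z" "cmod z < 1" for z
    using assms that by (simp add: testf_def)
  show "gx z = 0" if "r < cmod z" "cmod z < 1" for z by (rule pd_zero_annulus[OF p g that])
  show "gy z = 0" if "r < cmod z" "cmod z < 1" for z by (rule pd_zero_annulus[OF q g that])
qed

lemma testf_add:
  assumes "testf r g gx gy" "testf s h hx hy"
  shows "testf (max r s) (\<lambda>z. g z + h z) (\<lambda>z. gx z + hx z) (\<lambda>z. gy z + hy z)"
proof -
  obtain gxy hxy where "smooth2 \<D> g gx gy gxy" "smooth2 \<D> h hx hy hxy"
    using assms unfolding testf_def by blast
  from smooth2_add[OF this] show ?thesis using assms unfolding testf_def by auto
qed

lemma testf_mult:
  assumes "testf r g gx gy" "smooth2 \<D> h hx hy hxy"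
  shows "testf r (\<lambda>z. h z * g z) (\<lambda>z. h z * gx z + hx z * g z) (\<lambda>z. h z * gy z + hy z * g z)"
proof -
  obtain gxy where "smooth2 \<D> g gx gy gxy" using assms unfolding testf_def by blast
  from smooth2_mult[OF assms(2) this] show ?thesis using assms unfolding testf_def by auto
qed

lemma testf_cmult:
  assumes "testf r g gx gy"
  shows "testf r (\<lambda>z. c * g z) (\<lambda>z. c * gx z) (\<lambda>z. c * gy z)"
  using testf_mult[OF assms smooth2_const[of \<D> c]] by simp

text \<open>The partial derivatives of \<open>\<phi>\<close> are explicit parameters, so that the
  computations below are algebra in their values at a point.\<close>

locale disk_weight =
  fixes \<omega> \<phi> px py pxx pyy :: "complex \<Rightarrow> real"
  assumes pd_phi: "pd 1 \<D> \<phi> px" "pd \<i> \<D> \<phi> py" "pd 1 \<D> px pxx" "pd \<i> \<D> py pyy"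
    and omega_eq: "z \<in> \<D> \<Longrightarrow> \<omega> z = exp (- 2 * \<phi> z)"
    and lap_pos: "z \<in> \<D> \<Longrightarrow> pxx z + pyy z > 0"
    and omega_int: "integrable \<mu> \<omega>"
begin

definition lap :: "complex \<Rightarrow> real" where "lap z = pxx z + pyy z"

definition N :: "complex measure" where "N = density \<mu> (\<lambda>z. ennreal (\<omega> z))"

lemma omega_pos: "z \<in> \<D> \<Longrightarrow> \<omega> z > 0"
  by (simp add: omega_eq)

lemma exp_phi: "z \<in> \<D> \<Longrightarrow> exp (2 * \<phi> z) = 1 / \<omega> z"
  by (simp add: omega_eq exp_minus field_simps)

lemma cont_phi: "continuous_on \<D> \<phi>"
  using pd_phi pd_cont0 by blast

lemma cont_omega: "continuous_on \<D> \<omega>"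
  by (rule continuous_on_eq[where f="\<lambda>z. exp (- 2 * \<phi> z)"]) (auto simp: omega_eq intro!: continuous_intros cont_phi)

lemma cont_lap: "continuous_on \<D> lap"
  unfolding lap_def[abs_def] using pd_phi[THEN pd_cont] by (auto intro!: continuous_intros)

lemma omega_meas [measurable]: "\<omega> \<in> borel_measurable \<mu>"
  using omega_int by auto

lemma omega_AE: "AE z in \<mu>. 0 \<le> \<omega> z"
  by (rule AE_I2) (use omega_pos in \<open>auto intro: less_imp_le\<close>)

lemma sets_N [measurable_cong]: "sets N = sets \<mu>"
  by (simp add: N_def)

lemma space_N [simp]: "space N = \<D>"
  by (simp add: N_def)

lemma N_measurable: "f \<in> borel_measurable N \<longleftrightarrow> f \<in> borel_measurable \<mu>"
  using measurable_cong_sets[OF sets_N refl] by blast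

lemma integral_N:
  fixes f :: "complex \<Rightarrow> 'b::euclidean_space"
  shows "f \<in> borel_measurable \<mu> \<Longrightarrow> integral\<^sup>L N f = (\<integral>z. \<omega> z *\<^sub>R f z \<partial>\<mu>)"
  unfolding N_def by (rule integral_density) (auto intro: omega_AE)

lemma integrable_N:
  fixes f :: "complex \<Rightarrow> 'b::euclidean_space"
  shows "f \<in> borel_measurable \<mu> \<Longrightarrow> integrable N f \<longleftrightarrow> integrable \<mu> (\<lambda>z. \<omega> z *\<^sub>R f z)"
  unfolding N_def by (rule integrable_density) (auto intro: omega_AE)

lemma AE_N: "(AE z in N. P z) \<longleftrightarrow> (AE z in \<mu>. P z)"
proof -
  have "(AE z in N. P z) \<longleftrightarrow> (AE z in \<mu>. 0 < ennreal (\<omega> z) \<longrightarrow> P z)"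
    unfolding N_def by (rule AE_density) measurable
  also have "\<dots> \<longleftrightarrow> (AE z in \<mu>. P z)"
    by (rule AE_cong) (simp add: omega_pos)
  finally show ?thesis .
qed

lemma finite_measure_N: "finite_measure N"
proof (rule finite_measureI)
  have "emeasure N (space N) = (\<integral>\<^sup>+z. ennreal (\<omega> z) * indicator \<D> z \<partial>\<mu>)"
    unfolding space_N unfolding N_def using sets.top[of \<mu>] by (intro emeasure_density) auto
  also have "\<dots> = (\<integral>\<^sup>+z. ennreal (\<omega> z) \<partial>\<mu>)"
    by (rule nn_integral_cong) (auto simp: indicator_def)
  also have "\<dots> = ennreal (\<integral>z. \<omega> z \<partial>\<mu>)"
    by (rule nn_integral_eq_integral[OF omega_int omega_AE])
  finally show "emeasure N (space N) \<noteq> \<infinity>" by simp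
qed

lemma L2_N_bounded:
  assumes "f \<in> borel_measurable \<mu>" "\<And>z. z \<in> \<D> \<Longrightarrow> cmod (f z) \<le> B"
  shows "f \<in> L2 N"
proof -
  have "integrable N (\<lambda>z. (cmod (f z))\<^sup>2)"
    using assms by (intro finite_measure.integrable_const_bound[OF finite_measure_N, of _ "B\<^sup>2"] AE_I2)
      (auto simp: N_measurable intro!: power_mono)
  thus ?thesis using assms by (simp add: L2_def N_measurable)
qed

lemma L2_N_compact:
  assumes "continuous_on \<D> f" "r < 1" "\<And>z. r < cmod z \<Longrightarrow> cmod z < 1 \<Longrightarrow> f z = 0"
  shows "f \<in> L2 N"
proof -
  obtain B where "\<And>z. z \<in> \<D> \<Longrightarrow> norm (f z) \<le> B"
    using bounded_disk_compact[OF assms] by blast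
  thus ?thesis using L2_N_bounded disk_measurable[OF assms(1)] by blast
qed

text \<open>In complex notation this is \<open>2 (dg/dz) / \<omega>\<close>, minus the formal
  adjoint of twice the dbar operator from L^2(omega dA) to L^2(dA). The division by
  \<open>\<omega>\<close> makes the weight cancel in \<open>ip_TT\<close>, so that orthogonality to
  all \<open>TT gx gy\<close> is the weak Cauchy-Riemann equation.\<close>

definition TT :: "(complex \<Rightarrow> complex) \<Rightarrow> (complex \<Rightarrow> complex) \<Rightarrow> complex \<Rightarrow> complex" where
  "TT gx gy z = (gx z - \<i> * gy z) / of_real (\<omega> z)"

lemma cont_TT:
  assumes "testf r g gx gy" shows "continuous_on \<D> (TT gx gy)"
  unfolding TT_def[abs_def] using testfD[OF assms] omega_pos
  by (auto intro!: continuous_intros cont_omega) (metis less_irrefl mem_ball_0 omega_pos)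

lemma TT_L2:
  assumes "testf r g gx gy" shows "TT gx gy \<in> L2 N"
  by (rule L2_N_compact[OF cont_TT[OF assms] testfD(1)[OF assms]]) (simp add: TT_def testfD[OF assms])

lemma n2_TT:
  assumes "testf r g gx gy"
  shows "(n2 N (TT gx gy))\<^sup>2 = (\<integral>z. (cmod (gx z - \<i> * gy z))\<^sup>2 / \<omega> z \<partial>\<mu>)"
proof -
  have "(n2 N (TT gx gy))\<^sup>2 = (\<integral>z. \<omega> z *\<^sub>R (cmod (TT gx gy z))\<^sup>2 \<partial>\<mu>)"
    unfolding n2_sq by (rule integral_N) (intro disk_measurable continuous_on_power continuous_on_norm cont_TT[OF assms])
  also have "\<dots> = (\<integral>z. (cmod (gx z - \<i> * gy z))\<^sup>2 / \<omega> z \<partial>\<mu>)"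
  proof (rule lint_cong[OF refl])
    fix z assume "z \<in> space \<mu>"
    hence "\<omega> z > 0" using omega_pos by simp
    thus "\<omega> z *\<^sub>R (cmod (TT gx gy z))\<^sup>2 = (cmod (gx z - \<i> * gy z))\<^sup>2 / \<omega> z"
      by (simp add: TT_def norm_divide power_divide power2_eq_square[of "\<omega> z"])
  qed
  finally show ?thesis .
qed

lemma ip_TT:
  assumes t: "testf r g gx gy" and v: "v \<in> L2 N"
  shows "ip N v (TT gx gy) = (\<integral>z. v z * cnj (gx z - \<i> * gy z) \<partial>\<mu>)"
proof -
  have "ip N v (TT gx gy) = (\<integral>z. \<omega> z *\<^sub>R (v z * cnj (TT gx gy z)) \<partial>\<mu>)"
    unfolding ip_def using v disk_measurable[OF cont_TT[OF t]]
    by (intro integral_N borel_measurable_times borel_measurable_cnj') (auto simp: L2_def N_measurable)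
  also have "\<dots> = (\<integral>z. v z * cnj (gx z - \<i> * gy z) \<partial>\<mu>)"
  proof (rule lint_cong[OF refl])
    fix z assume "z \<in> space \<mu>"
    hence "\<omega> z > 0" using omega_pos by simp
    thus "\<omega> z *\<^sub>R (v z * cnj (TT gx gy z)) = v z * cnj (gx z - \<i> * gy z)"
      by (simp add: TT_def scaleR_conv_of_real)
  qed
  finally show ?thesis .
qed

definition n_lap :: "(complex \<Rightarrow> complex) \<Rightarrow> real" where
  "n_lap g = sqrt (\<integral>z. lap z * (cmod (g z))\<^sup>2 / \<omega> z \<partial>\<mu>)"

lemma cont_div_omega: "continuous_on \<D> f \<Longrightarrow> continuous_on \<D> (\<lambda>z. f z / \<omega> z)" for f :: "complex \<Rightarrow> real"
  using omega_pos by (intro continuous_on_divide cont_omega) (auto simp: less_le)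

lemma lap_integrable:
  assumes t: "testf r g gx gy"
  shows "integrable \<mu> (\<lambda>z. lap z * (cmod (g z))\<^sup>2 / \<omega> z)"
  by (rule integrable_disk_compact[OF _ testfD(1)[OF t]])
    (use testfD[OF t] in \<open>auto intro!: cont_div_omega continuous_intros cont_lap\<close>)

lemma n_lap_sq:
  "(n_lap g)\<^sup>2 = (\<integral>z. lap z * (cmod (g z))\<^sup>2 / \<omega> z \<partial>\<mu>)"
proof -
  have "(\<integral>z. lap z * (cmod (g z))\<^sup>2 / \<omega> z \<partial>\<mu>) \<ge> 0"
    by (rule integral_nonneg_AE, rule AE_I2) (simp add: lap_def lap_pos omega_pos less_imp_le)
  thus ?thesis by (simp add: n_lap_def)
qed

text \<open>The two squares are those of \<open>2 dg/dz\<close> and of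
  \<open>2 \<omega> dbar(g / \<omega>)\<close>, where \<open>p\<close>, \<open>q\<close> and
  \<open>a\<close>, \<open>b\<close> stand for the first and the pure second derivatives of
  \<open>\<phi>\<close>. The right-hand side is, up to a factor \<open>exp (2 * \<phi> z)\<close>,
  minus twice the divergence of a vector field; the term with \<open>gxy\<close> occurs in its two
  components with opposite signs.\<close>

lemma basic_pointwise:
  fixes g gx gy gxy :: complex and p q a b :: real
  shows "(cmod (gx - \<i> * gy))\<^sup>2 - (cmod (gx + \<i> * gy + 2 * g * Complex p q))\<^sup>2 - 2 * (a + b) * (cmod g)\<^sup>2
   = - 2 * ((Im (g * cnj gy) + Re (g * cnj g) * p) * (2 * p) + (Im (g * cnj gxy + gx * cnj gy) + (Re (g * cnj g) * a + Re (g * cnj gx + gx * cnj g) * p)))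
     - 2 * ((- Im (g * cnj gx) + Re (g * cnj g) * q) * (2 * q) + (- Im (g * cnj gxy + gy * cnj gx) + (Re (g * cnj g) * b + Re (g * cnj gy + gy * cnj g) * q)))"
  unfolding cmod_power2 by (simp add: power2_eq_square algebra_simps)

text \<open>Integrated against \<open>exp (2 * \<phi> z)\<close>, the divergence in
  \<open>basic_pointwise\<close> disappears, and the dbar-type square is dropped because it is
  nonnegative.\<close>

theorem basic_estimate:
  assumes t: "testf r g gx gy"
  shows "2 * (n_lap g)\<^sup>2 \<le> (n2 N (TT gx gy))\<^sup>2"
proof -
  obtain gxy where s: "smooth2 \<D> g gx gy gxy" using t by (auto simp: testf_def)
  note D = smooth2D[OF s] and Z = testfD(7-9)[OF t] and r = testfD(1)[OF t]
  have e: "pd b \<D> (\<lambda>z. exp (2 * \<phi> z)) (\<lambda>z. 2 * exp (2 * \<phi> z) * p z)" if "pd b \<D> \<phi> p" for b p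
    by (rule pd_compose[OF that, of "\<lambda>s. exp (2 * s)" "\<lambda>s. 2 * exp (2 * s)"]) (auto intro!: derivative_eq_intros continuous_intros)
  define U where "U z = (Im (g z * cnj (gy z)) + Re (g z * cnj (g z)) * px z) * exp (2 * \<phi> z)" for z
  define V where "V z = (- Im (g z * cnj (gx z)) + Re (g z * cnj (g z)) * py z) * exp (2 * \<phi> z)" for z
  define U' where "U' z = (Im (g z * cnj (gy z)) + Re (g z * cnj (g z)) * px z) * (2 * exp (2 * \<phi> z) * px z) +
     (Im (g z * cnj (gxy z) + gx z * cnj (gy z)) + (Re (g z * cnj (g z)) * pxx z + Re (g z * cnj (gx z) + gx z * cnj (g z)) * px z)) * exp (2 * \<phi> z)" for z
  define V' where "V' z = (- Im (g z * cnj (gx z)) + Re (g z * cnj (g z)) * py z) * (2 * exp (2 * \<phi> z) * py z) +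
     (- Im (g z * cnj (gxy z) + gy z * cnj (gx z)) + (Re (g z * cnj (g z)) * pyy z + Re (g z * cnj (gy z) + gy z * cnj (g z)) * py z)) * exp (2 * \<phi> z)" for z
  have pU: "pd 1 \<D> U U'" unfolding U_def[abs_def] U'_def[abs_def]
    by (intro pd_mult pd_add pd_Im pd_Re pd_cnj e pd_phi D)
  have pV: "pd \<i> \<D> V V'" unfolding V_def[abs_def] V'_def[abs_def]
    by (intro pd_mult pd_add pd_minus pd_Im pd_Re pd_cnj e pd_phi D)
  have iU: "integral\<^sup>L \<mu> U' = 0" "integrable \<mu> U'"
    by (rule integral_pd_disk[OF pU r]; use Z in \<open>simp add: U_def\<close>)+
  have iV: "integral\<^sup>L \<mu> V' = 0" "integrable \<mu> V'"
    by (rule integral_pd_disk[OF pV r]; use Z in \<open>simp add: V_def\<close>)+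
  define A where "A z = (cmod (gx z - \<i> * gy z))\<^sup>2 / \<omega> z" for z
  define B where "B z = (cmod (gx z + \<i> * gy z + 2 * g z * Complex (px z) (py z)))\<^sup>2 / \<omega> z" for z
  define C where "C z = lap z * (cmod (g z))\<^sup>2 / \<omega> z" for z
  have iC: "integrable \<mu> C" unfolding C_def[abs_def] by (rule lap_integrable[OF t])
  have iA: "integrable \<mu> A" unfolding A_def[abs_def]
    by (rule integrable_disk_compact[OF _ r]) (use Z D in \<open>auto intro!: cont_div_omega continuous_intros\<close>)
  have eq: "B z = A z - 2 * C z + 2 * (U' z + V' z)" if z: "z \<in> \<D>" for z
  proof -
    let ?E = "exp (2 * \<phi> z)"
    have "A z - B z - 2 * C z = ((cmod (gx z - \<i> * gy z))\<^sup>2 - (cmod (gx z + \<i> * gy z + 2 * g z * Complex (px z) (py z)))\<^sup>2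
       - 2 * (pxx z + pyy z) * (cmod (g z))\<^sup>2) * ?E"
      unfolding exp_phi[OF z] A_def B_def C_def lap_def by (simp add: algebra_simps add_divide_distrib diff_divide_distrib)
    also have "\<dots> = - 2 * (U' z + V' z)"
      unfolding basic_pointwise[where gxy="gxy z"] U'_def V'_def by (simp add: algebra_simps)
    finally show ?thesis by simp
  qed
  \<comment> \<open>The integral of \<open>B\<close> is handled through the right-hand side of
    \<open>eq\<close>, each term of which is known to be integrable.\<close>
  have "0 \<le> (\<integral>z. A z - 2 * C z + 2 * (U' z + V' z) \<partial>\<mu>)"
  proof (rule integral_nonneg_AE, rule AE_I2)
    fix z assume "z \<in> space \<mu>"
    hence z: "z \<in> \<D>" by simp
    have "B z \<ge> 0" using omega_pos[OF z] by (simp add: B_def)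
    thus "0 \<le> A z - 2 * C z + 2 * (U' z + V' z)" using eq[OF z] by simp
  qed
  also have "\<dots> = integral\<^sup>L \<mu> A - 2 * integral\<^sup>L \<mu> C"
    using iU iV iA iC by simp
  finally show ?thesis unfolding n2_TT[OF t] n_lap_sq A_def C_def by simp
qed

end

section \<open>Weyl's lemma\<close>

text \<open>At \<open>c\<close> the difference quotients of the glued function are dominated by
  those of \<open>g\<close>, which tend to \<open>gd c = 0\<close>.\<close>

lemma DERIV_cutoff:
  fixes g gd :: "real \<Rightarrow> real"
  assumes g: "s \<le> c \<Longrightarrow> (g has_real_derivative gd s) (at s)" and c: "g c = 0" "gd c = 0"
  shows "((\<lambda>s. if s \<le> c then g s else 0) has_real_derivative (if s \<le> c then gd s else 0)) (at s)"
proof -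
  let ?h = "\<lambda>s. if s \<le> c then g s else 0"
  consider "s < c" | "s > c" | "s = c" by linarith
  thus ?thesis
  proof cases
    case 1
    have "(?h has_real_derivative gd s) (at s)"
      by (rule has_field_derivative_transform_within_open[of g _ _ "{..<c}"]) (use 1 g in auto)
    thus ?thesis using 1 by simp
  next
    case 2
    have "(?h has_real_derivative 0) (at s)"
      by (rule has_field_derivative_transform_within_open[of "\<lambda>_. 0" _ _ "{c<..}"]) (use 2 in auto)
    thus ?thesis using 2 by simp
  next
    case 3
    have "((\<lambda>y. (g y - g c) / (y - c)) \<longlongrightarrow> 0) (at c)"
      using g c 3 by (simp add: has_field_derivative_iff)
    hence "((\<lambda>y. (?h y - ?h c) / (y - c)) \<longlongrightarrow> 0) (at c)"
      by (rule Lim_null_comparison[rotated, OF tendsto_norm_zero]) (simp add: c)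
    thus ?thesis using 3 c by (simp add: has_field_derivative_iff)
  qed
qed

text \<open>\<open>c\<close> is the square of the radius. On its support a bump is a polynomial in
  \<open>(cmod u)^2\<close>, so identities between bumps of different exponents are algebraic;
  exponent 3 is smooth enough for \<open>smooth2\<close>.\<close>

definition bump :: "nat \<Rightarrow> real \<Rightarrow> complex \<Rightarrow> real" where
  "bump n c u = max 0 (c - (cmod u)\<^sup>2) ^ n"

lemma bump_nonneg: "bump n c u \<ge> 0"
  by (simp add: bump_def)

lemma bump_le: "0 \<le> c \<Longrightarrow> bump n c u \<le> c ^ n"
  unfolding bump_def by (intro power_mono) auto

lemma bump_cont: "continuous_on S (\<lambda>z. bump n c (z - w))"
  unfolding bump_def by (intro continuous_intros)

lemma bump_zero: "n > 0 \<Longrightarrow> c \<le> (cmod u)\<^sup>2 \<Longrightarrow> bump n c u = 0"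
  by (simp add: bump_def max_absorb1)

lemma bump_pos: "(cmod u)\<^sup>2 < c \<Longrightarrow> bump n c u > 0"
  by (simp add: bump_def)

lemma DERIV_max_pow:
  "((\<lambda>s. max 0 (c - s) ^ Suc (Suc n)) has_real_derivative - (real (Suc (Suc n)) * max 0 (c - s) ^ Suc n)) (at s)"
proof -
  have "((\<lambda>s. if s \<le> c then (c - s) ^ Suc (Suc n) else 0) has_real_derivative
     (if s \<le> c then - (real (Suc (Suc n)) * (c - s) ^ Suc n) else 0)) (at s)"
  proof (rule DERIV_cutoff)
    fix s
    have "((\<lambda>s. c - s) has_real_derivative -1) (at s)" by (auto intro!: derivative_eq_intros)
    from DERIV_power[OF this, of "Suc (Suc n)"]
    show "((\<lambda>s. (c - s) ^ Suc (Suc n)) has_real_derivative - (real (Suc (Suc n)) * (c - s) ^ Suc n)) (at s)" by simp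
  qed auto
  moreover have "(\<lambda>s. if s \<le> c then (c - s) ^ Suc (Suc n) else 0) = (\<lambda>s. max 0 (c - s) ^ Suc (Suc n))"
    by (auto simp: fun_eq_iff max_def)
  moreover have "(if s \<le> c then - (real (Suc (Suc n)) * (c - s) ^ Suc n) else 0) = - (real (Suc (Suc n)) * max 0 (c - s) ^ Suc n)"
    by (auto simp: max_def)
  ultimately show ?thesis by simp
qed

lemma pd_bump:
  "pd b S (\<lambda>z. bump (Suc (Suc n)) c (z - w))
     (\<lambda>z. - (real (Suc (Suc n)) * bump (Suc n) c (z - w)) * (2 * (Re b * Re (z - w) + Im b * Im (z - w))))"
  unfolding bump_def
  by (rule pd_compose[OF pd_dist2 DERIV_max_pow]) (intro continuous_intros)

lemma pd_Re_diff: "pd b S (\<lambda>z. Re (z - w)) (\<lambda>_. Re b)"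
  and pd_Im_diff: "pd b S (\<lambda>z. Im (z - w)) (\<lambda>_. Im b)"
  and pd_id_diff: "pd b S (\<lambda>z. z - w) (\<lambda>_. b)"
  unfolding pd_def by (auto intro!: continuous_intros derivative_eq_intros
     simp: has_real_derivative_iff_has_vector_derivative[symmetric])

lemma smooth2_bump:
  "smooth2 S (\<lambda>z. bump 3 c (z - w)) (\<lambda>z. - 6 * bump 2 c (z - w) * Re (z - w)) (\<lambda>z. - 6 * bump 2 c (z - w) * Im (z - w))
     (\<lambda>z. 24 * bump 1 c (z - w) * Re (z - w) * Im (z - w))"
proof -
  have 3: "pd b S (\<lambda>z. bump 3 c (z - w)) (\<lambda>z. - 3 * bump 2 c (z - w) * (2 * (Re b * Re (z - w) + Im b * Im (z - w))))" for b
    using pd_bump[of b S 1 c w] by (simp add: eval_nat_numeral)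
  have 2: "pd b S (\<lambda>z. bump 2 c (z - w)) (\<lambda>z. - 2 * bump 1 c (z - w) * (2 * (Re b * Re (z - w) + Im b * Im (z - w))))" for b
    using pd_bump[of b S 0 c w] by (simp add: eval_nat_numeral)
  have x: "pd \<i> S (\<lambda>z. (- 6 * bump 2 c (z - w)) * Re (z - w)) (\<lambda>z. (- 6 * bump 2 c (z - w)) * Re \<i> +
      (- 6 * (- 2 * bump 1 c (z - w) * (2 * (Re \<i> * Re (z - w) + Im \<i> * Im (z - w)))) + 0 * bump 2 c (z - w)) * Re (z - w))"
    by (intro pd_mult pd_Re_diff 2 pd_const)
  have y: "pd 1 S (\<lambda>z. (- 6 * bump 2 c (z - w)) * Im (z - w)) (\<lambda>z. (- 6 * bump 2 c (z - w)) * Im 1 +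
      (- 6 * (- 2 * bump 1 c (z - w) * (2 * (Re 1 * Re (z - w) + Im 1 * Im (z - w)))) + 0 * bump 2 c (z - w)) * Im (z - w))"
    by (intro pd_mult pd_Im_diff 2 pd_const)
  show ?thesis unfolding smooth2_def using 3[of 1] 3[of \<i>] x y by (simp add: algebra_simps)
qed

lemma bump_support:
  assumes "n > 0" "c \<ge> 0" "cmod w + sqrt c < cmod z"
  shows "bump n c (z - w) = 0"
proof (rule bump_zero[OF assms(1)])
  have "sqrt c < cmod (z - w)" using assms norm_triangle_ineq2[of z w] by linarith
  hence "(sqrt c)\<^sup>2 < (cmod (z - w))\<^sup>2" using assms(2) by (intro power_strict_mono) auto
  thus "c \<le> (cmod (z - w))\<^sup>2" using assms(2) by simp
qed

lemma testf_bump: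
  assumes "c \<ge> 0" "cmod w + sqrt c < 1"
  shows "testf (cmod w + sqrt c) (\<lambda>z. of_real (bump 3 c (z - w)))
     (\<lambda>z. of_real (- 6 * bump 2 c (z - w) * Re (z - w))) (\<lambda>z. of_real (- 6 * bump 2 c (z - w) * Im (z - w)))"
  unfolding testf_def using assms smooth2_linear[OF bounded_linear_of_real smooth2_bump, of \<D> c w]
  by (auto simp: bump_support)

lemma testf_id_bump:
  assumes "c \<ge> 0" "cmod w + sqrt c < 1"
  shows "testf (cmod w + sqrt c) (\<lambda>z. (z - w) * of_real (bump 3 c (z - w)))
     (\<lambda>z. (z - w) * of_real (- 6 * bump 2 c (z - w) * Re (z - w)) + 1 * of_real (bump 3 c (z - w)))
     (\<lambda>z. (z - w) * of_real (- 6 * bump 2 c (z - w) * Im (z - w)) + \<i> * of_real (bump 3 c (z - w)))"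
proof -
  have "smooth2 \<D> (\<lambda>z. z - w) (\<lambda>_. 1) (\<lambda>_. \<i>) (\<lambda>_. 0)"
    unfolding smooth2_def using pd_id_diff pd_const by blast
  from testf_mult[OF testf_bump[OF assms] this] show ?thesis by simp
qed

text \<open>For a radial test function the conjugated derivative is a radial multiple of
  \<open>u\<close>. Testing with it says that the first moments of \<open>v\<close> against
  \<open>bump 2\<close> vanish.\<close>

lemma bump_orth_identity:
  "cnj (of_real (- 6 * bump 2 c u * Re u) - \<i> * of_real (- 6 * bump 2 c u * Im u)) = - 6 * (u * of_real (bump 2 c u))"
  by (simp add: complex_eq_iff algebra_simps)

text \<open>With \<open>(z - w) * bump 3\<close> the outcome is radial, because
  \<open>(cmod u)^2 * bump 2 = c * bump 2 - bump 3\<close>. As \<open>3 * bump 2\<close> is the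
  \<open>c\<close>-derivative of \<open>bump 3\<close>, its vanishing against \<open>v\<close> is
  the differential equation solved by multiples of \<open>c^4\<close>.\<close>

lemma id_bump_orth_identity:
  "cnj ((u * of_real (- 6 * bump 2 c u * Re u) + 1 * of_real (bump 3 c u)) -
     \<i> * (u * of_real (- 6 * bump 2 c u * Im u) + \<i> * of_real (bump 3 c u))) = 2 * of_real (4 * bump 3 c u - 3 * c * bump 2 c u)"
proof -
  have "bump 3 c u = bump 2 c u * (c - (cmod u)\<^sup>2)"
    by (auto simp: bump_def max_def power3_eq_cube power2_eq_square)
  thus ?thesis unfolding cmod_power2
    by (simp add: complex_eq_iff algebra_simps power2_eq_square)
qed

lemma has_derivative_quadratic:
  fixes f :: "'a::real_normed_vector \<Rightarrow> 'b::real_normed_vector"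
  assumes "bounded_linear L" "e > 0" "\<And>t. norm t < e \<Longrightarrow> norm (f (x + t) - f x - L t) \<le> B * (norm t)\<^sup>2"
  shows "(f has_derivative L) (at x)"
proof -
  have "((\<lambda>h. norm (f (x + h) - f x - L h) / norm h) \<longlongrightarrow> 0) (at 0)"
  proof (rule Lim_null_comparison)
    show "\<forall>\<^sub>F h in at 0. norm (norm (f (x + h) - f x - L h) / norm h) \<le> B * norm h"
      unfolding eventually_at
    proof (intro exI[of _ e] conjI ballI impI)
      fix h :: 'a assume h: "h \<noteq> 0 \<and> dist h 0 < e"
      hence "norm (f (x + h) - f x - L h) \<le> B * (norm h)\<^sup>2" using assms(3)[of h] by simp
      thus "norm (norm (f (x + h) - f x - L h) / norm h) \<le> B * norm h"
        using h by (simp add: divide_le_eq power2_eq_square mult.assoc)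
    qed (rule assms)
    have "((\<lambda>h. B * norm h) \<longlongrightarrow> B * norm (0::'a)) (at (0::'a))"
      by (intro tendsto_intros)
    thus "((\<lambda>h. B * norm h) \<longlongrightarrow> 0) (at (0::'a))" by simp
  qed
  thus ?thesis using assms(1) by (simp add: has_derivative_at)
qed

lemma integrable_bmult:
  fixes v h :: "'a \<Rightarrow> complex"
  assumes "integrable M v" "h \<in> borel_measurable M" "\<And>x. x \<in> space M \<Longrightarrow> cmod (h x) \<le> B"
  shows "integrable M (\<lambda>x. v x * h x)"
proof (rule integrable_dominated)
  show "integrable M (\<lambda>x. B * norm (v x))" using assms by simp
  show "AE x in M. norm (v x * h x) \<le> norm (B * norm (v x))"
  proof (rule AE_I2)
    fix x assume "x \<in> space M"
    hence "cmod (h x) \<le> B" "cmod (h x) \<le> \<bar>B\<bar>" using assms(3)[of x] by auto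
    hence "cmod (v x) * cmod (h x) \<le> cmod (v x) * \<bar>B\<bar>" by (intro mult_left_mono) auto
    thus "norm (v x * h x) \<le> norm (B * norm (v x))" by (simp add: norm_mult abs_mult mult.commute)
  qed
qed (use assms in \<open>auto intro!: borel_measurable_times\<close>)

lemma integral_bmult_le:
  fixes v h :: "'a \<Rightarrow> complex"
  assumes "integrable M v" "h \<in> borel_measurable M" "\<And>x. x \<in> space M \<Longrightarrow> cmod (h x) \<le> B"
  shows "cmod (\<integral>x. v x * h x \<partial>M) \<le> B * (\<integral>x. cmod (v x) \<partial>M)"
proof -
  have "cmod (\<integral>x. v x * h x \<partial>M) \<le> (\<integral>x. cmod (v x * h x) \<partial>M)" by (rule integral_norm_bound)
  also have "\<dots> \<le> (\<integral>x. B * cmod (v x) \<partial>M)"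
  proof (rule integral_mono)
    show "integrable M (\<lambda>x. cmod (v x * h x))" using integrable_bmult[OF assms] by simp
    show "integrable M (\<lambda>x. B * cmod (v x))" using assms by simp
    fix x assume "x \<in> space M"
    from mult_left_mono[OF assms(3)[OF this], of "cmod (v x)"]
    show "cmod (v x * h x) \<le> B * cmod (v x)" by (simp add: norm_mult mult.commute)
  qed
  finally show ?thesis by simp
qed

text \<open>A Taylor estimate across the kink at 0. Upper bounds on the arguments are enough, since
  the cubes ignore negative values; for nonnegative arguments the remainder is
  \<open>(y + 2 * x) * (y - x)^2\<close>, whence the factor \<open>3 * B\<close>.\<close>

lemma max_cube_taylor:
  fixes x y B :: real
  assumes "x \<le> B" "y \<le> B" "B \<ge> 0"
  shows "\<bar>max 0 y ^ 3 - max 0 x ^ 3 - 3 * max 0 x ^ 2 * (y - x)\<bar> \<le> 3 * B * (y - x)\<^sup>2"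
proof -
  consider "x \<ge> 0" "y \<ge> 0" | "x \<ge> 0" "y < 0" | "x < 0" "y \<ge> 0" | "x < 0" "y < 0" by linarith
  thus ?thesis
  proof cases
    case 1
    have "max 0 y ^ 3 - max 0 x ^ 3 - 3 * max 0 x ^ 2 * (y - x) = (y + 2 * x) * (y - x)\<^sup>2"
      using 1 by (simp add: power2_eq_square power3_eq_cube algebra_simps)
    moreover have "(y + 2 * x) * (y - x)\<^sup>2 \<le> 3 * B * (y - x)\<^sup>2" using assms by (intro mult_right_mono) auto
    ultimately show ?thesis using 1 by simp
  next
    case 2
    have "max 0 y ^ 3 - max 0 x ^ 3 - 3 * max 0 x ^ 2 * (y - x) = x * (x * (2 * x - 3 * y))"
      using 2 by (simp add: power2_eq_square power3_eq_cube algebra_simps)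
    moreover have "0 \<le> x * (x * (2 * x - 3 * y))" using 2 by (intro mult_nonneg_nonneg) auto
    moreover have "x * (x * (2 * x - 3 * y)) \<le> B * ((x - y) * (3 * (x - y)))"
      using 2 assms by (intro mult_mono mult_nonneg_nonneg) auto
    ultimately show ?thesis by (simp add: power2_eq_square algebra_simps)
  next
    case 3
    have "max 0 y ^ 3 - max 0 x ^ 3 - 3 * max 0 x ^ 2 * (y - x) = y * (y * y)"
      using 3 by (simp add: power3_eq_cube)
    moreover have "0 \<le> y * (y * y)" using 3 by (intro mult_nonneg_nonneg) auto
    moreover have "y * (y * y) \<le> (3 * B) * ((y - x) * (y - x))"
      using 3 assms by (intro mult_mono mult_nonneg_nonneg) auto
    ultimately show ?thesis by (simp add: power2_eq_square)
  next
    case 4 thus ?thesis using assms by simp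
  qed
qed

definition mol :: "(complex \<Rightarrow> complex) \<Rightarrow> nat \<Rightarrow> real \<Rightarrow> complex \<Rightarrow> complex" where
  "mol v n c w = (\<integral>z. v z * of_real (bump n c (z - w)) \<partial>\<mu>)"

lemma bump_meas: "(\<lambda>z. complex_of_real (bump n c (z - w))) \<in> borel_measurable \<mu>"
  by (intro disk_measurable continuous_on_of_real bump_cont)

lemma mol_integrable:
  fixes v :: "complex \<Rightarrow> complex"
  assumes "integrable \<mu> v" "c \<ge> 0"
  shows "integrable \<mu> (\<lambda>z. v z * of_real (bump n c (z - w)))"
  by (rule integrable_bmult[OF assms(1) bump_meas, of _ _ _ "c ^ n"]) (use bump_le bump_nonneg assms in auto)

text \<open>Moving the centre by \<open>t\<close> changes the bump to first order by
  \<open>3 * bump 2\<close> times \<open>2 * Re (cnj t * (z - w))\<close>, which is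
  \<open>cnj t * (z - w) + t * cnj (z - w)\<close>. The assumption removes the part antilinear in
  \<open>t\<close>, so the real derivative is complex linear.\<close>

lemma mol_deriv_w:
  assumes v: "integrable \<mu> v" and c: "0 \<le> c" "c \<le> 1" and w: "w \<in> \<D>"
    and orth: "(\<integral>z. v z * ((z - w) * of_real (bump 2 c (z - w))) \<partial>\<mu>) = 0"
  shows "((mol v 3 c) has_field_derivative (3 * (\<integral>z. v z * (cnj (z - w) * of_real (bump 2 c (z - w))) \<partial>\<mu>))) (at w)"
  unfolding has_field_derivative_def
\<comment> \<open>78 = 3 * 5^2 + 3: the increment of the argument in the cubic Taylor estimate is at
  most \<open>5 * cmod t\<close>, and the summand \<open>(cmod t)^2\<close> contained in it adds the
  last 3.\<close>
proof (rule has_derivative_quadratic[where e=1 and B="78 * (\<integral>z. cmod (v z) \<partial>\<mu>)"])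
  let ?D = "\<integral>z. v z * (cnj (z - w) * of_real (bump 2 c (z - w))) \<partial>\<mu>"
  show "bounded_linear ((*) (3 * ?D))" by (rule bounded_linear_mult_right)
  fix t :: complex assume t: "norm t < 1"
  have c2: "bump 2 c u \<le> 1" for u using bump_le[of c 2 u] c power_le_one[of c 2] by simp
  have u2: "cmod (z - w) \<le> 2" if "z \<in> space \<mu>" for z
    using that w norm_triangle_ineq4[of z w] by simp
  define h where "h z = of_real (bump 3 c (z - (w + t))) - of_real (bump 3 c (z - w))
     - 3 * (cnj t * ((z - w) * of_real (bump 2 c (z - w))) + t * (cnj (z - w) * of_real (bump 2 c (z - w))))" for z
  have hm: "h \<in> borel_measurable \<mu>" unfolding h_def
    by (intro disk_measurable continuous_intros bump_cont continuous_on_of_real)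
  have hb: "cmod (h z) \<le> 78 * (cmod t)\<^sup>2" if z: "z \<in> space \<mu>" for z
  proof -
    define x where "x = c - (cmod (z - w))\<^sup>2"
    define y where "y = c - (cmod (z - (w + t)))\<^sup>2"
    define R where "R = Re (cnj t * (z - w))"
    have yx: "y - x = 2 * R - (cmod t)\<^sup>2"
      unfolding x_def y_def cmod_power2 R_def by (simp add: power2_eq_square algebra_simps)
    have "\<bar>R\<bar> \<le> cmod t * 2"
      using order_trans[OF abs_Re_le_cmod, of "cnj t * (z - w)"] mult_left_mono[OF u2[OF z], of "cmod t"]
      unfolding R_def by (simp add: norm_mult del: times_complex.sel)
    moreover have "(cmod t)\<^sup>2 \<le> cmod t" using t mult_left_mono[of "cmod t" 1 "cmod t"] by (simp add: power2_eq_square)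
    ultimately have "\<bar>y - x\<bar> \<le> 5 * cmod t" using yx zero_le_power2[of "cmod t"] by linarith
    hence yx2: "(y - x)\<^sup>2 \<le> (5 * cmod t)\<^sup>2" unfolding abs_le_square_iff[symmetric] by simp
    have tay: "\<bar>max 0 y ^ 3 - max 0 x ^ 3 - 3 * max 0 x ^ 2 * (y - x)\<bar> \<le> 3 * 1 * (y - x)\<^sup>2"
    proof (rule max_cube_taylor)
      show "x \<le> 1" "y \<le> 1" unfolding x_def y_def
        using c zero_le_power2[of "cmod (z - w)"] zero_le_power2[of "cmod (z - (w + t))"] by linarith+
    qed simp
    have "cnj t * (z - w) + t * cnj (z - w) = of_real (2 * R)"
      unfolding R_def by (simp add: complex_eq_iff algebra_simps)
    moreover have "cnj t * ((z - w) * A) + t * (cnj (z - w) * A) = (cnj t * (z - w) + t * cnj (z - w)) * A" for A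
      by (simp only: distrib_right mult.assoc)
    ultimately have "h z = of_real (max 0 y ^ 3) - of_real (max 0 x ^ 3) - 3 * (of_real (2 * R) * of_real (max 0 x ^ 2))"
      unfolding h_def bump_def x_def y_def by metis
    also have "\<dots> = of_real (max 0 y ^ 3 - max 0 x ^ 3 - 3 * max 0 x ^ 2 * (y - x) - 3 * max 0 x ^ 2 * (cmod t)\<^sup>2)"
      unfolding yx by (simp add: algebra_simps)
    finally have "cmod (h z) = \<bar>max 0 y ^ 3 - max 0 x ^ 3 - 3 * max 0 x ^ 2 * (y - x) - 3 * max 0 x ^ 2 * (cmod t)\<^sup>2\<bar>"
      by (simp only: norm_of_real)
    also have "\<dots> \<le> 3 * (y - x)\<^sup>2 + 3 * max 0 x ^ 2 * (cmod t)\<^sup>2"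
      using tay by (intro order_trans[OF abs_triangle_ineq4]) (simp add: abs_mult)
    also have "\<dots> \<le> 3 * (y - x)\<^sup>2 + 3 * 1 * (cmod t)\<^sup>2"
      using c2[of "z - w"] by (intro add_left_mono mult_right_mono) (auto simp: bump_def x_def)
    finally show ?thesis using yx2 by (simp add: power_mult_distrib)
  qed
  have i: "integrable \<mu> (\<lambda>z. v z * g z)" if "continuous_on \<D> g" "\<And>z. z \<in> \<D> \<Longrightarrow> cmod (g z) \<le> 2" for g
    by (rule integrable_bmult[OF v disk_measurable[OF that(1)], of 2]) (use that in auto)
  have b2: "cmod (u * of_real (bump 2 c z)) \<le> 2" if "cmod u \<le> 2" for u z
    using mult_mono[OF that c2[of z]] bump_nonneg[of 2 c z] by (simp add: norm_mult)
  have i1: "integrable \<mu> (\<lambda>z. v z * ((z - w) * of_real (bump 2 c (z - w))))"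
  proof (rule i)
    show "continuous_on \<D> (\<lambda>z. (z - w) * of_real (bump 2 c (z - w)))"
      by (intro continuous_intros bump_cont)
  qed (use b2 u2 in auto)
  have i2: "integrable \<mu> (\<lambda>z. v z * (cnj (z - w) * of_real (bump 2 c (z - w))))"
  proof (rule i)
    show "continuous_on \<D> (\<lambda>z. cnj (z - w) * of_real (bump 2 c (z - w)))"
      by (intro continuous_intros bump_cont)
    show "cmod (cnj (z - w) * of_real (bump 2 c (z - w))) \<le> 2" if "z \<in> \<D>" for z
      by (rule b2) (use u2[of z] that in \<open>simp del: complex_cnj_diff\<close>)
  qed
  have "(\<integral>z. v z * h z \<partial>\<mu>) = (\<integral>z. v z * of_real (bump 3 c (z - (w + t))) - v z * of_real (bump 3 c (z - w))
     - 3 * (cnj t * (v z * ((z - w) * of_real (bump 2 c (z - w)))) + t * (v z * (cnj (z - w) * of_real (bump 2 c (z - w))))) \<partial>\<mu>)"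
    unfolding h_def right_diff_distrib distrib_left by (simp only: mult.left_commute[of "v _"])
  also have "\<dots> = mol v 3 c (w + t) - mol v 3 c w - 3 * ?D * t"
    using mol_integrable[OF v c(1)] i1 i2 orth unfolding mol_def by simp
  finally show "norm (mol v 3 c (w + t) - mol v 3 c w - 3 * ?D * t) \<le> 78 * (\<integral>z. cmod (v z) \<partial>\<mu>) * (norm t)\<^sup>2"
    using integral_bmult_le[OF v hm hb] by (simp add: mult_ac)
qed simp

lemma mol_deriv_c:
  assumes v: "integrable \<mu> v" and c: "0 < c" "c < 1"
  shows "((\<lambda>c. mol v 3 c w) has_vector_derivative (3 * mol v 2 c w)) (at c)"
  unfolding has_vector_derivative_def
proof (rule has_derivative_quadratic[where e="min c (1 - c)" and B="3 * (\<integral>z. cmod (v z) \<partial>\<mu>)"])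
  show "bounded_linear (\<lambda>x. x *\<^sub>R (3 * mol v 2 c w))" by (rule bounded_linear_scaleR_left)
  show "min c (1 - c) > 0" using c by simp
  fix t :: real assume t: "norm t < min c (1 - c)"
  hence ct: "0 \<le> c + t" "c + t \<le> 1" by auto
  define h where "h z = complex_of_real (bump 3 (c + t) (z - w) - bump 3 c (z - w) - t * (3 * bump 2 c (z - w)))" for z
  have hm: "h \<in> borel_measurable \<mu>" unfolding h_def
    by (intro disk_measurable continuous_intros bump_cont continuous_on_of_real)
  have hb: "cmod (h z) \<le> 3 * (norm t)\<^sup>2" for z
  proof -
    have "cmod (h z) = \<bar>max 0 (c + t - (cmod (z - w))\<^sup>2) ^ 3 - max 0 (c - (cmod (z - w))\<^sup>2) ^ 3
        - 3 * max 0 (c - (cmod (z - w))\<^sup>2) ^ 2 * ((c + t - (cmod (z - w))\<^sup>2) - (c - (cmod (z - w))\<^sup>2))\<bar>"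
      unfolding h_def bump_def norm_of_real by (simp add: algebra_simps)
    also have "\<dots> \<le> 3 * 1 * ((c + t - (cmod (z - w))\<^sup>2) - (c - (cmod (z - w))\<^sup>2))\<^sup>2"
      by (rule max_cube_taylor) (use c ct zero_le_power2[of "cmod (z - w)"] in linarith)+
    finally show ?thesis by simp
  qed
  have "(\<integral>z. v z * h z \<partial>\<mu>) = (\<integral>z. v z * of_real (bump 3 (c + t) (z - w)) - v z * of_real (bump 3 c (z - w))
     - t *\<^sub>R (3 * (v z * of_real (bump 2 c (z - w)))) \<partial>\<mu>)"
    unfolding h_def by (simp add: right_diff_distrib scaleR_conv_of_real mult.left_commute[of "v _"])
  also have "\<dots> = mol v 3 (c + t) w - mol v 3 c w - t *\<^sub>R (3 * mol v 2 c w)"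
    using mol_integrable[OF v] c ct unfolding mol_def by simp
  finally show "norm (mol v 3 (c + t) w - mol v 3 c w - t *\<^sub>R (3 * mol v 2 c w)) \<le> 3 * (\<integral>z. cmod (v z) \<partial>\<mu>) * (norm t)\<^sup>2"
    using integral_bmult_le[OF v hm hb] by (simp add: mult_ac)
qed

lemma null_disk:
  assumes "T \<in> null_sets lebesgue" "T \<subseteq> \<D>" shows "T \<in> null_sets \<mu>"
proof -
  have m: "T \<in> sets (lebesgue_on \<D>)" using assms by (auto simp: sets_restrict_space_iff)
  have "emeasure \<mu> T = ennreal (1 / pi) * emeasure (lebesgue_on \<D>) T"
    unfolding disk_area_def by (rule emeasure_density_const[OF m])
  also have "emeasure (lebesgue_on \<D>) T = 0"
    using assms by (subst emeasure_restrict_space) auto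
  finally show ?thesis using m by (auto simp: sets_disk intro: null_setsI)
qed

lemma compact_disk_radius:
  assumes "compact K" "K \<subseteq> \<D>"
  obtains R where "0 \<le> R" "R < 1" "K \<subseteq> cball 0 R"
proof (cases "K = {}")
  case True thus ?thesis using that[of 0] by auto
next
  case False
  obtain x where x: "x \<in> K" "\<forall>y\<in>K. cmod y \<le> cmod x"
    using continuous_attains_sup[OF assms(1) False continuous_on_norm_id] by blast
  thus ?thesis using that[of "cmod x"] assms(2) by (auto simp: subset_iff)
qed

text \<open>The set where \<open>r\<close> is positive is, up to a null set, a countable union of
  closed sets. Their intersections with smaller discs are compact, and since \<open>r\<close> is
  positive on them with integral zero, they are null.\<close>

lemma AE_nonpos_of_compacts:
  fixes r :: "complex \<Rightarrow> real"
  assumes m: "r \<in> borel_measurable \<mu>"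
    and K: "\<And>K. compact K \<Longrightarrow> K \<subseteq> \<D> \<Longrightarrow> integrable \<mu> (\<lambda>z. indicator K z * r z)"
      "\<And>K. compact K \<Longrightarrow> K \<subseteq> \<D> \<Longrightarrow> (\<integral>z. indicator K z * r z \<partial>\<mu>) = 0"
  shows "AE z in \<mu>. r z \<le> 0"
proof -
  define E where "E = {z \<in> \<D>. r z > 0}"
  have "E = {z \<in> space \<mu>. r z > 0}" by (simp add: E_def)
  also have "\<dots> \<in> sets \<mu>" using m by measurable
  finally have "E \<in> sets (lebesgue_on \<D>)" by (simp add: sets_disk)
  hence "E \<in> sets lebesgue" by (simp add: sets_restrict_space_iff)
  then obtain C T where CT: "fsigma C" "T \<in> null_sets lebesgue" "C \<union> T = E" by (rule lebesgue_set_almost_fsigma)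
  obtain F :: "nat \<Rightarrow> complex set" where F: "\<And>n. closed (F n)" "C = \<Union>(range F)"
    using CT(1) by (auto elim: fsigma.cases)
  have null: "F n \<inter> cball 0 (1 - 1 / Suc k) \<in> null_sets \<mu>" for n and k :: nat
  proof -
    let ?K = "F n \<inter> cball 0 (1 - 1 / real (Suc k))"
    have cK: "compact ?K" using F by (intro closed_Int_compact) auto
    have KE: "?K \<subseteq> E" using CT(3) F(2) by auto
    hence KD: "?K \<subseteq> \<D>" by (auto simp: E_def)
    have "AE z in \<mu>. indicator ?K z * r z = 0"
    proof (rule integral_nonneg_eq_0_iff_AE[THEN iffD1, OF K(1)[OF cK KD] _ K(2)[OF cK KD]])
      show "AE z in \<mu>. 0 \<le> indicator ?K z * r z"
        by (rule AE_I2) (use KE in \<open>auto simp: indicator_def E_def\<close>)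
    qed
    hence "AE z in \<mu>. z \<notin> ?K"
      by eventually_elim (use KE in \<open>auto simp: indicator_def E_def split: if_splits\<close>)
    moreover have "?K \<in> sets \<mu>"
      using closed_disk_sets[of ?K] cK KD by (simp add: compact_imp_closed Int_absorb2)
    ultimately show ?thesis by (subst AE_iff_null_sets) auto
  qed
  have "E \<subseteq> (\<Union>n. \<Union>k. F n \<inter> cball 0 (1 - 1 / real (Suc k))) \<union> T"
  proof
    fix z assume z: "z \<in> E"
    show "z \<in> (\<Union>n. \<Union>k. F n \<inter> cball 0 (1 - 1 / real (Suc k))) \<union> T"
    proof (cases "z \<in> T")
      case False
      then obtain n where n: "z \<in> F n" using z CT(3) F(2) by auto
      have "1 - cmod z > 0" using z by (simp add: E_def)
      then obtain k where "inverse (real (Suc k)) < 1 - cmod z" using reals_Archimedean by blast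
      hence "z \<in> cball 0 (1 - 1 / real (Suc k))" by (simp add: inverse_eq_divide)
      thus ?thesis using n by blast
    qed simp
  qed
  moreover have "T \<in> null_sets \<mu>" by (rule null_disk) (use CT in \<open>auto simp: E_def\<close>)
  moreover have "(\<Union>n. \<Union>k. F n \<inter> cball 0 (1 - 1 / real (Suc k))) \<in> null_sets \<mu>"
    by (intro null_sets_UN null)
  ultimately have "AE z in \<mu>. z \<notin> E"
    by (intro AE_I'[of "(\<Union>n. \<Union>k. F n \<inter> cball 0 (1 - 1 / real (Suc k))) \<union> T"]) (auto intro!: null_sets.Un)
  thus ?thesis
    by (rule AE_mp) (rule AE_I2, auto simp: E_def)
qed

text \<open>The weak form of dbar v = 0. Integrability is asked for on smaller discs only, since an
  element of L^2(omega dA) may grow without control towards the boundary.\<close>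

locale weakly_hol =
  fixes v :: "complex \<Rightarrow> complex"
  assumes meas: "v \<in> borel_measurable \<mu>"
    and loc_int: "R < 1 \<Longrightarrow> integrable \<mu> (\<lambda>z. indicator (cball 0 R) z * v z)"
    and orth: "testf r g gx gy \<Longrightarrow> (\<integral>z. v z * cnj (gx z - \<i> * gy z) \<partial>\<mu>) = 0"
begin

lemma orth1:
  assumes c: "0 \<le> c" "cmod w + sqrt c < 1"
  shows "(\<integral>z. v z * ((z - w) * of_real (bump 2 c (z - w))) \<partial>\<mu>) = 0"
proof -
  have "(\<integral>z. v z * (- 6 * ((z - w) * of_real (bump 2 c (z - w)))) \<partial>\<mu>) = 0"
    using orth[OF testf_bump[OF c]] unfolding bump_orth_identity .
  hence "(\<integral>z. - 6 * (v z * ((z - w) * of_real (bump 2 c (z - w)))) \<partial>\<mu>) = 0" by (simp only: mult.left_commute)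
  hence "- 6 * (\<integral>z. v z * ((z - w) * of_real (bump 2 c (z - w))) \<partial>\<mu>) = 0" unfolding integral_mult_right_zero .
  thus ?thesis by simp
qed

lemma orth2:
  assumes c: "0 \<le> c" "cmod w + sqrt c < 1"
  shows "(\<integral>z. v z * of_real (4 * bump 3 c (z - w) - 3 * c * bump 2 c (z - w)) \<partial>\<mu>) = 0"
proof -
  have "(\<integral>z. v z * (2 * of_real (4 * bump 3 c (z - w) - 3 * c * bump 2 c (z - w))) \<partial>\<mu>) = 0"
    using orth[OF testf_id_bump[OF c]] unfolding id_bump_orth_identity .
  hence "(\<integral>z. 2 * (v z * of_real (4 * bump 3 c (z - w) - 3 * c * bump 2 c (z - w))) \<partial>\<mu>) = 0" by (simp only: mult.left_commute)
  hence "2 * (\<integral>z. v z * of_real (4 * bump 3 c (z - w) - 3 * c * bump 2 c (z - w)) \<partial>\<mu>) = 0" unfolding integral_mult_right_zero .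
  thus ?thesis unfolding mult_eq_0_iff by (rule disjE) (simp, assumption)
qed

text \<open>The derivative lemmas for \<open>mol\<close> assume integrability on the whole disk.
  Truncation provides it and does not alter integrals against bumps supported in
  \<open>cball 0 R\<close>.\<close>

definition vR :: "real \<Rightarrow> complex \<Rightarrow> complex" where "vR R z = indicator (cball 0 R) z * v z"

lemma vR_int: "R < 1 \<Longrightarrow> integrable \<mu> (vR R)"
  using loc_int by (simp add: vR_def[abs_def])

lemma vR_bump:
  assumes "n > 0" "c \<ge> 0" "cmod w + sqrt c \<le> R"
  shows "(\<lambda>z. vR R z * (a z * of_real (bump n c (z - w)))) = (\<lambda>z. v z * (a z * of_real (bump n c (z - w))))"
proof
  fix z
  show "vR R z * (a z * of_real (bump n c (z - w))) = v z * (a z * of_real (bump n c (z - w)))"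
    using bump_support[of n c w z] assms by (cases "cmod z \<le> R") (auto simp: vR_def indicator_def)
qed

lemma mol_vR: "n > 0 \<Longrightarrow> c \<ge> 0 \<Longrightarrow> cmod w + sqrt c \<le> R \<Longrightarrow> mol (vR R) n c w = mol v n c w"
  using vR_bump[of n c w R "\<lambda>_. 1"] unfolding mol_def by (simp only: mult_1)

lemma mol_int: "n > 0 \<Longrightarrow> 0 \<le> c \<Longrightarrow> cmod w + sqrt c < 1 \<Longrightarrow> integrable \<mu> (\<lambda>z. v z * of_real (bump n c (z - w)))"
  using mol_integrable[OF vR_int, of "cmod w + sqrt c" c n w] vR_bump[of n c w "cmod w + sqrt c" "\<lambda>_. 1"] by (simp only: mult_1)

lemma mol_deriv:
  assumes c: "0 < c" "cmod w + sqrt c < R" "R < 1"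
  shows "(mol v 3 c has_field_derivative 3 * (\<integral>z. v z * (cnj (z - w) * of_real (bump 2 c (z - w))) \<partial>\<mu>)) (at w)"
proof -
  have c1: "c \<le> 1" using c by (smt (verit) norm_ge_zero real_sqrt_le_1_iff)
  have orth: "(\<integral>z. vR R z * ((z - w) * of_real (bump 2 c (z - w))) \<partial>\<mu>) = 0"
    using orth1[of c w] c vR_bump[of 2 c w R "\<lambda>z. z - w"] by simp
  have "cmod w < 1" using c real_sqrt_gt_zero[OF c(1)] by linarith
  hence w: "w \<in> \<D>" by simp
  have "(mol (vR R) 3 c has_field_derivative 3 * (\<integral>z. vR R z * (cnj (z - w) * of_real (bump 2 c (z - w))) \<partial>\<mu>)) (at w)"
    by (rule mol_deriv_w[OF vR_int]) (use c c1 orth w in auto)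
  hence "(mol (vR R) 3 c has_field_derivative 3 * (\<integral>z. v z * (cnj (z - w) * of_real (bump 2 c (z - w))) \<partial>\<mu>)) (at w)"
    using c vR_bump[of 2 c w R "\<lambda>z. cnj (z - w)"] by simp
  thus ?thesis
    by (rule has_field_derivative_transform_within_open[where S="ball 0 (R - sqrt c)"]) (use c mol_vR in auto)
qed

text \<open>By \<open>orth2\<close>, the \<open>c\<close>-derivative of \<open>mol v 3 c w / c\<^sup>4\<close> vanishes. So the normalised mollifications of \<open>v\<close>
  do not depend on the radius, and they are holomorphic because \<open>orth1\<close> kills the \<open>cnj t\<close>-part of their derivative.\<close>

lemma mol_ratio:
  assumes c: "0 < c" "cmod w + sqrt c < 1" "0 < d" "cmod w + sqrt d < 1"
  shows "mol v 3 c w / of_real (c ^ 4) = mol v 3 d w / of_real (d ^ 4)"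
proof -
  obtain R where R: "cmod w + sqrt c < R" "cmod w + sqrt d < R" "R < 1"
    using dense[of "max (cmod w + sqrt c) (cmod w + sqrt d)" 1] c by auto
  \<comment> \<open>The values of \<open>c\<close> for which the disc of radius
    \<open>sqrt c\<close> around \<open>w\<close> stays inside radius \<open>R\<close>. They form an
    interval, on which a vanishing derivative implies constancy.\<close>
  define S where "S = {0<..<(R - cmod w)\<^sup>2}"
  have SI: "a \<in> S" if "0 < a" "cmod w + sqrt a < R" for a
  proof -
    have "(sqrt a)\<^sup>2 < (R - cmod w)\<^sup>2" using that by (intro power_strict_mono) auto
    thus ?thesis using that by (simp add: S_def)
  qed
  obtain k where k: "\<And>a. a \<in> S \<Longrightarrow> mol (vR R) 3 a w / of_real (a ^ 4) = k"
  proof (rule has_vector_derivative_zero_constant[of S "\<lambda>a. mol (vR R) 3 a w / of_real (a ^ 4)"])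
    show "convex S" by (simp add: S_def)
    fix a assume "a \<in> S"
    hence a: "0 < a" "a < (R - cmod w)\<^sup>2" by (auto simp: S_def)
    have Rw: "R - cmod w > 0" using R c by (smt (verit) real_sqrt_gt_zero)
    have sa: "cmod w + sqrt a < R"
      using real_sqrt_less_mono[OF a(2)] Rw by simp
    have "(R - cmod w)\<^sup>2 \<le> 1" using Rw R norm_ge_zero[of w] by (intro power_le_one) linarith+
    hence a1: "a < 1" using a by simp
    have d: "((\<lambda>c. mol (vR R) 3 c w) has_vector_derivative (3 * mol (vR R) 2 a w)) (at a)"
      by (rule mol_deriv_c[OF vR_int[OF R(3)] a(1) a1])
    have d2: "((\<lambda>a. complex_of_real (inverse (a ^ 4))) has_vector_derivative complex_of_real (- 4 * inverse (a ^ 5))) (at a)"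
      using a by (intro has_vector_derivative_of_real) (auto simp: has_real_derivative_iff_has_vector_derivative[symmetric]
         field_simps eval_nat_numeral intro!: derivative_eq_intros)
    have "(\<integral>z. v z * of_real (4 * bump 3 a (z - w) - 3 * a * bump 2 a (z - w)) \<partial>\<mu>) =
      (\<integral>z. 4 * (v z * of_real (bump 3 a (z - w))) - 3 * of_real a * (v z * of_real (bump 2 a (z - w))) \<partial>\<mu>)"
      by (rule lint_cong) (simp_all add: algebra_simps)
    also have "\<dots> = 4 * mol v 3 a w - 3 * of_real a * mol v 2 a w"
      unfolding mol_def using mol_int[of 3 a w] mol_int[of 2 a w] a sa R by simp
    finally have o: "4 * mol v 3 a w = 3 * of_real a * mol v 2 a w"
      using orth2[of a w] a sa R by simp
    have z: "mol (vR R) 3 a w * complex_of_real (- 4 * inverse (a ^ 5)) + 3 * mol (vR R) 2 a w * complex_of_real (inverse (a ^ 4)) = 0"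
    proof -
      have "mol v 3 a w * complex_of_real (- 4 * inverse (a ^ 5)) = - (4 * mol v 3 a w) * complex_of_real (inverse (a ^ 5))" by simp
      also have "\<dots> = - (3 * of_real a * mol v 2 a w) * complex_of_real (inverse (a ^ 5))" by (simp only: o)
      also have "\<dots> = - (3 * mol v 2 a w) * complex_of_real (inverse (a ^ 4))"
        using a by (simp add: field_simps eval_nat_numeral)
      finally show ?thesis using mol_vR[of 3 a w R] mol_vR[of 2 a w R] a sa by simp
    qed
    have "((\<lambda>a. mol (vR R) 3 a w * complex_of_real (inverse (a ^ 4))) has_vector_derivative 0) (at a)"
      using has_vector_derivative_mult[OF d d2] z by simp
    thus "((\<lambda>a. mol (vR R) 3 a w / of_real (a ^ 4)) has_vector_derivative 0) (at a within S)"
      by (simp add: divide_inverse has_vector_derivative_at_within)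
  qed blast
  show ?thesis using k[OF SI[OF c(1) R(1)]] k[OF SI[OF c(3) R(2)]] mol_vR[of 3 c w R] mol_vR[of 3 d w R] c R by simp
qed

end

text \<open>The terms with \<open>deriv f\<close> cancel between the two directions because
  \<open>1 + \<i> * \<i> = 0\<close>, which is the Cauchy-Riemann equation.\<close>

lemma holomorphic_testf:
  assumes f: "f holomorphic_on \<D>" and t: "testf r g gx gy"
  shows "(\<integral>z. f z * cnj (gx z - \<i> * gy z) \<partial>\<mu>) = 0"
proof -
  note T = testfD[OF t]
  note F = pd_holomorphic[OF open_ball f]
  have px: "pd 1 \<D> (\<lambda>z. f z * cnj (g z)) (\<lambda>z. f z * cnj (gx z) + (1 * deriv f z) * cnj (g z))"
    by (intro pd_mult pd_cnj T F)
  have py: "pd \<i> \<D> (\<lambda>z. f z * cnj (g z)) (\<lambda>z. f z * cnj (gy z) + (\<i> * deriv f z) * cnj (g z))"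
    by (intro pd_mult pd_cnj T F)
  have zero: "f z * cnj (g z) = 0" if "r < cmod z" "cmod z < 1" for z using T(7)[OF that] by simp
  note ix = integral_pd_disk[OF px T(1) zero] and iy = integral_pd_disk[OF py T(1) zero]
  have "(\<integral>z. f z * cnj (gx z - \<i> * gy z) \<partial>\<mu>) =
    (\<integral>z. (f z * cnj (gx z) + (1 * deriv f z) * cnj (g z)) + \<i> * (f z * cnj (gy z) + (\<i> * deriv f z) * cnj (g z)) \<partial>\<mu>)"
    by (rule lint_cong[OF refl]) (simp add: algebra_simps)
  also have "\<dots> = (\<integral>z. f z * cnj (gx z) + (1 * deriv f z) * cnj (g z) \<partial>\<mu>) +
      \<i> * (\<integral>z. f z * cnj (gy z) + (\<i> * deriv f z) * cnj (g z) \<partial>\<mu>)"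
    using ix(2) iy(2) by (simp only: Bochner_Integration.integral_add integrable_mult_right norm_one norm_ii integral_mult_right_zero)
  also have "\<dots> = 0" using ix(1) iy(1) by simp
  finally show ?thesis .
qed

lemma holomorphic_weakly_hol:
  assumes f: "f holomorphic_on \<D>" shows "weakly_hol f"
proof
  have c: "continuous_on \<D> f" by (rule holomorphic_on_imp_continuous_on[OF f])
  show "f \<in> borel_measurable \<mu>" by (rule disk_measurable[OF c])
  show "integrable \<mu> (\<lambda>z. indicator (cball 0 R) z * f z)" if "R < 1" for R
    by (rule integrable_disk_indicator[OF c compact_cball]) (use that in auto)
qed (rule holomorphic_testf[OF f])

text \<open>Applied to the constant 1, the theory of weakly holomorphic functions shows that the
  total mass of a bump does not depend on its centre and is proportional to \<open>c^4\<close>,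
  without evaluating an integral in polar coordinates.\<close>

interpretation one: weakly_hol "\<lambda>_. 1"
  by (rule holomorphic_weakly_hol) simp

definition mass :: "real \<Rightarrow> real" where "mass c = (\<integral>z. bump 3 c z \<partial>\<mu>)"

lemma bump_int:
  assumes "c \<ge> 0" shows "integrable \<mu> (\<lambda>z. bump n c (z - w))"
proof -
  have "continuous_on \<D> (\<lambda>z. bump n c (z - w))" by (rule bump_cont)
  from integrable_disk_bounded[OF disk_measurable[OF this], of "c ^ n"] show ?thesis
    using bump_le[OF assms, of n] bump_nonneg by simp
qed

lemma mol_one: "mol (\<lambda>_. 1) 3 c 0 = of_real (mass c)"
  by (simp add: mol_def mass_def)

text \<open>The derivative with respect to the centre is a multiple of the conjugate of a first
  moment, which vanishes by \<open>orth1\<close>.\<close>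

lemma mass_eq_mol:
  assumes c: "0 < c" "cmod w + sqrt c < 1"
  shows "mol (\<lambda>_. 1) 3 c w = of_real (mass c)"
proof -
  obtain R where R: "cmod w + sqrt c < R" "R < 1" using dense[OF c(2)] by blast
  have "\<exists>k. \<forall>u\<in>ball (0::complex) (R - sqrt c). mol (\<lambda>_. 1) 3 c u = k"
  proof (rule has_field_derivative_zero_constant)
    fix u :: complex assume u: "u \<in> ball 0 (R - sqrt c)"
    have "(\<integral>z. 1 * (cnj (z - u) * of_real (bump 2 c (z - u))) \<partial>\<mu>) = (\<integral>z. cnj (1 * ((z - u) * of_real (bump 2 c (z - u)))) \<partial>\<mu>)"
      by simp
    also have "\<dots> = cnj (\<integral>z. 1 * ((z - u) * of_real (bump 2 c (z - u))) \<partial>\<mu>)"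
      by (rule Bochner_Integration.integral_cnj)
    also have "\<dots> = 0" using one.orth1[of c u] c u R by simp
    finally show "(mol (\<lambda>_. 1) 3 c has_field_derivative 0) (at u within ball 0 (R - sqrt c))"
      using one.mol_deriv[of c u R] c u R has_field_derivative_at_within by simp
  qed auto
  moreover have "w \<in> ball 0 (R - sqrt c)" "0 \<in> ball 0 (R - sqrt c)" using R c by (auto simp: less_diff_eq intro: le_less_trans[rotated])
  ultimately show ?thesis using mol_one by metis
qed

lemma mass_real:
  assumes c: "0 < c" "cmod w + sqrt c < 1"
  shows "(\<integral>z. bump 3 c (z - w) \<partial>\<mu>) = mass c"
proof -
  have "complex_of_real (\<integral>z. bump 3 c (z - w) \<partial>\<mu>) = mol (\<lambda>_. 1) 3 c w"
    unfolding mol_def by simp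
  thus ?thesis using mass_eq_mol[OF c] by simp
qed

lemma mass_pos:
  assumes "0 < c" "c < 1" shows "mass c > 0"
proof -
  have nn: "mass c \<ge> 0" unfolding mass_def by (rule integral_nonneg_AE) (simp add: bump_nonneg)
  have "mass c \<noteq> 0"
  proof
    assume "mass c = 0"
    hence "AE z in \<mu>. bump 3 c z = 0"
      using integral_nonneg_eq_0_iff_AE[OF bump_int[of c 3 0]] assms by (simp add: mass_def bump_nonneg)
    hence "AE z in \<mu>. z \<notin> ball 0 (sqrt c)"
    proof eventually_elim
      case (elim z)
      have False if "cmod z < sqrt c"
      proof -
        have "(cmod z)\<^sup>2 < (sqrt c)\<^sup>2" using that by (intro power_strict_mono) auto
        thus False using bump_pos[of z c 3] elim assms by simp
      qed
      thus ?case by auto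
    qed
    moreover have b: "ball 0 (sqrt c) \<subseteq> \<D>" using assms by (intro subset_ball) simp
    moreover have s: "ball (0::complex) (sqrt c) \<in> sets \<mu>" using b by (auto simp: sets_disk sets_restrict_space_iff)
    ultimately have "emeasure \<mu> (ball 0 (sqrt c)) = 0"
      by (subst (asm) AE_iff_null_sets[symmetric]) auto
    thus False using emeasure_disk_ball[OF b] assms by simp
  qed
  thus ?thesis using nn by simp
qed

text \<open>\<open>mol_ratio\<close> for the constant 1, with \<open>c = 1/4\<close> as reference
  value; 256 is \<open>4^4\<close>.\<close>

lemma mass_scale:
  assumes "0 < c" "c < 1" shows "mass c = mass (1/4) * 256 * c ^ 4"
proof -
  have "mol (\<lambda>_. 1) 3 c 0 / of_real (c ^ 4) = mol (\<lambda>_. 1) 3 (1/4) 0 / of_real ((1/4) ^ 4)"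
    by (rule one.mol_ratio) (use assms in \<open>auto simp: real_sqrt_divide\<close>)
  hence "complex_of_real (mass c / c ^ 4) = of_real (mass (1/4) * 256)"
    unfolding mol_one by (simp add: power_divide)
  hence "mass c / c ^ 4 = mass (1/4) * 256" by (simp only: of_real_eq_iff)
  thus ?thesis using assms by (simp add: field_simps)
qed

lemma bump_commute: "bump n c (z - w) = bump n c (w - z)"
  by (simp add: bump_def norm_minus_commute)

lemma sigma_finite_disk: "sigma_finite_measure \<mu>"
proof -
  interpret finite_measure \<mu> by (rule finite_measure_disk)
  show ?thesis by unfold_locales
qed

lemma pair_sigma_finite_disk: "pair_sigma_finite \<mu> \<mu>"
  using sigma_finite_disk by (simp add: pair_sigma_finite_def)

lemma fst_meas [measurable]: "(\<lambda>p. fst p) \<in> borel_measurable (\<mu> \<Otimes>\<^sub>M \<mu>)"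
  and snd_meas [measurable]: "(\<lambda>p. snd p) \<in> borel_measurable (\<mu> \<Otimes>\<^sub>M \<mu>)"
  by (rule measurable_compose[OF measurable_fst id_meas], rule measurable_compose[OF measurable_snd id_meas])

lemma integrable_pair_fst:
  fixes g :: "complex \<Rightarrow> complex"
  assumes "integrable \<mu> g"
  shows "integrable (\<mu> \<Otimes>\<^sub>M \<mu>) (\<lambda>p. g (fst p))"
proof -
  interpret pair_sigma_finite \<mu> \<mu> by (rule pair_sigma_finite_disk)
  have m: "g \<in> borel_measurable \<mu>" using assms by auto
  have "integrable (\<mu> \<Otimes>\<^sub>M \<mu>) (\<lambda>(x, y). g x)"
  proof (rule Fubini_integrable)
    show "(\<lambda>(x, y). g x) \<in> borel_measurable (\<mu> \<Otimes>\<^sub>M \<mu>)" using m by measurable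
    show "integrable \<mu> (\<lambda>x. \<integral>y. norm (case (x, y) of (x, y) \<Rightarrow> g x) \<partial>\<mu>)"
      using assms by simp
    show "AE x in \<mu>. integrable \<mu> (\<lambda>y. case (x, y) of (x, y) \<Rightarrow> g x)"
      by (rule AE_I2, simp only: prod.case, rule finite_measure.integrable_const[OF finite_measure_disk])
  qed
  thus ?thesis by (simp add: case_prod_unfold)
qed

context weakly_hol
begin

text \<open>The common value of the normalised mollifications. The radius, half the distance to the
  unit circle, is just one that is admissible at every point of the disk.\<close>

definition V :: "complex \<Rightarrow> complex" where
  "V w = mol v 3 (((1 - cmod w) / 2)\<^sup>2) w / of_real (mass (((1 - cmod w) / 2)\<^sup>2))"

lemma V_eq:
  assumes c: "0 < c" "cmod w + sqrt c < 1"
  shows "mol v 3 c w = V w * of_real (mass c)"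
proof -
  define d where "d = ((1 - cmod w) / 2)\<^sup>2"
  have w: "cmod w < 1" using c real_sqrt_gt_zero[OF c(1)] by linarith
  have sd: "sqrt d = (1 - cmod w) / 2" using w by (simp add: d_def)
  have d: "0 < d" "cmod w + sqrt d < 1" using w sd by (simp_all add: d_def field_simps)
  have lt: "a < 1" if "0 < a" "cmod w + sqrt a < 1" for a
  proof -
    have "sqrt a < 1" using that norm_ge_zero[of w] by linarith
    thus ?thesis by simp
  qed
  have c1: "c < 1" and d1: "d < 1" using lt c d by auto
  have r: "mol v 3 c w / of_real (c ^ 4) = mol v 3 d w / of_real (d ^ 4)" by (rule mol_ratio[OF c d])
  have "mass (1/4) > 0" by (rule mass_pos) auto
  have "V w * of_real (mass c) = (mol v 3 d w / of_real (d ^ 4)) * of_real (c ^ 4)"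
    unfolding V_def d_def[symmetric] mass_scale[OF c(1) c1] mass_scale[OF d(1) d1]
    using \<open>mass (1/4) > 0\<close> by (simp add: field_simps)
  also have "\<dots> = mol v 3 c w" unfolding r[symmetric] using c by simp
  finally show ?thesis by simp
qed

lemma V_holomorphic: "V holomorphic_on \<D>"
  unfolding holomorphic_on_open[OF open_ball]
proof
  fix w :: complex assume "w \<in> \<D>"
  then obtain R where R: "cmod w < R" "R < 1" using dense[of "cmod w" 1] by auto
  \<comment> \<open>This radius is admissible for all centres in \<open>ball 0 R\<close>, so near
    \<open>w\<close> the function \<open>V\<close> is a mollification of fixed radius, for which
    \<open>mol_deriv\<close> applies.\<close>
  define c where "c = ((1 - R) / 2)\<^sup>2"
  have sc: "sqrt c = (1 - R) / 2" and c0: "0 < c" using R by (auto simp: c_def)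
  have R0: "R > 0" using R norm_ge_zero[of w] by linarith
  have c1: "c < 1"
  proof -
    have "c \<le> (1 / 2)\<^sup>2" unfolding c_def using R R0 by (intro power_mono) auto
    thus ?thesis by (simp add: power2_eq_square)
  qed
  have "cmod w + sqrt c < (R + 1) / 2" "(R + 1) / 2 < 1" using R sc by (auto simp: field_simps)
  from mol_deriv[OF c0 this] obtain D where D: "(mol v 3 c has_field_derivative D) (at w)" by blast
  have D': "((\<lambda>w. mol v 3 c w / of_real (mass c)) has_field_derivative D / of_real (mass c)) (at w)"
    by (rule DERIV_cdivide[OF D])
  have eq: "mol v 3 c u / of_real (mass c) = V u" if "u \<in> ball 0 R" for u
  proof -
    have "cmod u + sqrt c < 1" using that R sc by (simp add: field_simps)
    thus ?thesis using V_eq[OF c0, of u] mass_pos[OF c0 c1] by simp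
  qed
  have "(V has_field_derivative D / of_real (mass c)) (at w)"
    by (rule has_field_derivative_transform_within_open[OF D' open_ball[of 0 R] _ eq]) (use R in auto)
  thus "\<exists>D. (V has_field_derivative D) (at w)" by blast
qed

lemma V_cont: "continuous_on \<D> V"
  using V_holomorphic by (rule holomorphic_on_imp_continuous_on)

lemma Fubini_mol:
  assumes R: "R < 1" and K: "closed K" and c: "0 \<le> c" "c \<le> 1"
  shows "(\<integral>w. indicator K w * mol (vR R) 3 c w \<partial>\<mu>) =
     (\<integral>z. vR R z * of_real (\<integral>w. indicator K w * bump 3 c (z - w) \<partial>\<mu>) \<partial>\<mu>)"
proof -
  interpret pair_sigma_finite \<mu> \<mu> by (rule pair_sigma_finite_disk)
  let ?P = "\<mu> \<Otimes>\<^sub>M \<mu>"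
  define f where "f z w = vR R z * of_real (indicator K w * bump 3 c (z - w))" for z w
  have [measurable]: "vR R \<in> borel_measurable \<mu>" using vR_int[OF R] by auto
  have [measurable]: "bump 3 c \<in> borel_measurable borel"
    using bump_cont[of UNIV 3 c 0] by (intro borel_measurable_continuous_onI) simp
  have [measurable]: "K \<in> sets borel" using K by simp
  have fm: "(\<lambda>(z, w). f z w) \<in> borel_measurable ?P"
    unfolding f_def case_prod_unfold by measurable
  have "integrable ?P (\<lambda>(z, w). f z w)"
  proof (rule integrable_dominated)
    show "integrable ?P (\<lambda>p. norm (vR R (fst p)))" using integrable_pair_fst[OF vR_int[OF R]] by simp
    show "AE p in ?P. norm (case p of (z, w) \<Rightarrow> f z w) \<le> norm (norm (vR R (fst p)))"
    proof (rule AE_I2)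
      fix p
      have "bump 3 c u \<le> 1" for u using bump_le[of c 3 u] c power_le_one[of c 3] by simp
      hence "\<bar>indicator K w * bump 3 c u\<bar> \<le> (1::real)" for w u using bump_nonneg[of 3 c u] by (auto simp: indicator_def)
      hence "cmod (vR R z) * \<bar>indicator K w * bump 3 c u\<bar> \<le> cmod (vR R z)" for z w u
        by (intro mult_left_le) auto
      thus "norm (case p of (z, w) \<Rightarrow> f z w) \<le> norm (norm (vR R (fst p)))"
        by (simp add: f_def case_prod_unfold norm_mult del: of_real_mult)
    qed
  qed (rule fm)
  hence "(\<integral>w. (\<integral>z. f z w \<partial>\<mu>) \<partial>\<mu>) = (\<integral>z. (\<integral>w. f z w \<partial>\<mu>) \<partial>\<mu>)"
    by (rule Fubini_integral)
  moreover have "(\<integral>z. f z w \<partial>\<mu>) = indicator K w * mol (vR R) 3 c w" for w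
    unfolding f_def mol_def integral_mult_right_zero[symmetric] by (simp add: mult_ac of_real_indicator)
  moreover have "(\<integral>w. f z w \<partial>\<mu>) = vR R z * of_real (\<integral>w. indicator K w * bump 3 c (z - w) \<partial>\<mu>)" for z
    unfolding f_def by (simp del: of_real_mult)
  ultimately show ?thesis by simp
qed

text \<open>Both sides are limits of the integrals of mollifications of \<open>v\<close> over closed neighbourhoods shrinking to \<open>K\<close>.\<close>

lemma compact_eq:
  assumes K: "compact K" "K \<subseteq> \<D>"
  shows "(\<integral>z. indicator K z * v z \<partial>\<mu>) = (\<integral>z. indicator K z * V z \<partial>\<mu>)"
proof (cases "K = {}")
  case False
  obtain R where R: "0 \<le> R" "R < 1" "K \<subseteq> cball 0 R" using compact_disk_radius[OF K] .
  define R' where "R' = (1 + R) / 2"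
  have R': "R \<le> R'" "R' < 1" using R by (auto simp: R'_def)
  \<comment> \<open>The quarter leaves room for three steps of length \<open>e n\<close>: points of
    \<open>Kn n\<close> lie within \<open>R + e n\<close>, bumps around them reach
    \<open>R + 2 * e n\<close>, and bumps around the points so reached still fit into the
    disk.\<close>
  define e where "e n = (1 - R) / (4 * real (Suc n))" for n :: nat
  have e0: "e n > 0" for n using R by (simp add: e_def)
  have e1: "e n \<le> (1 - R) / 4" for n
    unfolding e_def using R by (intro divide_left_mono) auto
  have e2: "R + 2 * e n \<le> R'" "R + 3 * e n < 1" for n using e1[of n] R by (simp_all add: R'_def field_simps)
  have elim: "e \<longlonglongrightarrow> 0"
  proof -
    have "(\<lambda>n. (1 - R) / 4 * (1 / real (Suc n))) \<longlonglongrightarrow> (1 - R) / 4 * 0"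
      by (intro tendsto_mult tendsto_const LIMSEQ_Suc[OF lim_1_over_n])
    thus ?thesis by (simp add: e_def[abs_def])
  qed
  define Kn where "Kn n = {w. infdist w K \<le> e n}" for n
  have Kc: "closed (Kn n)" for n unfolding Kn_def by (intro closed_Collect_le continuous_intros)
  have KR: "cmod w \<le> R + e n" if "w \<in> Kn n" for w n
  proof -
    obtain a where "a \<in> K" "infdist w K = dist w a"
      using infdist_attains_inf[OF compact_imp_closed[OF K(1)] False] by blast
    hence "cmod (w - a) \<le> e n" "cmod a \<le> R" using that R by (auto simp: Kn_def dist_norm)
    thus ?thesis using norm_triangle_sub[of w a] by linarith
  qed
  define m where "m n = mass ((e n)\<^sup>2)" for n
  have ee: "0 < (e n)\<^sup>2" "(e n)\<^sup>2 < 1" "sqrt ((e n)\<^sup>2) = e n" for n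
  proof -
    have "e n < 1" using e1[of n] R by simp
    thus "0 < (e n)\<^sup>2" "(e n)\<^sup>2 < 1" "sqrt ((e n)\<^sup>2) = e n" using e0[of n] by (auto simp: power_less_one_iff)
  qed
  have m0: "m n > 0" for n unfolding m_def by (rule mass_pos) (use ee in auto)
  \<comment> \<open>\<open>J n z / m n\<close> is the share of the bump at \<open>z\<close> that
    lies over \<open>Kn n\<close>. It is 1 on \<open>K\<close>, vanishes at distance more than
    \<open>2 * e n\<close> from \<open>K\<close>, and stays between 0 and 1 on the discs that
    matter.\<close>
  define J where "J n z = (\<integral>w. indicator (Kn n) w * bump 3 ((e n)\<^sup>2) (z - w) \<partial>\<mu>)" for n z
  have eq: "(\<integral>w. indicator (Kn n) w * V w \<partial>\<mu>) = (\<integral>z. vR (R + 2 * e n) z * of_real (J n z / m n) \<partial>\<mu>)" for n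
  proof -
    have "of_real (m n) * (\<integral>w. indicator (Kn n) w * V w \<partial>\<mu>) = (\<integral>w. of_real (m n) * (indicator (Kn n) w * V w) \<partial>\<mu>)"
      by simp
    also have "\<dots> = (\<integral>w. indicator (Kn n) w * mol (vR (R + 2 * e n)) 3 ((e n)\<^sup>2) w \<partial>\<mu>)"
    proof (rule lint_cong[OF refl])
      fix w
      show "of_real (m n) * (indicator (Kn n) w * V w) = indicator (Kn n) w * mol (vR (R + 2 * e n)) 3 ((e n)\<^sup>2) w"
      proof (cases "w \<in> Kn n")
        case True
        have w: "cmod w + e n \<le> R + 2 * e n" "cmod w + e n < 1" using KR[OF True] e2[of n] e0[of n] by linarith+
        have "mol (vR (R + 2 * e n)) 3 ((e n)\<^sup>2) w = mol v 3 ((e n)\<^sup>2) w"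
          by (rule mol_vR) (use w ee[of n] in auto)
        also have "\<dots> = V w * of_real (m n)" unfolding m_def by (rule V_eq) (use w ee[of n] in auto)
        finally show ?thesis by simp
      qed simp
    qed
    also have "\<dots> = (\<integral>z. vR (R + 2 * e n) z * of_real (J n z) \<partial>\<mu>)"
      unfolding J_def by (rule Fubini_mol) (use e2[of n] R' Kc ee[of n] in auto)
    finally have "(\<integral>w. indicator (Kn n) w * V w \<partial>\<mu>) = (\<integral>z. vR (R + 2 * e n) z * of_real (J n z) \<partial>\<mu>) / of_real (m n)"
      using m0[of n] by (simp add: field_simps)
    also have "\<dots> = (\<integral>z. vR (R + 2 * e n) z * of_real (J n z / m n) \<partial>\<mu>)"
      by simp
    finally show ?thesis .
  qed
  have bi: "integrable \<mu> (\<lambda>w. bump 3 ((e n)\<^sup>2) (z - w))" for n z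
    using bump_int[of "(e n)\<^sup>2" 3 z] by (subst bump_commute) simp
  have Jint: "integrable \<mu> (\<lambda>w. indicator (Kn n) w * bump 3 ((e n)\<^sup>2) (z - w))" for n z
  proof -
    have "integrable \<mu> (\<lambda>w. indicator (Kn n \<inter> \<D>) w *\<^sub>R bump 3 ((e n)\<^sup>2) (z - w))"
      by (rule integrable_mult_indicator[OF closed_disk_sets[OF Kc] bi])
    also have "?this \<longleftrightarrow> integrable \<mu> (\<lambda>w. indicator (Kn n) w * bump 3 ((e n)\<^sup>2) (z - w))"
      by (rule Bochner_Integration.integrable_cong) (auto simp: indicator_def)
    finally show ?thesis .
  qed
  have mz: "(\<integral>w. bump 3 ((e n)\<^sup>2) (z - w) \<partial>\<mu>) = m n" if "cmod z + e n < 1" for z n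
    using mass_real[of "(e n)\<^sup>2" z] ee[of n] that unfolding m_def by (subst bump_commute) simp
  have J0: "J n z \<ge> 0" for n z unfolding J_def by (rule integral_nonneg_AE) (auto simp: bump_nonneg)
  have J1: "J n z \<le> m n" if "cmod z + e n < 1" for n z
    unfolding mz[OF that, symmetric] J_def
    by (rule integral_mono[OF Jint bi]) (auto simp: indicator_def bump_nonneg)
  have JK: "J n z = m n" if "z \<in> K" for n z
  proof -
    have "cmod z \<le> R" using that R by auto
    hence "cmod z + e n < 1" using e2[of n] e0[of n] by linarith
    have "J n z = (\<integral>w. bump 3 ((e n)\<^sup>2) (z - w) \<partial>\<mu>)" unfolding J_def
    proof (rule lint_cong[OF refl])
      fix w
      have "w \<in> Kn n" if "w \<notin> Kn n \<longrightarrow> bump 3 ((e n)\<^sup>2) (z - w) \<noteq> 0"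
      proof (rule ccontr)
        assume w: "w \<notin> Kn n"
        hence "\<not> (e n)\<^sup>2 \<le> (cmod (z - w))\<^sup>2" using that bump_zero[of 3 "(e n)\<^sup>2" "z - w"] by auto
        hence "cmod (z - w) < e n" using e0[of n] using power2_less_imp_less[of "cmod (z - w)" "e n"] by simp
        hence "infdist w K \<le> e n" using infdist_le[OF \<open>z \<in> K\<close>, of w] by (simp add: dist_norm norm_minus_commute)
        thus False using w by (simp add: Kn_def)
      qed
      thus "indicator (Kn n) w * bump 3 ((e n)\<^sup>2) (z - w) = bump 3 ((e n)\<^sup>2) (z - w)"
        by (cases "w \<in> Kn n") auto
    qed
    thus ?thesis using mz[OF \<open>cmod z + e n < 1\<close>] by simp
  qed
  have Jfar: "J n z = 0" if "2 * e n < infdist z K" for n z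
  proof -
    have "indicator (Kn n) w * bump 3 ((e n)\<^sup>2) (z - w) = 0" for w
    proof (cases "w \<in> Kn n")
      case True
      have "infdist z K \<le> infdist w K + dist z w" by (rule infdist_triangle)
      hence "e n \<le> cmod (z - w)" using True that by (auto simp: Kn_def dist_norm)
      hence "(e n)\<^sup>2 \<le> (cmod (z - w))\<^sup>2" using e0[of n] by (intro power_mono) auto
      thus ?thesis by (simp add: bump_zero)
    qed simp
    thus ?thesis unfolding J_def by (simp only: Bochner_Integration.integral_zero)
  qed
  have dist: "infdist z K > 0" if "z \<notin> K" for z
    using that infdist_pos_not_in_closed[OF compact_imp_closed[OF K(1)] False] by blast
  have Jm: "J n \<in> borel_measurable \<mu>" for n
  proof -
    interpret sigma_finite_measure \<mu> by (rule sigma_finite_disk)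
    let ?P = "\<mu> \<Otimes>\<^sub>M \<mu>"
    have [measurable]: "bump 3 ((e n)\<^sup>2) \<in> borel_measurable borel"
      using bump_cont[of UNIV 3 "(e n)\<^sup>2" 0] by (intro borel_measurable_continuous_onI) simp
    have [measurable]: "Kn n \<in> sets borel" using Kc by simp
    show ?thesis unfolding J_def[abs_def]
      by (rule borel_measurable_lebesgue_integral) (unfold case_prod_unfold, measurable)
  qed
  have "(\<lambda>n. \<integral>z. vR (R + 2 * e n) z * of_real (J n z / m n) \<partial>\<mu>) \<longlonglongrightarrow> (\<integral>z. indicator K z * v z \<partial>\<mu>)"
  proof (rule integral_dominated_convergence[where w="\<lambda>z. cmod (vR R' z)"])
    show "(\<lambda>z. indicator K z * v z) \<in> borel_measurable \<mu>"
      using meas indicator_meas[OF compact_imp_closed[OF K(1)]] by measurable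
    show "(\<lambda>z. vR (R + 2 * e n) z * of_real (J n z / m n)) \<in> borel_measurable \<mu>" for n
    proof -
      have "vR (R + 2 * e n) \<in> borel_measurable \<mu>" using vR_int[of "R + 2 * e n"] e2[of n] R' by auto
      thus ?thesis using Jm[of n] by measurable
    qed
    show "integrable \<mu> (\<lambda>z. cmod (vR R' z))" using vR_int[OF R'(2)] by simp
    show "AE z in \<mu>. cmod (vR (R + 2 * e n) z * of_real (J n z / m n)) \<le> cmod (vR R' z)" for n
    proof (rule AE_I2)
      fix z
      show "cmod (vR (R + 2 * e n) z * of_real (J n z / m n)) \<le> cmod (vR R' z)"
      proof (cases "cmod z \<le> R + 2 * e n")
        case True
        hence "cmod z + e n < 1" using e2[of n] by simp
        hence "\<bar>J n z / m n\<bar> \<le> 1" using J1[of z n] J0[of n z] m0[of n] by simp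
        hence "cmod (v z) * \<bar>J n z / m n\<bar> \<le> cmod (v z)" by (intro mult_left_le) auto
        thus ?thesis using True e2[of n] by (simp add: vR_def norm_mult norm_divide)
      qed (simp add: vR_def)
    qed
    show "AE z in \<mu>. (\<lambda>n. vR (R + 2 * e n) z * of_real (J n z / m n)) \<longlonglongrightarrow> indicator K z * v z"
    proof (rule AE_I2)
      fix z
      show "(\<lambda>n. vR (R + 2 * e n) z * of_real (J n z / m n)) \<longlonglongrightarrow> indicator K z * v z"
      proof (cases "z \<in> K")
        case True
        have "vR (R + 2 * e n) z * of_real (J n z / m n) = indicator K z * v z" for n
        proof -
          have "cmod z \<le> R" using True R by auto
          hence "cmod z \<le> R + 2 * e n" using e0[of n] by simp
          thus ?thesis using JK[OF True, of n] m0[of n] True by (simp add: vR_def)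
        qed
        thus ?thesis by simp
      next
        case False
        have "infdist z K / 2 > 0" using dist[OF False] by simp
        hence "\<forall>\<^sub>F n in sequentially. e n < infdist z K / 2" by (rule order_tendstoD(2)[OF elim])
        hence "\<forall>\<^sub>F n in sequentially. 2 * e n < infdist z K" by eventually_elim simp
        hence "\<forall>\<^sub>F n in sequentially. vR (R + 2 * e n) z * of_real (J n z / m n) = 0"
          by eventually_elim (simp add: Jfar)
        thus ?thesis using False by (simp add: tendsto_eventually)
      qed
    qed
  qed
  moreover have "(\<lambda>n. \<integral>w. indicator (Kn n) w * V w \<partial>\<mu>) \<longlonglongrightarrow> (\<integral>z. indicator K z * V z \<partial>\<mu>)"
  proof -
    have "cball 0 R' \<subseteq> \<D>" using R'(2) by auto
    then obtain B where B: "B \<ge> 0" "\<And>z. z \<in> cball 0 R' \<Longrightarrow> cmod (V z) \<le> B"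
      using compact_continuous_bound[OF compact_cball continuous_on_subset[OF V_cont]] by blast
    show ?thesis
    proof (rule integral_dominated_convergence[where w="\<lambda>_. B"])
      show "(\<lambda>z. indicator K z * V z) \<in> borel_measurable \<mu>"
        using disk_measurable[OF V_cont] indicator_meas[OF compact_imp_closed[OF K(1)]] by measurable
      show "(\<lambda>z. indicator (Kn n) z * V z) \<in> borel_measurable \<mu>" for n
        using disk_measurable[OF V_cont] indicator_meas[OF Kc] by measurable
      show "integrable \<mu> (\<lambda>_. B)" by (rule finite_measure.integrable_const[OF finite_measure_disk])
      show "AE w in \<mu>. norm (indicator (Kn n) w * V w) \<le> B" for n
      proof (rule AE_I2)
        fix w
        have "cmod (V w) \<le> B" if "w \<in> Kn n"
          using KR[OF that] e2[of n] e0[of n] by (intro B) simp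
        thus "norm (indicator (Kn n) w * V w) \<le> B" using B(1) by (auto simp: indicator_def)
      qed
      show "AE z in \<mu>. (\<lambda>n. indicator (Kn n) z * V z) \<longlonglongrightarrow> indicator K z * V z"
      proof (rule AE_I2)
        fix z
        show "(\<lambda>n. indicator (Kn n) z * V z) \<longlonglongrightarrow> indicator K z * V z"
        proof (cases "z \<in> K")
          case True
          hence "z \<in> Kn n" for n using e0[of n] by (simp add: Kn_def)
          thus ?thesis using True by simp
        next
          case False
          have "\<forall>\<^sub>F n in sequentially. e n < infdist z K" using dist[OF False] elim by (simp add: order_tendstoD)
          hence "\<forall>\<^sub>F n in sequentially. indicator (Kn n) z * V z = 0"
            by eventually_elim (simp add: Kn_def)
          thus ?thesis using False by (simp add: tendsto_eventually)
        qed
      qed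
    qed
  qed
  ultimately show ?thesis unfolding eq by (rule LIMSEQ_unique)
qed simp

text \<open>By \<open>compact_eq\<close> the difference has integral zero over every compact subset;
  \<open>AE_nonpos_of_compacts\<close> is applied to plus and minus its real and imaginary
  parts.\<close>

theorem AE_holomorphic: "AE z in \<mu>. v z = V z"
proof -
  define h where "h z = v z - V z" for z
  have hm: "h \<in> borel_measurable \<mu>" unfolding h_def using meas disk_measurable[OF V_cont] by measurable
  have hK: "integrable \<mu> (\<lambda>z. indicator K z * h z)" "(\<integral>z. indicator K z * h z \<partial>\<mu>) = 0"
    if K: "compact K" "K \<subseteq> \<D>" for K
  proof -
    obtain R where R: "0 \<le> R" "R < 1" "K \<subseteq> cball 0 R" using compact_disk_radius[OF K] .
    have iV: "integrable \<mu> (\<lambda>z. indicator K z * V z)" by (rule integrable_disk_indicator[OF V_cont K])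
    have "integrable \<mu> (\<lambda>z. vR R z * indicator K z)"
      by (rule integrable_bmult[OF vR_int[OF R(2)] indicator_meas[OF compact_imp_closed[OF K(1)]], of 1]) (auto simp: indicator_def)
    moreover have "(\<lambda>z. vR R z * indicator K z) = (\<lambda>z. indicator K z * v z)" using R(3) by (auto simp: vR_def indicator_def fun_eq_iff)
    ultimately have iv: "integrable \<mu> (\<lambda>z. indicator K z * v z)" by simp
    show "integrable \<mu> (\<lambda>z. indicator K z * h z)" using iv iV by (simp add: h_def right_diff_distrib)
    show "(\<integral>z. indicator K z * h z \<partial>\<mu>) = 0" using iv iV compact_eq[OF K] by (simp add: h_def right_diff_distrib)
  qed
  have key: "AE z in \<mu>. L (h z) \<le> 0" if L: "bounded_linear L" for L :: "complex \<Rightarrow> real"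
  proof (rule AE_nonpos_of_compacts)
    show "(\<lambda>z. L (h z)) \<in> borel_measurable \<mu>"
      using L hm by (intro borel_measurable_continuous_onI[THEN measurable_compose[OF hm]] linear_continuous_on) auto
    fix K :: "complex set" assume K: "compact K" "K \<subseteq> \<D>"
    have e: "(\<lambda>z. indicator K z * L (h z)) = (\<lambda>z. L (indicator K z * h z))"
      using linear_0[OF bounded_linear.linear[OF L]] by (auto simp: indicator_def)
    show "integrable \<mu> (\<lambda>z. indicator K z * L (h z))" unfolding e
      by (rule integrable_bounded_linear[OF L hK(1)[OF K]])
    show "(\<integral>z. indicator K z * L (h z) \<partial>\<mu>) = 0" unfolding e
      using integral_bounded_linear[OF L hK(1)[OF K]] hK(2)[OF K] linear_0[OF bounded_linear.linear[OF L]] by simp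
  qed
  have "AE z in \<mu>. Re (h z) \<le> 0" "AE z in \<mu>. Im (h z) \<le> 0"
    "AE z in \<mu>. - Re (h z) \<le> 0" "AE z in \<mu>. - Im (h z) \<le> 0"
    by (intro key bounded_linear_Re bounded_linear_Im bounded_linear_minus)+
  thus ?thesis by eventually_elim (simp add: h_def complex_eq_iff)
qed

end

context disk_weight
begin

theorem Weyl:
  assumes v: "v \<in> L2 N" and orth: "\<And>r g gx gy. testf r g gx gy \<Longrightarrow> ip N v (TT gx gy) = 0"
  obtains V where "V holomorphic_on \<D>" "AE z in \<mu>. v z = V z"
proof -
  have m: "v \<in> borel_measurable \<mu>" using v by (simp add: L2_def N_measurable)
  interpret weakly_hol v
  proof
    show "v \<in> borel_measurable \<mu>" by (rule m)
    show "integrable \<mu> (\<lambda>z. indicator (cball 0 R) z * v z)" if R: "R < 1" for R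
    proof -
      note im = indicator_meas[OF closed_cball, of 0 R, where 'b=real]
      \<comment> \<open>\<open>h\<close> is bounded, hence in \<open>L2 N\<close>, and the product
        of \<open>v\<close> with it cancels the weight; so local integrability is an instance of
        integrability of products in \<open>L2 N\<close>.\<close>
      define h where "h z = complex_of_real (indicator (cball 0 R) z / \<omega> z)" for z
      have hm: "h \<in> borel_measurable \<mu>" unfolding h_def using im by measurable
      have "cball 0 R \<subseteq> \<D>" using R by auto
      then obtain B where B: "B \<ge> 0" "\<And>z. z \<in> cball 0 R \<Longrightarrow> norm (1 / \<omega> z) \<le> B"
        using compact_continuous_bound[OF compact_cball continuous_on_subset[OF cont_div_omega[OF continuous_on_const]]] by blast
      have hL: "h \<in> L2 N"
      proof (rule L2_N_bounded[OF hm])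
        show "cmod (h z) \<le> B" for z
          using B unfolding h_def norm_of_real by (auto simp: indicator_def)
      qed
      have pm: "(\<lambda>z. v z * cnj (h z)) \<in> borel_measurable \<mu>" using m hm by measurable
      have "integrable N (\<lambda>z. v z * cnj (h z))" by (rule L2_prod_integrable[OF v hL])
      hence "integrable \<mu> (\<lambda>z. \<omega> z *\<^sub>R (v z * cnj (h z)))" using integrable_N[OF pm] by simp
      also have "?this \<longleftrightarrow> ?thesis"
      proof (rule Bochner_Integration.integrable_cong[OF refl])
        fix z assume "z \<in> space \<mu>"
        hence "\<omega> z > 0" using omega_pos by simp
        thus "\<omega> z *\<^sub>R (v z * cnj (h z)) = indicator (cball 0 R) z * v z"
          by (simp add: h_def scaleR_conv_of_real indicator_def)
      qed
      finally show ?thesis .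
    qed
    show "(\<integral>z. v z * cnj (gx z - \<i> * gy z) \<partial>\<mu>) = 0" if "testf r g gx gy" for r g gx gy
      using orth[OF that] unfolding ip_TT[OF that v] .
  qed
  show ?thesis using that[OF V_holomorphic AE_holomorphic] .
qed

end

section \<open>The Bergman projection in L^2\<close>

lemma n2_cong_AE:
  assumes "f \<in> borel_measurable M" "g \<in> borel_measurable M" "AE x in M. f x = g x"
  shows "n2 M f = n2 M g"
proof -
  have "(\<integral>x. (cmod (f x))\<^sup>2 \<partial>M) = (\<integral>x. (cmod (g x))\<^sup>2 \<partial>M)"
    by (rule integral_cong_AE) (use assms in auto)
  thus ?thesis by (simp add: n2_def)
qed

lemma L2_cong_AE:
  assumes "f \<in> L2 M" "g \<in> borel_measurable M" "AE x in M. f x = g x"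
  shows "g \<in> L2 M"
proof -
  have "integrable M (\<lambda>x. (cmod (g x))\<^sup>2)"
    by (rule integrable_cong_AE_imp[OF L2_integrable[OF assms(1)]]) (use assms in auto)
  thus ?thesis using assms by (simp add: L2_def)
qed

lemma ip_real_mult:
  "ip M (\<lambda>x. of_real (h x) * f x) g = ip M f (\<lambda>x. of_real (h x) * g x)"
  by (simp add: ip_def mult_ac)

context disk_weight
begin

text \<open>In contrast to \<open>bergman\<close>, values outside the disk are left free, so
  elements of \<open>A2\<close> are compared on the disk only (\<open>A2_cong\<close>,
  \<open>ip_cong_disk\<close>).\<close>

definition A2 :: "(complex \<Rightarrow> complex) set" where "A2 = {f \<in> L2 N. f holomorphic_on \<D>}"

lemma A2D: "f \<in> A2 \<Longrightarrow> f \<in> L2 N" "f \<in> A2 \<Longrightarrow> f holomorphic_on \<D>"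
  by (simp_all add: A2_def)

lemma A2_orth:
  assumes f: "f \<in> A2" and t: "testf r g gx gy"
  shows "ip N f (TT gx gy) = 0"
  using holomorphic_testf[OF A2D(2)[OF f] t] unfolding ip_TT[OF t A2D(1)[OF f]] .

lemma TT_add: "TT (\<lambda>z. gx z + hx z) (\<lambda>z. gy z + hy z) = (\<lambda>z. TT gx gy z + TT hx hy z)"
  by (auto simp: TT_def fun_eq_iff algebra_simps add_divide_distrib diff_divide_distrib)

lemma TT_cmult: "TT (\<lambda>z. c * gx z) (\<lambda>z. c * gy z) = (\<lambda>z. c * TT gx gy z)"
  by (auto simp: TT_def fun_eq_iff algebra_simps diff_divide_distrib)

text \<open>\<open>f\<close> is the Bergman projection of \<open>u\<close>: the part orthogonal to
  the range of \<open>TT\<close> is holomorphic by \<open>Weyl\<close>. The approximation of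
  \<open>u - f\<close> is part of the result, since the weighted estimates integrate by parts and
  hence are proved for compactly supported \<open>g n\<close> first.\<close>

theorem projection:
  assumes u: "u \<in> L2 N"
  obtains f r g gx gy where "f \<in> A2" "\<And>n::nat. testf (r n) (g n) (gx n) (gy n)"
    "(\<lambda>n. n2 N (\<lambda>z. TT (gx n) (gy n) z - (u z - f z))) \<longlonglongrightarrow> 0"
proof -
  define S where "S = {f. \<exists>r g gx gy. testf r g gx gy \<and> f = TT gx gy}"
  have S1: "S \<subseteq> L2 N" unfolding S_def using TT_L2 by blast
  have S2: "(\<lambda>_. 0) \<in> S"
  proof -
    have "testf 0 (\<lambda>_. 0) (\<lambda>_. 0) (\<lambda>_. 0)" unfolding testf_def using smooth2_const[of \<D> "0::complex"] by auto
    moreover have "(\<lambda>_. 0) = TT (\<lambda>_. 0) (\<lambda>_. 0)" by (auto simp: TT_def)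
    ultimately show ?thesis unfolding S_def by blast
  qed
  have S3: "(\<lambda>x. f x + g x) \<in> S" if "f \<in> S" "g \<in> S" for f g
    using that testf_add TT_add[symmetric] unfolding S_def by blast
  have S4: "(\<lambda>x. c * f x) \<in> S" if "f \<in> S" for f c
    using that testf_cmult TT_cmult[symmetric] unfolding S_def by blast
  obtain s v where s: "\<And>n. s n \<in> S" and v: "v \<in> L2 N" "\<And>h. h \<in> S \<Longrightarrow> ip N v h = 0"
    and lim: "(\<lambda>n::nat. n2 N (\<lambda>x. s n x - (u x - v x))) \<longlonglongrightarrow> 0"
    using L2_projection[OF S1 S2 S3 S4 u] by blast
  obtain V where V: "V holomorphic_on \<D>" "AE z in \<mu>. v z = V z"
    by (rule Weyl[OF v(1)]) (use v(2) S_def in blast)+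
  have Vm: "V \<in> borel_measurable N"
    unfolding N_measurable by (rule disk_measurable[OF holomorphic_on_imp_continuous_on[OF V(1)]])
  have ae: "AE z in N. v z = V z" using V(2) by (simp add: AE_N)
  have "V \<in> A2" using L2_cong_AE[OF v(1) Vm ae] V(1) by (simp add: A2_def)
  have "\<exists>r g gx gy. testf r g gx gy \<and> s n = TT gx gy" for n using s[of n] by (simp add: S_def)
  then obtain r g gx gy where t: "\<And>n. testf (r n) (g n) (gx n) (gy n)" "\<And>n. s n = TT (gx n) (gy n)" by metis
  have "n2 N (\<lambda>z. TT (gx n) (gy n) z - (u z - V z)) = n2 N (\<lambda>x. s n x - (u x - v x))" for n
  proof -
    have sm: "s n \<in> borel_measurable N" "u \<in> borel_measurable N" "v \<in> borel_measurable N"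
      using s[of n] S1 u v by (auto simp: L2_def)
    show ?thesis unfolding t(2)[symmetric]
      by (rule n2_cong_AE) (use sm Vm ae in \<open>auto elim: AE_mp\<close>)
  qed
  thus ?thesis using that[OF \<open>V \<in> A2\<close> t(1)] lim by simp
qed

text \<open>\<open>u - f\<close> is a limit of functions orthogonal to \<open>A2\<close>; this
  identifies \<open>f\<close> as the orthogonal projection of \<open>u\<close>.\<close>

lemma ip_approx_A2:
  assumes h: "h \<in> A2" and f: "f \<in> A2" and u: "u \<in> L2 N" and t: "\<And>n::nat. testf (r n) (g n) (gx n) (gy n)"
    and lim: "(\<lambda>n. n2 N (\<lambda>z. TT (gx n) (gy n) z - (u z - f z))) \<longlonglongrightarrow> 0"
  shows "ip N u h = ip N f h"
proof -
  have "(\<lambda>n. ip N (TT (gx n) (gy n)) h) \<longlonglongrightarrow> ip N (\<lambda>z. u z - f z) h"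
    by (rule ip_tendsto_left[OF TT_L2[OF t] L2_diff[OF u A2D(1)[OF f]] A2D(1)[OF h] lim])
  moreover have "ip N (TT (gx n) (gy n)) h = 0" for n
    using A2_orth[OF h t[of n]] ip_commute[of N "TT (gx n) (gy n)" h] by simp
  ultimately have "ip N (\<lambda>z. u z - f z) h = 0" by (simp add: LIMSEQ_const_iff)
  thus ?thesis using ip_diff_left[OF u A2D(1)[OF f] A2D(1)[OF h]] by simp
qed

end

section \<open>Weighted estimates for the Bergman projection\<close>

text \<open>\<open>slow\<close> is the square of
  \<open>4 * |grad \<rho>| <= \<rho> * sqrt lap\<close>. The bound \<open>B\<close> keeps
  multiplication by \<open>\<rho>\<close> inside L^2; it enters error terms that tend to zero, but
  not the final constants.\<close>

locale slow_weight = disk_weight +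
  fixes \<rho> \<rho>x \<rho>y \<rho>xy :: "complex \<Rightarrow> real" and B :: real
  assumes smooth: "smooth2 \<D> \<rho> \<rho>x \<rho>y \<rho>xy"
    and rho_pos: "z \<in> \<D> \<Longrightarrow> 0 < \<rho> z"
    and rho_le: "z \<in> \<D> \<Longrightarrow> \<rho> z \<le> B"
    and slow: "z \<in> \<D> \<Longrightarrow> 16 * ((\<rho>x z)\<^sup>2 + (\<rho>y z)\<^sup>2) \<le> lap z * (\<rho> z)\<^sup>2"
begin

lemma rho_meas: "(\<lambda>z. complex_of_real (\<rho> z)) \<in> borel_measurable N"
  unfolding N_measurable using smooth2D[OF smooth] by (intro disk_measurable continuous_on_of_real) auto

lemma rho_norm: "z \<in> space N \<Longrightarrow> cmod (complex_of_real (\<rho> z)) \<le> B"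
  using rho_le[of z] rho_pos[of z] by simp

lemma B_nonneg: "B \<ge> 0"
  using rho_le[of 0] rho_pos[of 0] by simp

lemma rho_L2: "f \<in> L2 N \<Longrightarrow> (\<lambda>z. of_real (\<rho> z) * f z) \<in> L2 N"
  by (rule L2_bmult[OF _ rho_meas rho_norm])

lemma rho_n2: "f \<in> L2 N \<Longrightarrow> n2 N (\<lambda>z. of_real (\<rho> z) * f z) \<le> B * n2 N f"
  by (rule n2_bmult[OF _ rho_meas rho_norm B_nonneg])

lemma smooth_c: "smooth2 \<D> (\<lambda>z. complex_of_real (\<rho> z)) (\<lambda>z. of_real (\<rho>x z)) (\<lambda>z. of_real (\<rho>y z)) (\<lambda>z. of_real (\<rho>xy z))"
  by (rule smooth2_linear[OF bounded_linear_of_real smooth])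

text \<open>With \<open>X = \<rho> T g\<close> and \<open>Y = (\<rho>\<^sub>x - \<i> \<rho>\<^sub>y) g / \<omega>\<close> one has \<open>T (\<rho>\<^sup>2 g) = \<rho> (X + 2 Y)\<close>, and the basic estimate for
  \<open>\<rho> g\<close> gives \<open>4 \<parallel>Y\<parallel> \<le> \<parallel>X\<parallel>\<close>; now pair \<open>u - f\<close> with \<open>T (\<rho>\<^sup>2 g)\<close>, which is orthogonal to \<open>f\<close>.\<close>

lemma agmon_step:
  assumes f: "f \<in> A2" and u: "u \<in> L2 N" and t: "testf r g gx gy"
  defines "d \<equiv> n2 N (\<lambda>z. TT gx gy z - (u z - f z))"
  shows "n2 N (\<lambda>z. of_real (\<rho> z) * TT gx gy z) \<le> 3 * (B * d + n2 N (\<lambda>z. of_real (\<rho> z) * u z))"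
    "n_lap (\<lambda>z. of_real (\<rho> z) * g z) \<le> n2 N (\<lambda>z. of_real (\<rho> z) * TT gx gy z)"
proof -
  define X where "X z = of_real (\<rho> z) * TT gx gy z" for z
  define Y where "Y z = (of_real (\<rho>x z) - \<i> * of_real (\<rho>y z)) * g z / of_real (\<omega> z)" for z
  note t1 = testf_mult[OF t smooth_c]
  note t2 = testf_mult[OF t1 smooth_c]
  let ?g1x = "\<lambda>z. complex_of_real (\<rho> z) * gx z + of_real (\<rho>x z) * g z"
  let ?g1y = "\<lambda>z. complex_of_real (\<rho> z) * gy z + of_real (\<rho>y z) * g z"
  have T1: "TT ?g1x ?g1y = (\<lambda>z. X z + Y z)"
    by (auto simp: TT_def X_def Y_def fun_eq_iff algebra_simps add_divide_distrib diff_divide_distrib)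
  have T2: "TT (\<lambda>z. of_real (\<rho> z) * ?g1x z + of_real (\<rho>x z) * (of_real (\<rho> z) * g z))
      (\<lambda>z. of_real (\<rho> z) * ?g1y z + of_real (\<rho>y z) * (of_real (\<rho> z) * g z)) = (\<lambda>z. of_real (\<rho> z) * (X z + 2 * Y z))"
    by (auto simp: TT_def X_def Y_def fun_eq_iff algebra_simps add_divide_distrib diff_divide_distrib)
  have TL: "TT gx gy \<in> L2 N" by (rule TT_L2[OF t])
  have XL: "X \<in> L2 N" unfolding X_def[abs_def] by (rule rho_L2[OF TL])
  have XYL: "(\<lambda>z. X z + Y z) \<in> L2 N" unfolding T1[symmetric] by (rule TT_L2[OF t1])
  have YL: "Y \<in> L2 N" using L2_diff[OF XYL XL] by simp
  have ZL: "(\<lambda>z. X z + 2 * Y z) \<in> L2 N" by (rule L2_add[OF XL L2_cmult[OF YL]])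
  have WL: "(\<lambda>z. of_real (\<rho> z) * (X z + 2 * Y z)) \<in> L2 N" by (rule rho_L2[OF ZL])
  have be: "2 * (n_lap (\<lambda>z. of_real (\<rho> z) * g z))\<^sup>2 \<le> (n2 N (\<lambda>z. X z + Y z))\<^sup>2"
    using basic_estimate[OF t1] unfolding T1 .
  have Ym: "(\<lambda>z. (cmod (Y z))\<^sup>2) \<in> borel_measurable \<mu>" using YL by (auto simp: L2_def N_measurable)
  have "16 * (n2 N Y)\<^sup>2 \<le> (n_lap (\<lambda>z. of_real (\<rho> z) * g z))\<^sup>2"
  proof -
    have iY: "integrable \<mu> (\<lambda>z. \<omega> z *\<^sub>R (cmod (Y z))\<^sup>2)"
      using integrable_N[OF Ym] L2_integrable[OF YL] by simp
    have "16 * (n2 N Y)\<^sup>2 = (\<integral>z. 16 * (\<omega> z *\<^sub>R (cmod (Y z))\<^sup>2) \<partial>\<mu>)"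
      unfolding n2_sq integral_N[OF Ym] by simp
    also have "\<dots> \<le> (\<integral>z. lap z * (cmod (of_real (\<rho> z) * g z))\<^sup>2 / \<omega> z \<partial>\<mu>)"
    proof (rule integral_mono)
      show "integrable \<mu> (\<lambda>z. 16 * (\<omega> z *\<^sub>R (cmod (Y z))\<^sup>2))" using iY by simp
      show "integrable \<mu> (\<lambda>z. lap z * (cmod (of_real (\<rho> z) * g z))\<^sup>2 / \<omega> z)" by (rule lap_integrable[OF t1])
      fix z assume "z \<in> space \<mu>"
      hence z: "z \<in> \<D>" by simp
      have e: "(cmod (of_real (\<rho>x z) - \<i> * of_real (\<rho>y z)))\<^sup>2 = (\<rho>x z)\<^sup>2 + (\<rho>y z)\<^sup>2" by (simp add: cmod_power2)
      have "16 * (\<omega> z *\<^sub>R (cmod (Y z))\<^sup>2) = (16 * ((\<rho>x z)\<^sup>2 + (\<rho>y z)\<^sup>2)) * ((cmod (g z))\<^sup>2 / \<omega> z)"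
        using omega_pos[OF z] unfolding Y_def norm_divide norm_mult power_mult_distrib power_divide e
        by (simp add: power2_eq_square[of "\<omega> z"])
      also have "\<dots> \<le> (lap z * (\<rho> z)\<^sup>2) * ((cmod (g z))\<^sup>2 / \<omega> z)"
        using omega_pos[OF z] by (intro mult_right_mono slow[OF z]) auto
      finally show "16 * (\<omega> z *\<^sub>R (cmod (Y z))\<^sup>2) \<le> lap z * (cmod (of_real (\<rho> z) * g z))\<^sup>2 / \<omega> z"
        by (simp add: norm_mult power_mult_distrib)
    qed
    finally show ?thesis unfolding n_lap_sq .
  qed
  \<comment> \<open>The two inequalities give the factor 32. It is lowered to the square 25, so that
    taking roots leaves \<open>5 * |Y| <= |X + Y| <= |X| + |Y|\<close>.\<close>
  hence "25 * (n2 N Y)\<^sup>2 \<le> (n2 N (\<lambda>z. X z + Y z))\<^sup>2" using be zero_le_power2[of "n2 N Y"] by linarith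
  hence "(5 * n2 N Y)\<^sup>2 \<le> (n2 N (\<lambda>z. X z + Y z))\<^sup>2" by (simp add: power_mult_distrib)
  hence "5 * n2 N Y \<le> n2 N (\<lambda>z. X z + Y z)" by (rule power2_le_imp_le) simp
  moreover have tri: "n2 N (\<lambda>z. X z + Y z) \<le> n2 N X + n2 N Y" by (rule n2_triangle[OF XL YL])
  ultimately have Y4: "4 * n2 N Y \<le> n2 N X" by simp
  have "(n_lap (\<lambda>z. of_real (\<rho> z) * g z))\<^sup>2 \<le> (n2 N X)\<^sup>2"
  proof -
    have "4 * n2 N (\<lambda>z. X z + Y z) \<le> 5 * n2 N X" using tri Y4 by simp
    hence "(4 * n2 N (\<lambda>z. X z + Y z))\<^sup>2 \<le> (5 * n2 N X)\<^sup>2" by (rule power_mono) simp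
    hence "16 * (n2 N (\<lambda>z. X z + Y z))\<^sup>2 \<le> 25 * (n2 N X)\<^sup>2" by (simp add: power_mult_distrib)
    thus ?thesis using be zero_le_power2[of "n2 N X"] by linarith
  qed
  hence "n_lap (\<lambda>z. of_real (\<rho> z) * g z) \<le> n2 N X" by (rule power2_le_imp_le) simp
  thus "n_lap (\<lambda>z. of_real (\<rho> z) * g z) \<le> n2 N (\<lambda>z. of_real (\<rho> z) * TT gx gy z)" by (simp add: X_def[abs_def])
  have uL: "(\<lambda>z. u z - f z) \<in> L2 N" by (rule L2_diff[OF u A2D(1)[OF f]])
  have DL: "(\<lambda>z. TT gx gy z - (u z - f z)) \<in> L2 N" by (rule L2_diff[OF TL uL])
  let ?Z = "\<lambda>z. X z + 2 * Y z" and ?W = "\<lambda>z. of_real (\<rho> z) * (X z + 2 * Y z)"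
  have Z: "n2 N ?Z \<le> 3/2 * n2 N X"
    using n2_triangle[OF XL L2_cmult[OF YL, of 2]] Y4 unfolding n2_cmult by simp
  have fW: "ip N f ?W = 0" using A2_orth[OF f t2] unfolding T2 .
  \<comment> \<open>Moving one factor \<open>\<rho>\<close> across the pairing turns
    \<open>X\<close> into \<open>TT gx gy\<close> and \<open>?Z\<close> into \<open>?W\<close>, a
    function in the range of \<open>TT\<close>. Replacing \<open>TT gx gy\<close> by
    \<open>u - f\<close> costs an error controlled by \<open>d\<close>, and \<open>f\<close> drops
    out by orthogonality.\<close>
  have "ip N X ?Z = ip N (TT gx gy) ?W" unfolding X_def[abs_def] by (rule ip_real_mult)
  also have "\<dots> = ip N (\<lambda>z. (TT gx gy z - (u z - f z)) + (u z - f z)) ?W" by simp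
  also have "\<dots> = ip N (\<lambda>z. TT gx gy z - (u z - f z)) ?W + ip N (\<lambda>z. u z - f z) ?W"
    by (rule ip_add_left[OF DL uL WL])
  also have "ip N (\<lambda>z. u z - f z) ?W = ip N u ?W" using ip_diff_left[OF u A2D(1)[OF f] WL] fW by simp
  also have "ip N (\<lambda>z. TT gx gy z - (u z - f z)) ?W = ip N (\<lambda>z. of_real (\<rho> z) * (TT gx gy z - (u z - f z))) ?Z"
    by (rule ip_real_mult[symmetric])
  also have "ip N u ?W = ip N (\<lambda>z. of_real (\<rho> z) * u z) ?Z" by (rule ip_real_mult[symmetric])
  finally have "cmod (ip N X ?Z) \<le> cmod (ip N (\<lambda>z. of_real (\<rho> z) * (TT gx gy z - (u z - f z))) ?Z) + cmod (ip N (\<lambda>z. of_real (\<rho> z) * u z) ?Z)"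
    by (simp only: norm_triangle_ineq)
  also have "\<dots> \<le> (B * d) * n2 N ?Z + n2 N (\<lambda>z. of_real (\<rho> z) * u z) * n2 N ?Z"
  proof (rule add_mono)
    have "cmod (ip N (\<lambda>z. of_real (\<rho> z) * (TT gx gy z - (u z - f z))) ?Z) \<le> n2 N (\<lambda>z. of_real (\<rho> z) * (TT gx gy z - (u z - f z))) * n2 N ?Z"
      by (rule ip_Cauchy_Schwarz[OF rho_L2[OF DL] ZL])
    also have "\<dots> \<le> (B * d) * n2 N ?Z" unfolding d_def by (intro mult_right_mono rho_n2[OF DL]) simp
    finally show "cmod (ip N (\<lambda>z. of_real (\<rho> z) * (TT gx gy z - (u z - f z))) ?Z) \<le> (B * d) * n2 N ?Z" .
    show "cmod (ip N (\<lambda>z. of_real (\<rho> z) * u z) ?Z) \<le> n2 N (\<lambda>z. of_real (\<rho> z) * u z) * n2 N ?Z"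
      by (rule ip_Cauchy_Schwarz[OF rho_L2[OF u] ZL])
  qed
  also have "\<dots> = (B * d + n2 N (\<lambda>z. of_real (\<rho> z) * u z)) * n2 N ?Z" by (simp add: distrib_right)
  also have "\<dots> \<le> (B * d + n2 N (\<lambda>z. of_real (\<rho> z) * u z)) * (3/2 * n2 N X)"
    by (intro mult_left_mono Z add_nonneg_nonneg mult_nonneg_nonneg B_nonneg) (auto simp: d_def)
  finally have up: "cmod (ip N X ?Z) \<le> (B * d + n2 N (\<lambda>z. of_real (\<rho> z) * u z)) * (3/2 * n2 N X)" .
  have "ip N X ?Z = ip N X X + cnj 2 * ip N X Y"
    unfolding ip_add_right[OF XL L2_cmult[OF YL] XL] ip_cmult_right by simp
  hence "Re (ip N X ?Z) = (n2 N X)\<^sup>2 + 2 * Re (ip N X Y)" by (simp add: ip_self)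
  \<comment> \<open>Because \<open>4 * |Y| <= |X|\<close>, the cross term
    \<open>2 * Re (ip N X Y)\<close> absorbs at most half of \<open>|X|^2\<close>.\<close>
  moreover have "\<bar>Re (ip N X Y)\<bar> \<le> n2 N X * n2 N Y"
    using ip_Cauchy_Schwarz[OF XL YL] abs_Re_le_cmod order_trans by blast
  moreover have "n2 N X * (4 * n2 N Y) \<le> n2 N X * n2 N X" by (intro mult_left_mono Y4) simp
  ultimately have "(n2 N X)\<^sup>2 / 2 \<le> Re (ip N X ?Z)" by (simp add: power2_eq_square abs_le_iff)
  also have "\<dots> \<le> cmod (ip N X ?Z)" by (rule complex_Re_le_cmod)
  also note up
  finally have fin: "n2 N X * n2 N X \<le> 3 * (B * d + n2 N (\<lambda>z. of_real (\<rho> z) * u z)) * n2 N X"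
    by (simp add: power2_eq_square algebra_simps)
  have "n2 N X \<le> 3 * (B * d + n2 N (\<lambda>z. of_real (\<rho> z) * u z))"
  proof (cases "n2 N X = 0")
    case True thus ?thesis using B_nonneg by (simp add: d_def)
  next
    case False
    hence "0 < n2 N X" by (simp add: less_le)
    thus ?thesis using fin by (simp add: mult_le_cancel_right)
  qed
  thus "n2 N (\<lambda>z. of_real (\<rho> z) * TT gx gy z) \<le> 3 * (B * d + n2 N (\<lambda>z. of_real (\<rho> z) * u z))"
    by (simp add: X_def[abs_def])
qed

text \<open>The error \<open>d\<close> of \<open>agmon_step\<close> is multiplied by
  \<open>B\<close> but tends to zero along the approximating sequence. Hence the constants 3 and 4
  are the same for all admissible weights \<open>\<rho>\<close>, and this uniformity later allows
  averaging over a family of them.\<close>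

theorem agmon:
  assumes f: "f \<in> A2" and u: "u \<in> L2 N" and t: "\<And>n::nat. testf (r n) (g n) (gx n) (gy n)"
    and lim: "(\<lambda>n. n2 N (\<lambda>z. TT (gx n) (gy n) z - (u z - f z))) \<longlonglongrightarrow> 0"
  shows "n2 N (\<lambda>z. of_real (\<rho> z) * (u z - f z)) \<le> 3 * n2 N (\<lambda>z. of_real (\<rho> z) * u z)"
    "n2 N (\<lambda>z. of_real (\<rho> z) * f z) \<le> 4 * n2 N (\<lambda>z. of_real (\<rho> z) * u z)"
proof -
  let ?d = "\<lambda>n. n2 N (\<lambda>z. TT (gx n) (gy n) z - (u z - f z))"
  let ?U = "n2 N (\<lambda>z. of_real (\<rho> z) * u z)"
  have uL: "(\<lambda>z. u z - f z) \<in> L2 N" by (rule L2_diff[OF u A2D(1)[OF f]])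
  have "n2 N (\<lambda>z. of_real (\<rho> z) * (u z - f z)) \<le> 4 * B * ?d n + 3 * ?U" for n
  proof -
    have TL: "TT (gx n) (gy n) \<in> L2 N" by (rule TT_L2[OF t])
    have DL: "(\<lambda>z. TT (gx n) (gy n) z - (u z - f z)) \<in> L2 N" by (rule L2_diff[OF TL uL])
    have "(\<lambda>z. of_real (\<rho> z) * (u z - f z)) =
       (\<lambda>z. of_real (\<rho> z) * TT (gx n) (gy n) z - of_real (\<rho> z) * (TT (gx n) (gy n) z - (u z - f z)))"
      by (simp add: algebra_simps)
    hence "n2 N (\<lambda>z. of_real (\<rho> z) * (u z - f z)) \<le> n2 N (\<lambda>z. of_real (\<rho> z) * TT (gx n) (gy n) z)
        + n2 N (\<lambda>z. of_real (\<rho> z) * (TT (gx n) (gy n) z - (u z - f z)))"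
      using n2_triangle_diff[OF rho_L2[OF TL] rho_L2[OF DL]] by simp
    also have "\<dots> \<le> 3 * (B * ?d n + ?U) + B * ?d n"
      by (intro add_mono agmon_step[OF f u t] rho_n2[OF DL])
    finally show ?thesis by simp
  qed
  moreover have "(\<lambda>n. 4 * B * ?d n + 3 * ?U) \<longlonglongrightarrow> 4 * B * 0 + 3 * ?U"
    by (intro tendsto_intros lim)
  ultimately have 1: "n2 N (\<lambda>z. of_real (\<rho> z) * (u z - f z)) \<le> 4 * B * 0 + 3 * ?U"
    using LIMSEQ_le_const by blast
  thus "n2 N (\<lambda>z. of_real (\<rho> z) * (u z - f z)) \<le> 3 * ?U" by simp
  have "(\<lambda>z. of_real (\<rho> z) * f z) = (\<lambda>z. of_real (\<rho> z) * u z - of_real (\<rho> z) * (u z - f z))"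
    by (simp add: algebra_simps)
  hence "n2 N (\<lambda>z. of_real (\<rho> z) * f z) \<le> ?U + n2 N (\<lambda>z. of_real (\<rho> z) * (u z - f z))"
    using n2_triangle_diff[OF rho_L2[OF u] rho_L2[OF uL]] by simp
  thus "n2 N (\<lambda>z. of_real (\<rho> z) * f z) \<le> 4 * ?U" using 1 by simp
qed

end

section \<open>A submean value property\<close>

text \<open>The regularised fundamental solution \<open>ln (|z - w|\<^sup>2 + e)\<close>, corrected by a quadratic polynomial in \<open>s = |z - w|\<^sup>2\<close>
  so that it vanishes to second order on the circle \<open>s = r\<close>; its Laplacian is a multiple of an approximate
  point mass minus a bounded function.\<close>

definition lk :: "real \<Rightarrow> real \<Rightarrow> real \<Rightarrow> real" where
  "lk r e s = (if s \<le> r then ln (s + e) - ln (r + e) - (s - r) / (r + e) + (s - r)\<^sup>2 / (2 * (r + e)\<^sup>2) else 0)"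

definition lk1 :: "real \<Rightarrow> real \<Rightarrow> real \<Rightarrow> real" where
  "lk1 r e s = (if s \<le> r then 1 / (s + e) - 1 / (r + e) + (s - r) / (r + e)\<^sup>2 else 0)"

definition lk2 :: "real \<Rightarrow> real \<Rightarrow> real \<Rightarrow> real" where
  "lk2 r e s = (if s \<le> r then - 1 / (s + e)\<^sup>2 + 1 / (r + e)\<^sup>2 else 0)"

lemma DERIV_lk:
  assumes "0 < r" "0 < e" "0 \<le> s"
  shows "(lk r e has_real_derivative lk1 r e s) (at s)"
  unfolding lk_def[abs_def] lk1_def
proof (rule DERIV_cutoff)
  have "s + e > 0" using assms by simp
  hence 1: "((\<lambda>s. ln (s + e)) has_real_derivative 1 / (s + e)) (at s)" by (auto intro!: derivative_eq_intros)
  have 2: "((\<lambda>s. s - r) has_real_derivative 1) (at s)" by (auto intro!: derivative_eq_intros)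
  have 3: "((\<lambda>s. (s - r)\<^sup>2) has_real_derivative 2 * (s - r)) (at s)" by (auto intro!: derivative_eq_intros)
  have q: "2 * (s - r) / (2 * (r + e)\<^sup>2) = (s - r) / (r + e)\<^sup>2" by (rule mult_divide_mult_cancel_left) simp
  from DERIV_add[OF DERIV_diff[OF DERIV_diff[OF 1 DERIV_const[of "ln (r + e)"]] DERIV_cdivide[OF 2, of "r + e"]] DERIV_cdivide[OF 3, of "2 * (r + e)\<^sup>2"]]
  show "((\<lambda>s. ln (s + e) - ln (r + e) - (s - r) / (r + e) + (s - r)\<^sup>2 / (2 * (r + e)\<^sup>2)) has_real_derivative
      1 / (s + e) - 1 / (r + e) + (s - r) / (r + e)\<^sup>2) (at s)"
    by (simp only: q diff_0_right)
qed (use assms in auto)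

lemma DERIV_lk1:
  assumes "0 < r" "0 < e" "0 \<le> s"
  shows "(lk1 r e has_real_derivative lk2 r e s) (at s)"
  unfolding lk1_def[abs_def] lk2_def
proof (rule DERIV_cutoff)
  have "s + e \<noteq> 0" using assms by simp
  moreover have "((\<lambda>s. s + e) has_real_derivative 1) (at s)" by (auto intro!: derivative_eq_intros)
  ultimately have 1: "((\<lambda>s. inverse (s + e)) has_real_derivative - (inverse (s + e) * 1 * inverse (s + e))) (at s)"
    by (intro DERIV_inverse')
  have "((\<lambda>s. s - r) has_real_derivative 1) (at s)" by (auto intro!: derivative_eq_intros)
  from DERIV_add[OF DERIV_diff[OF 1 DERIV_const[of "inverse (r + e)"]] DERIV_cdivide[OF this, of "(r + e)\<^sup>2"]]
  show "((\<lambda>s. 1 / (s + e) - 1 / (r + e) + (s - r) / (r + e)\<^sup>2) has_real_derivative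
      - 1 / (s + e)\<^sup>2 + 1 / (r + e)\<^sup>2) (at s)"
    by (simp add: inverse_eq_divide power2_eq_square)
qed (use assms in auto)

text \<open>The correction, a Taylor polynomial at \<open>r\<close>, leaves
  \<open>(s - r)^2 / ((s + e) * (r + e)^2)\<close>, a square over positive quantities.\<close>

lemma lk1_nonneg:
  assumes "0 < r" "0 < e" "0 \<le> s" shows "lk1 r e s \<ge> 0"
proof -
  have "1 / (s + e) - 1 / (r + e) + (s - r) / (r + e)\<^sup>2 = (s - r)\<^sup>2 / ((s + e) * (r + e)\<^sup>2)"
  proof -
    have "s + e \<noteq> 0" "r + e \<noteq> 0" using assms by auto
    thus ?thesis by (simp add: divide_simps) (simp add: power2_eq_square algebra_simps)
  qed
  thus ?thesis using assms by (simp add: lk1_def)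
qed

lemma lk_nonpos:
  assumes "0 < r" "0 < e" "0 \<le> s" shows "lk r e s \<le> 0"
proof (cases "s \<le> r")
  case True
  have "lk r e s \<le> lk r e r"
  proof (rule DERIV_nonneg_imp_nondecreasing[OF True])
    fix x assume "s \<le> x"
    hence "0 \<le> x" using assms by simp
    thus "\<exists>y. (lk r e has_real_derivative y) (at x) \<and> 0 \<le> y"
      by (intro exI[of _ "lk1 r e x"] conjI DERIV_lk lk1_nonneg assms(1,2))
  qed
  thus ?thesis by (simp add: lk_def)
qed (simp add: lk_def)

text \<open>The left-hand side is the Laplacian in the plane of \<open>lk r e\<close> as a function
  of \<open>s = |z - w|^2\<close>. The logarithm contributes the approximate point mass
  \<open>4 * e / (s + e)^2\<close>, the polynomial correction an error of at most
  \<open>8 / r\<close>.\<close>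

lemma lk_lap_ge:
  assumes "0 < r" "0 < e" "0 \<le> s" "s \<le> r"
  shows "4 * lk1 r e s + 4 * s * lk2 r e s \<ge> 4 * e / (s + e)\<^sup>2 - 8 / r"
proof -
  have nz: "s + e \<noteq> 0" "r + e \<noteq> 0" using assms by auto
  have "4 * lk1 r e s + 4 * s * lk2 r e s = 4 * (1 / (s + e) - s / (s + e)\<^sup>2) - 4 / (r + e) + (8 * s - 4 * r) / (r + e)\<^sup>2"
    using assms by (simp add: lk1_def lk2_def divide_inverse algebra_simps)
  also have "1 / (s + e) - s / (s + e)\<^sup>2 = e / (s + e)\<^sup>2" using nz by (simp add: divide_simps power2_eq_square)
  finally have eq: "4 * lk1 r e s + 4 * s * lk2 r e s = 4 * e / (s + e)\<^sup>2 - 4 / (r + e) + (8 * s - 4 * r) / (r + e)\<^sup>2" by simp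
  have "4 / (r + e) \<le> 4 / r" using assms by (intro divide_left_mono) auto
  moreover have "- ((8 * s - 4 * r) / (r + e)\<^sup>2) \<le> 4 / r"
  proof -
    have "- ((8 * s - 4 * r) / (r + e)\<^sup>2) \<le> 4 * r / (r + e)\<^sup>2"
      unfolding minus_divide_left using assms by (intro divide_right_mono) auto
    also have "\<dots> \<le> 4 * r / r\<^sup>2" using assms by (intro divide_left_mono power_mono mult_pos_pos) auto
    also have "\<dots> = 4 / r" using assms by (simp add: power2_eq_square)
    finally show ?thesis .
  qed
  ultimately show ?thesis unfolding eq by linarith
qed

text \<open>As \<open>lk\<close> takes a squared distance, a disc of radius \<open>r\<close>
  corresponds to the parameter \<open>r^2\<close>.\<close>

definition kap :: "complex \<Rightarrow> real \<Rightarrow> real \<Rightarrow> complex \<Rightarrow> real" where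
  "kap w r e z = lk r e ((cmod (z - w))\<^sup>2)"

definition kapx :: "complex \<Rightarrow> real \<Rightarrow> real \<Rightarrow> complex \<Rightarrow> complex \<Rightarrow> real" where
  "kapx b r e w z = lk1 r e ((cmod (z - w))\<^sup>2) * (2 * (Re b * Re (z - w) + Im b * Im (z - w)))"

definition kapxx :: "complex \<Rightarrow> real \<Rightarrow> real \<Rightarrow> complex \<Rightarrow> complex \<Rightarrow> real" where
  "kapxx b r e w z = lk1 r e ((cmod (z - w))\<^sup>2) * (2 * (Re b * Re b + Im b * Im b)) +
     (lk2 r e ((cmod (z - w))\<^sup>2) * (2 * (Re b * Re (z - w) + Im b * Im (z - w)))) * (2 * (Re b * Re (z - w) + Im b * Im (z - w)))"

lemma cont_lk2:
  assumes "0 < r" "0 < e" shows "continuous_on {0..} (lk2 r e)"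
proof -
  have "continuous_on {0..} (\<lambda>s. - 1 / (min s r + e)\<^sup>2 + 1 / (r + e)\<^sup>2)"
    using assms by (intro continuous_intros) auto
  thus ?thesis by (rule continuous_on_eq) (auto simp: lk2_def min_def)
qed

lemma pd_kap:
  assumes "0 < r" "0 < e" shows "pd b S (kap w r e) (kapx b r e w)"
  unfolding kap_def[abs_def] kapx_def[abs_def]
proof (rule pd_compose[OF pd_dist2])
  have "continuous_on {0..} (lk1 r e)"
    by (intro continuous_at_imp_continuous_on ballI DERIV_isCont[OF DERIV_lk1[OF assms]]) auto
  thus "continuous_on ((\<lambda>z. (cmod (z - w))\<^sup>2) ` S) (lk1 r e)" by (rule continuous_on_subset) auto
qed (auto intro: DERIV_lk assms)

lemma pd_kapx:
  assumes "0 < r" "0 < e" shows "pd b S (kapx b r e w) (kapxx b r e w)"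
proof -
  have 1: "pd b S (\<lambda>z. lk1 r e ((cmod (z - w))\<^sup>2)) (\<lambda>z. lk2 r e ((cmod (z - w))\<^sup>2) * (2 * (Re b * Re (z - w) + Im b * Im (z - w))))"
    by (rule pd_compose[OF pd_dist2]) (auto intro: DERIV_lk1 assms continuous_on_subset[OF cont_lk2[OF assms]])
  have 2: "pd b S (\<lambda>z. 2 * (Re b * Re (z - w) + Im b * Im (z - w))) (\<lambda>z. 2 * ((Re b * Re b + 0 * Re (z - w)) + (Im b * Im b + 0 * Im (z - w))) + 0 * (Re b * Re (z - w) + Im b * Im (z - w)))"
    by (intro pd_mult pd_add pd_const pd_Re_diff pd_Im_diff)
  show ?thesis
    using pd_mult[OF 1 2] unfolding kapx_def[abs_def] kapxx_def[abs_def] by simp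
qed

lemma kap_lap: "kapxx 1 r e w z + kapxx \<i> r e w z = 4 * lk1 r e ((cmod (z - w))\<^sup>2) + 4 * (cmod (z - w))\<^sup>2 * lk2 r e ((cmod (z - w))\<^sup>2)"
proof -
  have "kapxx 1 r e w z + kapxx \<i> r e w z = 4 * lk1 r e ((cmod (z - w))\<^sup>2) + 4 * ((Re (z - w))\<^sup>2 + (Im (z - w))\<^sup>2) * lk2 r e ((cmod (z - w))\<^sup>2)"
    unfolding kapxx_def by (simp add: power2_eq_square algebra_simps)
  thus ?thesis by (simp only: cmod_power2)
qed

lemma kap_out:
  assumes "0 < r" "r < cmod (z - w)"
  shows "kap w (r\<^sup>2) e z = 0" "kapx b (r\<^sup>2) e w z = 0" "kapxx b (r\<^sup>2) e w z = 0"
proof -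
  have "r\<^sup>2 < (cmod (z - w))\<^sup>2" using assms by (intro power_strict_mono) auto
  thus "kap w (r\<^sup>2) e z = 0" "kapx b (r\<^sup>2) e w z = 0" "kapxx b (r\<^sup>2) e w z = 0"
    by (auto simp: kap_def kapx_def kapxx_def lk_def lk1_def lk2_def)
qed

text \<open>Green's formula for \<open>F\<close> and the kernel \<open>kap\<close>, which is
  nonpositive and supported in the disc. Since \<open>F\<close> is subharmonic there, the integral
  of \<open>F\<close> times the Laplacian of the kernel is at most zero. By \<open>lk_lap_ge\<close>
  that Laplacian plus \<open>8 / r^2\<close> is nonnegative on the disc and at least
  \<open>1 / e^2\<close> on \<open>ball w e\<close>, a set of mass \<open>e^2\<close> on which
  \<open>F\<close> exceeds \<open>F w - d\<close>.\<close>

lemma submean: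
  fixes F :: "complex \<Rightarrow> real"
  assumes F: "pd 1 \<D> F Fx" "pd \<i> \<D> F Fy" "pd 1 \<D> Fx Fxx" "pd \<i> \<D> Fy Fyy"
    and r: "0 < r" "cmod w + r < 1"
    and nn: "\<And>z. z \<in> cball w r \<Longrightarrow> 0 \<le> F z"
    and sub: "\<And>z. z \<in> cball w r \<Longrightarrow> 0 \<le> Fxx z + Fyy z"
  shows "F w \<le> 8 / r\<^sup>2 * (\<integral>z. indicator (cball w r) z * F z \<partial>\<mu>)"
proof (rule field_le_epsilon)
  fix d :: real assume d: "d > 0"
  have w: "w \<in> \<D>" using r by simp
  have BD: "cball w r \<subseteq> \<D>"
  proof
    fix z assume "z \<in> cball w r"
    hence "cmod (z - w) \<le> r" by (simp add: dist_norm norm_minus_commute)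
    thus "z \<in> \<D>" using norm_triangle_sub[of z w] r by simp
  qed
  obtain e0 where e0: "e0 > 0" "\<And>z. z \<in> \<D> \<Longrightarrow> dist z w < e0 \<Longrightarrow> dist (F z) (F w) < d"
    using pd_cont0[OF F(1)] w d unfolding continuous_on_iff by blast
  define e where "e = min (e0) r"
  have e: "e > 0" "e \<le> e0" "e \<le> r" using e0 r by (auto simp: e_def)
  let ?k = "kap w (r\<^sup>2) (e\<^sup>2)" and ?kx = "\<lambda>b. kapx b (r\<^sup>2) (e\<^sup>2) w" and ?kxx = "\<lambda>b. kapxx b (r\<^sup>2) (e\<^sup>2) w"
  have pos: "0 < r\<^sup>2" "0 < e\<^sup>2" using r e by auto
  note K = pd_kap[OF pos, of _ \<D> w] pd_kapx[OF pos, of _ \<D> w]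
  have out: "r < cmod (z - w)" if "cmod w + r < cmod z" for z
    using norm_triangle_ineq2[of z w] that by linarith
  note kout = kap_out[OF r(1) out]
  have pdx: "pd 1 \<D> (\<lambda>z. Fx z * ?k z - F z * ?kx 1 z) (\<lambda>z. (Fx z * ?kx 1 z + Fxx z * ?k z) - (F z * ?kxx 1 z + Fx z * ?kx 1 z))"
    by (intro pd_diff pd_mult F K)
  have pdy: "pd \<i> \<D> (\<lambda>z. Fy z * ?k z - F z * ?kx \<i> z) (\<lambda>z. (Fy z * ?kx \<i> z + Fyy z * ?k z) - (F z * ?kxx \<i> z + Fy z * ?kx \<i> z))"
    by (intro pd_diff pd_mult F K)
  note ix = integral_pd_disk[OF pdx r(2)] and iy = integral_pd_disk[OF pdy r(2)]
  define G where "G z = (Fxx z + Fyy z) * ?k z - F z * (?kxx 1 z + ?kxx \<i> z)" for z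
  have Geq: "G z = ((Fx z * ?kx 1 z + Fxx z * ?k z) - (F z * ?kxx 1 z + Fx z * ?kx 1 z)) + ((Fy z * ?kx \<i> z + Fyy z * ?k z) - (F z * ?kxx \<i> z + Fy z * ?kx \<i> z))" for z
    by (simp add: G_def algebra_simps)
  have G: "integral\<^sup>L \<mu> G = 0" "integrable \<mu> G"
    unfolding Geq[abs_def] using ix iy kout by simp_all
  define H where "H z = 8 / r\<^sup>2 * (indicator (cball w r) z * F z) - (F w - d) / e\<^sup>2 * indicator (ball w e) z" for z
  have Gle: "G z \<le> H z" if z: "z \<in> \<D>" for z
  proof (cases "z \<in> cball w r")
    case True
    let ?s = "(cmod (z - w))\<^sup>2"
    have sr: "?s \<le> r\<^sup>2" using True r by (intro power_mono) (auto simp: dist_norm norm_minus_commute)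
    have "(Fxx z + Fyy z) * ?k z \<le> 0"
      using sub[OF True] lk_nonpos[OF pos, of ?s] unfolding kap_def by (simp add: mult_nonneg_nonpos)
    moreover have "F z * (4 * e\<^sup>2 / (?s + e\<^sup>2)\<^sup>2 - 8 / r\<^sup>2) \<le> F z * (?kxx 1 z + ?kxx \<i> z)"
      unfolding kap_lap by (intro mult_left_mono lk_lap_ge nn True pos sr) auto
    moreover have "(F w - d) / e\<^sup>2 * indicator (ball w e) z \<le> F z * (4 * e\<^sup>2 / (?s + e\<^sup>2)\<^sup>2)"
    proof (cases "z \<in> ball w e")
      case True
      hence "dist z w < e0" using e by (simp add: dist_commute)
      from e0(2)[OF z this] have "F w - d \<le> F z" by (simp add: dist_real_def)
      moreover have "1 / e\<^sup>2 \<le> 4 * e\<^sup>2 / (?s + e\<^sup>2)\<^sup>2"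
      proof -
        have "?s \<le> e\<^sup>2" using True by (intro power_mono) (auto simp: dist_norm norm_minus_commute)
        hence "(?s + e\<^sup>2)\<^sup>2 \<le> (2 * e\<^sup>2)\<^sup>2" by (intro power_mono) auto
        hence "4 * e\<^sup>2 / (2 * e\<^sup>2)\<^sup>2 \<le> 4 * e\<^sup>2 / (?s + e\<^sup>2)\<^sup>2" using pos by (intro divide_left_mono mult_pos_pos) (auto simp: add_nonneg_pos)
        thus ?thesis using pos e(1) by (simp add: power2_eq_square)
      qed
      ultimately have "(F w - d) * (1 / e\<^sup>2) \<le> F z * (4 * e\<^sup>2 / (?s + e\<^sup>2)\<^sup>2)"
        using nn[OF \<open>z \<in> cball w r\<close>] by (intro order_trans[OF mult_right_mono mult_left_mono]) auto
      thus ?thesis using True by simp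
    next
      case False
      thus ?thesis using nn[OF \<open>z \<in> cball w r\<close>] by simp
    qed
    ultimately show ?thesis using True unfolding G_def H_def by (simp add: algebra_simps)
  next
    case False
    hence f: "r < cmod (z - w)" "z \<notin> ball w e" using e by (auto simp: dist_norm norm_minus_commute)
    have "G z = 0" unfolding G_def using kap_out[OF r(1) f(1)] by simp
    thus ?thesis using False f by (simp add: H_def)
  qed
  have cb: "cball w r \<in> sets \<mu>" "ball w e \<in> sets \<mu>"
  proof -
    show "cball w r \<in> sets \<mu>" using closed_disk_sets[OF closed_cball, of w r] BD by (simp add: Int_absorb2)
    have "ball w e \<subseteq> \<D>" using e BD by (meson ball_subset_cball order_trans cball_subset_cball_iff subset_cball)
    thus "ball w e \<in> sets \<mu>" by (auto simp: sets_disk sets_restrict_space_iff)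
  qed
  have eb: "ball w e \<subseteq> \<D>" using sets.sets_into_space[OF cb(2)] by simp
  have iF: "integrable \<mu> (\<lambda>z. indicator (cball w r) z * F z)"
    by (rule integrable_disk_indicator[OF pd_cont0[OF F(1)] compact_cball BD])
  have ib: "integrable \<mu> (indicator (ball w e) :: complex \<Rightarrow> real)"
    using cb(2) finite_measure.emeasure_finite[OF finite_measure_disk] by (intro integrable_real_indicator) (auto simp: less_top)
  have mb: "measure \<mu> (ball w e) = e\<^sup>2"
    using emeasure_disk_ball[OF eb] e by (simp add: measure_def)
  have "0 \<le> integral\<^sup>L \<mu> H"
    unfolding G(1)[symmetric] by (rule integral_mono[OF G(2)]) (use iF ib Gle in \<open>auto simp: H_def[abs_def]\<close>)
  also have "integral\<^sup>L \<mu> H = 8 / r\<^sup>2 * (\<integral>z. indicator (cball w r) z * F z \<partial>\<mu>) - (F w - d)"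
    unfolding H_def[abs_def] using iF ib mb cb(2) eb e by (simp add: Int_absorb2)
  finally show "F w \<le> 8 / r\<^sup>2 * (\<integral>z. indicator (cball w r) z * F z \<partial>\<mu>) + d" by simp
qed

text \<open>The Laplacian of the compactly supported kernel integrates to zero. With squared radius
  4, \<open>lk_lap_ge\<close> bounds the integral of \<open>4 * e / (e + |z - w|^2)^2\<close> over
  \<open>cball w 2\<close>, which contains the disk, by twice the area
  \<open>4 * pi\<close>.\<close>

lemma sigma_integral:
  assumes e: "0 < e" and w: "w \<in> \<D>"
  shows "(\<integral>z. 1 / (e + (cmod (z - w))\<^sup>2)\<^sup>2 \<partial>\<mu>) \<le> 2 / e"
proof -
  let ?kx = "\<lambda>b. kapx b (2\<^sup>2) e w" and ?kxx = "\<lambda>b. kapxx b (2\<^sup>2) e w"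
  have pos: "0 < (2::real)\<^sup>2" by simp
  have out: "2 < cmod (z - w)" if "3 < cmod z" for z
    using norm_triangle_ineq2[of z w] that w by simp
  note kout = kap_out[OF _ out]
  have z: "integral\<^sup>L lborel (?kxx b) = 0" if "cmod b = 1" for b
    by (rule integral_pd_lborel[OF pd_kapx[OF pos e], where R=3]) (use kout that in auto)
  have c: "continuous_on UNIV (?kxx b)" for b using pd_cont[OF pd_kapx[OF pos e]] .
  have ck: "integrable lborel (?kxx b)" for b
  proof -
    have "integrable lborel (\<lambda>x. indicator (cball 0 3) x *\<^sub>R ?kxx b x)"
      by (rule borel_integrable_compact[OF compact_cball continuous_on_subset[OF c subset_UNIV]])
    also have "(\<lambda>x. indicator (cball 0 3) x *\<^sub>R ?kxx b x) = ?kxx b"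
      using kout(3) by (auto simp: indicator_def fun_eq_iff not_le)
    finally show ?thesis .
  qed
  define f where "f z = 1 / (e + (cmod (z - w))\<^sup>2)\<^sup>2" for z
  have cf: "continuous_on UNIV f" unfolding f_def using e by (intro continuous_intros) (auto simp: add_pos_nonneg less_imp_neq[THEN not_sym])
  have fm: "f \<in> borel_measurable borel" using cf by (rule borel_measurable_continuous_onI)
  have f0: "f z \<ge> 0" for z by (simp add: f_def)
  let ?B = "cball w 2"
  have iB: "integrable lborel (\<lambda>z. indicator ?B z *\<^sub>R f z)"
    by (rule borel_integrable_compact[OF compact_cball continuous_on_subset[OF cf subset_UNIV]])
  have iI: "integrable lborel (indicator ?B :: complex \<Rightarrow> real)"
    by (rule integrable_real_indicator) (use emeasure_lborel_cball_finite[of w 2] in simp_all)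
  have "(\<integral>z. 4 * e * (indicator ?B z *\<^sub>R f z) - 2 * indicator ?B z \<partial>lborel) \<le> (\<integral>z. ?kxx 1 z + ?kxx \<i> z \<partial>lborel)"
  proof (rule integral_mono)
    show "integrable lborel (\<lambda>z. 4 * e * (indicator ?B z *\<^sub>R f z) - 2 * indicator ?B z)" using iB iI by auto
    show "integrable lborel (\<lambda>z. ?kxx 1 z + ?kxx \<i> z)" using ck by auto
    fix z
    show "4 * e * (indicator ?B z *\<^sub>R f z) - 2 * indicator ?B z \<le> ?kxx 1 z + ?kxx \<i> z"
    proof (cases "z \<in> ?B")
      case True
      have sr: "(cmod (z - w))\<^sup>2 \<le> 2\<^sup>2" using True by (intro power_mono) (auto simp: dist_norm norm_minus_commute)
      have "4 * e / ((cmod (z - w))\<^sup>2 + e)\<^sup>2 - 8 / 2\<^sup>2 \<le> ?kxx 1 z + ?kxx \<i> z"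
        unfolding kap_lap by (rule lk_lap_ge[OF pos e _ sr]) simp
      thus ?thesis using True by (simp add: f_def add.commute)
    next
      case False
      hence "2 < cmod (z - w)" by (simp add: dist_norm norm_minus_commute)
      thus ?thesis using False kap_out(3)[of 2 z w 1 e] kap_out(3)[of 2 z w "\<i>" e] by simp
    qed
  qed
  also have "(\<integral>z. ?kxx 1 z + ?kxx \<i> z \<partial>lborel) = 0" using z ck by simp
  also have "(\<integral>z. 4 * e * (indicator ?B z *\<^sub>R f z) - 2 * indicator ?B z \<partial>lborel) =
      4 * e * (\<integral>z. indicator ?B z *\<^sub>R f z \<partial>lborel) - 2 * measure lborel ?B"
    using iB iI by (simp del: integral_mult_right_zero add: integral_mult_right_zero)
  also have "measure lborel ?B = 4 * pi"
    using emeasure_cball[of 2 w] by (simp add: measure_def unit_ball_vol_2 power2_eq_square)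
  finally have b: "(\<integral>z. indicator ?B z *\<^sub>R f z \<partial>lborel) \<le> 2 * pi / e" using e by (simp add: field_simps)
  have DB: "\<D> \<subseteq> ?B"
  proof
    fix z assume "z \<in> \<D>"
    thus "z \<in> ?B" using w norm_triangle_ineq4[of z w] by (simp add: dist_norm norm_minus_commute)
  qed
  have im: "(\<lambda>z. indicator \<D> z *\<^sub>R f z) \<in> borel_measurable borel"
    by (intro borel_measurable_scaleR borel_measurable_indicator fm) simp
  have "(\<integral>z. f z \<partial>\<mu>) = (1 / pi) * (\<integral>z. indicator \<D> z *\<^sub>R f z \<partial>lebesgue)"
    using integral_disk_conv[OF disk_measurable[OF continuous_on_subset[OF cf]]] by simp
  also have "(\<integral>z. indicator \<D> z *\<^sub>R f z \<partial>lebesgue) = (\<integral>z. indicator \<D> z *\<^sub>R f z \<partial>lborel)"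
    by (rule integral_completion) (use im in simp)
  finally have eq: "(\<integral>z. f z \<partial>\<mu>) = (1 / pi) * (\<integral>z. indicator \<D> z *\<^sub>R f z \<partial>lborel)" .
  have "(\<integral>z. indicator \<D> z *\<^sub>R f z \<partial>lborel) \<le> (\<integral>z. indicator ?B z *\<^sub>R f z \<partial>lborel)"
  proof (rule integral_mono[OF _ iB])
    show "integrable lborel (\<lambda>z. indicator \<D> z *\<^sub>R f z)"
    proof (rule integrable_dominated[OF iB])
      show "AE z in lborel. norm (indicator \<D> z *\<^sub>R f z) \<le> norm (indicator ?B z *\<^sub>R f z)"
        by (rule AE_I2) (use DB f0 in \<open>auto simp: indicator_def subset_iff\<close>)
    qed (use im in simp)
    show "indicator \<D> z *\<^sub>R f z \<le> indicator ?B z *\<^sub>R f z" for z using DB f0[of z] by (auto simp: indicator_def)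
  qed
  also note b
  finally have "(1 / pi) * (\<integral>z. indicator \<D> z *\<^sub>R f z \<partial>lborel) \<le> (1 / pi) * (2 * pi / e)"
    by (intro mult_left_mono) auto
  hence "(\<integral>z. f z \<partial>\<mu>) \<le> 2 / e" unfolding eq by simp
  thus ?thesis by (simp add: f_def[abs_def])
qed

text \<open>The Laplacian and the squared gradient of \<open>F = m * E\<close>, where
  \<open>m\<close> is \<open>|f|^2\<close>, \<open>E\<close> is the exponential of some S with
  derivatives \<open>x\<close>, \<open>y\<close>, \<open>xx\<close>, \<open>yy\<close>, and
  \<open>g\<close>, \<open>h\<close> are the first two derivatives of \<open>f\<close>. The same
  square \<open>Q\<close> occurs in both, so F times its Laplacian dominates
  \<open>|grad F|^2\<close> when S is subharmonic. Factors such as \<open>1 * g\<close> keep the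
  shape produced by the rules for \<open>pd\<close>.\<close>

lemma log_subharmonic_pointwise:
  fixes f g h :: complex and E x y xx yy :: real
  defines "m \<equiv> Re (f * cnj f)"
    and "mx \<equiv> Re (f * cnj (1 * g) + (1 * g) * cnj f)"
    and "my \<equiv> Re (f * cnj (\<i> * g) + (\<i> * g) * cnj f)"
    and "mxx \<equiv> Re ((f * cnj (1 * (1 * h)) + (1 * g) * cnj (1 * g)) + ((1 * g) * cnj (1 * g) + (1 * (1 * h)) * cnj f))"
    and "myy \<equiv> Re ((f * cnj (\<i> * (\<i> * h)) + (\<i> * g) * cnj (\<i> * g)) + ((\<i> * g) * cnj (\<i> * g) + (\<i> * (\<i> * h)) * cnj f))"
    and "Q \<equiv> (cmod (2 * g + f * Complex x (- y)))\<^sup>2"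
  shows "((m * (E * xx + (E * x) * x) + mx * (E * x)) + (mx * (E * x) + mxx * E)) + ((m * (E * yy + (E * y) * y) + my * (E * y)) + (my * (E * y) + myy * E))
      = E * (m * (xx + yy) + Q)"
    and "(m * (E * x) + mx * E)\<^sup>2 + (m * (E * y) + my * E)\<^sup>2 = (m * E) * (E * Q)"
  unfolding m_def mx_def my_def mxx_def myy_def Q_def cmod_power2
  by (simp_all add: power2_eq_square algebra_simps)

text \<open>The expression is the Laplacian of \<open>sqrt (F + e)\<close> for a function with
  gradient \<open>(a, b)\<close> and Laplacian \<open>c\<close>. The positive \<open>e\<close> keeps
  the root smooth at zeros of \<open>F\<close>.\<close>

lemma sqrt_lap_nonneg:
  fixes F e a b c :: real
  assumes "F \<ge> 0" "e > 0" "a\<^sup>2 + b\<^sup>2 \<le> F * c" "c \<ge> 0"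
  shows "0 \<le> c * (inverse (sqrt (F + e)) / 2) - (a\<^sup>2 + b\<^sup>2) * (inverse (sqrt (F + e)) ^ 3 / 4)"
proof -
  define g where "g = sqrt (F + e)"
  have g: "g > 0" "g\<^sup>2 = F + e" using assms by (auto simp: g_def)
  have "(a\<^sup>2 + b\<^sup>2) * (inverse g ^ 3 / 4) \<le> (2 * g\<^sup>2 * c) * (inverse g ^ 3 / 4)"
  proof (rule mult_right_mono)
    have "F * c \<le> (2 * g\<^sup>2) * c" using assms g by (intro mult_right_mono) auto
    thus "a\<^sup>2 + b\<^sup>2 \<le> 2 * g\<^sup>2 * c" using assms by simp
    show "0 \<le> inverse g ^ 3 / 4" using g by simp
  qed
  also have "\<dots> = c * (inverse g / 2)" using g(1) by (simp add: power2_eq_square power3_eq_cube field_simps)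
  finally show ?thesis by (simp add: g_def)
qed

context disk_weight
begin

text \<open>Adding \<open>2 * A * |z - w|^2\<close>, of Laplacian \<open>8 * A\<close>, to
  \<open>- 2 * \<phi>\<close> makes the exponent subharmonic on the disc, so \<open>|f|\<close>
  times the root of the modified weight is subharmonic there. The modification multiplies the root
  of the weight by a factor between 1 and \<open>exp (A * r^2)\<close>.\<close>

theorem submean_weight:
  assumes f: "f holomorphic_on \<D>" and r: "0 < r" "cmod w + r < 1" and A: "A \<ge> 0"
    and lapA: "\<And>z. z \<in> cball w r \<Longrightarrow> lap z \<le> 4 * A"
  shows "cmod (f w) * sqrt (\<omega> w) \<le> 8 / r\<^sup>2 * exp (A * r\<^sup>2) * (\<integral>z. indicator (cball w r) z * (cmod (f z) * sqrt (\<omega> z)) \<partial>\<mu>)"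
proof -
  define f1 where "f1 = deriv f"
  define f2 where "f2 = deriv f1"
  have f1: "f1 holomorphic_on \<D>" unfolding f1_def by (rule holomorphic_deriv[OF f open_ball])
  have F0: "pd b \<D> f (\<lambda>z. b * f1 z)" for b unfolding f1_def by (rule pd_holomorphic[OF open_ball f])
  have F1: "pd b \<D> (\<lambda>z. c * f1 z) (\<lambda>z. c * (b * f2 z))" for b c
    using pd_mult[OF pd_const[of b \<D> c] pd_holomorphic[OF open_ball f1, of b]] by (simp add: f2_def)
  define S where "S z = - 2 * \<phi> z + 2 * A * (cmod (z - w))\<^sup>2" for z
  define tx where "tx z = - 2 * px z + 2 * A * (2 * Re (z - w))" for z
  define ty where "ty z = - 2 * py z + 2 * A * (2 * Im (z - w))" for z
  define txx where "txx z = - 2 * pxx z + 2 * A * 2" for z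
  define tyy where "tyy z = - 2 * pyy z + 2 * A * 2" for z
  have Sx: "pd 1 \<D> S tx" and Sy: "pd \<i> \<D> S ty"
    using pd_add[OF pd_mult[OF pd_const[of _ _ "- 2"] pd_phi(1)] pd_mult[OF pd_const[of _ _ "2 * A"] pd_dist2[of 1 \<D> w]]]
      pd_add[OF pd_mult[OF pd_const[of _ _ "- 2"] pd_phi(2)] pd_mult[OF pd_const[of _ _ "2 * A"] pd_dist2[of "\<i>" \<D> w]]]
    unfolding S_def[abs_def] tx_def[abs_def] ty_def[abs_def] by simp_all
  have Txx: "pd 1 \<D> tx txx" and Tyy: "pd \<i> \<D> ty tyy"
    using pd_add[OF pd_mult[OF pd_const[of _ _ "- 2"] pd_phi(3)] pd_mult[OF pd_const[of _ _ "2 * A"] pd_mult[OF pd_const[of _ _ 2] pd_Re_diff[of 1 \<D> w]]]]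
      pd_add[OF pd_mult[OF pd_const[of _ _ "- 2"] pd_phi(4)] pd_mult[OF pd_const[of _ _ "2 * A"] pd_mult[OF pd_const[of _ _ 2] pd_Im_diff[of "\<i>" \<D> w]]]]
    unfolding tx_def[abs_def] ty_def[abs_def] txx_def[abs_def] tyy_def[abs_def] by simp_all
  define E where "E z = exp (S z)" for z
  have Ed: "pd b \<D> E (\<lambda>z. E z * s z)" if "pd b \<D> S s" for b s
    unfolding E_def by (rule pd_compose[OF that]) (auto intro!: continuous_intros derivative_eq_intros)
  define m where "m z = Re (f z * cnj (f z))" for z
  define mb where "mb b z = Re (f z * cnj (b * f1 z) + (b * f1 z) * cnj (f z))" for b z
  define mbb where "mbb b z = Re ((f z * cnj (b * (b * f2 z)) + (b * f1 z) * cnj (b * f1 z)) + ((b * f1 z) * cnj (b * f1 z) + (b * (b * f2 z)) * cnj (f z)))" for b z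
  have M1: "pd b \<D> m (mb b)" for b
    unfolding m_def[abs_def] mb_def[abs_def] by (intro pd_Re pd_mult pd_cnj F0)
  have M2: "pd b \<D> (mb b) (mbb b)" for b
    unfolding mb_def[abs_def] mbb_def[abs_def] by (intro pd_Re pd_add pd_mult pd_cnj F0 F1)
  define F where "F z = m z * E z" for z
  define Fx where "Fx z = m z * (E z * tx z) + mb 1 z * E z" for z
  define Fy where "Fy z = m z * (E z * ty z) + mb \<i> z * E z" for z
  define Fxx where "Fxx z = (m z * (E z * txx z + (E z * tx z) * tx z) + mb 1 z * (E z * tx z)) + (mb 1 z * (E z * tx z) + mbb 1 z * E z)" for z
  define Fyy where "Fyy z = (m z * (E z * tyy z + (E z * ty z) * ty z) + mb \<i> z * (E z * ty z)) + (mb \<i> z * (E z * ty z) + mbb \<i> z * E z)" for z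
  have pF: "pd 1 \<D> F Fx" "pd \<i> \<D> F Fy"
    unfolding F_def[abs_def] Fx_def[abs_def] Fy_def[abs_def] by (intro pd_mult M1 Ed Sx Sy)+
  have pFF: "pd 1 \<D> Fx Fxx" "pd \<i> \<D> Fy Fyy"
    unfolding Fx_def[abs_def] Fy_def[abs_def] Fxx_def[abs_def] Fyy_def[abs_def]
    by (intro pd_add pd_mult M1 M2 Ed Sx Sy Txx Tyy)+
  have Fnn: "F z \<ge> 0" for z by (simp add: F_def m_def E_def flip: power2_eq_square)
  define Q where "Q z = (cmod (2 * f1 z + f z * Complex (tx z) (- ty z)))\<^sup>2" for z
  have lapF: "Fxx z + Fyy z = E z * (m z * (txx z + tyy z) + Q z)" for z
    unfolding Fxx_def Fyy_def m_def mb_def mbb_def Q_def by (rule log_subharmonic_pointwise(1))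
  have gradF: "(Fx z)\<^sup>2 + (Fy z)\<^sup>2 = F z * (E z * Q z)" for z
    unfolding Fx_def Fy_def F_def m_def mb_def Q_def by (rule log_subharmonic_pointwise(2))
  have mnn: "m z \<ge> 0" for z by (simp add: m_def flip: power2_eq_square)
  have tnn: "txx z + tyy z \<ge> 0" if "z \<in> cball w r" for z
    using lapA[OF that] by (simp add: txx_def tyy_def lap_def)
  have lapF0: "E z * Q z \<le> Fxx z + Fyy z" "0 \<le> Fxx z + Fyy z" if "z \<in> cball w r" for z
    unfolding lapF using tnn[OF that] mnn[of z] by (auto simp: E_def Q_def intro!: mult_nonneg_nonneg add_nonneg_nonneg)
  have ineq: "(Fx z)\<^sup>2 + (Fy z)\<^sup>2 \<le> F z * (Fxx z + Fyy z)" if "z \<in> cball w r" for z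
    unfolding gradF by (rule mult_left_mono[OF lapF0(1)[OF that] Fnn])
  have main: "sqrt (F w + e) \<le> 8 / r\<^sup>2 * (\<integral>z. indicator (cball w r) z * sqrt (F z + e) \<partial>\<mu>)" if e: "e > 0" for e
  proof (rule submean[OF _ _ _ _ r])
    let ?k = "\<lambda>s. inverse (sqrt (s + e)) / 2" and ?k2 = "\<lambda>s. - (inverse (sqrt (s + e)) ^ 3 / 4)"
    have d1: "((\<lambda>s. sqrt (s + e)) has_real_derivative ?k s) (at s)" if "s \<ge> 0" for s
      using that e by (auto intro!: derivative_eq_intros)
    have d2: "(?k has_real_derivative ?k2 s) (at s)" if "s \<ge> 0" for s
    proof -
      have "sqrt (s + e) \<noteq> 0" using that e by simp
      from DERIV_cdivide[OF DERIV_inverse'[OF d1[OF that] this], of 2]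
      show ?thesis by (simp add: power3_eq_cube)
    qed
    have c: "continuous_on (F ` \<D>) ?k" "continuous_on (F ` \<D>) ?k2"
      using Fnn e by (auto intro!: continuous_intros simp: add_nonneg_pos less_imp_neq[THEN not_sym])
    have p1: "pd b \<D> (\<lambda>z. sqrt (F z + e)) (\<lambda>z. ?k (F z) * f' z)" if "pd b \<D> F f'" for b f'
      by (rule pd_compose[OF that d1[OF Fnn] c(1)])
    have p2: "pd b \<D> (\<lambda>z. ?k (F z)) (\<lambda>z. ?k2 (F z) * f' z)" if "pd b \<D> F f'" for b f'
      by (rule pd_compose[OF that d2[OF Fnn] c(2)])
    show "pd 1 \<D> (\<lambda>z. sqrt (F z + e)) (\<lambda>z. ?k (F z) * Fx z)" "pd \<i> \<D> (\<lambda>z. sqrt (F z + e)) (\<lambda>z. ?k (F z) * Fy z)"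
      by (intro p1 pF)+
    show "pd 1 \<D> (\<lambda>z. ?k (F z) * Fx z) (\<lambda>z. ?k (F z) * Fxx z + (?k2 (F z) * Fx z) * Fx z)"
      "pd \<i> \<D> (\<lambda>z. ?k (F z) * Fy z) (\<lambda>z. ?k (F z) * Fyy z + (?k2 (F z) * Fy z) * Fy z)"
      by (intro pd_mult p2 pF pFF)+
    show "0 \<le> sqrt (F z + e)" for z using Fnn[of z] e by simp
    show "0 \<le> (?k (F z) * Fxx z + (?k2 (F z) * Fx z) * Fx z) + (?k (F z) * Fyy z + (?k2 (F z) * Fy z) * Fy z)" if "z \<in> cball w r" for z
      using sqrt_lap_nonneg[OF Fnn e ineq[OF that] lapF0(2)[OF that]] by (simp add: algebra_simps power2_eq_square)
  qed
  have BD: "cball w r \<subseteq> \<D>"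
  proof
    fix z assume "z \<in> cball w r"
    hence "cmod (z - w) \<le> r" by (simp add: dist_norm norm_minus_commute)
    thus "z \<in> \<D>" using norm_triangle_sub[of z w] r by simp
  qed
  have Feq: "F z = (cmod (f z))\<^sup>2 * \<omega> z * (exp (A * (cmod (z - w))\<^sup>2))\<^sup>2" if "z \<in> \<D>" for z
  proof -
    have "m z = (cmod (f z))\<^sup>2" unfolding m_def cmod_power2 by (simp add: power2_eq_square)
    moreover have "E z = \<omega> z * (exp (A * (cmod (z - w))\<^sup>2))\<^sup>2"
      unfolding E_def S_def omega_eq[OF that] by (simp add: exp_add[symmetric] power2_eq_square)
    ultimately show ?thesis by (simp add: F_def)
  qed
  have sF: "sqrt (F z) = cmod (f z) * sqrt (\<omega> z) * exp (A * (cmod (z - w))\<^sup>2)" if "z \<in> \<D>" for z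
    unfolding Feq[OF that] using omega_pos[OF that] by (simp add: real_sqrt_mult)
  define h where "h z = cmod (f z) * sqrt (\<omega> z)" for z
  have ch: "continuous_on \<D> h" unfolding h_def
    by (intro continuous_intros holomorphic_on_imp_continuous_on[OF f] cont_omega)
  have cs: "cball w r \<in> sets \<mu>" using closed_disk_sets[OF closed_cball, of w r] BD by (simp add: Int_absorb2)
  have bint: "integrable \<mu> (\<lambda>z. indicator (cball w r) z * k z)" if "continuous_on \<D> k" for k :: "complex \<Rightarrow> real"
    by (rule integrable_disk_indicator[OF that compact_cball BD])
  let ?I = "\<integral>z. indicator (cball w r) z * h z \<partial>\<mu>"
  have w: "w \<in> \<D>" using r by simp
  show ?thesis
  proof (rule field_le_epsilon)
    fix d :: real assume d: "d > 0"
    \<comment> \<open>Chosen so that \<open>8 / r^2 * sqrt e = d\<close>.\<close>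
    define e where "e = (d * r\<^sup>2 / 8)\<^sup>2"
    have e: "e > 0" and se: "sqrt e = d * r\<^sup>2 / 8" using d r by (auto simp: e_def)
    have "(\<integral>z. indicator (cball w r) z * sqrt (F z + e) \<partial>\<mu>) \<le> (\<integral>z. exp (A * r\<^sup>2) * (indicator (cball w r) z * h z) + sqrt e \<partial>\<mu>)"
    proof (rule integral_mono)
      show "integrable \<mu> (\<lambda>z. indicator (cball w r) z * sqrt (F z + e))"
        by (rule bint) (intro continuous_intros pd_cont0[OF pF(1)])
      show "integrable \<mu> (\<lambda>z. exp (A * r\<^sup>2) * (indicator (cball w r) z * h z) + sqrt e)"
        by (intro Bochner_Integration.integrable_add integrable_mult_right bint[OF ch] finite_measure.integrable_const[OF finite_measure_disk])
      fix z assume "z \<in> space \<mu>"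
      hence z: "z \<in> \<D>" by simp
      have e0: "sqrt e \<ge> 0" using e by simp
      show "indicator (cball w r) z * sqrt (F z + e) \<le> exp (A * r\<^sup>2) * (indicator (cball w r) z * h z) + sqrt e"
      proof (cases "z \<in> cball w r")
        case True
        have "sqrt (F z + e) \<le> sqrt (F z) + sqrt e" using Fnn[of z] e by (intro sqrt_add_le_add_sqrt) auto
        also have "sqrt (F z) = h z * exp (A * (cmod (z - w))\<^sup>2)" using sF[OF z] by (simp add: h_def)
        also have "\<dots> \<le> h z * exp (A * r\<^sup>2)"
        proof (rule mult_left_mono)
          have "(cmod (z - w))\<^sup>2 \<le> r\<^sup>2" using True by (intro power_mono) (auto simp: dist_norm norm_minus_commute)
          thus "exp (A * (cmod (z - w))\<^sup>2) \<le> exp (A * r\<^sup>2)" using A by (simp add: mult_left_mono)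
          show "0 \<le> h z" using omega_pos[OF z] by (simp add: h_def)
        qed
        finally show ?thesis using True by (simp add: mult.commute)
      next
        case False thus ?thesis using e0 by simp
      qed
    qed
    also have "\<dots> = exp (A * r\<^sup>2) * ?I + sqrt e"
      using bint[OF ch] finite_measure.integrable_const[OF finite_measure_disk, of "sqrt e"] emeasure_disk by (simp add: measure_def)
    finally have le: "(\<integral>z. indicator (cball w r) z * sqrt (F z + e) \<partial>\<mu>) \<le> exp (A * r\<^sup>2) * ?I + sqrt e" .
    have "cmod (f w) * sqrt (\<omega> w) = sqrt (F w)" using sF[OF w] by simp
    also have "\<dots> \<le> sqrt (F w + e)" using e by simp
    also have "\<dots> \<le> 8 / r\<^sup>2 * (\<integral>z. indicator (cball w r) z * sqrt (F z + e) \<partial>\<mu>)" by (rule main[OF e])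
    also have "\<dots> \<le> 8 / r\<^sup>2 * (exp (A * r\<^sup>2) * ?I + sqrt e)"
      by (rule mult_left_mono[OF le]) simp
    also have "\<dots> = 8 / r\<^sup>2 * exp (A * r\<^sup>2) * ?I + d" using r unfolding se by (simp add: distrib_left)
    finally show "cmod (f w) * sqrt (\<omega> w) \<le> 8 / r\<^sup>2 * exp (A * r\<^sup>2) * (\<integral>z. indicator (cball w r) z * (cmod (f z) * sqrt (\<omega> z)) \<partial>\<mu>) + d"
      by (simp add: h_def)
  qed
qed

section \<open>Linear structure of A2 and the Riesz representation theorem\<close>

lemma L2_N_iff: "f \<in> L2 N \<longleftrightarrow> f \<in> borel_measurable \<mu> \<and> integrable \<mu> (\<lambda>z. \<omega> z * (cmod (f z))\<^sup>2)"
proof -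
  have "integrable N (\<lambda>z. (cmod (f z))\<^sup>2) \<longleftrightarrow> integrable \<mu> (\<lambda>z. \<omega> z * (cmod (f z))\<^sup>2)" if "f \<in> borel_measurable \<mu>"
    using integrable_N[of "\<lambda>z. (cmod (f z))\<^sup>2"] that by simp
  thus ?thesis by (auto simp: L2_def N_measurable)
qed

lemma n2_N:
  assumes "f \<in> borel_measurable \<mu>"
  shows "(n2 N f)\<^sup>2 = (\<integral>z. \<omega> z * (cmod (f z))\<^sup>2 \<partial>\<mu>)"
  unfolding n2_sq using integral_N[of "\<lambda>z. (cmod (f z))\<^sup>2"] assms by simp

lemma ip_N:
  assumes "f \<in> borel_measurable \<mu>" "g \<in> borel_measurable \<mu>"
  shows "ip N f g = pairing \<omega> f g"
proof -
  have "(\<lambda>z. f z * cnj (g z)) \<in> borel_measurable \<mu>"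
    using assms by (intro borel_measurable_times borel_measurable_cnj')
  from integral_N[OF this] show ?thesis
    by (simp add: ip_def pairing_def scaleR_conv_of_real mult_ac)
qed

lemma A2_meas: "f \<in> A2 \<Longrightarrow> f \<in> borel_measurable \<mu>"
  using A2D(1) L2_N_iff by blast

lemma holomorphic_meas: "f holomorphic_on \<D> \<Longrightarrow> f \<in> borel_measurable \<mu>"
  by (intro disk_measurable holomorphic_on_imp_continuous_on)

lemma A2_add: "f \<in> A2 \<Longrightarrow> g \<in> A2 \<Longrightarrow> (\<lambda>z. f z + g z) \<in> A2"
  by (auto simp: A2_def intro: L2_add holomorphic_intros)

lemma A2_cmult: "f \<in> A2 \<Longrightarrow> (\<lambda>z. c * f z) \<in> A2"
  by (auto simp: A2_def intro: L2_cmult holomorphic_intros)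

lemma A2_diff: "f \<in> A2 \<Longrightarrow> g \<in> A2 \<Longrightarrow> (\<lambda>z. f z - g z) \<in> A2"
  by (auto simp: A2_def intro: L2_diff holomorphic_intros)

lemma A2_zero: "(\<lambda>_. 0) \<in> A2"
  by (auto simp: A2_def intro: L2_zero holomorphic_intros)

lemma ip_cong_disk:
  assumes "\<And>z. z \<in> \<D> \<Longrightarrow> f z = f' z" "\<And>z. z \<in> \<D> \<Longrightarrow> g z = g' z"
  shows "ip N f g = ip N f' g'"
  unfolding ip_def by (rule lint_cong) (use assms in auto)

lemma A2_cong:
  assumes "f \<in> A2" "\<And>z. z \<in> \<D> \<Longrightarrow> f z = f' z" shows "f' \<in> A2"
proof -
  have h: "f' holomorphic_on \<D>" using A2D(2)[OF assms(1)] assms(2) holomorphic_cong[OF refl] by metis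
  have "f' \<in> borel_measurable N" using holomorphic_meas[OF h] by (simp add: N_measurable)
  from L2_cong_AE[OF A2D(1)[OF assms(1)] this AE_I2] assms(2) h show ?thesis by (simp add: A2_def)
qed

text \<open>The usual argument: a vector with value 1 is projected onto the null space of the
  functional, and the remainder is rescaled. The delicate point is that the remainder
  \<open>v\<close> must again lie in \<open>A2\<close>: as an L^2 limit of members of
  \<open>A2\<close> it is orthogonal to the range of \<open>TT\<close>, hence has a holomorphic
  representative by \<open>Weyl\<close>.\<close>

lemma A2_Riesz:
  assumes add: "\<And>f h. f \<in> A2 \<Longrightarrow> h \<in> A2 \<Longrightarrow> \<Lambda> (\<lambda>z. f z + h z) = \<Lambda> f + \<Lambda> h"
    and cmult: "\<And>c f. f \<in> A2 \<Longrightarrow> \<Lambda> (\<lambda>z. c * f z) = c * \<Lambda> f"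
    and bound: "\<And>f. f \<in> A2 \<Longrightarrow> cmod (\<Lambda> f) \<le> C * n2 N f"
  obtains g where "g \<in> A2" "\<And>f. f \<in> A2 \<Longrightarrow> \<Lambda> f = ip N f g"
proof (cases "\<forall>f\<in>A2. \<Lambda> f = 0")
  case True
  thus ?thesis using that[OF A2_zero] by (simp add: ip_def)
next
  case False
  have dif: "\<Lambda> (\<lambda>z. f z - h z) = \<Lambda> f - \<Lambda> h" if "f \<in> A2" "h \<in> A2" for f h
    using add[OF that(1) A2_cmult[OF that(2)], of "-1"] cmult[OF that(2), of "-1"] by simp
  obtain f0 where f0: "f0 \<in> A2" "\<Lambda> f0 \<noteq> 0" using False by blast
  define f1 where "f1 z = (1 / \<Lambda> f0) * f0 z" for z
  have f1: "f1 \<in> A2" unfolding f1_def[abs_def] by (rule A2_cmult[OF f0(1)])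
  have L1: "\<Lambda> f1 = 1" unfolding f1_def[abs_def] cmult[OF f0(1)] using f0(2) by simp
  define S where "S = {f \<in> A2. \<Lambda> f = 0}"
  have z0: "\<Lambda> (\<lambda>_. 0) = 0" using cmult[OF f1, of 0] by simp
  have S: "S \<subseteq> L2 N" "(\<lambda>_. 0) \<in> S" "\<And>f g. f \<in> S \<Longrightarrow> g \<in> S \<Longrightarrow> (\<lambda>x. f x + g x) \<in> S" "\<And>c f. f \<in> S \<Longrightarrow> (\<lambda>x. c * f x) \<in> S"
    using A2_zero z0 A2_add A2_cmult add cmult A2D(1) by (auto simp: S_def)
  obtain s v where s: "\<And>n. s n \<in> S" and v: "v \<in> L2 N" "\<And>h. h \<in> S \<Longrightarrow> ip N v h = 0"
    and lim: "(\<lambda>n::nat. n2 N (\<lambda>x. s n x - (f1 x - v x))) \<longlonglongrightarrow> 0"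
    using L2_projection[OF S A2D(1)[OF f1]] by blast
  have sA: "s n \<in> A2" "\<Lambda> (s n) = 0" for n using s[of n] by (auto simp: S_def)
  have dL: "(\<lambda>x. f1 x - s n x) \<in> A2" for n by (rule A2_diff[OF f1 sA(1)])
  have lim': "(\<lambda>n. n2 N (\<lambda>x. (f1 x - s n x) - v x)) \<longlonglongrightarrow> 0"
  proof -
    have "(\<lambda>x. (f1 x - s n x) - v x) = (\<lambda>x. - (s n x - (f1 x - v x)))" for n by auto
    thus ?thesis using lim by (simp only: n2_minus)
  qed
  have vo: "ip N v (TT gx gy) = 0" if t: "testf r g gx gy" for r g gx gy
  proof -
    have "(\<lambda>n. ip N (\<lambda>x. f1 x - s n x) (TT gx gy)) \<longlonglongrightarrow> ip N v (TT gx gy)"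
      by (rule ip_tendsto_left[OF A2D(1)[OF dL] v(1) TT_L2[OF t] lim'])
    moreover have "ip N (\<lambda>x. f1 x - s n x) (TT gx gy) = 0" for n by (rule A2_orth[OF dL t])
    ultimately show ?thesis by (simp add: LIMSEQ_const_iff)
  qed
  obtain V where V: "V holomorphic_on \<D>" "AE z in \<mu>. v z = V z" by (rule Weyl[OF v(1) vo])
  have Vm: "V \<in> borel_measurable N" using holomorphic_meas[OF V(1)] by (simp add: N_measurable)
  have ae: "AE z in N. v z = V z" using V(2) by (simp add: AE_N)
  have VA: "V \<in> A2" using L2_cong_AE[OF v(1) Vm ae] V(1) by (simp add: A2_def)
  have "(\<lambda>n. C * n2 N (\<lambda>x. (f1 x - s n x) - V x)) \<longlonglongrightarrow> C * 0"
  proof (intro tendsto_intros)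
    have "n2 N (\<lambda>x. (f1 x - s n x) - V x) = n2 N (\<lambda>x. (f1 x - s n x) - v x)" for n
    proof (rule n2_cong_AE)
      show "(\<lambda>x. f1 x - s n x - V x) \<in> borel_measurable N" "(\<lambda>x. f1 x - s n x - v x) \<in> borel_measurable N"
        using A2D(1)[OF dL[of n]] Vm v(1) by (auto simp: L2_def)
      show "AE x in N. f1 x - s n x - V x = f1 x - s n x - v x" using ae by eventually_elim simp
    qed
    thus "(\<lambda>n. n2 N (\<lambda>x. (f1 x - s n x) - V x)) \<longlonglongrightarrow> 0" using lim' by simp
  qed
  moreover have "cmod (1 - \<Lambda> V) \<le> C * n2 N (\<lambda>x. (f1 x - s n x) - V x)" for n
    using bound[OF A2_diff[OF dL VA], of n] dif[OF dL VA, of n] dif[OF f1 sA(1), of n] L1 sA(2)[of n] by simp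
  ultimately have "cmod (1 - \<Lambda> V) \<le> C * 0" using LIMSEQ_le_const by blast
  hence V1: "\<Lambda> V = 1" by simp
  have n0: "n2 N V \<noteq> 0" using bound[OF VA] V1 by auto
  have VS: "ip N h V = 0" if "h \<in> S" for h
  proof -
    have "ip N V h = ip N v h"
      unfolding ip_def
    proof (rule integral_cong_AE)
      show "(\<lambda>x. V x * cnj (h x)) \<in> borel_measurable N" "(\<lambda>x. v x * cnj (h x)) \<in> borel_measurable N"
        using that S(1) v(1) Vm by (auto simp: L2_def intro!: borel_measurable_times borel_measurable_cnj')
      show "AE x in N. V x * cnj (h x) = v x * cnj (h x)" using ae by eventually_elim simp
    qed
    thus ?thesis using v(2)[OF that] ip_commute[of N h V] by simp
  qed
  show ?thesis
  proof (rule that)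
    show "(\<lambda>z. of_real (1 / (n2 N V)\<^sup>2) * V z) \<in> A2" by (rule A2_cmult[OF VA])
    fix f assume f: "f \<in> A2"
    have "\<Lambda> (\<lambda>z. f z - \<Lambda> f * V z) = 0"
      using dif[OF f A2_cmult[OF VA]] cmult[OF VA] V1 by simp
    hence "(\<lambda>z. f z - \<Lambda> f * V z) \<in> S" using A2_diff[OF f A2_cmult[OF VA]] by (simp add: S_def)
    hence "ip N (\<lambda>z. f z - \<Lambda> f * V z) V = 0" by (rule VS)
    hence "ip N f V - \<Lambda> f * ip N V V = 0"
      unfolding ip_diff_left[OF A2D(1)[OF f] A2D(1)[OF A2_cmult[OF VA]] A2D(1)[OF VA]] ip_cmult_left .
    hence "ip N f V = \<Lambda> f * of_real ((n2 N V)\<^sup>2)" unfolding ip_self by simp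
    thus "\<Lambda> f = ip N f (\<lambda>z. of_real (1 / (n2 N V)\<^sup>2) * V z)"
      using n0 unfolding ip_cmult_right by simp
  qed
qed

end

lemma smooth2_compose:
  fixes u :: "complex \<Rightarrow> real"
  assumes s: "smooth2 S u ux uy uxy"
    and k: "\<And>z. z \<in> S \<Longrightarrow> (k has_real_derivative k' (u z)) (at (u z))"
    and k': "\<And>z. z \<in> S \<Longrightarrow> (k' has_real_derivative k'' (u z)) (at (u z))"
    and c: "continuous_on (u ` S) k''"
  shows "smooth2 S (\<lambda>z. k (u z)) (\<lambda>z. k' (u z) * ux z) (\<lambda>z. k' (u z) * uy z) (\<lambda>z. k' (u z) * uxy z + (k'' (u z) * uy z) * ux z)"
proof -
  note D = smooth2D[OF s]
  have c': "continuous_on (u ` S) k'" using k' by (intro continuous_at_imp_continuous_on) (auto intro: DERIV_isCont)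
  note p = pd_compose[OF _ k c'] and p' = pd_compose[OF _ k' c]
  have 1: "pd \<i> S (\<lambda>z. k' (u z) * ux z) (\<lambda>z. k' (u z) * uxy z + (k'' (u z) * uy z) * ux z)"
    by (rule pd_mult[OF p'[OF D(2)] D(3)])
  have 2: "pd 1 S (\<lambda>z. k' (u z) * uy z) (\<lambda>z. k' (u z) * uxy z + (k'' (u z) * ux z) * uy z)"
    by (rule pd_mult[OF p'[OF D(1)] D(4)])
  show ?thesis unfolding smooth2_def using 1 2 p[OF D(1)] p[OF D(2)] by (simp add: mult_ac)
qed

lemma smooth2_dist2:
  "smooth2 S (\<lambda>z. (cmod (z - w))\<^sup>2) (\<lambda>z. 2 * Re (z - w)) (\<lambda>z. 2 * Im (z - w)) (\<lambda>_. 0)"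
proof -
  have "pd \<i> S (\<lambda>z. 2 * Re (z - w)) (\<lambda>z. 2 * Re \<i> + 0 * Re (z - w))"
    by (rule pd_mult[OF pd_const pd_Re_diff])
  moreover have "pd 1 S (\<lambda>z. 2 * Im (z - w)) (\<lambda>z. 2 * Im 1 + 0 * Im (z - w))"
    by (rule pd_mult[OF pd_const pd_Im_diff])
  ultimately show ?thesis unfolding smooth2_def using pd_dist2[of 1 S w] pd_dist2[of "\<i>" S w] by simp
qed

text \<open>The last assumption makes \<open>sig w\<close> below an admissible weight \<open>\<rho>\<close> for every \<open>w\<close>; it is what class \<open>\<E>\<close> provides.\<close>

locale regular_weight = disk_weight +
  fixes \<tau> :: "complex \<Rightarrow> real" and \<delta> K L :: real
  assumes tau_pos: "z \<in> \<D> \<Longrightarrow> \<tau> z > 0"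
    and tau_cont: "continuous_on \<D> \<tau>"
    and delta: "0 < \<delta>" "\<delta> \<le> 1"
    and tau_disk: "z \<in> \<D> \<Longrightarrow> cmod z + 2 * \<delta> * \<tau> z < 1"
    and tau_ball: "z \<in> \<D> \<Longrightarrow> \<xi> \<in> \<D> \<Longrightarrow> cmod (\<xi> - z) \<le> \<delta> * \<tau> z \<Longrightarrow> \<tau> z \<le> 2 * \<tau> \<xi> \<and> \<tau> \<xi> \<le> 2 * \<tau> z"
    and K1: "1 \<le> K"
    and lap_le: "z \<in> \<D> \<Longrightarrow> lap z \<le> K / (\<tau> z)\<^sup>2"
    and lap_ge: "z \<in> \<D> \<Longrightarrow> 1 / (K * (\<tau> z)\<^sup>2) \<le> lap z"
    and L1: "1 \<le> L"
    and tau_slow: "z \<in> \<D> \<Longrightarrow> w \<in> \<D> \<Longrightarrow> 64 * K * (\<tau> z)\<^sup>2 \<le> L\<^sup>2 * (\<tau> w)\<^sup>2 + (cmod (z - w))\<^sup>2"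
begin

definition C1 :: real where "C1 = 8 / \<delta>\<^sup>2 * exp K"

lemma C1_pos: "C1 > 0" using delta by (simp add: C1_def)

lemma tball_sub: "z \<in> \<D> \<Longrightarrow> cball z (\<delta> * \<tau> z) \<subseteq> \<D>" "z \<in> \<D> \<Longrightarrow> ball z (2 * \<delta> * \<tau> z) \<subseteq> \<D>"
  "z \<in> \<D> \<Longrightarrow> cball z (\<delta> * \<tau> z) \<subseteq> ball z (2 * \<delta> * \<tau> z)"
proof -
  assume z: "z \<in> \<D>"
  show b: "ball z (2 * \<delta> * \<tau> z) \<subseteq> \<D>"
  proof
    fix x assume "x \<in> ball z (2 * \<delta> * \<tau> z)"
    hence "cmod (x - z) < 2 * \<delta> * \<tau> z" by (simp add: dist_norm norm_minus_commute)
    thus "x \<in> \<D>" using tau_disk[OF z] norm_triangle_sub[of x z] by simp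
  qed
  show c: "cball z (\<delta> * \<tau> z) \<subseteq> ball z (2 * \<delta> * \<tau> z)"
    using tau_pos[OF z] delta by (intro cball_subset_ball_iff[THEN iffD2]) simp
  show "cball z (\<delta> * \<tau> z) \<subseteq> \<D>" using b c by blast
qed

text \<open>On the disc of radius \<open>\<delta> * \<tau> z\<close> the function
  \<open>\<tau>\<close> changes at most by a factor 2, so the Laplacian is at most
  \<open>4 * K / (\<tau> z)^2\<close>. With \<open>A = K / (\<tau> z)^2\<close> the exponent in
  \<open>submean_weight\<close> is at most \<open>K\<close>, which explains
  \<open>C1\<close>.\<close>

theorem submean_L1:
  assumes f: "f holomorphic_on \<D>" and z: "z \<in> \<D>"
  shows "cmod (f z) * sqrt (\<omega> z) \<le> C1 / (\<tau> z)\<^sup>2 * (\<integral>x. indicator (cball z (\<delta> * \<tau> z)) x * (cmod (f x) * sqrt (\<omega> x)) \<partial>\<mu>)"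
proof -
  have t: "\<tau> z > 0" by (rule tau_pos[OF z])
  define A where "A = K / (\<tau> z)\<^sup>2"
  have A: "A \<ge> 0" using K1 by (simp add: A_def)
  let ?I = "\<integral>x. indicator (cball z (\<delta> * \<tau> z)) x * (cmod (f x) * sqrt (\<omega> x)) \<partial>\<mu>"
  have I: "?I \<ge> 0"
    by (rule integral_nonneg_AE, rule AE_I2) (auto simp: omega_pos less_imp_le)
  have "cmod (f z) * sqrt (\<omega> z) \<le> 8 / (\<delta> * \<tau> z)\<^sup>2 * exp (A * (\<delta> * \<tau> z)\<^sup>2) * ?I"
  proof (rule submean_weight[OF f _ _ A])
    show "0 < \<delta> * \<tau> z" using t delta by simp
    show "cmod z + \<delta> * \<tau> z < 1" using tau_disk[OF z] mult_pos_pos[OF delta(1) t] unfolding mult.assoc by linarith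
    fix x assume x: "x \<in> cball z (\<delta> * \<tau> z)"
    hence xD: "x \<in> \<D>" using tball_sub(1)[OF z] by blast
    have "\<tau> z \<le> 2 * \<tau> x" using tau_ball[OF z xD] x by (simp add: dist_norm norm_minus_commute)
    hence "(\<tau> z)\<^sup>2 \<le> (2 * \<tau> x)\<^sup>2" using t by (intro power_mono) auto
    hence "4 * K / (2 * \<tau> x)\<^sup>2 \<le> 4 * K / (\<tau> z)\<^sup>2" using t tau_pos[OF xD] K1
      by (intro divide_left_mono mult_pos_pos) auto
    hence "K / (\<tau> x)\<^sup>2 \<le> 4 * K / (\<tau> z)\<^sup>2" by (simp add: power_mult_distrib)
    thus "lap x \<le> 4 * A" using lap_le[OF xD] by (simp add: A_def)
  qed
  also have "A * (\<delta> * \<tau> z)\<^sup>2 = K * \<delta>\<^sup>2" using t by (simp add: A_def power_mult_distrib)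
  also have "8 / (\<delta> * \<tau> z)\<^sup>2 * exp (K * \<delta>\<^sup>2) * ?I \<le> 8 / (\<delta> * \<tau> z)\<^sup>2 * exp K * ?I"
  proof (intro mult_right_mono mult_left_mono I)
    have "\<delta>\<^sup>2 \<le> 1" using delta by (intro power_le_one) auto
    thus "exp (K * \<delta>\<^sup>2) \<le> exp K" using K1 by (simp add: mult_left_le)
  qed simp
  also have "\<dots> = C1 / (\<tau> z)\<^sup>2 * ?I" by (simp add: C1_def power_mult_distrib)
  finally show ?thesis .
qed

lemma cball_sets: "z \<in> \<D> \<Longrightarrow> cball z (\<delta> * \<tau> z) \<in> sets \<mu>"
  using closed_disk_sets[OF closed_cball, of z "\<delta> * \<tau> z"] tball_sub(1)[of z] by (simp add: Int_absorb2)

text \<open>Comparison with the open ball of twice the radius, which still lies in the disk, costs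
  the factor 4.\<close>

lemma measure_tball:
  assumes z: "z \<in> \<D>" shows "measure \<mu> (cball z (\<delta> * \<tau> z)) \<le> 4 * (\<tau> z)\<^sup>2"
proof -
  have t: "\<tau> z > 0" by (rule tau_pos[OF z])
  have s: "ball z (2 * \<delta> * \<tau> z) \<in> sets \<mu>" using tball_sub(2)[OF z] by (auto simp: sets_disk sets_restrict_space_iff)
  have "measure \<mu> (cball z (\<delta> * \<tau> z)) \<le> measure \<mu> (ball z (2 * \<delta> * \<tau> z))"
    by (rule finite_measure.finite_measure_mono[OF finite_measure_disk tball_sub(3)[OF z] s])
  also have "\<dots> = (2 * \<delta> * \<tau> z)\<^sup>2"
    using emeasure_disk_ball[OF tball_sub(2)[OF z]] t delta by (simp add: measure_def)
  also have "\<dots> \<le> (2 * \<tau> z)\<^sup>2"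
    using t delta by (intro power_mono) (auto simp: mult_left_le mult.assoc mult_left_le_one_le)
  finally show ?thesis by (simp add: power_mult_distrib)
qed

text \<open>Cauchy-Schwarz applied to \<open>submean_L1\<close>; the area of the disc cancels one of
  the two factors \<open>1 / (\<tau> z)^2\<close>.\<close>

theorem submean_L2:
  assumes f: "f \<in> A2" and z: "z \<in> \<D>"
  shows "(cmod (f z))\<^sup>2 * \<omega> z \<le> 4 * C1\<^sup>2 / (\<tau> z)\<^sup>2 * (\<integral>x. indicator (cball z (\<delta> * \<tau> z)) x * (\<omega> x * (cmod (f x))\<^sup>2) \<partial>\<mu>)"
proof -
  let ?B = "cball z (\<delta> * \<tau> z)"
  have t: "\<tau> z > 0" by (rule tau_pos[OF z])
  define h where "h x = complex_of_real (indicator ?B x * (cmod (f x) * sqrt (\<omega> x)))" for x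
  define k where "k x = complex_of_real (indicator ?B x)" for x
  have [measurable]: "(indicator ?B :: complex \<Rightarrow> real) \<in> borel_measurable \<mu>"
    using cball_sets[OF z] by simp
  have [measurable]: "f \<in> borel_measurable \<mu>" by (rule A2_meas[OF f])
  have hm: "h \<in> borel_measurable \<mu>" and km: "k \<in> borel_measurable \<mu>"
    unfolding h_def k_def by measurable
  have hsq: "(cmod (h x))\<^sup>2 = indicator ?B x * (\<omega> x * (cmod (f x))\<^sup>2)" if "x \<in> \<D>" for x
    using omega_pos[OF that] unfolding h_def norm_of_real by (auto simp: power_mult_distrib indicator_def)
  have "integrable \<mu> (\<lambda>x. (cmod (h x))\<^sup>2)"
  proof (rule integrable_dominated)
    show "integrable \<mu> (\<lambda>x. \<omega> x * (cmod (f x))\<^sup>2)" using A2D(1)[OF f] by (simp add: L2_N_iff)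
    show "AE x in \<mu>. norm ((cmod (h x))\<^sup>2) \<le> norm (\<omega> x * (cmod (f x))\<^sup>2)"
      by (rule AE_I2) (simp add: hsq, simp add: indicator_def)
  qed (use hm in measurable)
  hence hL: "h \<in> L2 \<mu>" using hm by (simp add: L2_def)
  have "integrable \<mu> (\<lambda>x. (cmod (k x))\<^sup>2)"
    by (rule integrable_disk_bounded[where B=1]) (use km in \<open>auto simp: k_def indicator_def\<close>)
  hence kL: "k \<in> L2 \<mu>" using km by (simp add: L2_def)
  have hn: "(n2 \<mu> h)\<^sup>2 = (\<integral>x. indicator ?B x * (\<omega> x * (cmod (f x))\<^sup>2) \<partial>\<mu>)" (is "_ = ?J")
    unfolding n2_sq by (rule lint_cong) (auto simp: hsq)
  have "(n2 \<mu> k)\<^sup>2 = (\<integral>x. indicator ?B x \<partial>\<mu>)"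
    unfolding n2_sq k_def by (rule lint_cong) (auto simp: indicator_def)
  also have "\<dots> = measure \<mu> ?B" using tball_sub(1)[OF z] by (simp add: Int_absorb2)
  also have "\<dots> \<le> 4 * (\<tau> z)\<^sup>2" by (rule measure_tball[OF z])
  finally have kn: "(n2 \<mu> k)\<^sup>2 \<le> 4 * (\<tau> z)\<^sup>2" .
  let ?I = "\<integral>x. indicator ?B x * (cmod (f x) * sqrt (\<omega> x)) \<partial>\<mu>"
  have I0: "?I \<ge> 0" by (rule integral_nonneg_AE, rule AE_I2) (auto simp: omega_pos less_imp_le)
  have "ip \<mu> h k = (\<integral>x. complex_of_real (indicator ?B x * (cmod (f x) * sqrt (\<omega> x))) \<partial>\<mu>)"
    unfolding ip_def h_def k_def by (rule lint_cong) (auto simp: indicator_def)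
  also have "\<dots> = of_real ?I" by (rule integral_complex_of_real)
  finally have "?I \<le> n2 \<mu> h * n2 \<mu> k" using ip_Cauchy_Schwarz[OF hL kL] I0 by simp
  hence "?I\<^sup>2 \<le> (n2 \<mu> h * n2 \<mu> k)\<^sup>2" using I0 by (rule power_mono)
  also have "\<dots> \<le> ?J * (4 * (\<tau> z)\<^sup>2)" unfolding power_mult_distrib hn
    by (rule mult_left_mono[OF kn]) (simp add: hn[symmetric])
  finally have I2: "?I\<^sup>2 \<le> ?J * (4 * (\<tau> z)\<^sup>2)" .
  have "(cmod (f z) * sqrt (\<omega> z))\<^sup>2 \<le> (C1 / (\<tau> z)\<^sup>2 * ?I)\<^sup>2"
    by (rule power_mono[OF submean_L1[OF A2D(2)[OF f] z]]) (simp add: omega_pos[OF z] less_imp_le)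
  also have "\<dots> = (C1 / (\<tau> z)\<^sup>2)\<^sup>2 * ?I\<^sup>2" by (rule power_mult_distrib)
  also have "\<dots> \<le> (C1 / (\<tau> z)\<^sup>2)\<^sup>2 * (?J * (4 * (\<tau> z)\<^sup>2))" by (rule mult_left_mono[OF I2]) simp
  also have "\<dots> = 4 * C1\<^sup>2 / (\<tau> z)\<^sup>2 * ?J" using t by (simp add: power_divide power2_eq_square[of "(\<tau> z)\<^sup>2"] divide_simps)
  finally show ?thesis using omega_pos[OF z] by (simp add: power_mult_distrib)
qed

section \<open>The reproducing kernel and its decay\<close>

definition ev :: "complex \<Rightarrow> real" where "ev z = 2 * C1 / (\<tau> z * sqrt (\<omega> z))"

lemma ev_cont: "continuous_on \<D> ev"
  unfolding ev_def
proof (intro continuous_on_divide continuous_on_mult continuous_on_const tau_cont continuous_on_real_sqrt cont_omega ballI)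
  fix z assume "z \<in> \<D>"
  hence "\<tau> z > 0" "\<omega> z > 0" using tau_pos omega_pos by blast+
  thus "\<tau> z * sqrt (\<omega> z) \<noteq> 0" by simp
qed

lemma ev_nonneg: "z \<in> \<D> \<Longrightarrow> ev z \<ge> 0"
  unfolding ev_def by (intro divide_nonneg_pos mult_nonneg_nonneg mult_pos_pos tau_pos)
    (use C1_pos omega_pos[of z] in \<open>simp_all add: less_imp_le\<close>)

lemma evaluation_bound:
  assumes f: "f \<in> A2" and z: "z \<in> \<D>"
  shows "cmod (f z) \<le> ev z * n2 N f"
proof -
  have t: "\<tau> z > 0" "\<omega> z > 0" by (rule tau_pos[OF z], rule omega_pos[OF z])
  let ?B = "cball z (\<delta> * \<tau> z)"
  have i: "integrable \<mu> (\<lambda>x. \<omega> x * (cmod (f x))\<^sup>2)" using A2D(1)[OF f] by (simp add: L2_N_iff)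
  have "(\<integral>x. indicator ?B x * (\<omega> x * (cmod (f x))\<^sup>2) \<partial>\<mu>) \<le> (\<integral>x. \<omega> x * (cmod (f x))\<^sup>2 \<partial>\<mu>)"
    using integrable_mult_indicator[OF cball_sets[OF z] i]
    by (intro integral_mono[OF _ i]) (auto simp: indicator_def omega_pos less_imp_le)
  hence le: "(\<integral>x. indicator ?B x * (\<omega> x * (cmod (f x))\<^sup>2) \<partial>\<mu>) \<le> (n2 N f)\<^sup>2"
    using n2_N[OF A2_meas[OF f]] by simp
  have "(cmod (f z))\<^sup>2 * \<omega> z \<le> 4 * C1\<^sup>2 / (\<tau> z)\<^sup>2 * (n2 N f)\<^sup>2"
    by (rule order_trans[OF submean_L2[OF f z]], rule mult_left_mono[OF le]) simp
  hence "(cmod (f z))\<^sup>2 \<le> 4 * C1\<^sup>2 / (\<tau> z)\<^sup>2 * (n2 N f)\<^sup>2 / \<omega> z"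
    using t by (simp only: pos_le_divide_eq)
  also have "\<dots> = (ev z * n2 N f)\<^sup>2" using t by (simp add: ev_def power_mult_distrib power_divide)
  finally show ?thesis by (rule power2_le_imp_le) (use ev_nonneg[OF z] in simp)
qed

lemma kernel_exists:
  assumes z: "z \<in> \<D>"
  shows "\<exists>k. k \<in> A2 \<and> (\<forall>x. x \<notin> \<D> \<longrightarrow> k x = 0) \<and> (\<forall>f\<in>A2. f z = ip N f k)"
proof -
  have "\<exists>g. g \<in> A2 \<and> (\<forall>f\<in>A2. f z = ip N f g)"
  proof (rule A2_Riesz[where \<Lambda>="\<lambda>f. f z" and C="ev z", OF refl refl evaluation_bound[OF _ z]])
    fix g assume "g \<in> A2" "\<And>f. f \<in> A2 \<Longrightarrow> f z = ip N f g"
    thus ?thesis by (intro exI[of _ g] conjI ballI)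
  qed
  then obtain g where g: "g \<in> A2" "\<forall>f\<in>A2. f z = ip N f g" by (elim exE conjE)
  define k where "k x = (if x \<in> \<D> then g x else 0)" for x
  have kA: "k \<in> A2" by (rule A2_cong[OF g(1)]) (simp add: k_def)
  have kg: "ip N f k = ip N f g" for f by (rule ip_cong_disk) (auto simp: k_def)
  from kA
  moreover have "k x = 0" if "x \<notin> \<D>" for x using that by (simp add: k_def)
  moreover have "f z = ip N f k" if "f \<in> A2" for f
    by (rule trans[OF bspec[OF g(2) that]]) (rule kg[symmetric])
  ultimately show ?thesis by (intro exI[of _ k] conjI allI impI ballI)
qed

text \<open>\<open>ker z\<close> is the function K_z, holomorphic in the second argument.
  Prescribing zero off the disk fixes the values that \<open>A2\<close> leaves free.\<close>

definition ker :: "complex \<Rightarrow> complex \<Rightarrow> complex" where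
  "ker z = (SOME k. k \<in> A2 \<and> (\<forall>x. x \<notin> \<D> \<longrightarrow> k x = 0) \<and> (\<forall>f\<in>A2. f z = ip N f k))"

lemma ker:
  assumes "z \<in> \<D>"
  shows "ker z \<in> A2" "x \<notin> \<D> \<Longrightarrow> ker z x = 0" "f \<in> A2 \<Longrightarrow> f z = ip N f (ker z)"
proof -
  have *: "ker z \<in> A2 \<and> (\<forall>x. x \<notin> \<D> \<longrightarrow> ker z x = 0) \<and> (\<forall>f\<in>A2. f z = ip N f (ker z))"
    unfolding ker_def by (rule someI_ex[OF kernel_exists[OF assms]])
  show "ker z \<in> A2" using * by simp
  show "ker z x = 0" if "x \<notin> \<D>" using * that by simp
  show "f z = ip N f (ker z)" if "f \<in> A2" by (rule bspec[OF conjunct2[OF conjunct2[OF *]] that])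
qed

lemma ker_sym:
  assumes z: "z \<in> \<D>" and w: "w \<in> \<D>" shows "ker z w = cnj (ker w z)"
proof -
  have "ker z w = ip N (ker z) (ker w)" by (rule ker(3)[OF w ker(1)[OF z]])
  also have "\<dots> = cnj (ip N (ker w) (ker z))" by (rule ip_commute)
  also have "ip N (ker w) (ker z) = ker w z" by (rule ker(3)[OF z ker(1)[OF w], symmetric])
  finally show ?thesis .
qed

text \<open>\<open>ker z z\<close> is the square of the norm of \<open>ker z\<close>, so the
  evaluation bound for \<open>ker z\<close> at \<open>z\<close> can be divided by that norm.\<close>

lemma ker_norm:
  assumes z: "z \<in> \<D>" shows "n2 N (ker z) \<le> ev z"
proof -
  have "ker z z = complex_of_real ((n2 N (ker z))\<^sup>2)" by (rule trans[OF ker(3)[OF z ker(1)[OF z]] ip_self])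
  hence "cmod (ker z z) = cmod (complex_of_real ((n2 N (ker z))\<^sup>2))" by (rule arg_cong)
  also have "\<dots> = (n2 N (ker z))\<^sup>2" unfolding norm_of_real by simp
  finally have "(n2 N (ker z))\<^sup>2 = cmod (ker z z)" by simp
  also have "\<dots> \<le> ev z * n2 N (ker z)" by (rule evaluation_bound[OF ker(1)[OF z] z])
  finally have "n2 N (ker z) * n2 N (ker z) \<le> ev z * n2 N (ker z)" by (simp add: power2_eq_square)
  moreover have "n2 N (ker z) = 0 \<or> n2 N (ker z) > 0" using n2_nonneg[of N "ker z"] by linarith
  ultimately show ?thesis using ev_nonneg[OF z] by (auto simp: mult_le_cancel_right)
qed

definition sig :: "complex \<Rightarrow> complex \<Rightarrow> real" where
  "sig w z = 1 / (L\<^sup>2 * (\<tau> w)\<^sup>2 + (cmod (z - w))\<^sup>2)"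

lemma sig_den: "w \<in> \<D> \<Longrightarrow> L\<^sup>2 * (\<tau> w)\<^sup>2 > 0" "w \<in> \<D> \<Longrightarrow> L\<^sup>2 * (\<tau> w)\<^sup>2 + (cmod (z - w))\<^sup>2 > 0"
proof -
  assume w: "w \<in> \<D>"
  show "L\<^sup>2 * (\<tau> w)\<^sup>2 > 0" using tau_pos[OF w] L1 by simp
  thus "L\<^sup>2 * (\<tau> w)\<^sup>2 + (cmod (z - w))\<^sup>2 > 0" by (simp add: add_pos_nonneg)
qed

text \<open>With \<open>D = 1 / sig w z\<close> the squared gradient is
  \<open>4 * |z - w|^2 / D^4\<close>, at most \<open>4 / D^3\<close>. So slowness reduces to
  \<open>64 / D <= lap z\<close>, which is \<open>tau_slow\<close> combined with
  \<open>lap_ge\<close>; this is the origin of the number 64.\<close>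

lemma sig_slow:
  assumes w: "w \<in> \<D>"
  shows "\<exists>sx sy sxy. slow_weight \<omega> \<phi> px py pxx pyy (sig w) sx sy sxy (1 / (L\<^sup>2 * (\<tau> w)\<^sup>2))"
proof -
  define e where "e = L\<^sup>2 * (\<tau> w)\<^sup>2"
  have e: "e > 0" using sig_den(1)[OF w] by (simp add: e_def)
  define k1 where "k1 s = - (inverse (e + s))\<^sup>2" for s
  define k2 where "k2 s = 2 * (inverse (e + s)) ^ 3" for s
  have d0: "((\<lambda>s. e + s) has_real_derivative 1) (at s)" for s by (auto intro!: derivative_eq_intros)
  have d1: "((\<lambda>s. inverse (e + s)) has_real_derivative k1 s) (at s)" if "s \<ge> 0" for s
    using DERIV_inverse'[OF d0, of s] e that by (simp add: k1_def power2_eq_square)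
  have d2: "(k1 has_real_derivative k2 s) (at s)" if "s \<ge> 0" for s
    using DERIV_minus[OF DERIV_power[OF d1[OF that], of 2]] unfolding k1_def[abs_def] k2_def
    by (simp add: power2_eq_square power3_eq_cube)
  have c: "continuous_on {0..} k2" unfolding k2_def using e by (intro continuous_intros) auto
  have s: "smooth2 \<D> (\<lambda>z. inverse (e + (cmod (z - w))\<^sup>2)) (\<lambda>z. k1 ((cmod (z - w))\<^sup>2) * (2 * Re (z - w))) (\<lambda>z. k1 ((cmod (z - w))\<^sup>2) * (2 * Im (z - w)))
     (\<lambda>z. k1 ((cmod (z - w))\<^sup>2) * 0 + (k2 ((cmod (z - w))\<^sup>2) * (2 * Im (z - w))) * (2 * Re (z - w)))"
    by (rule smooth2_compose[OF smooth2_dist2]) (auto intro: d1 d2 continuous_on_subset[OF c])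
  have sig: "sig w = (\<lambda>z. inverse (e + (cmod (z - w))\<^sup>2))" by (auto simp: sig_def e_def inverse_eq_divide)
  have "slow_weight \<omega> \<phi> px py pxx pyy (sig w) (\<lambda>z. k1 ((cmod (z - w))\<^sup>2) * (2 * Re (z - w))) (\<lambda>z. k1 ((cmod (z - w))\<^sup>2) * (2 * Im (z - w)))
     (\<lambda>z. k1 ((cmod (z - w))\<^sup>2) * 0 + (k2 ((cmod (z - w))\<^sup>2) * (2 * Im (z - w))) * (2 * Re (z - w))) (1 / (L\<^sup>2 * (\<tau> w)\<^sup>2))"
  proof (unfold_locales)
    show "smooth2 \<D> (sig w) (\<lambda>z. k1 ((cmod (z - w))\<^sup>2) * (2 * Re (z - w))) (\<lambda>z. k1 ((cmod (z - w))\<^sup>2) * (2 * Im (z - w)))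
     (\<lambda>z. k1 ((cmod (z - w))\<^sup>2) * 0 + (k2 ((cmod (z - w))\<^sup>2) * (2 * Im (z - w))) * (2 * Re (z - w)))"
      unfolding sig by (rule s)
    fix z assume z: "z \<in> \<D>"
    define D where "D = e + (cmod (z - w))\<^sup>2"
    have D: "D > 0" "(cmod (z - w))\<^sup>2 \<le> D" "e \<le> D" using e by (auto simp: D_def add_pos_nonneg)
    have sD: "sig w z = inverse D" by (simp add: sig D_def)
    show "0 < sig w z" using D by (simp add: sD)
    show "sig w z \<le> 1 / (L\<^sup>2 * (\<tau> w)\<^sup>2)" unfolding sD e_def[symmetric] inverse_eq_divide using D e by (intro divide_left_mono) auto
    have k: "k1 ((cmod (z - w))\<^sup>2) = - (inverse D)\<^sup>2" by (simp add: k1_def D_def)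
    have "16 * ((k1 ((cmod (z - w))\<^sup>2) * (2 * Re (z - w)))\<^sup>2 + (k1 ((cmod (z - w))\<^sup>2) * (2 * Im (z - w)))\<^sup>2) = 64 * (cmod (z - w))\<^sup>2 * ((inverse D)\<^sup>2)\<^sup>2"
    proof -
      have eq: "16 * ((k * (2 * a))\<^sup>2 + (k * (2 * b))\<^sup>2) = 64 * (a\<^sup>2 + b\<^sup>2) * k\<^sup>2" for k a b :: real
        by (simp add: power2_eq_square algebra_simps)
      show ?thesis unfolding eq k cmod_power2[symmetric] by simp
    qed
    also have "\<dots> \<le> 64 * D * ((inverse D)\<^sup>2)\<^sup>2" using D by (intro mult_right_mono) auto
    also have "\<dots> = (64 / D) * (inverse D)\<^sup>2" using D by (simp add: power2_eq_square field_simps)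
    also have "\<dots> \<le> lap z * (inverse D)\<^sup>2"
    proof (rule mult_right_mono)
      have "64 * (K * (\<tau> z)\<^sup>2) \<le> D" using tau_slow[OF z w] by (simp add: D_def e_def mult.assoc)
      moreover have "K * (\<tau> z)\<^sup>2 > 0" using K1 tau_pos[OF z] by simp
      ultimately have "64 / D \<le> 1 / (K * (\<tau> z)\<^sup>2)" using D by (simp add: divide_simps)
      thus "64 / D \<le> lap z" using lap_ge[OF z] by simp
    qed simp
    finally show "16 * ((k1 ((cmod (z - w))\<^sup>2) * (2 * Re (z - w)))\<^sup>2 + (k1 ((cmod (z - w))\<^sup>2) * (2 * Im (z - w)))\<^sup>2) \<le> lap z * (sig w z)\<^sup>2"
      by (simp add: sD)
  qed
  thus ?thesis by blast
qed

lemma sig_pos: "w \<in> \<D> \<Longrightarrow> sig w z > 0"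
  using sig_den(2)[of w z] by (simp add: sig_def)

lemma sig_cont2: "w \<in> \<D> \<Longrightarrow> continuous_on S (sig w)"
  unfolding sig_def using sig_den(2)[of w] by (intro continuous_intros) (auto simp: less_imp_neq[THEN not_sym])

lemma inv_sig_cont: "continuous_on S (\<lambda>z. 1 / sig w z)"
  unfolding sig_def by (simp, intro continuous_intros)

lemma inv_sig_bound:
  assumes w: "w \<in> \<D>" and z: "z \<in> \<D>" shows "1 / sig w z \<le> L\<^sup>2 * (\<tau> w)\<^sup>2 + 4"
proof -
  have "cmod (z - w) \<le> 2" using norm_triangle_ineq4[of z w] w z by simp
  hence "(cmod (z - w))\<^sup>2 \<le> 2\<^sup>2" by (intro power_mono) auto
  thus ?thesis by (simp add: sig_def)
qed

text \<open>For \<open>F = \<sigma>\<^sub>z\<^sup>-\<^sup>2 K\<^sub>z\<close> the value \<open>(P F)(z)\<close> equals \<open>\<parallel>\<sigma>\<^sub>z\<^sup>-\<^sup>1 K\<^sub>z\<parallel>\<^sup>2\<close>, while the weighted estimate bounds \<open>\<sigma>\<^sub>z P F\<close> near \<open>z\<close>.\<close>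

theorem kernel_decay:
  assumes z: "z \<in> \<D>"
  shows "(n2 N (\<lambda>x. of_real (1 / sig z x) * ker z x))\<^sup>2 \<le> 64 * C1\<^sup>2 * (L\<^sup>2 + 1)\<^sup>2 * (\<tau> z)\<^sup>2 / \<omega> z"
proof -
  have t: "\<tau> z > 0" "\<omega> z > 0" by (rule tau_pos[OF z], rule omega_pos[OF z])
  obtain sx sy sxy where "slow_weight \<omega> \<phi> px py pxx pyy (sig z) sx sy sxy (1 / (L\<^sup>2 * (\<tau> z)\<^sup>2))"
    using sig_slow[OF z] by blast
  then interpret S: slow_weight \<omega> \<phi> px py pxx pyy "sig z" sx sy sxy "1 / (L\<^sup>2 * (\<tau> z)\<^sup>2)" .
  define G where "G x = of_real (1 / sig z x) * ker z x" for x
  define F where "F x = of_real (1 / sig z x) * G x" for x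
  have im: "(\<lambda>x. complex_of_real (1 / sig z x)) \<in> borel_measurable N"
    unfolding N_measurable by (intro disk_measurable continuous_on_of_real inv_sig_cont)
  have ib: "cmod (complex_of_real (1 / sig z x)) \<le> L\<^sup>2 * (\<tau> z)\<^sup>2 + 4" if "x \<in> space N" for x
    using inv_sig_bound[OF z, of x] sig_pos[OF z, of x] that unfolding norm_of_real by simp
  have kL: "ker z \<in> L2 N" by (rule A2D(1)[OF ker(1)[OF z]])
  have GL: "G \<in> L2 N" unfolding G_def[abs_def] by (rule L2_bmult[OF kL im ib])
  have FL: "F \<in> L2 N" unfolding F_def[abs_def] by (rule L2_bmult[OF GL im ib])
  obtain f r g gx gy where f: "f \<in> A2" and T: "\<And>n::nat. testf (r n) (g n) (gx n) (gy n)"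
    and lim: "(\<lambda>n. n2 N (\<lambda>x. TT (gx n) (gy n) x - (F x - f x))) \<longlonglongrightarrow> 0"
    using projection[OF FL] by blast
  let ?I = "(n2 N G)\<^sup>2"
  have "f z = ip N f (ker z)" by (rule ker(3)[OF z f])
  also have "\<dots> = ip N F (ker z)" by (rule ip_approx_A2[OF ker(1)[OF z] f FL T lim, symmetric])
  also have "\<dots> = ip N G G" unfolding F_def[abs_def] ip_real_mult G_def[abs_def] ..
  also have "\<dots> = of_real ?I" by (rule ip_self)
  finally have fz: "cmod (f z) = ?I" by (simp only: norm_of_real abs_of_nonneg[OF zero_le_power2])
  have "(\<lambda>x. of_real (sig z x) * F x) = G" using sig_pos[OF z] by (auto simp: F_def fun_eq_iff less_imp_neq[THEN not_sym])
  hence ag: "n2 N (\<lambda>x. of_real (sig z x) * f x) \<le> 4 * n2 N G" using S.agmon(2)[OF f FL T lim] by simp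
  let ?B = "cball z (\<delta> * \<tau> z)"
  let ?f = "\<lambda>x. of_real (sig z x) * f x"
  have fm: "f \<in> borel_measurable \<mu>" by (rule A2_meas[OF f])
  have sfL: "?f \<in> L2 N" by (rule S.rho_L2[OF A2D(1)[OF f]])
  have "(\<integral>x. indicator ?B x * (\<omega> x * (cmod (f x))\<^sup>2) \<partial>\<mu>) \<le> (\<integral>x. ((L\<^sup>2 + 1) * (\<tau> z)\<^sup>2)\<^sup>2 * (\<omega> x * (cmod (?f x))\<^sup>2) \<partial>\<mu>)"
  proof (rule integral_mono)
    have i: "integrable \<mu> (\<lambda>x. \<omega> x * (cmod (f x))\<^sup>2)" using A2D(1)[OF f] by (simp add: L2_N_iff)
    show "integrable \<mu> (\<lambda>x. indicator ?B x * (\<omega> x * (cmod (f x))\<^sup>2))"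
      using integrable_mult_indicator[OF cball_sets[OF z] i] by simp
    show "integrable \<mu> (\<lambda>x. ((L\<^sup>2 + 1) * (\<tau> z)\<^sup>2)\<^sup>2 * (\<omega> x * (cmod (?f x))\<^sup>2))"
      using sfL unfolding L2_N_iff by (intro integrable_mult_right) simp
    fix x assume "x \<in> space \<mu>"
    hence x: "\<omega> x > 0" using omega_pos by simp
    show "indicator ?B x * (\<omega> x * (cmod (f x))\<^sup>2) \<le> ((L\<^sup>2 + 1) * (\<tau> z)\<^sup>2)\<^sup>2 * (\<omega> x * (cmod (?f x))\<^sup>2)"
    proof (cases "x \<in> ?B")
      case True
      have "cmod (x - z) \<le> \<delta> * \<tau> z" using True by (simp add: dist_norm norm_minus_commute)
      also have "\<dots> \<le> \<tau> z" using delta t by (simp add: mult_left_le_one_le)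
      finally have "(cmod (x - z))\<^sup>2 \<le> (\<tau> z)\<^sup>2" by (rule power_mono) simp
      hence "1 / sig z x \<le> (L\<^sup>2 + 1) * (\<tau> z)\<^sup>2" by (simp add: sig_def algebra_simps)
      hence "1 \<le> (L\<^sup>2 + 1) * (\<tau> z)\<^sup>2 * sig z x" using sig_pos[OF z, of x] by (simp add: divide_le_eq)
      hence "1\<^sup>2 \<le> ((L\<^sup>2 + 1) * (\<tau> z)\<^sup>2 * sig z x)\<^sup>2" by (intro power_mono) auto
      hence "1 * (\<omega> x * (cmod (f x))\<^sup>2) \<le> ((L\<^sup>2 + 1) * (\<tau> z)\<^sup>2 * sig z x)\<^sup>2 * (\<omega> x * (cmod (f x))\<^sup>2)"
        using x by (intro mult_right_mono) auto
      thus ?thesis using True by (simp add: norm_mult power_mult_distrib mult_ac)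
    next
      case False thus ?thesis using x by simp
    qed
  qed
  also have "\<dots> = ((L\<^sup>2 + 1) * (\<tau> z)\<^sup>2)\<^sup>2 * (n2 N ?f)\<^sup>2"
    using n2_N[of ?f] sfL by (simp add: L2_N_iff)
  also have "\<dots> \<le> ((L\<^sup>2 + 1) * (\<tau> z)\<^sup>2)\<^sup>2 * (4 * n2 N G)\<^sup>2"
    by (intro mult_left_mono power_mono ag) auto
  finally have J: "(\<integral>x. indicator ?B x * (\<omega> x * (cmod (f x))\<^sup>2) \<partial>\<mu>) \<le> ((L\<^sup>2 + 1) * (\<tau> z)\<^sup>2)\<^sup>2 * (4 * n2 N G)\<^sup>2" .
  have "?I\<^sup>2 * \<omega> z \<le> 4 * C1\<^sup>2 / (\<tau> z)\<^sup>2 * (((L\<^sup>2 + 1) * (\<tau> z)\<^sup>2)\<^sup>2 * (4 * n2 N G)\<^sup>2)"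
    unfolding fz[symmetric] by (rule order_trans[OF submean_L2[OF f z] mult_left_mono[OF J]]) simp
  also have "\<dots> = (64 * C1\<^sup>2 * (L\<^sup>2 + 1)\<^sup>2 * (\<tau> z)\<^sup>2) * ?I"
    using t by (simp add: power2_eq_square field_simps)
  finally have "(?I * \<omega> z) * ?I \<le> (64 * C1\<^sup>2 * (L\<^sup>2 + 1)\<^sup>2 * (\<tau> z)\<^sup>2) * ?I" by (simp add: power2_eq_square mult_ac)
  \<comment> \<open>The preceding inequality carries the factor \<open>?I\<close> on both sides; the
    bound arises by cancelling it.\<close>
  moreover have "?I = 0 \<or> ?I > 0" by auto
  ultimately have "?I * \<omega> z \<le> 64 * C1\<^sup>2 * (L\<^sup>2 + 1)\<^sup>2 * (\<tau> z)\<^sup>2"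
    by (elim disjE) (simp_all add: mult_le_cancel_right)
  thus ?thesis using t by (simp add: G_def[abs_def] pos_le_divide_eq)
qed

definition C3 :: real where "C3 = 16 * C1 * (L\<^sup>2 + 1)"

lemma C3_pos: "C3 > 0"
  unfolding C3_def using C1_pos zero_le_power2[of L] by (intro mult_pos_pos) (auto intro: add_nonneg_pos)

text \<open>Cauchy-Schwarz for the factors \<open>|K_z| * sqrt \<omega> / sig z\<close> and
  \<open>sig z\<close>: \<open>kernel_decay\<close> and \<open>sigma_integral\<close> bound their
  squared norms by multiples of \<open>(\<tau> z)^2 / \<omega> z\<close> and
  \<open>1 / (\<tau> z)^2\<close>, so \<open>\<tau>\<close> cancels. The resulting 128 is raised to
  the square 256.\<close>

theorem kernel_L1:
  assumes z: "z \<in> \<D>"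
  shows "integrable \<mu> (\<lambda>x. cmod (ker z x) * sqrt (\<omega> x))"
    "(\<integral>x. cmod (ker z x) * sqrt (\<omega> x) \<partial>\<mu>) \<le> C3 / sqrt (\<omega> z)"
proof -
  have t: "\<tau> z > 0" "\<omega> z > 0" by (rule tau_pos[OF z], rule omega_pos[OF z])
  define G where "G x = of_real (1 / sig z x) * ker z x" for x
  define h where "h x = complex_of_real (cmod (G x) * sqrt (\<omega> x))" for x
  define k where "k x = complex_of_real (sig z x)" for x
  have im: "(\<lambda>x. complex_of_real (1 / sig z x)) \<in> borel_measurable N"
    unfolding N_measurable by (intro disk_measurable continuous_on_of_real inv_sig_cont)
  have ib: "cmod (complex_of_real (1 / sig z x)) \<le> L\<^sup>2 * (\<tau> z)\<^sup>2 + 4" if "x \<in> space N" for x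
    using inv_sig_bound[OF z, of x] sig_pos[OF z, of x] that unfolding norm_of_real by simp
  have GL: "G \<in> L2 N" unfolding G_def[abs_def] by (rule L2_bmult[OF A2D(1)[OF ker(1)[OF z]] im ib])
  hence Gm [measurable]: "G \<in> borel_measurable \<mu>" and Gi: "integrable \<mu> (\<lambda>x. \<omega> x * (cmod (G x))\<^sup>2)"
    by (auto simp: L2_N_iff)
  have hm: "h \<in> borel_measurable \<mu>" unfolding h_def by measurable
  have hsq: "(cmod (h x))\<^sup>2 = \<omega> x * (cmod (G x))\<^sup>2" if "x \<in> \<D>" for x
    using omega_pos[OF that] unfolding h_def norm_of_real by (simp add: power_mult_distrib)
  have "integrable \<mu> (\<lambda>x. (cmod (h x))\<^sup>2)"
    using Gi by (rule integrable_transfer) (auto simp: hsq)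
  hence hL: "h \<in> L2 \<mu>" using hm by (simp add: L2_def)
  have km: "k \<in> borel_measurable \<mu>" unfolding k_def by (intro disk_measurable continuous_on_of_real sig_cont2[OF z])
  have sb: "sig z x \<le> 1 / (L\<^sup>2 * (\<tau> z)\<^sup>2)" for x
    unfolding sig_def using sig_den[OF z] by (intro divide_left_mono) auto
  have ki: "integrable \<mu> (\<lambda>x. (cmod (k x))\<^sup>2)"
  proof (rule integrable_disk_bounded)
    show "(\<lambda>x. (cmod (k x))\<^sup>2) \<in> borel_measurable \<mu>" using km by measurable
    show "norm ((cmod (k x))\<^sup>2) \<le> (1 / (L\<^sup>2 * (\<tau> z)\<^sup>2))\<^sup>2" for x
      using sb[of x] sig_pos[OF z, of x] unfolding k_def norm_of_real by (simp add: power_mono del: power_divide)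
  qed
  hence kL: "k \<in> L2 \<mu>" using km by (simp add: L2_def)
  have hn: "(n2 \<mu> h)\<^sup>2 \<le> 64 * C1\<^sup>2 * (L\<^sup>2 + 1)\<^sup>2 * (\<tau> z)\<^sup>2 / \<omega> z"
  proof -
    have "(n2 \<mu> h)\<^sup>2 = (\<integral>x. \<omega> x * (cmod (G x))\<^sup>2 \<partial>\<mu>)"
      unfolding n2_sq by (rule lint_cong) (auto simp: hsq)
    also have "\<dots> = (n2 N G)\<^sup>2" by (rule n2_N[OF Gm, symmetric])
    also have "\<dots> \<le> 64 * C1\<^sup>2 * (L\<^sup>2 + 1)\<^sup>2 * (\<tau> z)\<^sup>2 / \<omega> z" unfolding G_def[abs_def] by (rule kernel_decay[OF z])
    finally show ?thesis .
  qed
  have kn: "(n2 \<mu> k)\<^sup>2 \<le> 2 / (L\<^sup>2 * (\<tau> z)\<^sup>2)"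
  proof -
    have "(n2 \<mu> k)\<^sup>2 = (\<integral>x. 1 / (L\<^sup>2 * (\<tau> z)\<^sup>2 + (cmod (x - z))\<^sup>2)\<^sup>2 \<partial>\<mu>)"
      unfolding n2_sq k_def norm_of_real by (simp add: sig_def power_divide)
    also have "\<dots> \<le> 2 / (L\<^sup>2 * (\<tau> z)\<^sup>2)" by (rule sigma_integral[OF sig_den(1)[OF z] z])
    finally show ?thesis .
  qed
  have eq: "h x * cnj (k x) = complex_of_real (cmod (ker z x) * sqrt (\<omega> x))" for x
    using sig_pos[OF z, of x] unfolding h_def k_def G_def norm_mult norm_of_real by (simp add: less_imp_neq[THEN not_sym])
  have "integrable \<mu> (\<lambda>x. complex_of_real (cmod (ker z x) * sqrt (\<omega> x)))"
    using L2_prod_integrable[OF hL kL] unfolding eq .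
  thus i: "integrable \<mu> (\<lambda>x. cmod (ker z x) * sqrt (\<omega> x))" by (simp only: complex_of_real_integrable_eq)
  let ?J = "\<integral>x. cmod (ker z x) * sqrt (\<omega> x) \<partial>\<mu>"
  have J0: "?J \<ge> 0" by (rule integral_nonneg_AE, rule AE_I2) (auto simp: omega_pos less_imp_le)
  have "ip \<mu> h k = of_real ?J" unfolding ip_def eq by (rule integral_complex_of_real)
  hence "?J \<le> n2 \<mu> h * n2 \<mu> k" using ip_Cauchy_Schwarz[OF hL kL] J0 by simp
  hence "?J\<^sup>2 \<le> (n2 \<mu> h * n2 \<mu> k)\<^sup>2" using J0 by (rule power_mono)
  also have "\<dots> \<le> (64 * C1\<^sup>2 * (L\<^sup>2 + 1)\<^sup>2 * (\<tau> z)\<^sup>2 / \<omega> z) * (2 / (L\<^sup>2 * (\<tau> z)\<^sup>2))"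
    unfolding power_mult_distrib by (rule mult_mono[OF hn kn]) (use t in auto)
  also have "\<dots> = 128 * C1\<^sup>2 * (L\<^sup>2 + 1)\<^sup>2 / \<omega> z / L\<^sup>2"
    using t L1 by simp
  also have "\<dots> \<le> 128 * C1\<^sup>2 * (L\<^sup>2 + 1)\<^sup>2 / \<omega> z"
  proof -
    have "128 * C1\<^sup>2 * (L\<^sup>2 + 1)\<^sup>2 / \<omega> z / L\<^sup>2 \<le> 128 * C1\<^sup>2 * (L\<^sup>2 + 1)\<^sup>2 / \<omega> z / 1"
      using t L1 by (intro divide_left_mono one_le_power) auto
    thus ?thesis by simp
  qed
  also have "\<dots> \<le> 256 * C1\<^sup>2 * (L\<^sup>2 + 1)\<^sup>2 / \<omega> z"
    using t by (intro divide_right_mono mult_right_mono) auto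
  also have "\<dots> = (C3 / sqrt (\<omega> z))\<^sup>2" using t by (simp add: C3_def power_divide power_mult_distrib)
  finally show "?J \<le> C3 / sqrt (\<omega> z)" by (rule power2_le_imp_le) (use C3_pos t in simp)
qed

text \<open>Cauchy's inequality on discs of radius \<open>r / 2\<close> bounds derivatives near
  \<open>z\<close> by a multiple of the norm, so the Lipschitz constant is uniform over the unit
  ball of \<open>A2\<close>.\<close>

lemma A2_Lipschitz:
  assumes z: "z \<in> \<D>"
  shows "\<exists>C d. 0 < d \<and> (\<forall>f u. f \<in> A2 \<longrightarrow> cmod (u - z) < d \<longrightarrow> cmod (f u - f z) \<le> C * n2 N f * cmod (u - z))"
proof -
  define r where "r = (1 - cmod z) / 2"
  have r: "r > 0" using z by (simp add: r_def)
  have sub: "cball z r \<subseteq> \<D>"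
  proof
    fix x assume "x \<in> cball z r"
    hence "cmod (x - z) \<le> r" by (simp add: dist_norm norm_minus_commute)
    thus "x \<in> \<D>" using norm_triangle_sub[of x z] r z by (simp add: r_def)
  qed
  obtain M where "M \<ge> 0" and M: "\<And>x. x \<in> cball z r \<Longrightarrow> norm (ev x) \<le> M"
    using compact_continuous_bound[OF compact_cball continuous_on_subset[OF ev_cont sub]] by blast
  have bound: "cmod (f u - f z) \<le> (M / (r / 2)) * n2 N f * cmod (u - z)" if f: "f \<in> A2" and u: "cmod (u - z) < r / 2" for f u
  proof -
    have fM: "cmod (f x) \<le> M * n2 N f" if "x \<in> cball z r" for x
    proof -
      have "x \<in> \<D>" using that sub by blast
      hence "cmod (f x) \<le> ev x * n2 N f" by (rule evaluation_bound[OF f])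
      also have "\<dots> \<le> M * n2 N f"
      proof (rule mult_right_mono)
        show "ev x \<le> M" using M[OF that] by simp
      qed simp
      finally show ?thesis .
    qed
    have inner: "cball x (r / 2) \<subseteq> cball z r" if "x \<in> ball z (r / 2)" for x
    proof
      fix y assume y: "y \<in> cball x (r / 2)"
      have "dist z y \<le> dist z x + dist x y" by (rule dist_triangle)
      thus "y \<in> cball z r" using y that by simp
    qed
    have "norm (f u - f z) \<le> (M * n2 N f / (r / 2)) * norm (u - z)"
    proof (rule field_differentiable_bound[OF convex_ball[of z "r / 2"]])
      fix x assume x: "x \<in> ball z (r / 2)"
      have xi: "cball x (r / 2) \<subseteq> \<D>" using inner[OF x] sub by blast
      have "x \<in> cball x (r / 2)" using r by simp
      hence xD: "x \<in> \<D>" using xi by blast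
      show "(f has_field_derivative deriv f x) (at x within ball z (r / 2))"
        by (rule has_field_derivative_at_within[OF holomorphic_derivI[OF A2D(2)[OF f] open_ball xD]])
      have "norm ((deriv ^^ 1) f x) \<le> fact 1 * (M * n2 N f) / (r / 2) ^ 1"
      proof (rule Cauchy_inequality)
        show "f holomorphic_on ball x (r / 2)"
          by (rule holomorphic_on_subset[OF A2D(2)[OF f]]) (rule subset_trans[OF ball_subset_cball xi])
        show "continuous_on (cball x (r / 2)) f"
          by (rule continuous_on_subset[OF holomorphic_on_imp_continuous_on[OF A2D(2)[OF f]] xi])
        show "norm (f y) \<le> M * n2 N f" if "norm (x - y) = r / 2" for y
        proof (rule fM)
          have "y \<in> cball x (r / 2)" using that by (simp add: dist_norm)
          thus "y \<in> cball z r" using inner[OF x] by blast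
        qed
      qed (use r in simp)
      thus "norm (deriv f x) \<le> M * n2 N f / (r / 2)" by simp
    qed (use u r in \<open>auto simp: dist_norm norm_minus_commute\<close>)
    thus ?thesis by (simp add: mult_ac)
  qed
  show ?thesis
  proof (intro exI conjI allI impI)
    show "0 < r / 2" using r by simp
    show "cmod (f u - f z) \<le> (M / (r / 2)) * n2 N f * cmod (u - z)" if "f \<in> A2" "cmod (u - z) < r / 2" for f u
      by (rule bound[OF that])
  qed
qed

text \<open>Joint continuity is wanted for measurability on the product space. A change of the
  second argument is controlled by \<open>A2_Lipschitz\<close> and \<open>ker_norm\<close>, a change
  of the first by symmetry and the continuity of the single function \<open>ker w\<close>.\<close>

lemma ker_continuous: "continuous_on (\<D> \<times> \<D>) (\<lambda>p. ker (fst p) (snd p))"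
  unfolding continuous_on_def
proof
  fix p assume "p \<in> \<D> \<times> \<D>"
  then obtain z w where p: "p = (z, w)" "z \<in> \<D>" "w \<in> \<D>" by auto
  let ?F = "at p within \<D> \<times> \<D>"
  obtain C d where d: "0 < d" and C: "\<forall>f u. f \<in> A2 \<longrightarrow> cmod (u - w) < d \<longrightarrow> cmod (f u - f w) \<le> C * n2 N f * cmod (u - w)"
    using A2_Lipschitz[OF p(3)] by (elim exE conjE)
  have tf: "((\<lambda>q. fst q) \<longlongrightarrow> z) ?F" "((\<lambda>q. snd q) \<longlongrightarrow> w) ?F"
    using tendsto_fst[OF tendsto_ident_at, of p "\<D> \<times> \<D>"] tendsto_snd[OF tendsto_ident_at, of p "\<D> \<times> \<D>"] p(1) by auto
  have inD: "\<forall>\<^sub>F q in ?F. q \<in> \<D> \<times> \<D>" by (simp add: eventually_at_filter)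
  have close: "\<forall>\<^sub>F q in ?F. cmod (snd q - w) < d"
    using tendstoD[OF tf(2) d] by (simp add: dist_norm)
  have evl: "((\<lambda>q. ev (fst q)) \<longlongrightarrow> ev z) ?F"
  proof (rule continuous_on_tendsto_compose[OF ev_cont tf(1) p(2)])
    show "\<forall>\<^sub>F q in ?F. fst q \<in> \<D>" using inD by eventually_elim auto
  qed
  have kwl: "((\<lambda>q. ker w (fst q)) \<longlongrightarrow> ker w z) ?F"
  proof (rule continuous_on_tendsto_compose[OF holomorphic_on_imp_continuous_on[OF A2D(2)[OF ker(1)[OF p(3)]]] tf(1) p(2)])
    show "\<forall>\<^sub>F q in ?F. fst q \<in> \<D>" using inD by eventually_elim auto
  qed
  have "((\<lambda>q. ker (fst q) (snd q) - ker z w) \<longlongrightarrow> 0) ?F"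
  proof (rule Lim_null_comparison)
    show "\<forall>\<^sub>F q in ?F. norm (ker (fst q) (snd q) - ker z w) \<le> \<bar>C\<bar> * ev (fst q) * cmod (snd q - w) + cmod (ker w (fst q) - ker w z)"
      using inD close
    proof eventually_elim
      case (elim q)
      have q: "fst q \<in> \<D>" "snd q \<in> \<D>" using elim(1) by auto
      have "cmod (ker (fst q) (snd q) - ker (fst q) w) \<le> C * n2 N (ker (fst q)) * cmod (snd q - w)"
        by (rule C[rule_format, OF ker(1)[OF q(1)] elim(2)])
      also have "\<dots> \<le> \<bar>C\<bar> * ev (fst q) * cmod (snd q - w)"
        by (intro mult_right_mono mult_mono ker_norm q) (use ev_nonneg[OF q(1)] in auto)
      finally have 1: "cmod (ker (fst q) (snd q) - ker (fst q) w) \<le> \<bar>C\<bar> * ev (fst q) * cmod (snd q - w)" .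
      have "cmod (ker (fst q) w - ker z w) = cmod (cnj (ker w (fst q) - ker w z))"
        using ker_sym[OF q(1) p(3)] ker_sym[OF p(2,3)] by simp
      also have "\<dots> = cmod (ker w (fst q) - ker w z)" by (rule complex_mod_cnj)
      finally show ?case using 1 norm_triangle_ineq[of "ker (fst q) (snd q) - ker (fst q) w" "ker (fst q) w - ker z w"] by simp
    qed
    have "((\<lambda>q. \<bar>C\<bar> * ev (fst q) * cmod (snd q - w) + cmod (ker w (fst q) - ker w z)) \<longlongrightarrow> \<bar>C\<bar> * ev z * cmod (w - w) + cmod (ker w z - ker w z)) ?F"
      by (intro tendsto_intros evl tf kwl)
    thus "((\<lambda>q. \<bar>C\<bar> * ev (fst q) * cmod (snd q - w) + cmod (ker w (fst q) - ker w z)) \<longlongrightarrow> 0) ?F" by simp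
  qed
  hence "((\<lambda>q. ker (fst q) (snd q)) \<longlongrightarrow> ker z w) ?F" by (rule LIM_zero_cancel)
  thus "((\<lambda>p. ker (fst p) (snd p)) \<longlongrightarrow> ker (fst p) (snd p)) ?F" using p(1) by simp
qed

end

section \<open>The reproducing formula beyond A2\<close>

lemma DERIV_pos_pow:
  "((\<lambda>y. max 0 y ^ Suc (Suc n)) has_real_derivative real (Suc (Suc n)) * max 0 y ^ Suc n) (at y)"
proof -
  have "((\<lambda>y. - y) has_real_derivative -1) (at y)" by (auto intro!: derivative_eq_intros)
  from DERIV_chain2[OF DERIV_max_pow[of 0 n "- y"] this] show ?thesis by simp
qed

lemma continuous_AE_eq:
  fixes f g :: "complex \<Rightarrow> complex"
  assumes f: "continuous_on \<D> f" and g: "continuous_on \<D> g"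
    and ae: "AE z in \<mu>. f z = g z" and w: "w \<in> \<D>"
  shows "f w = g w"
proof (rule ccontr)
  assume ne: "f w \<noteq> g w"
  have "continuous_on \<D> (\<lambda>z. f z - g z)" by (intro continuous_intros f g)
  then obtain e where e: "e > 0" "\<And>z. z \<in> \<D> \<Longrightarrow> dist z w < e \<Longrightarrow> dist (f z - g z) (f w - g w) < cmod (f w - g w)"
    unfolding continuous_on_iff using w ne by (metis norm_eq_zero right_minus_eq zero_less_norm_iff)
  obtain d where d: "d > 0" "ball w d \<subseteq> \<D>" using openE[OF open_ball w] by blast
  define r where "r = min d e"
  have r: "r > 0" "ball w r \<subseteq> \<D>" using d e by (auto simp: r_def)
  have "AE z in \<mu>. z \<notin> ball w r"
    using ae
  proof eventually_elim
    case (elim z)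
    show ?case
    proof
      assume z: "z \<in> ball w r"
      hence "z \<in> \<D>" "dist z w < e" using r by (auto simp: r_def dist_commute)
      from e(2)[OF this] elim show False by (simp add: dist_norm norm_minus_commute)
    qed
  qed
  moreover have "ball w r \<in> sets \<mu>" using r by (auto simp: sets_disk sets_restrict_space_iff)
  ultimately have "emeasure \<mu> (ball w r) = 0"
    by (subst (asm) AE_iff_null_sets[symmetric]) auto
  thus False using emeasure_disk_ball[OF r(2)] r(1) by simp
qed

text \<open>A holomorphic function is weakly holomorphic and agrees everywhere with its
  representative \<open>V\<close>, which is computed from bumps of any admissible radius.\<close>

lemma holomorphic_mean:
  assumes f: "f holomorphic_on \<D>" and c: "0 < c" "cmod w + sqrt c < 1"
  shows "(\<integral>z. f z * of_real (bump 3 c (z - w)) \<partial>\<mu>) = f w * of_real (mass c)"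
proof -
  interpret weakly_hol f by (rule holomorphic_weakly_hol[OF f])
  have "cmod w < 1" using c real_sqrt_gt_zero[OF c(1)] by linarith
  hence "f w = V w" by (intro continuous_AE_eq[OF holomorphic_on_imp_continuous_on[OF f] V_cont AE_holomorphic]) simp
  thus ?thesis using V_eq[OF c] by (simp add: mol_def)
qed

context regular_weight
begin

lemma sig_le_tau:
  assumes w: "w \<in> \<D>" and z: "z \<in> \<D>" shows "sig w z \<le> 1 / (64 * K * (\<tau> z)\<^sup>2)"
  unfolding sig_def using tau_slow[OF z w] tau_pos[OF z] K1
  by (intro divide_left_mono mult_pos_pos sig_den[OF w]) auto

text \<open>The constant in \<open>\<integral> \<sigma>\<^sub>w(x)\<^sup>2 dA(w) \<ge> cW / \<tau>(x)\<^sup>2\<close>. Averaging over \<open>w\<close> turns the estimates with \<open>\<rho> = \<sigma>\<^sub>w\<close>, uniform in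
  \<open>w\<close>, into estimates with the singular weight \<open>1 / \<tau>\<close>.\<close>

definition cW :: real where "cW = \<delta>\<^sup>2 / (4 * L\<^sup>2 + 1)\<^sup>2"

lemma cW_pos: "cW > 0"
  unfolding cW_def using delta zero_le_power2[of L] by (intro divide_pos_pos zero_less_power) (auto intro: add_nonneg_pos)

lemma tau_meas [measurable]: "\<tau> \<in> borel_measurable \<mu>"
  by (rule disk_measurable[OF tau_cont])

text \<open>For \<open>w\<close> within \<open>\<delta> * \<tau> x\<close> of \<open>x\<close> one
  has \<open>\<tau> w <= 2 * \<tau> x\<close>, hence
  \<open>sig w x >= 1 / ((4 * L^2 + 1) * (\<tau> x)^2)\<close>, and the ball of these
  \<open>w\<close> has mass \<open>(\<delta> * \<tau> x)^2\<close>. \<open>A\<close> is the set of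
  centres over which one averages.\<close>

lemma sig_average_ge:
  assumes x: "x \<in> \<D>" and A: "ball x (\<delta> * \<tau> x) \<subseteq> A"
  shows "ennreal (cW / (\<tau> x)\<^sup>2) \<le> (\<integral>\<^sup>+w. ennreal (indicator A w * (sig w x)\<^sup>2) \<partial>\<mu>)"
proof -
  have t: "\<tau> x > 0" by (rule tau_pos[OF x])
  have bD: "ball x (\<delta> * \<tau> x) \<subseteq> \<D>" using tball_sub(1)[OF x] ball_subset_cball by blast
  have bs: "ball x (\<delta> * \<tau> x) \<in> sets \<mu>" using bD by (auto simp: sets_disk sets_restrict_space_iff)
  let ?c = "(1 / ((4 * L\<^sup>2 + 1) * (\<tau> x)\<^sup>2))\<^sup>2"
  have Lp: "4 * L\<^sup>2 + 1 > 0" using zero_le_power2[of L] by linarith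
  have "ennreal (cW / (\<tau> x)\<^sup>2) = ennreal (?c * (\<delta> * \<tau> x)\<^sup>2)"
  proof (rule arg_cong[of _ _ ennreal])
    have "d\<^sup>2 / a\<^sup>2 / b\<^sup>2 = (1 / (a * b\<^sup>2))\<^sup>2 * (d * b)\<^sup>2" if "a > 0" "b > 0" for a b d :: real
      using that by (simp add: field_simps power2_eq_square)
    from this[OF Lp t] show "cW / (\<tau> x)\<^sup>2 = ?c * (\<delta> * \<tau> x)\<^sup>2" unfolding cW_def .
  qed
  also have "\<dots> = ennreal ?c * emeasure \<mu> (ball x (\<delta> * \<tau> x))"
    using emeasure_disk_ball[OF bD] t delta by (simp add: ennreal_mult')
  also have "\<dots> = (\<integral>\<^sup>+w. ennreal ?c * indicator (ball x (\<delta> * \<tau> x)) w \<partial>\<mu>)"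
    by (rule nn_integral_cmult_indicator[OF bs, symmetric])
  also have "\<dots> \<le> (\<integral>\<^sup>+w. ennreal (indicator A w * (sig w x)\<^sup>2) \<partial>\<mu>)"
  proof (rule nn_integral_mono)
    fix w assume "w \<in> space \<mu>"
    hence w: "w \<in> \<D>" by simp
    show "ennreal ?c * indicator (ball x (\<delta> * \<tau> x)) w \<le> ennreal (indicator A w * (sig w x)\<^sup>2)"
    proof (cases "w \<in> ball x (\<delta> * \<tau> x)")
      case True
      hence d: "cmod (w - x) \<le> \<delta> * \<tau> x" by (simp add: dist_norm norm_minus_commute)
      have tw: "\<tau> w \<le> 2 * \<tau> x" using tau_ball[OF x w d] by simp
      have "(\<tau> w)\<^sup>2 \<le> (2 * \<tau> x)\<^sup>2" using tw tau_pos[OF w] by (intro power_mono) auto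
      hence 1: "L\<^sup>2 * (\<tau> w)\<^sup>2 \<le> L\<^sup>2 * (4 * (\<tau> x)\<^sup>2)" by (intro mult_left_mono) (auto simp: power_mult_distrib)
      have "\<delta> * \<tau> x \<le> \<tau> x" using delta t by (simp add: mult_left_le_one_le)
      hence "cmod (x - w) \<le> \<tau> x" using d by (simp add: norm_minus_commute)
      hence "(cmod (x - w))\<^sup>2 \<le> (\<tau> x)\<^sup>2" by (intro power_mono) auto
      hence "L\<^sup>2 * (\<tau> w)\<^sup>2 + (cmod (x - w))\<^sup>2 \<le> (4 * L\<^sup>2 + 1) * (\<tau> x)\<^sup>2" using 1 by (simp add: algebra_simps)
      hence "1 / ((4 * L\<^sup>2 + 1) * (\<tau> x)\<^sup>2) \<le> sig w x" unfolding sig_def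
        using sig_den(2)[OF w] Lp t by (intro divide_left_mono mult_pos_pos) auto
      hence "?c \<le> (sig w x)\<^sup>2" using Lp t by (intro power_mono) auto
      moreover have "w \<in> A" using True A by blast
      ultimately show ?thesis using True by (simp add: ennreal_leI)
    qed simp
  qed
  finally show ?thesis .
qed

text \<open>Tonelli's theorem. The two sets are kept apart because some bounds hold only for centres
  \<open>w\<close> in a compact set \<open>A\<close>; the conclusion then concerns points of
  \<open>A'\<close>, whose small discs stay in \<open>A\<close>.\<close>

lemma sig_average:
  assumes A: "A \<in> sets \<mu>" and As [measurable]: "A' \<in> sets \<mu>" and A': "\<And>x. x \<in> A' \<Longrightarrow> x \<in> \<D> \<Longrightarrow> ball x (\<delta> * \<tau> x) \<subseteq> A"
    and G [measurable]: "G \<in> borel_measurable \<mu>" and G0: "\<And>x. x \<in> \<D> \<Longrightarrow> G x \<ge> 0" and M: "M \<ge> 0"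
    and le: "\<And>w. w \<in> A \<Longrightarrow> (\<integral>\<^sup>+x. ennreal ((sig w x)\<^sup>2 * G x) \<partial>\<mu>) \<le> ennreal M"
  shows "(\<integral>\<^sup>+x. ennreal (indicator A' x * (G x / (\<tau> x)\<^sup>2)) \<partial>\<mu>) \<le> ennreal (M / cW)"
proof -
  interpret pair_sigma_finite \<mu> \<mu> by (rule pair_sigma_finite_disk)
  let ?P = "\<mu> \<Otimes>\<^sub>M \<mu>"
  have [measurable]: "(indicator A :: complex \<Rightarrow> real) \<in> borel_measurable \<mu>" using A by simp
  define f where "f p = ennreal (indicator A (fst p) * (sig (fst p) (snd p))\<^sup>2 * G (snd p))" for p
  have fm: "f \<in> borel_measurable ?P" unfolding f_def sig_def by measurable
  have "ennreal cW * (\<integral>\<^sup>+x. ennreal (indicator A' x * (G x / (\<tau> x)\<^sup>2)) \<partial>\<mu>)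
     \<le> (\<integral>\<^sup>+x. (\<integral>\<^sup>+w. f (w, x) \<partial>\<mu>) \<partial>\<mu>)"
  proof -
    have "ennreal cW * (\<integral>\<^sup>+x. ennreal (indicator A' x * (G x / (\<tau> x)\<^sup>2)) \<partial>\<mu>)
      = (\<integral>\<^sup>+x. ennreal cW * ennreal (indicator A' x * (G x / (\<tau> x)\<^sup>2)) \<partial>\<mu>)"
      by (rule nn_integral_cmult[symmetric]) measurable
    also have "\<dots> \<le> (\<integral>\<^sup>+x. (\<integral>\<^sup>+w. f (w, x) \<partial>\<mu>) \<partial>\<mu>)"
    proof (rule nn_integral_mono)
      fix x assume "x \<in> space \<mu>"
      hence x: "x \<in> \<D>" by simp
      show "ennreal cW * ennreal (indicator A' x * (G x / (\<tau> x)\<^sup>2)) \<le> (\<integral>\<^sup>+w. f (w, x) \<partial>\<mu>)"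
      proof (cases "x \<in> A'")
        case True
        have "ennreal cW * ennreal (G x / (\<tau> x)\<^sup>2) = ennreal (cW / (\<tau> x)\<^sup>2) * ennreal (G x)"
          using cW_pos G0[OF x] by (simp add: ennreal_mult[symmetric])
        also have "\<dots> \<le> (\<integral>\<^sup>+w. ennreal (indicator A w * (sig w x)\<^sup>2) \<partial>\<mu>) * ennreal (G x)"
          by (rule mult_right_mono[OF sig_average_ge[OF x A'[OF True x]]]) simp
        also have "\<dots> = (\<integral>\<^sup>+w. ennreal (indicator A w * (sig w x)\<^sup>2) * ennreal (G x) \<partial>\<mu>)"
          by (rule nn_integral_multc[symmetric]) (unfold sig_def, measurable)
        also have "\<dots> = (\<integral>\<^sup>+w. f (w, x) \<partial>\<mu>)"
          by (rule nn_integral_cong) (simp add: f_def ennreal_mult[symmetric] G0[OF x])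
        finally show ?thesis using True by simp
      qed simp
    qed
    finally show ?thesis .
  qed
  also have "\<dots> = (\<integral>\<^sup>+w. (\<integral>\<^sup>+x. f (w, x) \<partial>\<mu>) \<partial>\<mu>)" by (rule Fubini[OF fm])
  also have "\<dots> \<le> (\<integral>\<^sup>+w. ennreal M \<partial>\<mu>)"
  proof (rule nn_integral_mono)
    fix w assume "w \<in> space \<mu>"
    show "(\<integral>\<^sup>+x. f (w, x) \<partial>\<mu>) \<le> ennreal M"
      using le[of w] M by (cases "w \<in> A") (auto simp: f_def)
  qed
  also have "\<dots> = ennreal M" by (simp add: emeasure_disk)
  finally have "ennreal cW * (\<integral>\<^sup>+x. ennreal (indicator A' x * (G x / (\<tau> x)\<^sup>2)) \<partial>\<mu>) \<le> ennreal M" .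
  hence "ennreal (1 / cW) * (ennreal cW * (\<integral>\<^sup>+x. ennreal (indicator A' x * (G x / (\<tau> x)\<^sup>2)) \<partial>\<mu>)) \<le> ennreal (1 / cW) * ennreal M"
    by (rule mult_left_mono) simp
  also have "ennreal (1 / cW) * (ennreal cW * (\<integral>\<^sup>+x. ennreal (indicator A' x * (G x / (\<tau> x)\<^sup>2)) \<partial>\<mu>)) = (\<integral>\<^sup>+x. ennreal (indicator A' x * (G x / (\<tau> x)\<^sup>2)) \<partial>\<mu>)"
    unfolding mult.assoc[symmetric] using cW_pos by (simp add: ennreal_mult[symmetric])
  also have "ennreal (1 / cW) * ennreal M = ennreal (M / cW)" using cW_pos M by (simp add: ennreal_mult[symmetric])
  finally show ?thesis .
qed

text \<open>The cutoff is the cube of the positive part of \<open>1 - y^3\<close>, where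
  \<open>y\<close> runs from 0 to 1 as \<open>(cmod x)^2\<close> runs from \<open>1 - 2 * e\<close>
  to \<open>1 - e\<close>. Its gradient is at most \<open>18 / e\<close>; in the layer
  \<open>1 - cmod x < 2 * e\<close>, so \<open>tau_disk\<close> gives
  \<open>\<delta> * \<tau> x <= e\<close>, and \<open>e\<close> can be traded for
  \<open>\<delta> * \<tau> x\<close>.\<close>

lemma cutoff_exists:
  assumes e: "0 < e" "e < 1 / 4"
  shows "\<exists>c cx cy cxy. smooth2 \<D> c cx cy cxy \<and> (\<forall>x. 0 \<le> c x \<and> c x \<le> (1::real)) \<and>
    (\<forall>x. (cmod x)\<^sup>2 \<le> 1 - 2 * e \<longrightarrow> c x = 1) \<and> (\<forall>x. 1 - e \<le> (cmod x)\<^sup>2 \<longrightarrow> c x = 0) \<and>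
    (\<forall>x\<in>\<D>. (cx x)\<^sup>2 + (cy x)\<^sup>2 \<le> (18 / \<delta>)\<^sup>2 / (\<tau> x)\<^sup>2) \<and>
    (\<forall>x. (cmod x)\<^sup>2 \<le> 1 - 2 * e \<or> 1 - e \<le> (cmod x)\<^sup>2 \<longrightarrow> cx x = 0 \<and> cy x = 0)"
proof -
  define a where "a = 1 - 2 * e"
  define y where "y s = (s - a) / e" for s :: real
  define k where "k s = max 0 (1 - max 0 (y s) ^ 3) ^ 3" for s
  define k1 where "k1 s = - (9 / e) * (max 0 (1 - max 0 (y s) ^ 3) ^ 2 * max 0 (y s) ^ 2)" for s
  define k2 where "k2 s = - (9 / e) * (max 0 (1 - max 0 (y s) ^ 3) ^ 2 * (2 * max 0 (y s) * (1 / e)) +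
     (2 * max 0 (1 - max 0 (y s) ^ 3) * (- (3 * max 0 (y s) ^ 2 * (1 / e)))) * max 0 (y s) ^ 2)" for s
  have p3: "((\<lambda>t. max 0 t ^ 3) has_real_derivative 3 * max 0 t ^ 2) (at t)" for t :: real
    using DERIV_pos_pow[of 1 t] by (simp add: eval_nat_numeral)
  have p2: "((\<lambda>t. max 0 t ^ 2) has_real_derivative 2 * max 0 t) (at t)" for t :: real
    using DERIV_pos_pow[of 0 t] by (simp add: eval_nat_numeral)
  have dy: "(y has_real_derivative 1 / e) (at s)" for s
    unfolding y_def[abs_def] using e by (auto intro!: derivative_eq_intros)
  have dq: "((\<lambda>s. 1 - max 0 (y s) ^ 3) has_real_derivative - (3 * max 0 (y s) ^ 2 * (1 / e))) (at s)" for s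
    using DERIV_diff[OF DERIV_const[of 1] DERIV_chain2[OF p3 dy]] by simp
  have d1: "(k has_real_derivative k1 s) (at s)" for s
    using DERIV_chain2[OF p3 dq, of s] unfolding k_def[abs_def] k1_def by (simp add: mult_ac)
  have d2: "(k1 has_real_derivative k2 s) (at s)" for s
    using DERIV_cmult[OF DERIV_mult[OF DERIV_chain2[OF p2 dq] DERIV_chain2[OF p2 dy]], where c="- (9 / e)" and x=s]
    unfolding k1_def[abs_def] k2_def by (simp add: algebra_simps)
  have ck2: "continuous_on S k2" for S unfolding k2_def y_def using e by (intro continuous_intros) auto
  have sm: "smooth2 \<D> (\<lambda>x. k ((cmod (x - 0))\<^sup>2)) (\<lambda>x. k1 ((cmod (x - 0))\<^sup>2) * (2 * Re (x - 0))) (\<lambda>x. k1 ((cmod (x - 0))\<^sup>2) * (2 * Im (x - 0)))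
     (\<lambda>x. k1 ((cmod (x - 0))\<^sup>2) * 0 + (k2 ((cmod (x - 0))\<^sup>2) * (2 * Im (x - 0))) * (2 * Re (x - 0)))"
    by (rule smooth2_compose[OF smooth2_dist2 d1 d2 ck2])
  have low: "k s = 1" "k1 s = 0" if "s \<le> 1 - 2 * e" for s
  proof -
    have "y s \<le> 0" using that e by (simp add: y_def a_def divide_le_0_iff)
    thus "k s = 1" "k1 s = 0" by (simp_all add: k_def k1_def max_absorb1)
  qed
  have high: "k s = 0" "k1 s = 0" if "1 - e \<le> s" for s
  proof -
    have "1 \<le> y s" using that e by (simp add: y_def a_def le_divide_eq)
    hence "1 \<le> max 0 (y s) ^ 3" by (intro one_le_power) simp
    thus "k s = 0" "k1 s = 0" by (simp_all add: k_def k1_def max_absorb1)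
  qed
  have k01: "0 \<le> k s" "k s \<le> 1" for s unfolding k_def by (auto intro!: power_le_one)
  have k1b: "\<bar>k1 s\<bar> \<le> 9 / e" for s
  proof (cases "1 - e \<le> s")
    case True thus ?thesis using high(2)[OF True] e by simp
  next
    case False
    hence "y s \<le> 1" using e by (simp add: y_def a_def divide_le_eq)
    hence "max 0 (y s) ^ 2 \<le> 1" by (intro power_le_one) auto
    moreover have "max 0 (1 - max 0 (y s) ^ 3) ^ 2 \<le> 1" by (intro power_le_one) auto
    ultimately have "max 0 (1 - max 0 (y s) ^ 3) ^ 2 * max 0 (y s) ^ 2 \<le> 1 * 1" by (intro mult_mono) auto
    hence "9 / e * (max 0 (1 - max 0 (y s) ^ 3) ^ 2 * max 0 (y s) ^ 2) \<le> 9 / e * 1" using e by (intro mult_left_mono) auto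
    thus ?thesis using e by (simp add: k1_def abs_mult)
  qed
  have grad: "(k1 ((cmod (x - 0))\<^sup>2) * (2 * Re (x - 0)))\<^sup>2 + (k1 ((cmod (x - 0))\<^sup>2) * (2 * Im (x - 0)))\<^sup>2 \<le> (18 / \<delta>)\<^sup>2 / (\<tau> x)\<^sup>2" if x: "x \<in> \<D>" for x
  proof -
    let ?s = "(cmod x)\<^sup>2"
    have t: "\<tau> x > 0" by (rule tau_pos[OF x])
    have x1: "cmod x < 1" using x by simp
    have eq: "(k1 ?s * (2 * Re x))\<^sup>2 + (k1 ?s * (2 * Im x))\<^sup>2 = (2 * k1 ?s * cmod x)\<^sup>2"
      unfolding power_mult_distrib cmod_power2 by (simp add: algebra_simps)
    have "\<bar>2 * k1 ?s * cmod x\<bar> \<le> 18 / (\<delta> * \<tau> x)"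
    proof (cases "?s \<le> 1 - 2 * e")
      case True thus ?thesis using low(2)[OF True] t delta by simp
    next
      case False
      have "\<bar>2 * k1 ?s * cmod x\<bar> \<le> 2 * (9 / e) * 1"
        unfolding abs_mult using k1b[of ?s] x1 e by (intro mult_mono) auto
      also have "\<dots> = 18 / e" by simp
      also have "\<dots> \<le> 18 / (\<delta> * \<tau> x)"
      proof (rule divide_left_mono)
        have "?s \<le> cmod x" using x1 by (simp add: power2_eq_square mult_left_le)
        hence "1 - cmod x < 2 * e" using False by linarith
        thus "\<delta> * \<tau> x \<le> e" using tau_disk[OF x] by linarith
      qed (use e t delta in auto)
      finally show ?thesis .
    qed
    hence "\<bar>2 * k1 ?s * cmod x\<bar>\<^sup>2 \<le> (18 / (\<delta> * \<tau> x))\<^sup>2" by (intro power_mono) auto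
    thus ?thesis unfolding diff_0_right eq power2_abs by (simp add: power_divide power_mult_distrib)
  qed
  show ?thesis
    by (rule exI[of _ "\<lambda>x. k ((cmod (x - 0))\<^sup>2)"], rule exI[of _ "\<lambda>x. k1 ((cmod (x - 0))\<^sup>2) * (2 * Re (x - 0))"],
        rule exI[of _ "\<lambda>x. k1 ((cmod (x - 0))\<^sup>2) * (2 * Im (x - 0))"], rule exI, intro conjI, rule sm)
      (use k01 low high grad in auto)
qed

text \<open>Averaging the bounds for \<open>sig w * g\<close> replaces the square of
  \<open>sig w\<close> by \<open>1 / \<tau>^2\<close>, and \<open>lap_ge\<close> turns the Laplacian
  into a second \<open>1 / \<tau>^2\<close>. Centres with \<open>cmod w <= (1 + \<rho>) / 2\<close>
  suffice for points of \<open>cball 0 \<rho>\<close>, since \<open>\<delta> * \<tau> x\<close> is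
  less than half of \<open>1 - cmod x\<close>.\<close>

lemma testf_tau_bound:
  assumes t: "testf r g gx gy" and \<rho>: "\<rho> < 1" and M: "M \<ge> 0"
    and le: "\<And>w. w \<in> \<D> \<Longrightarrow> cmod w \<le> (1 + \<rho>) / 2 \<Longrightarrow> (n_lap (\<lambda>x. of_real (sig w x) * g x))\<^sup>2 \<le> M"
  shows "(\<integral>\<^sup>+x. ennreal (indicator (cball 0 \<rho>) x * ((cmod (g x))\<^sup>2 / (\<omega> x * (\<tau> x) ^ 4))) \<partial>\<mu>) \<le> ennreal (K * M / cW)"
proof -
  define G where "G x = lap x * (cmod (g x))\<^sup>2 / \<omega> x" for x
  have cG: "continuous_on \<D> G" unfolding G_def using testfD[OF t]
    by (intro cont_div_omega continuous_intros cont_lap)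
  have G0: "G x \<ge> 0" if "x \<in> \<D>" for x
    unfolding G_def using lap_pos[OF that] omega_pos[OF that] by (simp add: lap_def)
  define A where "A = cball (0::complex) ((1 + \<rho>) / 2)"
  have AD: "A \<subseteq> \<D>" using \<rho> by (auto simp: A_def)
  have As': "cball 0 \<rho> \<in> sets \<mu>" using closed_disk_sets[of "cball 0 \<rho>"] cball_subset_ball_iff[of "0::complex" \<rho> 0 1] \<rho> by (simp add: Int_absorb2)
  have As: "A \<in> sets \<mu>" using closed_disk_sets[of A] AD by (simp add: A_def Int_absorb2)
  have "(\<integral>\<^sup>+x. ennreal (indicator (cball 0 \<rho>) x * (G x / (\<tau> x)\<^sup>2)) \<partial>\<mu>) \<le> ennreal (M / cW)"
  proof (rule sig_average[OF As As' _ disk_measurable[OF cG] G0 M])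
    fix x assume x: "x \<in> cball 0 \<rho>" "x \<in> \<D>"
    show "ball x (\<delta> * \<tau> x) \<subseteq> A"
    proof
      fix w assume "w \<in> ball x (\<delta> * \<tau> x)"
      hence "cmod (w - x) < \<delta> * \<tau> x" by (simp add: dist_norm norm_minus_commute)
      moreover have "2 * (\<delta> * \<tau> x) < 1 - cmod x" using tau_disk[OF x(2)] by simp
      moreover have "cmod x \<le> \<rho>" using x(1) by simp
      moreover have "cmod w \<le> cmod x + cmod (w - x)" by (rule norm_triangle_sub)
      ultimately have "cmod w \<le> (1 + \<rho>) / 2" by argo
      thus "w \<in> A" by (simp add: A_def)
    qed
  next
    fix w assume wA: "w \<in> A"
    hence w: "w \<in> \<D>" using AD by blast
    obtain sx sy sxy where "slow_weight \<omega> \<phi> px py pxx pyy (sig w) sx sy sxy (1 / (L\<^sup>2 * (\<tau> w)\<^sup>2))"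
      using sig_slow[OF w] by blast
    then interpret S: slow_weight \<omega> \<phi> px py pxx pyy "sig w" sx sy sxy "1 / (L\<^sup>2 * (\<tau> w)\<^sup>2)" .
    have eq: "lap x * (cmod (of_real (sig w x) * g x))\<^sup>2 / \<omega> x = (sig w x)\<^sup>2 * G x" for x
      by (simp add: G_def norm_mult power_mult_distrib)
    have i: "integrable \<mu> (\<lambda>x. (sig w x)\<^sup>2 * G x)"
      using lap_integrable[OF testf_mult[OF t S.smooth_c]] unfolding eq .
    have "(\<integral>\<^sup>+x. ennreal ((sig w x)\<^sup>2 * G x) \<partial>\<mu>) = ennreal (\<integral>x. (sig w x)\<^sup>2 * G x \<partial>\<mu>)"
      by (rule nn_integral_eq_integral[OF i], rule AE_I2) (simp add: G0)
    also have "(\<integral>x. (sig w x)\<^sup>2 * G x \<partial>\<mu>) = (n_lap (\<lambda>x. of_real (sig w x) * g x))\<^sup>2"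
      unfolding n_lap_sq eq ..
    also have "ennreal \<dots> \<le> ennreal M" using le[OF w] wA by (intro ennreal_leI) (simp add: A_def)
    finally show "(\<integral>\<^sup>+x. ennreal ((sig w x)\<^sup>2 * G x) \<partial>\<mu>) \<le> ennreal M" .
  qed
  hence "ennreal K * (\<integral>\<^sup>+x. ennreal (indicator (cball 0 \<rho>) x * (G x / (\<tau> x)\<^sup>2)) \<partial>\<mu>) \<le> ennreal K * ennreal (M / cW)"
    by (rule mult_left_mono) simp
  also have "\<dots> = ennreal (K * M / cW)" using K1 M cW_pos by (simp add: ennreal_mult[symmetric])
  finally have 1: "ennreal K * (\<integral>\<^sup>+x. ennreal (indicator (cball 0 \<rho>) x * (G x / (\<tau> x)\<^sup>2)) \<partial>\<mu>) \<le> ennreal (K * M / cW)" .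
  note ind = indicator_meas[OF closed_cball, of 0 \<rho>, where 'b=real]
  have "(\<integral>\<^sup>+x. ennreal (indicator (cball 0 \<rho>) x * ((cmod (g x))\<^sup>2 / (\<omega> x * (\<tau> x) ^ 4))) \<partial>\<mu>)
    \<le> (\<integral>\<^sup>+x. ennreal K * ennreal (indicator (cball 0 \<rho>) x * (G x / (\<tau> x)\<^sup>2)) \<partial>\<mu>)"
  proof (rule nn_integral_mono)
    fix x assume "x \<in> space \<mu>"
    hence x: "x \<in> \<D>" by simp
    have tx: "\<tau> x > 0" "\<omega> x > 0" by (rule tau_pos[OF x], rule omega_pos[OF x])
    have "1 / (\<tau> x)\<^sup>2 \<le> K * lap x" using lap_ge[OF x] K1 tx by (simp add: divide_simps mult_ac)
    hence "1 / (\<tau> x)\<^sup>2 * ((cmod (g x))\<^sup>2 / (\<omega> x * (\<tau> x)\<^sup>2)) \<le> (K * lap x) * ((cmod (g x))\<^sup>2 / (\<omega> x * (\<tau> x)\<^sup>2))"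
      using tx by (intro mult_right_mono) auto
    moreover have "1 / (\<tau> x)\<^sup>2 * ((cmod (g x))\<^sup>2 / (\<omega> x * (\<tau> x)\<^sup>2)) = (cmod (g x))\<^sup>2 / (\<omega> x * (\<tau> x) ^ 4)"
      using tx by (simp add: field_simps power_add[symmetric])
    moreover have "(K * lap x) * ((cmod (g x))\<^sup>2 / (\<omega> x * (\<tau> x)\<^sup>2)) = K * (G x / (\<tau> x)\<^sup>2)"
      by (simp add: G_def)
    ultimately have "(cmod (g x))\<^sup>2 / (\<omega> x * (\<tau> x) ^ 4) \<le> K * (G x / (\<tau> x)\<^sup>2)" by argo
    hence "indicator (cball 0 \<rho>) x * ((cmod (g x))\<^sup>2 / (\<omega> x * (\<tau> x) ^ 4)) \<le> indicator (cball 0 \<rho>) x * (K * (G x / (\<tau> x)\<^sup>2))"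
      by (intro mult_left_mono) auto
    thus "ennreal (indicator (cball 0 \<rho>) x * ((cmod (g x))\<^sup>2 / (\<omega> x * (\<tau> x) ^ 4))) \<le> ennreal K * ennreal (indicator (cball 0 \<rho>) x * (G x / (\<tau> x)\<^sup>2))"
      using K1 G0[OF x] by (simp add: ennreal_mult[symmetric] ennreal_leI mult_ac)
  qed
  also have "\<dots> = ennreal K * (\<integral>\<^sup>+x. ennreal (indicator (cball 0 \<rho>) x * (G x / (\<tau> x)\<^sup>2)) \<partial>\<mu>)"
  proof -
    have [measurable]: "G \<in> borel_measurable \<mu>" by (rule disk_measurable[OF cG])
    note ind [measurable]
    show ?thesis by (intro nn_integral_cmult measurable_compose[OF _ measurable_ennreal] borel_measurable_times ind) measurable
  qed
  also note 1
  finally show ?thesis .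
qed

text \<open>The product is split into \<open>g * \<tau>\<close> and \<open>v / \<tau>\<close>, both
  square integrable for the weight.\<close>

lemma tau_prod_integrable:
  assumes [measurable]: "g \<in> borel_measurable \<mu>" "v \<in> borel_measurable \<mu>"
    and gi: "integrable \<mu> (\<lambda>x. (cmod (g x))\<^sup>2 * \<omega> x * (\<tau> x)\<^sup>2)"
    and vi: "integrable \<mu> (\<lambda>x. \<omega> x * (cmod (v x))\<^sup>2 / (\<tau> x)\<^sup>2)"
  shows "integrable \<mu> (\<lambda>x. g x * cnj (v x) * of_real (\<omega> x))"
proof (rule integrable_dominated)
  show "integrable \<mu> (\<lambda>x. (cmod (g x))\<^sup>2 * \<omega> x * (\<tau> x)\<^sup>2 + \<omega> x * (cmod (v x))\<^sup>2 / (\<tau> x)\<^sup>2)"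
    by (rule Bochner_Integration.integrable_add[OF gi vi])
  show "(\<lambda>x. g x * cnj (v x) * of_real (\<omega> x)) \<in> borel_measurable \<mu>" by measurable
  show "AE x in \<mu>. norm (g x * cnj (v x) * of_real (\<omega> x)) \<le> norm ((cmod (g x))\<^sup>2 * \<omega> x * (\<tau> x)\<^sup>2 + \<omega> x * (cmod (v x))\<^sup>2 / (\<tau> x)\<^sup>2)"
  proof (rule AE_I2)
    fix x assume "x \<in> space \<mu>"
    hence x: "\<tau> x > 0" "\<omega> x > 0" using tau_pos omega_pos by auto
    let ?a = "cmod (g x) * \<tau> x" and ?b = "cmod (v x) / \<tau> x"
    have ab: "?a * ?b = cmod (g x) * cmod (v x)" using x by simp
    have "?a * ?b \<le> ?a\<^sup>2 + ?b\<^sup>2"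
    proof -
      have "2 * ?a * ?b \<le> ?a\<^sup>2 + ?b\<^sup>2" by (rule sum_squares_bound)
      moreover have "0 \<le> ?a * ?b" using x by (intro mult_nonneg_nonneg) auto
      ultimately show ?thesis by argo
    qed
    hence "\<omega> x * (cmod (g x) * cmod (v x)) \<le> \<omega> x * (?a\<^sup>2 + ?b\<^sup>2)" using x unfolding ab by (intro mult_left_mono) auto
    also have "\<dots> = (cmod (g x))\<^sup>2 * \<omega> x * (\<tau> x)\<^sup>2 + \<omega> x * (cmod (v x))\<^sup>2 / (\<tau> x)\<^sup>2"
      by (simp add: power_mult_distrib power_divide distrib_left)
    finally have "norm (g x * cnj (v x) * of_real (\<omega> x)) \<le> (cmod (g x))\<^sup>2 * \<omega> x * (\<tau> x)\<^sup>2 + \<omega> x * (cmod (v x))\<^sup>2 / (\<tau> x)\<^sup>2"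
      using x by (simp add: norm_mult mult_ac)
    thus "norm (g x * cnj (v x) * of_real (\<omega> x)) \<le> norm ((cmod (g x))\<^sup>2 * \<omega> x * (\<tau> x)\<^sup>2 + \<omega> x * (cmod (v x))\<^sup>2 / (\<tau> x)\<^sup>2)"
      unfolding real_norm_def by (rule order_trans[OF _ abs_ge_self])
  qed
qed

text \<open>Here one averages over all centres: bounds for \<open>sig w * v\<close> that are uniform
  in \<open>w\<close> make \<open>v / \<tau>\<close> square integrable for the weight.\<close>

lemma sig_average_integrable:
  assumes v: "v \<in> L2 N" and le: "\<And>w. w \<in> \<D> \<Longrightarrow> (n2 N (\<lambda>x. of_real (sig w x) * v x))\<^sup>2 \<le> M"
  shows "integrable \<mu> (\<lambda>x. \<omega> x * (cmod (v x))\<^sup>2 / (\<tau> x)\<^sup>2)"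
proof -
  have vm [measurable]: "v \<in> borel_measurable \<mu>" using v by (simp add: L2_N_iff)
  have M: "M \<ge> 0" using order_trans[OF zero_le_power2 le[of 0]] by simp
  have Ds: "\<D> \<in> sets \<mu>" using sets.top[of \<mu>] by simp
  have "(\<integral>\<^sup>+x. ennreal (indicator \<D> x * ((\<omega> x * (cmod (v x))\<^sup>2) / (\<tau> x)\<^sup>2)) \<partial>\<mu>) \<le> ennreal (M / cW)"
  proof (rule sig_average[OF Ds Ds _ _ _ M])
    fix x assume x: "x \<in> \<D>"
    show "ball x (\<delta> * \<tau> x) \<subseteq> \<D>" by (rule subset_trans[OF ball_subset_cball tball_sub(1)[OF x]])
    show "0 \<le> \<omega> x * (cmod (v x))\<^sup>2" using omega_pos[OF x] by simp
  next
    show "(\<lambda>x. \<omega> x * (cmod (v x))\<^sup>2) \<in> borel_measurable \<mu>" by measurable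
  next
    fix w assume w: "w \<in> \<D>"
    obtain sx sy sxy where "slow_weight \<omega> \<phi> px py pxx pyy (sig w) sx sy sxy (1 / (L\<^sup>2 * (\<tau> w)\<^sup>2))"
      using sig_slow[OF w] by blast
    then interpret S: slow_weight \<omega> \<phi> px py pxx pyy "sig w" sx sy sxy "1 / (L\<^sup>2 * (\<tau> w)\<^sup>2)" .
    let ?v = "\<lambda>x. of_real (sig w x) * v x"
    have vL: "?v \<in> L2 N" by (rule S.rho_L2[OF v])
    have eq: "\<omega> x * (cmod (?v x))\<^sup>2 = (sig w x)\<^sup>2 * (\<omega> x * (cmod (v x))\<^sup>2)" for x
      by (simp add: norm_mult power_mult_distrib)
    have i: "integrable \<mu> (\<lambda>x. (sig w x)\<^sup>2 * (\<omega> x * (cmod (v x))\<^sup>2))" and m: "?v \<in> borel_measurable \<mu>"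
      using vL unfolding L2_N_iff eq by auto
    have "(\<integral>\<^sup>+x. ennreal ((sig w x)\<^sup>2 * (\<omega> x * (cmod (v x))\<^sup>2)) \<partial>\<mu>) = ennreal (\<integral>x. (sig w x)\<^sup>2 * (\<omega> x * (cmod (v x))\<^sup>2) \<partial>\<mu>)"
      by (rule nn_integral_eq_integral[OF i], rule AE_I2) (simp add: omega_pos less_imp_le)
    also have "(\<integral>x. (sig w x)\<^sup>2 * (\<omega> x * (cmod (v x))\<^sup>2) \<partial>\<mu>) = (n2 N ?v)\<^sup>2"
      unfolding n2_N[OF m] eq ..
    also have "ennreal ((n2 N ?v)\<^sup>2) \<le> ennreal M" by (rule ennreal_leI[OF le[OF w]])
    finally show "(\<integral>\<^sup>+x. ennreal ((sig w x)\<^sup>2 * (\<omega> x * (cmod (v x))\<^sup>2)) \<partial>\<mu>) \<le> ennreal M" .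
  qed
  also have "(\<integral>\<^sup>+x. ennreal (indicator \<D> x * ((\<omega> x * (cmod (v x))\<^sup>2) / (\<tau> x)\<^sup>2)) \<partial>\<mu>) = (\<integral>\<^sup>+x. ennreal (\<omega> x * (cmod (v x))\<^sup>2 / (\<tau> x)\<^sup>2) \<partial>\<mu>)"
    by (rule nn_integral_cong) simp
  finally have "(\<integral>\<^sup>+x. ennreal (\<omega> x * (cmod (v x))\<^sup>2 / (\<tau> x)\<^sup>2) \<partial>\<mu>) < \<infinity>"
    using le_less_trans ennreal_less_top by (metis infinity_ennreal_def)
  thus ?thesis by (intro integrableI_nonneg) (auto simp: omega_pos less_imp_le)
qed

text \<open>Testing the holomorphic \<open>g\<close> with \<open>c * \<gamma> n\<close> moves the
  derivative from \<open>\<gamma> n\<close> to the cutoff, so the pairing becomes an integral over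
  the layer where \<open>c\<close> is not constant. There
  \<open>|grad c| <= 18 / (\<delta> * \<tau>)\<close>, and Cauchy-Schwarz pairs
  \<open>g * \<tau>\<close>, restricted to the layer, with \<open>\<gamma> n / \<tau>^2\<close>. The
  latter is bounded by \<open>testf_tau_bound\<close>, independently of the cutoff once
  \<open>n\<close> has tended to infinity.\<close>

lemma cutoff_estimate:
  assumes g: "g holomorphic_on \<D>" and gi: "integrable \<mu> (\<lambda>x. (cmod (g x))\<^sup>2 * \<omega> x * (\<tau> x)\<^sup>2)"
    and f: "f \<in> A2" and u: "u \<in> L2 N" and t: "\<And>n::nat. testf (s n) (\<gamma> n) (\<gamma>x n) (\<gamma>y n)"
    and lim: "(\<lambda>n. n2 N (\<lambda>z. TT (\<gamma>x n) (\<gamma>y n) z - (u z - f z))) \<longlonglongrightarrow> 0"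
    and M: "\<And>w. w \<in> \<D> \<Longrightarrow> (n2 N (\<lambda>x. of_real (sig w x) * u x))\<^sup>2 \<le> M"
    and e: "0 < e" "e < 1 / 4"
    and c: "smooth2 \<D> c cx cy cxy" "\<And>x. 1 - e \<le> (cmod x)\<^sup>2 \<Longrightarrow> c x = 0"
      "\<And>x. x \<in> \<D> \<Longrightarrow> (cx x)\<^sup>2 + (cy x)\<^sup>2 \<le> (18 / \<delta>)\<^sup>2 / (\<tau> x)\<^sup>2"
      "\<And>x. (cmod x)\<^sup>2 \<le> 1 - 2 * e \<or> 1 - e \<le> (cmod x)\<^sup>2 \<Longrightarrow> cx x = 0 \<and> cy x = 0"
  shows "(cmod (ip N (\<lambda>x. of_real (c x) * g x) (\<lambda>x. u x - f x)))\<^sup>2 \<le>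
    (\<integral>x. indicator {x. 1 - 2 * e \<le> (cmod x)\<^sup>2} x * ((cmod (g x))\<^sup>2 * \<omega> x * (\<tau> x)\<^sup>2) \<partial>\<mu>) * ((18 / \<delta>)\<^sup>2 * (K * (9 * M) / cW))"
    (is "_ \<le> ?T * _")
proof -
  define \<rho> where "\<rho> = sqrt (1 - e)"
  have rho: "\<rho> < 1" "0 \<le> \<rho>" "\<rho>\<^sup>2 = 1 - e" using e by (auto simp: \<rho>_def)
  have out: "1 - e \<le> (cmod x)\<^sup>2" if "\<rho> < cmod x" for x
    using power_mono[of \<rho> "cmod x" 2] that rho by simp
  have M0: "M \<ge> 0" using order_trans[OF zero_le_power2 M[of 0]] by simp
  define d where "d n = n2 N (\<lambda>z. TT (\<gamma>x n) (\<gamma>y n) z - (u z - f z))" for n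
  note C = smooth2D[OF c(1)]
  have gc: "continuous_on \<D> g" by (rule holomorphic_on_imp_continuous_on[OF g])
  have cgL: "(\<lambda>x. of_real (c x) * g x) \<in> L2 N" (is "?cg \<in> _")
    by (rule L2_N_compact[OF _ rho(1)]) (use C gc c(2)[OF out] in \<open>auto intro!: continuous_intros\<close>)
  define A where "A = cball (0::complex) ((1 + \<rho>) / 2)"
  have AD: "A \<subseteq> \<D>" using rho by (auto simp: A_def)
  have cB: "continuous_on \<D> (\<lambda>w. 1 / (L\<^sup>2 * (\<tau> w)\<^sup>2))"
  proof (intro continuous_intros tau_cont ballI)
    fix w assume "w \<in> \<D>" thus "L\<^sup>2 * (\<tau> w)\<^sup>2 \<noteq> 0" using sig_den(1)[of w] by linarith
  qed
  have "compact A" by (simp add: A_def)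
  \<comment> \<open>\<open>B\<close> bounds the weights \<open>sig w\<close> for all centres that
    occur. It may deteriorate as \<open>e\<close> tends to 0, but it multiplies \<open>d n\<close>,
    which tends to 0 for fixed \<open>e\<close>.\<close>
  then obtain B where B: "\<And>w. w \<in> A \<Longrightarrow> norm (1 / (L\<^sup>2 * (\<tau> w)\<^sup>2)) \<le> B"
    using compact_continuous_bound[OF _ continuous_on_subset[OF cB AD]] by blast
  define m where "m n = (3 * (B * d n + sqrt M))\<^sup>2" for n
  define Tl where "Tl = {x::complex. 1 - 2 * e \<le> (cmod x)\<^sup>2}"
  have Tlc: "closed Tl" unfolding Tl_def by (intro closed_Collect_le continuous_intros)
  note indicator_meas[OF Tlc, where 'b=real, measurable]
  have [measurable]: "g \<in> borel_measurable \<mu>" by (rule holomorphic_meas[OF g])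
  define h1 where "h1 x = complex_of_real (indicator Tl x * (sqrt (\<omega> x) * \<tau> x)) * g x" for x
  have h1m: "h1 \<in> borel_measurable \<mu>" unfolding h1_def by measurable
  have h1s: "(cmod (h1 x))\<^sup>2 = indicator Tl x * ((cmod (g x))\<^sup>2 * \<omega> x * (\<tau> x)\<^sup>2)" if "x \<in> \<D>" for x
    using omega_pos[OF that] unfolding h1_def norm_mult norm_of_real by (auto simp: power_mult_distrib indicator_def)
  have "integrable \<mu> (\<lambda>x. (cmod (h1 x))\<^sup>2)"
  proof (rule integrable_dominated[OF gi])
    show "AE x in \<mu>. norm ((cmod (h1 x))\<^sup>2) \<le> norm ((cmod (g x))\<^sup>2 * \<omega> x * (\<tau> x)\<^sup>2)"
      by (rule AE_I2) (simp add: h1s, simp add: indicator_def)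
  qed (use h1m in measurable)
  hence h1L: "h1 \<in> L2 \<mu>" using h1m by (simp add: L2_def)
  have h1n: "(n2 \<mu> h1)\<^sup>2 = ?T"
    unfolding n2_sq Tl_def[symmetric] by (rule lint_cong) (auto simp: h1s)
  have est: "(cmod (ip N ?cg (TT (\<gamma>x n) (\<gamma>y n))))\<^sup>2 \<le> ?T * ((18 / \<delta>)\<^sup>2 * (K * m n / cW))" for n
  proof -
    note T = testfD[OF t[of n]]
    have nl: "(n_lap (\<lambda>x. of_real (sig w x) * \<gamma> n x))\<^sup>2 \<le> m n" if w: "w \<in> \<D>" and wA: "cmod w \<le> (1 + \<rho>) / 2" for w
    proof -
      obtain sx sy sxy where "slow_weight \<omega> \<phi> px py pxx pyy (sig w) sx sy sxy (1 / (L\<^sup>2 * (\<tau> w)\<^sup>2))"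
        using sig_slow[OF w] by blast
      then interpret S: slow_weight \<omega> \<phi> px py pxx pyy "sig w" sx sy sxy "1 / (L\<^sup>2 * (\<tau> w)\<^sup>2)" .
      have lp: "0 \<le> lap x" if "x \<in> \<D>" for x using lap_pos[OF that] by (simp add: lap_def)
      have "w \<in> A" using wA by (simp add: A_def)
      hence "norm (1 / (L\<^sup>2 * (\<tau> w)\<^sup>2)) \<le> B" by (rule B)
      hence Bw: "1 / (L\<^sup>2 * (\<tau> w)\<^sup>2) \<le> B" unfolding real_norm_def by linarith
      have "n2 N (\<lambda>x. of_real (sig w x) * u x) \<le> sqrt M" using M[OF w] by (rule real_le_rsqrt)
      moreover have "1 / (L\<^sup>2 * (\<tau> w)\<^sup>2) * d n \<le> B * d n" by (rule mult_right_mono[OF Bw]) (simp add: d_def)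
      ultimately have "n_lap (\<lambda>x. of_real (sig w x) * \<gamma> n x) \<le> 3 * (B * d n + sqrt M)"
        using order_trans[OF S.agmon_step(2)[OF f u t[of n]] S.agmon_step(1)[OF f u t[of n]]] unfolding d_def[symmetric] by argo
      thus ?thesis unfolding m_def
      proof (rule power_mono)
        show "0 \<le> n_lap (\<lambda>x. of_real (sig w x) * \<gamma> n x)" unfolding n_lap_def
          by (rule real_sqrt_ge_zero, rule integral_nonneg_AE, rule AE_I2)
            (intro divide_nonneg_nonneg mult_nonneg_nonneg, simp_all add: lp omega_pos less_imp_le)
      qed
    qed
    define h2 where "h2 x = complex_of_real (1 / (sqrt (\<omega> x) * \<tau> x)) * ((of_real (cx x) - \<i> * of_real (cy x)) * \<gamma> n x)" for x
    have h2c: "continuous_on \<D> h2"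
      unfolding h2_def
    proof (intro continuous_intros cont_omega tau_cont C T ballI)
      fix x assume x: "x \<in> \<D>" show "sqrt (\<omega> x) * \<tau> x \<noteq> 0" using tau_pos[OF x] omega_pos[OF x] by simp
    qed
    have h2z: "h2 x = 0" if "s n < cmod x" "cmod x < 1" for x using T(7)[OF that] by (simp add: h2_def)
    have h2m: "h2 \<in> borel_measurable \<mu>" by (rule disk_measurable[OF h2c])
    have h2i: "integrable \<mu> (\<lambda>x. (cmod (h2 x))\<^sup>2)"
      by (rule integrable_disk_compact[OF _ T(1)]) (use h2c h2z in \<open>auto intro!: continuous_intros\<close>)
    have h2L: "h2 \<in> L2 \<mu>" using h2m h2i by (simp add: L2_def)
    note ind = indicator_meas[OF closed_cball, of 0 \<rho>, where 'b=real]
    have h2s: "(cmod (h2 x))\<^sup>2 \<le> (18 / \<delta>)\<^sup>2 * (indicator (cball 0 \<rho>) x * ((cmod (\<gamma> n x))\<^sup>2 / (\<omega> x * (\<tau> x) ^ 4)))" if x: "x \<in> \<D>" for x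
    proof (cases "x \<in> cball 0 \<rho>")
      case True
      have tx: "\<tau> x > 0" "\<omega> x > 0" by (rule tau_pos[OF x], rule omega_pos[OF x])
      have k: "(cmod (of_real (cx x) - \<i> * of_real (cy x)))\<^sup>2 = (cx x)\<^sup>2 + (cy x)\<^sup>2" by (simp add: cmod_power2)
      have "(cmod (h2 x))\<^sup>2 = ((cx x)\<^sup>2 + (cy x)\<^sup>2) * ((cmod (\<gamma> n x))\<^sup>2 / (\<omega> x * (\<tau> x)\<^sup>2))"
        unfolding h2_def norm_mult norm_of_real power_mult_distrib k using tx by (simp add: power_divide power_mult_distrib)
      also have "\<dots> \<le> ((18 / \<delta>)\<^sup>2 / (\<tau> x)\<^sup>2) * ((cmod (\<gamma> n x))\<^sup>2 / (\<omega> x * (\<tau> x)\<^sup>2))"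
        using tx by (intro mult_right_mono c(3)[OF x]) auto
      also have "\<dots> = (18 / \<delta>)\<^sup>2 * ((cmod (\<gamma> n x))\<^sup>2 / (\<omega> x * (\<tau> x) ^ 4))"
        using tx by (simp add: field_simps power_add[symmetric])
      finally show ?thesis using True by simp
    next
      case False
      hence "1 - e \<le> (cmod x)\<^sup>2" by (intro out) simp
      hence "cx x = 0" "cy x = 0" using c(4)[of x] by auto
      thus ?thesis using False by (simp add: h2_def)
    qed
    have h2n: "(n2 \<mu> h2)\<^sup>2 \<le> (18 / \<delta>)\<^sup>2 * (K * m n / cW)"
    proof -
      have "ennreal ((n2 \<mu> h2)\<^sup>2) = (\<integral>\<^sup>+x. ennreal ((cmod (h2 x))\<^sup>2) \<partial>\<mu>)"
        unfolding n2_sq by (rule nn_integral_eq_integral[OF h2i, symmetric]) simp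
      also have "\<dots> \<le> (\<integral>\<^sup>+x. ennreal ((18 / \<delta>)\<^sup>2) * ennreal (indicator (cball 0 \<rho>) x * ((cmod (\<gamma> n x))\<^sup>2 / (\<omega> x * (\<tau> x) ^ 4))) \<partial>\<mu>)"
      proof (rule nn_integral_mono)
        fix x assume "x \<in> space \<mu>"
        hence x: "x \<in> \<D>" by simp
        have "0 \<le> indicator (cball 0 \<rho>) x * ((cmod (\<gamma> n x))\<^sup>2 / (\<omega> x * (\<tau> x) ^ 4))"
          using tau_pos[OF x] omega_pos[OF x] by simp
        thus "ennreal ((cmod (h2 x))\<^sup>2) \<le> ennreal ((18 / \<delta>)\<^sup>2) * ennreal (indicator (cball 0 \<rho>) x * ((cmod (\<gamma> n x))\<^sup>2 / (\<omega> x * (\<tau> x) ^ 4)))"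
          using ennreal_leI[OF h2s[OF x]] by (simp only: ennreal_mult zero_le_power2)
      qed
      also have "\<dots> = ennreal ((18 / \<delta>)\<^sup>2) * (\<integral>\<^sup>+x. ennreal (indicator (cball 0 \<rho>) x * ((cmod (\<gamma> n x))\<^sup>2 / (\<omega> x * (\<tau> x) ^ 4))) \<partial>\<mu>)"
      proof (rule nn_integral_cmult)
        have [measurable]: "\<gamma> n \<in> borel_measurable \<mu>" by (rule disk_measurable[OF T(4)])
        show "(\<lambda>x. ennreal (indicator (cball 0 \<rho>) x * ((cmod (\<gamma> n x))\<^sup>2 / (\<omega> x * (\<tau> x) ^ 4)))) \<in> borel_measurable \<mu>"
          by (intro measurable_compose[OF _ measurable_ennreal] borel_measurable_times ind) measurable
      qed
      also have "\<dots> \<le> ennreal ((18 / \<delta>)\<^sup>2) * ennreal (K * m n / cW)"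
        by (rule mult_left_mono[OF testf_tau_bound[OF t[of n] rho(1) _ nl]]) (simp_all add: m_def)
      also have "\<dots> = ennreal ((18 / \<delta>)\<^sup>2 * (K * m n / cW))"
        using K1 cW_pos by (simp only: ennreal_mult[symmetric] zero_le_power2 m_def divide_nonneg_pos mult_nonneg_nonneg order_trans[OF zero_le_one])
      finally show ?thesis using K1 cW_pos by (simp add: m_def)
    qed
    let ?a = "\<lambda>x. of_real (c x) * g x * cnj (\<gamma>x n x - \<i> * \<gamma>y n x)"
    let ?b = "\<lambda>x. h1 x * cnj (h2 x)"
    have ai: "integrable \<mu> ?a"
      by (rule integrable_disk_compact[OF _ T(1)]) (use C gc T in \<open>auto intro!: continuous_intros\<close>)
    have bi: "integrable \<mu> ?b" by (rule L2_prod_integrable[OF h1L h2L])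
    have bx: "?b x = g x * cnj ((of_real (cx x) - \<i> * of_real (cy x)) * \<gamma> n x)" if x: "x \<in> \<D>" for x
    proof (cases "x \<in> Tl")
      case True
      have "sqrt (\<omega> x) * \<tau> x \<noteq> 0" using tau_pos[OF x] omega_pos[OF x] by simp
      hence "complex_of_real (sqrt (\<omega> x) * \<tau> x) * complex_of_real (1 / (sqrt (\<omega> x) * \<tau> x)) = 1"
        unfolding of_real_mult[symmetric] by simp
      hence "\<And>p q. complex_of_real (sqrt (\<omega> x) * \<tau> x) * p * (complex_of_real (1 / (sqrt (\<omega> x) * \<tau> x)) * q) = p * q"
        by (metis (no_types, lifting) mult.assoc mult.commute mult.right_neutral)
      thus ?thesis using True unfolding h1_def h2_def by (simp del: of_real_mult of_real_divide)
    next
      case False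
      hence "cx x = 0" "cy x = 0" using c(4)[of x] by (auto simp: Tl_def)
      thus ?thesis by (simp add: h2_def)
    qed
    have cS: "smooth2 \<D> (\<lambda>z. complex_of_real (c z)) (\<lambda>z. of_real (cx z)) (\<lambda>z. of_real (cy z)) (\<lambda>z. of_real (cxy z))"
      by (rule smooth2_linear[OF bounded_linear_of_real c(1)])
    \<comment> \<open>Orthogonality of \<open>g\<close> to the derivatives of the test function
      \<open>c * \<gamma> n\<close>, which the product rule splits into the wanted pairing
      \<open>?a\<close> and the layer term \<open>?b\<close>.\<close>
    have "0 = (\<integral>x. g x * cnj ((of_real (c x) * \<gamma>x n x + of_real (cx x) * \<gamma> n x) - \<i> * (of_real (c x) * \<gamma>y n x + of_real (cy x) * \<gamma> n x)) \<partial>\<mu>)"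
      by (rule holomorphic_testf[OF g testf_mult[OF t cS], symmetric])
    also have "\<dots> = (\<integral>x. ?a x + ?b x \<partial>\<mu>)"
      by (rule lint_cong[OF refl], subst bx) (simp_all add: algebra_simps)
    also have "\<dots> = (\<integral>x. ?a x \<partial>\<mu>) + ip \<mu> h1 h2"
      unfolding ip_def by (rule Bochner_Integration.integral_add[OF ai bi])
    finally have "(\<integral>x. ?a x \<partial>\<mu>) = - ip \<mu> h1 h2" by (simp add: eq_neg_iff_add_eq_0)
    hence "cmod (ip N ?cg (TT (\<gamma>x n) (\<gamma>y n))) = cmod (ip \<mu> h1 h2)"
      unfolding ip_TT[OF t cgL] by simp
    also have "\<dots> \<le> n2 \<mu> h1 * n2 \<mu> h2" by (rule ip_Cauchy_Schwarz[OF h1L h2L])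
    finally have "(cmod (ip N ?cg (TT (\<gamma>x n) (\<gamma>y n))))\<^sup>2 \<le> (n2 \<mu> h1 * n2 \<mu> h2)\<^sup>2" by (rule power_mono) simp
    also have "\<dots> = ?T * (n2 \<mu> h2)\<^sup>2" unfolding power_mult_distrib h1n ..
    also have "\<dots> \<le> ?T * ((18 / \<delta>)\<^sup>2 * (K * m n / cW))"
      by (rule mult_left_mono[OF h2n]) (simp add: h1n[symmetric])
    finally show ?thesis .
  qed
  have uL: "(\<lambda>z. u z - f z) \<in> L2 N" by (rule L2_diff[OF u A2D(1)[OF f]])
  have l1: "(\<lambda>n. (cmod (ip N ?cg (TT (\<gamma>x n) (\<gamma>y n))))\<^sup>2) \<longlonglongrightarrow> (cmod (ip N ?cg (\<lambda>x. u x - f x)))\<^sup>2"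
  proof -
    have "(\<lambda>n. (cmod (ip N (TT (\<gamma>x n) (\<gamma>y n)) ?cg))\<^sup>2) \<longlonglongrightarrow> (cmod (ip N (\<lambda>x. u x - f x) ?cg))\<^sup>2"
      by (intro tendsto_intros ip_tendsto_left[OF TT_L2[OF t] uL cgL lim])
    moreover have "cmod (ip N a b) = cmod (ip N b a)" for a b by (subst ip_commute) simp
    ultimately show ?thesis by simp
  qed
  have l2: "(\<lambda>n. ?T * ((18 / \<delta>)\<^sup>2 * (K * m n / cW))) \<longlonglongrightarrow> ?T * ((18 / \<delta>)\<^sup>2 * (K * (3 * (B * 0 + sqrt M))\<^sup>2 / cW))"
    unfolding m_def d_def using cW_pos by (intro tendsto_intros lim) simp
  have "(3 * (B * 0 + sqrt M))\<^sup>2 = 9 * M" using M0 by (simp add: power_mult_distrib)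
  with LIMSEQ_le[OF l1 l2] est show ?thesis by auto
qed

lemma sig_agmon:
  assumes f: "f \<in> A2" and u: "u \<in> L2 N" and t: "\<And>n::nat. testf (s n) (\<gamma> n) (\<gamma>x n) (\<gamma>y n)"
    and lim: "(\<lambda>n. n2 N (\<lambda>z. TT (\<gamma>x n) (\<gamma>y n) z - (u z - f z))) \<longlonglongrightarrow> 0"
    and M: "(n2 N (\<lambda>x. of_real (sig w x) * u x))\<^sup>2 \<le> M" and w: "w \<in> \<D>"
  shows "(n2 N (\<lambda>x. of_real (sig w x) * (u x - f x)))\<^sup>2 \<le> 9 * M" "(n2 N (\<lambda>x. of_real (sig w x) * f x))\<^sup>2 \<le> 16 * M"
proof -
  obtain sx sy sxy where "slow_weight \<omega> \<phi> px py pxx pyy (sig w) sx sy sxy (1 / (L\<^sup>2 * (\<tau> w)\<^sup>2))"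
    using sig_slow[OF w] by blast
  then interpret S: slow_weight \<omega> \<phi> px py pxx pyy "sig w" sx sy sxy "1 / (L\<^sup>2 * (\<tau> w)\<^sup>2)" .
  have "(n2 N (\<lambda>x. of_real (sig w x) * (u x - f x)))\<^sup>2 \<le> (3 * n2 N (\<lambda>x. of_real (sig w x) * u x))\<^sup>2"
    by (rule power_mono[OF S.agmon(1)[OF f u t lim]]) simp
  thus "(n2 N (\<lambda>x. of_real (sig w x) * (u x - f x)))\<^sup>2 \<le> 9 * M" using M unfolding power_mult_distrib by simp
  have "(n2 N (\<lambda>x. of_real (sig w x) * f x))\<^sup>2 \<le> (4 * n2 N (\<lambda>x. of_real (sig w x) * u x))\<^sup>2"
    by (rule power_mono[OF S.agmon(2)[OF f u t lim]]) simp
  thus "(n2 N (\<lambda>x. of_real (sig w x) * f x))\<^sup>2 \<le> 16 * M" using M unfolding power_mult_distrib by simp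
qed

text \<open>The cutoffs tend to 1. The pairings converge by dominated convergence, since
  \<open>g * \<tau>\<close> and \<open>(u - f) / \<tau>\<close> are square integrable for the
  weight, while the bound of \<open>cutoff_estimate\<close> is the tail of a convergent integral.
  Thus \<open>u - f\<close> is orthogonal to a space of holomorphic functions larger than
  \<open>A2\<close>.\<close>

lemma complement_orthogonal:
  assumes g: "g holomorphic_on \<D>" and gi: "integrable \<mu> (\<lambda>x. (cmod (g x))\<^sup>2 * \<omega> x * (\<tau> x)\<^sup>2)"
    and f: "f \<in> A2" and u: "u \<in> L2 N" and t: "\<And>n::nat. testf (s n) (\<gamma> n) (\<gamma>x n) (\<gamma>y n)"
    and lim: "(\<lambda>n. n2 N (\<lambda>z. TT (\<gamma>x n) (\<gamma>y n) z - (u z - f z))) \<longlonglongrightarrow> 0"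
    and M: "\<And>w. w \<in> \<D> \<Longrightarrow> (n2 N (\<lambda>x. of_real (sig w x) * u x))\<^sup>2 \<le> M"
  shows "integrable \<mu> (\<lambda>x. g x * cnj (u x - f x) * of_real (\<omega> x))"
    "(\<integral>x. g x * cnj (u x - f x) * of_real (\<omega> x) \<partial>\<mu>) = 0"
proof -
  define h where "h x = g x * cnj (u x - f x) * of_real (\<omega> x)" for x
  define G where "G x = (cmod (g x))\<^sup>2 * \<omega> x * (\<tau> x)\<^sup>2" for x
  have uL: "(\<lambda>z. u z - f z) \<in> L2 N" by (rule L2_diff[OF u A2D(1)[OF f]])
  have um [measurable]: "(\<lambda>z. u z - f z) \<in> borel_measurable \<mu>" using uL by (simp add: L2_N_iff)
  have gm [measurable]: "g \<in> borel_measurable \<mu>" by (rule holomorphic_meas[OF g])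
  have hi: "integrable \<mu> h" unfolding h_def
    by (rule tau_prod_integrable[OF gm um gi sig_average_integrable[OF uL sig_agmon(1)[OF f u t lim M]]])
  thus "integrable \<mu> (\<lambda>x. g x * cnj (u x - f x) * of_real (\<omega> x))" unfolding h_def .
  have Gm [measurable]: "G \<in> borel_measurable \<mu>" unfolding G_def by measurable
  define e where "e k = 1 / (real k + 5)" for k
  have e: "0 < e k" "e k < 1 / 4" for k by (auto simp: e_def divide_simps)
  have el: "e \<longlonglongrightarrow> 0" unfolding e_def by real_asymp
  define C where "C = (18 / \<delta>)\<^sup>2 * (K * (9 * M) / cW)"
  define T where "T k = (\<integral>x. indicator {x. 1 - 2 * e k \<le> (cmod x)\<^sup>2} x * G x \<partial>\<mu>)" for k
  have "\<exists>c. c \<in> borel_measurable \<mu> \<and> (\<forall>x. 0 \<le> c x \<and> c x \<le> (1::real)) \<and> (\<forall>x. (cmod x)\<^sup>2 \<le> 1 - 2 * e k \<longrightarrow> c x = 1) \<and>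
      (cmod (ip N (\<lambda>x. of_real (c x) * g x) (\<lambda>x. u x - f x)))\<^sup>2 \<le> T k * C" for k
  proof -
    obtain c cx cy cxy where c: "smooth2 \<D> c cx cy cxy" "\<forall>x. 0 \<le> c x \<and> c x \<le> (1::real)"
      "\<forall>x. (cmod x)\<^sup>2 \<le> 1 - 2 * e k \<longrightarrow> c x = 1" "\<forall>x. 1 - e k \<le> (cmod x)\<^sup>2 \<longrightarrow> c x = 0"
      "\<forall>x\<in>\<D>. (cx x)\<^sup>2 + (cy x)\<^sup>2 \<le> (18 / \<delta>)\<^sup>2 / (\<tau> x)\<^sup>2"
      "\<forall>x. (cmod x)\<^sup>2 \<le> 1 - 2 * e k \<or> 1 - e k \<le> (cmod x)\<^sup>2 \<longrightarrow> cx x = 0 \<and> cy x = 0"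
      using cutoff_exists[OF e[of k]] by (elim exE conjE)
    have "c \<in> borel_measurable \<mu>" using smooth2D[OF c(1)] by (intro disk_measurable)
    moreover have "(cmod (ip N (\<lambda>x. of_real (c x) * g x) (\<lambda>x. u x - f x)))\<^sup>2 \<le> T k * C"
      unfolding T_def C_def G_def
      by (rule cutoff_estimate[OF g gi f u t lim M e c(1)]) (use c(4,5,6) in blast)+
    ultimately show ?thesis using c(2,3) by (intro exI[of _ c] conjI)
  qed
  then obtain c where c0: "\<forall>k. c k \<in> borel_measurable \<mu> \<and> (\<forall>x. 0 \<le> c k x \<and> c k x \<le> (1::real)) \<and> (\<forall>x. (cmod x)\<^sup>2 \<le> 1 - 2 * e k \<longrightarrow> c k x = 1) \<and>
      (cmod (ip N (\<lambda>x. of_real (c k x) * g x) (\<lambda>x. u x - f x)))\<^sup>2 \<le> T k * C"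
    by (rule exE[OF choice[OF allI]])
  have c: "\<And>k. c k \<in> borel_measurable \<mu>" "\<And>k x. 0 \<le> c k x" "\<And>k x. c k x \<le> (1::real)"
    "\<And>k x. (cmod x)\<^sup>2 \<le> 1 - 2 * e k \<Longrightarrow> c k x = 1"
    "\<And>k. (cmod (ip N (\<lambda>x. of_real (c k x) * g x) (\<lambda>x. u x - f x)))\<^sup>2 \<le> T k * C"
    using c0 by blast+
  note c(1) [measurable]
  have hm [measurable]: "h \<in> borel_measurable \<mu>" using hi by auto
  have ipc: "ip N (\<lambda>x. of_real (c k x) * g x) (\<lambda>x. u x - f x) = (\<integral>x. of_real (c k x) * h x \<partial>\<mu>)" for k
    by (subst ip_N) (measurable, simp add: pairing_def h_def mult_ac)
  have ev: "\<forall>\<^sub>F k in sequentially. (cmod x)\<^sup>2 < 1 - 2 * e k" if x: "x \<in> \<D>" for x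
  proof -
    have "(\<lambda>k. 1 - 2 * e k) \<longlonglongrightarrow> 1 - 2 * 0" by (intro tendsto_intros el)
    moreover have "(cmod x)\<^sup>2 < 1 - 2 * 0" using x by (simp add: power_less_one_iff abs_square_less_1)
    ultimately show ?thesis by (rule order_tendstoD)
  qed
  have l1: "(\<lambda>k. \<integral>x. of_real (c k x) * h x \<partial>\<mu>) \<longlonglongrightarrow> (\<integral>x. h x \<partial>\<mu>)"
  proof (rule integral_dominated_convergence[where w="\<lambda>x. cmod (h x)"])
    show "integrable \<mu> (\<lambda>x. cmod (h x))" using hi by (rule integrable_norm)
    show "AE x in \<mu>. (\<lambda>k. of_real (c k x) * h x) \<longlonglongrightarrow> h x"
    proof (rule AE_I2)
      fix x assume "x \<in> space \<mu>"
      hence "\<forall>\<^sub>F k in sequentially. of_real (c k x) * h x = h x"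
        using eventually_mono[OF ev[of x]] c(4)[of x] by (simp add: less_imp_le)
      thus "(\<lambda>k. of_real (c k x) * h x) \<longlonglongrightarrow> h x" by (rule tendsto_eventually)
    qed
    show "AE x in \<mu>. norm (of_real (c k x) * h x) \<le> cmod (h x)" for k
      by (rule AE_I2) (simp add: norm_mult c(2,3) mult_left_le_one_le)
  qed measurable
  have Ind: "(indicator {x. 1 - 2 * e k \<le> (cmod x)\<^sup>2} :: complex \<Rightarrow> real) \<in> borel_measurable \<mu>" for k
    by (intro indicator_meas closed_Collect_le continuous_intros)
  have "T \<longlonglongrightarrow> (\<integral>x. 0 \<partial>\<mu>)"
    unfolding T_def
  proof (rule integral_dominated_convergence[where w="G"])
    show "integrable \<mu> G" unfolding G_def by (rule gi)
    show "AE x in \<mu>. (\<lambda>k. indicator {x. 1 - 2 * e k \<le> (cmod x)\<^sup>2} x * G x) \<longlonglongrightarrow> 0"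
    proof (rule AE_I2)
      fix x assume "x \<in> space \<mu>"
      hence "\<forall>\<^sub>F k in sequentially. indicator {x. 1 - 2 * e k \<le> (cmod x)\<^sup>2} x * G x = 0"
        using eventually_mono[OF ev[of x]] by simp
      thus "(\<lambda>k. indicator {x. 1 - 2 * e k \<le> (cmod x)\<^sup>2} x * G x) \<longlonglongrightarrow> 0" by (rule tendsto_eventually)
    qed
    show "AE x in \<mu>. norm (indicator {x. 1 - 2 * e k \<le> (cmod x)\<^sup>2} x * G x) \<le> G x" for k
      by (rule AE_I2) (auto simp: G_def indicator_def omega_pos less_imp_le)
    show "(\<lambda>x. indicator {x. 1 - 2 * e k \<le> (cmod x)\<^sup>2} x * G x) \<in> borel_measurable \<mu>" for k
      by (intro borel_measurable_times Ind Gm)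
  qed simp
  hence l2: "(\<lambda>k. T k * C) \<longlonglongrightarrow> 0 * C" by (intro tendsto_intros) simp
  have l3: "(\<lambda>k. (cmod (\<integral>x. of_real (c k x) * h x \<partial>\<mu>))\<^sup>2) \<longlonglongrightarrow> (cmod (\<integral>x. h x \<partial>\<mu>))\<^sup>2"
    by (intro tendsto_intros l1)
  have "(cmod (\<integral>x. h x \<partial>\<mu>))\<^sup>2 \<le> 0 * C"
    by (rule LIMSEQ_le[OF l3 l2]) (use c(5) ipc in auto)
  hence "(\<integral>x. h x \<partial>\<mu>) = 0" by simp
  thus "(\<integral>x. g x * cnj (u x - f x) * of_real (\<omega> x) \<partial>\<mu>) = 0" unfolding h_def .
qed

text \<open>Let \<open>\<eta>\<close> be a normalised bump at \<open>z\<close> divided by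
  \<open>\<omega>\<close>. By the mean value property the pairing of any holomorphic function with
  \<open>\<eta>\<close> is its value at \<open>z\<close>. Hence the projection of
  \<open>\<eta>\<close> is \<open>ker z\<close>, and \<open>complement_orthogonal\<close> allows
  \<open>\<eta>\<close> to be replaced by \<open>ker z\<close> in the pairing with
  \<open>g\<close>.\<close>

theorem reproducing:
  assumes g: "g holomorphic_on \<D>" and gi: "integrable \<mu> (\<lambda>x. (cmod (g x))\<^sup>2 * \<omega> x * (\<tau> x)\<^sup>2)"
    and z: "z \<in> \<D>"
  shows "integrable \<mu> (\<lambda>x. g x * cnj (ker z x) * of_real (\<omega> x))" "pairing \<omega> g (ker z) = g z"
proof -
  define c where "c = ((1 - cmod z) / 2)\<^sup>2"
  have z1: "cmod z < 1" using z by simp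
  have sc: "sqrt c = (1 - cmod z) / 2" using z1 by (simp add: c_def)
  have "((1 - cmod z) / 2)\<^sup>2 < 1\<^sup>2"
  proof (rule power_strict_mono)
    show "(1 - cmod z) / 2 < 1" using norm_ge_zero[of z] by argo
  qed (use z1 in simp_all)
  hence c: "0 < c" "c < 1" "cmod z + sqrt c < 1"
    using z1 unfolding sc by (simp_all add: c_def field_simps)
  define m where "m = mass c"
  have m: "m > 0" unfolding m_def by (rule mass_pos[OF c(1,2)])
  define \<eta> where "\<eta> x = complex_of_real (bump 3 c (x - z) / (m * \<omega> x))" for x
  have \<eta>c: "continuous_on \<D> \<eta>"
    unfolding \<eta>_def
  proof (intro continuous_on_of_real continuous_on_divide continuous_on_mult continuous_on_const bump_cont cont_omega ballI)
    fix x assume "x \<in> \<D>" thus "m * \<omega> x \<noteq> 0" using omega_pos[of x] m by simp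
  qed
  have \<eta>0: "\<eta> x = 0" if "cmod z + sqrt c < cmod x" "cmod x < 1" for x
    using bump_support[OF _ _ that(1), of 3] c by (simp add: \<eta>_def)
  have \<eta>L: "\<eta> \<in> L2 N" by (rule L2_N_compact[OF \<eta>c c(3) \<eta>0])
  have \<eta>m: "\<eta> \<in> borel_measurable \<mu>" by (rule disk_measurable[OF \<eta>c])
  have mean: "integrable \<mu> (\<lambda>x. k x * cnj (\<eta> x) * of_real (\<omega> x))" "(\<integral>x. k x * cnj (\<eta> x) * of_real (\<omega> x) \<partial>\<mu>) = k z"
    if k: "k holomorphic_on \<D>" for k
  proof -
    show "integrable \<mu> (\<lambda>x. k x * cnj (\<eta> x) * of_real (\<omega> x))"
      by (rule integrable_disk_compact[OF _ c(3)])
        (use \<eta>0 in \<open>auto intro!: continuous_intros \<eta>c cont_omega holomorphic_on_imp_continuous_on[OF k]\<close>)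
    have "(\<integral>x. k x * cnj (\<eta> x) * of_real (\<omega> x) \<partial>\<mu>) = (\<integral>x. (k x * of_real (bump 3 c (x - z))) / of_real m \<partial>\<mu>)"
    proof (rule lint_cong[OF refl])
      fix x assume "x \<in> space \<mu>"
      hence "\<omega> x > 0" using omega_pos by simp
      thus "k x * cnj (\<eta> x) * of_real (\<omega> x) = (k x * of_real (bump 3 c (x - z))) / of_real m"
        using m by (simp add: \<eta>_def)
    qed
    also have "\<dots> = (\<integral>x. k x * of_real (bump 3 c (x - z)) \<partial>\<mu>) / of_real m" by simp
    also have "\<dots> = k z" using holomorphic_mean[OF k c(1,3)] m by (simp add: m_def)
    finally show "(\<integral>x. k x * cnj (\<eta> x) * of_real (\<omega> x) \<partial>\<mu>) = k z" .
  qed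
  \<comment> \<open>\<open>sig_le_tau\<close> bounds \<open>sig w\<close> independently of
    \<open>w\<close>, and the integral is finite because \<open>\<eta>\<close> has compact
    support.\<close>
  define M where "M = (\<integral>x. (1 / (64 * K * (\<tau> x)\<^sup>2))\<^sup>2 * (\<omega> x * (cmod (\<eta> x))\<^sup>2) \<partial>\<mu>)"
  have M: "(n2 N (\<lambda>x. of_real (sig w x) * \<eta> x))\<^sup>2 \<le> M" if w: "w \<in> \<D>" for w
  proof -
    have scn: "continuous_on \<D> (\<lambda>x. complex_of_real (sig w x) * \<eta> x)"
      by (intro continuous_intros sig_cont2[OF w] \<eta>c)
    have "(n2 N (\<lambda>x. of_real (sig w x) * \<eta> x))\<^sup>2 = (\<integral>x. (sig w x)\<^sup>2 * (\<omega> x * (cmod (\<eta> x))\<^sup>2) \<partial>\<mu>)"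
      unfolding n2_N[OF disk_measurable[OF scn]] by (simp add: norm_mult power_mult_distrib mult_ac)
    also have "\<dots> \<le> M" unfolding M_def
    proof (rule integral_mono)
      show "integrable \<mu> (\<lambda>x. (sig w x)\<^sup>2 * (\<omega> x * (cmod (\<eta> x))\<^sup>2))"
        by (rule integrable_disk_compact[OF _ c(3)]) (use \<eta>0 in \<open>auto intro!: continuous_intros \<eta>c cont_omega sig_cont2[OF w]\<close>)
      show "integrable \<mu> (\<lambda>x. (1 / (64 * K * (\<tau> x)\<^sup>2))\<^sup>2 * (\<omega> x * (cmod (\<eta> x))\<^sup>2))"
      proof (rule integrable_disk_compact[OF _ c(3)])
        show "continuous_on \<D> (\<lambda>x. (1 / (64 * K * (\<tau> x)\<^sup>2))\<^sup>2 * (\<omega> x * (cmod (\<eta> x))\<^sup>2))"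
        proof (intro continuous_intros \<eta>c cont_omega tau_cont ballI)
          fix x assume "x \<in> \<D>" thus "64 * K * (\<tau> x)\<^sup>2 \<noteq> 0" using tau_pos[of x] K1 by simp
        qed
      qed (use \<eta>0 in simp)
      fix x assume "x \<in> space \<mu>"
      hence x: "x \<in> \<D>" by simp
      show "(sig w x)\<^sup>2 * (\<omega> x * (cmod (\<eta> x))\<^sup>2) \<le> (1 / (64 * K * (\<tau> x)\<^sup>2))\<^sup>2 * (\<omega> x * (cmod (\<eta> x))\<^sup>2)"
        using sig_le_tau[OF w x] sig_pos[OF w, of x] omega_pos[OF x]
        by (intro mult_right_mono power_mono mult_nonneg_nonneg) (simp_all add: less_imp_le)
    qed
    finally show ?thesis .
  qed
  obtain f s \<gamma> \<gamma>x \<gamma>y where f: "f \<in> A2" and t: "\<And>n::nat. testf (s n) (\<gamma> n) (\<gamma>x n) (\<gamma>y n)"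
    and lim: "(\<lambda>n. n2 N (\<lambda>x. TT (\<gamma>x n) (\<gamma>y n) x - (\<eta> x - f x))) \<longlonglongrightarrow> 0"
    using projection[OF \<eta>L] by blast
  have fk: "f \<xi> = ker z \<xi>" if \<xi>: "\<xi> \<in> \<D>" for \<xi>
  proof -
    note k = ker(1)[OF \<xi>]
    have "f \<xi> = ip N f (ker \<xi>)" by (rule ker(3)[OF \<xi> f])
    also have "\<dots> = ip N \<eta> (ker \<xi>)" by (rule ip_approx_A2[OF k f \<eta>L t lim, symmetric])
    also have "\<dots> = cnj (ip N (ker \<xi>) \<eta>)" by (rule ip_commute)
    also have "ip N (ker \<xi>) \<eta> = ker \<xi> z"
      unfolding ip_N[OF A2_meas[OF k] \<eta>m] pairing_def by (rule mean(2)[OF A2D(2)[OF k]])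
    also have "cnj (ker \<xi> z) = ker z \<xi>" by (rule ker_sym[OF z \<xi>, symmetric])
    finally show ?thesis .
  qed
  have o: "integrable \<mu> (\<lambda>x. g x * cnj (\<eta> x - f x) * of_real (\<omega> x))" "(\<integral>x. g x * cnj (\<eta> x - f x) * of_real (\<omega> x) \<partial>\<mu>) = 0"
    by (rule complement_orthogonal[OF g gi f \<eta>L t lim M], assumption)+
  have gm: "g \<in> borel_measurable \<mu>" by (rule holomorphic_meas[OF g])
  have fi: "integrable \<mu> (\<lambda>x. g x * cnj (f x) * of_real (\<omega> x))"
    by (rule tau_prod_integrable[OF gm A2_meas[OF f] gi sig_average_integrable[OF A2D(1)[OF f] sig_agmon(2)[OF f \<eta>L t lim M]]])
  have eq: "g x * cnj (f x) * of_real (\<omega> x) = g x * cnj (ker z x) * of_real (\<omega> x)" if "x \<in> space \<mu>" for x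
    using fk[of x] that by simp
  show "integrable \<mu> (\<lambda>x. g x * cnj (ker z x) * of_real (\<omega> x))"
    using fi by (rule integrable_transfer) (simp_all only: eq)
  have "pairing \<omega> g (ker z) = (\<integral>x. g x * cnj (f x) * of_real (\<omega> x) \<partial>\<mu>)"
    unfolding pairing_def by (rule lint_cong[OF refl]) (simp only: eq)
  also have "\<dots> = (\<integral>x. g x * cnj (\<eta> x) * of_real (\<omega> x) - g x * cnj (\<eta> x - f x) * of_real (\<omega> x) \<partial>\<mu>)"
    by (rule lint_cong[OF refl]) (simp add: algebra_simps)
  also have "\<dots> = g z - 0"
    by (rule trans[OF Bochner_Integration.integral_diff[OF mean(1)[OF g] o(1)]]) (simp only: mean(2)[OF g] o(2))
  finally show "pairing \<omega> g (ker z) = g z" by simp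
qed

end

section \<open>Boundedness of the Bergman projection\<close>

lemma conjugate_exponent:
  fixes p p' :: real
  assumes "1 < p" "p' = p / (p - 1)"
  shows "1 < p'" "1 / p + 1 / p' = 1" "p = p' / (p' - 1)" "(p' - 1) * p = p'" "(p - 1) * p' = p"
proof -
  have 1: "p' - 1 = 1 / (p - 1)" using assms by (simp add: field_simps)
  have "1 / (p - 1) > 0" using assms(1) by simp
  thus "1 < p'" unfolding 1[symmetric] by simp
  show "1 / p + 1 / p' = 1" using assms(1) unfolding assms(2) by (simp add: field_simps)
  show "p = p' / (p' - 1)" unfolding 1 using assms(1) unfolding assms(2) by simp
  show "(p' - 1) * p = p'" unfolding 1 unfolding assms(2) by simp
  show "(p - 1) * p' = p" using assms by simp
qed

lemma Holder:
  fixes F G :: "'a \<Rightarrow> real"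
  assumes p: "1 < p" "p' = p / (p - 1)"
    and [measurable]: "F \<in> borel_measurable M" "G \<in> borel_measurable M"
    and nn: "\<And>x. x \<in> space M \<Longrightarrow> 0 \<le> F x" "\<And>x. x \<in> space M \<Longrightarrow> 0 \<le> G x"
    and Fi: "integrable M (\<lambda>x. F x powr p)" and Gi: "integrable M (\<lambda>x. G x powr p')"
  shows "integrable M (\<lambda>x. F x * G x)"
    "(\<integral>x. F x * G x \<partial>M) \<le> (\<integral>x. F x powr p \<partial>M) powr (1 / p) * (\<integral>x. G x powr p' \<partial>M) powr (1 / p')"
proof -
  note c = conjugate_exponent[OF p]
  have Y: "a * b \<le> a powr p / p + b powr p' / p'" if "0 \<le> a" "0 \<le> b" for a b
    by (rule Youngs_inequality[OF p(1) c(1,2) that])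
  show i: "integrable M (\<lambda>x. F x * G x)"
  proof (rule integrable_dominated)
    show "integrable M (\<lambda>x. F x powr p / p + G x powr p' / p')" using Fi Gi by simp
    show "AE x in M. norm (F x * G x) \<le> norm (F x powr p / p + G x powr p' / p')"
    proof (rule AE_I2)
      fix x assume x: "x \<in> space M"
      have "0 \<le> F x * G x" using nn[OF x] by simp
      thus "norm (F x * G x) \<le> norm (F x powr p / p + G x powr p' / p')"
        using Y[OF nn(1)[OF x] nn(2)[OF x]] by simp
    qed
  qed measurable
  define a where "a = (\<integral>x. F x powr p \<partial>M) powr (1 / p)"
  define b where "b = (\<integral>x. G x powr p' \<partial>M) powr (1 / p')"
  have ap: "a powr p = (\<integral>x. F x powr p \<partial>M)" unfolding a_def powr_powr using p by (simp add: powr_one)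
  have bp: "b powr p' = (\<integral>x. G x powr p' \<partial>M)" unfolding b_def powr_powr using c(1) by (simp add: powr_one)
  show "(\<integral>x. F x * G x \<partial>M) \<le> a * b"
  proof (cases "a = 0 \<or> b = 0")
    case True
    have "AE x in M. F x * G x = 0"
    proof (rule disjE[OF True])
      assume "a = 0"
      hence "(\<integral>x. F x powr p \<partial>M) = 0" using ap p by simp
      hence "AE x in M. F x powr p = 0" using integral_nonneg_eq_0_iff_AE[OF Fi] by simp
      thus ?thesis by eventually_elim simp
    next
      assume "b = 0"
      hence "(\<integral>x. G x powr p' \<partial>M) = 0" using bp c(1) by simp
      hence "AE x in M. G x powr p' = 0" using integral_nonneg_eq_0_iff_AE[OF Gi] by simp
      thus ?thesis by eventually_elim simp
    qed
    hence "(\<integral>x. F x * G x \<partial>M) = 0" by (rule integral_eq_zero_AE)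
    thus ?thesis by (simp add: a_def b_def)
  next
    case False
    hence ab: "a > 0" "b > 0" by (auto simp: a_def b_def order_less_le)
    have "(\<integral>x. F x * G x / (a * b) \<partial>M) \<le> (\<integral>x. F x powr p / (a powr p) / p + G x powr p' / (b powr p') / p' \<partial>M)"
    proof (rule integral_mono)
      fix x assume x: "x \<in> space M"
      have "F x / a * (G x / b) \<le> (F x / a) powr p / p + (G x / b) powr p' / p'"
        using nn[OF x] ab by (intro Y) auto
      thus "F x * G x / (a * b) \<le> F x powr p / (a powr p) / p + G x powr p' / (b powr p') / p'"
        using nn[OF x] ab by (simp add: powr_divide)
    qed (use i Fi Gi in simp_all)
    also have "\<dots> = (\<integral>x. F x powr p \<partial>M) / (a powr p) / p + (\<integral>x. G x powr p' \<partial>M) / (b powr p') / p'"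
      using Fi Gi by simp
    also have "\<dots> = 1 / p + 1 / p'" using ab unfolding ap[symmetric] bp[symmetric] by simp
    finally show ?thesis using c(2) ab by (simp add: pos_divide_le_eq)
  qed
qed

section \<open>Weighted L^p spaces and pointwise bounds\<close>

lemma bergman_norm_nonneg: "bergman_norm q \<omega> f \<ge> 0"
  by (simp add: bergman_norm_def)

lemma bergman_norm_cmult:
  assumes "q > 0" shows "bergman_norm q \<omega> (\<lambda>z. c * f z) = cmod c * bergman_norm q \<omega> f"
  unfolding bergman_norm_def norm_mult using assms
  by (simp add: powr_mult powr_powr mult.assoc integral_nonneg_AE)

context disk_weight
begin

lemma weighted_powr: "z \<in> \<D> \<Longrightarrow> cmod (f z) powr q * \<omega> z powr (q / 2) = (cmod (f z) * sqrt (\<omega> z)) powr q"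
  using omega_pos[of z] by (simp add: powr_mult powr_half_sqrt[symmetric] powr_powr)

text \<open>The weighted space L^q(omega^(q/2)) of measurable functions, whose holomorphic part is
  \<open>bergman q \<omega>\<close>; \<open>bergman_norm\<close> serves as its norm as well.\<close>

definition Lp :: "real \<Rightarrow> (complex \<Rightarrow> complex) set" where
  "Lp q = {f \<in> borel_measurable \<mu>. integrable \<mu> (\<lambda>z. cmod (f z) powr q * \<omega> z powr (q / 2))}"

lemma LpD: "f \<in> Lp q \<Longrightarrow> f \<in> borel_measurable \<mu>"
  "f \<in> Lp q \<Longrightarrow> integrable \<mu> (\<lambda>z. cmod (f z) powr q * \<omega> z powr (q / 2))"
  "f \<in> Lp q \<Longrightarrow> integrable \<mu> (\<lambda>z. (cmod (f z) * sqrt (\<omega> z)) powr q)"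
proof -
  assume f: "f \<in> Lp q"
  show "f \<in> borel_measurable \<mu>" and i: "integrable \<mu> (\<lambda>z. cmod (f z) powr q * \<omega> z powr (q / 2))"
    using f by (auto simp: Lp_def)
  show "integrable \<mu> (\<lambda>z. (cmod (f z) * sqrt (\<omega> z)) powr q)"
    using i by (rule integrable_transfer) (auto simp: weighted_powr)
qed

lemma bergman_norm_eq: "bergman_norm q \<omega> f = (\<integral>z. (cmod (f z) * sqrt (\<omega> z)) powr q \<partial>\<mu>) powr (1 / q)"
  unfolding bergman_norm_def by (intro arg_cong2[of _ _ _ _ "(powr)"] lint_cong) (auto simp: weighted_powr)

lemma bergman_Lp: "f \<in> bergman q \<omega> \<Longrightarrow> f \<in> Lp q"
  by (auto simp: bergman_def Lp_def intro: holomorphic_meas)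

lemma Lp_bound:
  assumes [measurable]: "f \<in> borel_measurable \<mu>" and g: "g \<in> Lp q" and q: "q > 0"
    and le: "\<And>z. z \<in> \<D> \<Longrightarrow> cmod (f z) \<le> cmod (g z)"
  shows "f \<in> Lp q" "bergman_norm q \<omega> f \<le> bergman_norm q \<omega> g"
proof -
  have i: "integrable \<mu> (\<lambda>z. cmod (f z) powr q * \<omega> z powr (q / 2))"
  proof (rule integrable_dominated[OF LpD(2)[OF g]])
    show "AE z in \<mu>. norm (cmod (f z) powr q * \<omega> z powr (q / 2)) \<le> norm (cmod (g z) powr q * \<omega> z powr (q / 2))"
      using le q by (intro AE_I2) (simp add: mult_right_mono powr_mono2)
  qed measurable
  thus f: "f \<in> Lp q" by (simp add: Lp_def)
  show "bergman_norm q \<omega> f \<le> bergman_norm q \<omega> g"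
    unfolding bergman_norm_def using LpD(2)[OF g] i le q
    by (intro powr_mono2 integral_mono) (auto intro!: mult_right_mono powr_mono2 integral_nonneg_AE)
qed

lemma Lp_diff:
  assumes f: "f \<in> Lp q" and g: "g \<in> Lp q" and q: "q > 0" shows "(\<lambda>z. f z - g z) \<in> Lp q"
proof -
  have [measurable]: "f \<in> borel_measurable \<mu>" "g \<in> borel_measurable \<mu>" using f g by (auto simp: Lp_def)
  have "integrable \<mu> (\<lambda>z. cmod (f z - g z) powr q * \<omega> z powr (q / 2))"
  proof (rule integrable_dominated)
    show "integrable \<mu> (\<lambda>z. 2 powr q * (cmod (f z) powr q * \<omega> z powr (q / 2) + cmod (g z) powr q * \<omega> z powr (q / 2)))"
      using LpD(2)[OF f] LpD(2)[OF g] by simp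
    show "AE z in \<mu>. norm (cmod (f z - g z) powr q * \<omega> z powr (q / 2)) \<le> norm (2 powr q * (cmod (f z) powr q * \<omega> z powr (q / 2) + cmod (g z) powr q * \<omega> z powr (q / 2)))"
    proof (rule AE_I2)
      fix z
      let ?m = "max (cmod (f z)) (cmod (g z))"
      have "cmod (f z - g z) powr q \<le> (2 * ?m) powr q"
        using norm_triangle_ineq4[of "f z" "g z"] q by (intro powr_mono2) auto
      also have "\<dots> = 2 powr q * ?m powr q" by (simp add: powr_mult)
      also have "\<dots> \<le> 2 powr q * (cmod (f z) powr q + cmod (g z) powr q)" by (intro mult_left_mono) (auto simp: max_def)
      finally have "cmod (f z - g z) powr q * \<omega> z powr (q / 2) \<le> 2 powr q * (cmod (f z) powr q + cmod (g z) powr q) * \<omega> z powr (q / 2)"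
        by (rule mult_right_mono) simp
      thus "norm (cmod (f z - g z) powr q * \<omega> z powr (q / 2)) \<le> norm (2 powr q * (cmod (f z) powr q * \<omega> z powr (q / 2) + cmod (g z) powr q * \<omega> z powr (q / 2)))"
        by (simp add: algebra_simps)
    qed
  qed measurable
  thus ?thesis by (simp add: Lp_def)
qed

lemma Holder_pairing:
  assumes p: "1 < p" "p' = p / (p - 1)" and f: "f \<in> Lp p" and g: "g \<in> Lp p'"
  shows "integrable \<mu> (\<lambda>z. f z * cnj (g z) * of_real (\<omega> z))"
    "cmod (pairing \<omega> f g) \<le> bergman_norm p \<omega> f * bergman_norm p' \<omega> g"
proof -
  note [measurable] = LpD(1)[OF f] LpD(1)[OF g]
  let ?F = "\<lambda>z. cmod (f z) * sqrt (\<omega> z)" and ?G = "\<lambda>z. cmod (g z) * sqrt (\<omega> z)"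
  have nn: "0 \<le> cmod (h z) * sqrt (\<omega> z)" if "z \<in> space \<mu>" for z and h :: "complex \<Rightarrow> complex"
    using omega_pos[of z] that by simp
  have Fm: "?F \<in> borel_measurable \<mu>" and Gm: "?G \<in> borel_measurable \<mu>" by measurable
  have H: "integrable \<mu> (\<lambda>z. ?F z * ?G z)" "(\<integral>z. ?F z * ?G z \<partial>\<mu>) \<le> bergman_norm p \<omega> f * bergman_norm p' \<omega> g"
    unfolding bergman_norm_eq
    by (rule Holder[where F="?F" and G="?G" and M=\<mu>, OF p Fm Gm nn[where h=f] nn[where h=g] LpD(3)[OF f] LpD(3)[OF g]]; assumption)+
  have eq: "?F z * ?G z = norm (f z * cnj (g z) * of_real (\<omega> z))" if "z \<in> space \<mu>" for z
    using omega_pos[of z] that by (simp add: norm_mult)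
  have "integrable \<mu> (\<lambda>z. norm (f z * cnj (g z) * of_real (\<omega> z)))"
    using H(1) by (rule integrable_transfer) (simp_all only: eq)
  thus i: "integrable \<mu> (\<lambda>z. f z * cnj (g z) * of_real (\<omega> z))" by (subst (asm) integrable_norm_iff) measurable
  have "cmod (pairing \<omega> f g) \<le> (\<integral>z. norm (f z * cnj (g z) * of_real (\<omega> z)) \<partial>\<mu>)"
    unfolding pairing_def by (rule integral_norm_bound)
  also have "\<dots> = (\<integral>z. ?F z * ?G z \<partial>\<mu>)"
    by (rule lint_cong[OF refl]) (simp only: eq)
  also note H(2)
  finally show "cmod (pairing \<omega> f g) \<le> bergman_norm p \<omega> f * bergman_norm p' \<omega> g" .
qed

end

context regular_weight
begin

text \<open>\<open>\<mu>\<close> is a probability measure, so Hoelder's inequality against 1 turns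
  the L^1 bound of \<open>submean_L1\<close> into one by the L^q norm.\<close>

lemma bergman_pointwise:
  assumes f: "f \<in> bergman q \<omega>" and q: "1 < q" and z: "z \<in> \<D>"
  shows "cmod (f z) * sqrt (\<omega> z) \<le> C1 / (\<tau> z)\<^sup>2 * bergman_norm q \<omega> f"
proof -
  have fh: "f holomorphic_on \<D>" using f by (simp add: bergman_def)
  note fL = bergman_Lp[OF f]
  note [measurable] = LpD(1)[OF fL]
  let ?h = "\<lambda>x. cmod (f x) * sqrt (\<omega> x)"
  have nn: "0 \<le> ?h x" if "x \<in> space \<mu>" for x using omega_pos[of x] that by simp
  have m1: "measure \<mu> (space \<mu>) = 1" by (simp add: measure_def emeasure_disk)
  have one: "integrable \<mu> (\<lambda>x. 1 powr (q / (q - 1)))" by (rule finite_measure.integrable_const[OF finite_measure_disk])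
  have h: "integrable \<mu> ?h" "(\<integral>x. ?h x \<partial>\<mu>) \<le> bergman_norm q \<omega> f"
  proof -
    have hm: "?h \<in> borel_measurable \<mu>" "(\<lambda>_. 1::real) \<in> borel_measurable \<mu>" by measurable
    note H = Holder[where F="?h" and G="\<lambda>_. 1", OF q refl hm nn zero_le_one LpD(3)[OF fL] one]
    show "integrable \<mu> ?h" using H(1) by simp
    show "(\<integral>x. ?h x \<partial>\<mu>) \<le> bergman_norm q \<omega> f" using H(2) m1 by (simp add: bergman_norm_eq)
  qed
  have "(\<integral>x. indicator (cball z (\<delta> * \<tau> z)) x * ?h x \<partial>\<mu>) \<le> (\<integral>x. ?h x \<partial>\<mu>)"
  proof (rule integral_mono)
    show "integrable \<mu> (\<lambda>x. indicator (cball z (\<delta> * \<tau> z)) x * ?h x)"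
      using integrable_mult_indicator[OF cball_sets[OF z] h(1)] by simp
    show "indicator (cball z (\<delta> * \<tau> z)) x * ?h x \<le> ?h x" if "x \<in> space \<mu>" for x
      using nn[OF that] by (simp add: indicator_def)
  qed (rule h)
  also note h(2)
  finally have "C1 / (\<tau> z)\<^sup>2 * (\<integral>x. indicator (cball z (\<delta> * \<tau> z)) x * ?h x \<partial>\<mu>) \<le> C1 / (\<tau> z)\<^sup>2 * bergman_norm q \<omega> f"
    using C1_pos by (intro mult_left_mono) auto
  with submean_L1[OF fh z] show ?thesis by linarith
qed

lemma tau_le: "z \<in> \<D> \<Longrightarrow> \<tau> z \<le> 1 / (2 * \<delta>)"
proof -
  assume "z \<in> \<D>"
  hence "cmod z + 2 * \<delta> * \<tau> z < 1" by (rule tau_disk)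
  hence "\<tau> z * (2 * \<delta>) \<le> 1" using norm_ge_zero[of z] by argo
  thus "\<tau> z \<le> 1 / (2 * \<delta>)" using delta by (simp only: pos_le_divide_eq mult_pos_pos zero_less_numeral)
qed

text \<open>With \<open>h = |f| * sqrt \<omega>\<close> the claim is integrability of
  \<open>h^2 * \<tau>^2\<close>. For \<open>q >= 2\<close> it follows since \<open>\<mu>\<close> is
  finite and \<open>\<tau>\<close> bounded. For \<open>q < 2\<close> write \<open>h^2\<close> as
  \<open>h^q * h^(2 - q)\<close> and insert \<open>h <= D / \<tau>^2\<close> in the second factor;
  what remains is \<open>\<tau>^(2 * q - 2)\<close>, bounded because \<open>q > 1\<close>.\<close>

lemma bergman_tau:
  assumes f: "f \<in> bergman q \<omega>" and q: "1 < q"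
  shows "integrable \<mu> (\<lambda>x. (cmod (f x))\<^sup>2 * \<omega> x * (\<tau> x)\<^sup>2)"
proof -
  note fL = bergman_Lp[OF f]
  note [measurable] = LpD(1)[OF fL]
  let ?h = "\<lambda>x. cmod (f x) * sqrt (\<omega> x)"
  define T where "T = 1 / (2 * \<delta>)"
  have T: "T > 0" using delta by (simp add: T_def)
  define D where "D = C1 * bergman_norm q \<omega> f"
  have D: "D \<ge> 0" unfolding D_def using C1_pos by (intro mult_nonneg_nonneg bergman_norm_nonneg) simp
  have hD: "?h x \<le> D / (\<tau> x)\<^sup>2" if "x \<in> \<D>" for x using bergman_pointwise[OF f q that] by (simp add: D_def)
  define B where "B = (if q < 2 then D powr (2 - q) * T powr (2 * q - 2) else T\<^sup>2)"
  show ?thesis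
  proof (rule integrable_dominated)
    show "integrable \<mu> (\<lambda>x. T\<^sup>2 + B * ?h x powr q)"
      by (intro Bochner_Integration.integrable_add integrable_mult_right LpD(3)[OF fL] finite_measure.integrable_const[OF finite_measure_disk])
    show "AE x in \<mu>. norm ((cmod (f x))\<^sup>2 * \<omega> x * (\<tau> x)\<^sup>2) \<le> norm (T\<^sup>2 + B * ?h x powr q)"
    proof (rule AE_I2)
      fix x assume "x \<in> space \<mu>"
      hence x: "x \<in> \<D>" by simp
      have t: "\<tau> x > 0" "\<tau> x \<le> T" using tau_pos[OF x] tau_le[OF x] by (simp_all add: T_def)
      define h where "h = ?h x"
      have h0: "h \<ge> 0" using omega_pos[OF x] by (simp add: h_def)
      have hd: "h \<le> D / (\<tau> x)\<^sup>2" unfolding h_def by (rule hD[OF x])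
      have eq: "(cmod (f x))\<^sup>2 * \<omega> x * (\<tau> x)\<^sup>2 = h\<^sup>2 * (\<tau> x)\<^sup>2" using omega_pos[OF x] by (simp add: h_def power_mult_distrib)
      have T2: "(\<tau> x)\<^sup>2 \<le> T\<^sup>2" using t by (intro power_mono) auto
      have "h\<^sup>2 * (\<tau> x)\<^sup>2 \<le> T\<^sup>2 + B * h powr q"
      proof (cases "q < 2")
        case True
        have "h\<^sup>2 * (\<tau> x)\<^sup>2 \<le> B * h powr q"
        proof (cases "h = 0")
          case False
          hence h: "h > 0" using h0 by simp
          have "h\<^sup>2 = h powr 2" using h by (simp add: powr_numeral)
          also have "\<dots> = h powr q * h powr (2 - q)" using h by (simp add: powr_add[symmetric])
          finally have "h\<^sup>2 * (\<tau> x)\<^sup>2 = h powr q * (h powr (2 - q) * (\<tau> x)\<^sup>2)" by simp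
          also have "\<dots> \<le> h powr q * (D powr (2 - q) * T powr (2 * q - 2))"
          proof (rule mult_left_mono)
            have "h powr (2 - q) * (\<tau> x)\<^sup>2 \<le> (D / (\<tau> x)\<^sup>2) powr (2 - q) * (\<tau> x)\<^sup>2"
              using True h by (intro mult_right_mono powr_mono2 hd) auto
            also have "\<dots> = D powr (2 - q) * (\<tau> x powr (2 * q - 2))"
            proof -
              have 1: "(\<tau> x)\<^sup>2 = \<tau> x powr 2" using t by (simp add: powr_numeral)
              have "(\<tau> x powr 2) powr (2 - q) * \<tau> x powr (2 * q - 2) = \<tau> x powr 2"
                unfolding powr_powr powr_add[symmetric] by (simp add: algebra_simps)
              hence "\<tau> x powr 2 / (\<tau> x powr 2) powr (2 - q) = \<tau> x powr (2 * q - 2)" using t by (simp add: field_simps)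
              moreover have "(D / \<tau> x powr 2) powr (2 - q) * \<tau> x powr 2 = D powr (2 - q) * (\<tau> x powr 2 / (\<tau> x powr 2) powr (2 - q))"
                using D t by (simp add: powr_divide del: powr_numeral)
              ultimately show ?thesis unfolding 1 by simp
            qed
            also have "\<dots> \<le> D powr (2 - q) * T powr (2 * q - 2)"
              using t q by (intro mult_left_mono powr_mono2) auto
            finally show "h powr (2 - q) * (\<tau> x)\<^sup>2 \<le> D powr (2 - q) * T powr (2 * q - 2)" .
          qed simp
          finally show ?thesis using True by (simp add: B_def mult_ac)
        qed simp
        moreover have "0 \<le> T\<^sup>2" by simp
        ultimately show ?thesis by linarith
      next
        case False
        have "h\<^sup>2 \<le> 1 + h powr q"
        proof (cases "h \<le> 1")
          case True
          have "h\<^sup>2 \<le> 1" using True h0 by (simp add: power_le_one)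
          moreover have "0 \<le> h powr q" by simp
          ultimately show ?thesis by linarith
        next
          assume h1: "\<not> h \<le> 1"
          have "h\<^sup>2 = h powr 2" using h1 by (simp add: powr_numeral)
          also have "\<dots> \<le> h powr q" using h1 False by (intro powr_mono) auto
          finally show ?thesis by simp
        qed
        hence "h\<^sup>2 * (\<tau> x)\<^sup>2 \<le> (1 + h powr q) * T\<^sup>2" by (intro mult_mono T2) auto
        thus ?thesis using False by (simp add: B_def algebra_simps)
      qed
      moreover have "0 \<le> h\<^sup>2 * (\<tau> x)\<^sup>2" by simp
      ultimately show "norm ((cmod (f x))\<^sup>2 * \<omega> x * (\<tau> x)\<^sup>2) \<le> norm (T\<^sup>2 + B * ?h x powr q)"
        unfolding eq h_def[symmetric] by simp
    qed
  qed measurable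
qed

lemma bergman_reproducing:
  assumes g: "g \<in> bergman q \<omega>" and q: "1 < q" and z: "z \<in> \<D>"
  shows "integrable \<mu> (\<lambda>x. g x * cnj (ker z x) * of_real (\<omega> x))" "pairing \<omega> g (ker z) = g z"
  using reproducing[OF _ bergman_tau[OF g q] z] g by (auto simp: bergman_def)

text \<open>The modulus of the kernel with the root of the weight absorbed in each variable. It is
  symmetric, so one bound serves for its integrals in either variable.\<close>

definition wker :: "complex \<Rightarrow> complex \<Rightarrow> real" where
  "wker \<xi> z = cmod (ker \<xi> z) * (sqrt (\<omega> \<xi>) * sqrt (\<omega> z))"

lemma wker_nonneg: "\<xi> \<in> \<D> \<Longrightarrow> z \<in> \<D> \<Longrightarrow> 0 \<le> wker \<xi> z"
  using omega_pos[of \<xi>] omega_pos[of z] by (simp add: wker_def)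

lemma wker_sym: "\<xi> \<in> \<D> \<Longrightarrow> z \<in> \<D> \<Longrightarrow> wker \<xi> z = wker z \<xi>"
  using ker_sym[of \<xi> z] by (simp add: wker_def mult_ac)

lemma ker_meas2 [measurable]: "(\<lambda>p. ker (fst p) (snd p)) \<in> borel_measurable (\<mu> \<Otimes>\<^sub>M \<mu>)"
proof -
  have "open (\<D> \<times> \<D>)" by (intro open_Times open_ball)
  hence b: "(\<lambda>p. indicator (\<D> \<times> \<D>) p *\<^sub>R ker (fst p) (snd p)) \<in> borel_measurable borel"
    by (rule borel_measurable_continuous_on_indicator[OF borel_open ker_continuous])
  have m: "(\<lambda>p. (fst p, snd p)) \<in> measurable (\<mu> \<Otimes>\<^sub>M \<mu>) borel"
    by (rule borel_measurable_Pair[OF fst_meas snd_meas])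
  have eq: "ker (fst p) (snd p) = indicator (\<D> \<times> \<D>) (fst p, snd p) *\<^sub>R ker (fst (fst p, snd p)) (snd (fst p, snd p))"
    if "p \<in> space (\<mu> \<Otimes>\<^sub>M \<mu>)" for p
    using that by (simp add: space_pair_measure mem_Times_iff)
  show ?thesis by (rule iffD2[OF measurable_cong[OF eq] measurable_compose[OF m b]])
qed

lemma omega_fst [measurable]: "(\<lambda>p. \<omega> (fst p)) \<in> borel_measurable (\<mu> \<Otimes>\<^sub>M \<mu>)"
  and omega_snd [measurable]: "(\<lambda>p. \<omega> (snd p)) \<in> borel_measurable (\<mu> \<Otimes>\<^sub>M \<mu>)"
  by (rule measurable_compose[OF measurable_fst omega_meas], rule measurable_compose[OF measurable_snd omega_meas])

lemma wker_meas2 [measurable]: "(\<lambda>p. wker (fst p) (snd p)) \<in> borel_measurable (\<mu> \<Otimes>\<^sub>M \<mu>)"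
  unfolding wker_def by measurable

lemma wker_int:
  assumes z: "z \<in> \<D>"
  shows "integrable \<mu> (wker z)" "(\<integral>x. wker z x \<partial>\<mu>) \<le> C3"
    "(\<integral>\<^sup>+x. ennreal (wker z x) \<partial>\<mu>) \<le> ennreal C3" "(\<integral>\<^sup>+x. ennreal (wker x z) \<partial>\<mu>) \<le> ennreal C3"
proof -
  have eq: "wker z = (\<lambda>x. sqrt (\<omega> z) * (cmod (ker z x) * sqrt (\<omega> x)))" by (auto simp: wker_def mult_ac)
  show i: "integrable \<mu> (wker z)" unfolding eq by (rule integrable_mult_right[OF kernel_L1(1)[OF z]])
  have "(\<integral>x. wker z x \<partial>\<mu>) = sqrt (\<omega> z) * (\<integral>x. cmod (ker z x) * sqrt (\<omega> x) \<partial>\<mu>)" unfolding eq by simp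
  also have "\<dots> \<le> sqrt (\<omega> z) * (C3 / sqrt (\<omega> z))" using omega_pos[OF z] by (intro mult_left_mono kernel_L1(2)[OF z]) simp
  also have "\<dots> = C3" using omega_pos[OF z] by simp
  finally show le: "(\<integral>x. wker z x \<partial>\<mu>) \<le> C3" .
  have "(\<integral>\<^sup>+x. ennreal (wker z x) \<partial>\<mu>) = ennreal (\<integral>x. wker z x \<partial>\<mu>)"
    by (rule nn_integral_eq_integral[OF i], rule AE_I2) (simp add: wker_nonneg[OF z])
  thus 1: "(\<integral>\<^sup>+x. ennreal (wker z x) \<partial>\<mu>) \<le> ennreal C3" using ennreal_leI[OF le] by simp
  have "(\<integral>\<^sup>+x. ennreal (wker x z) \<partial>\<mu>) = (\<integral>\<^sup>+x. ennreal (wker z x) \<partial>\<mu>)"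
    by (rule nn_integral_cong) (simp add: wker_sym[OF _ z])
  thus "(\<integral>\<^sup>+x. ennreal (wker x z) \<partial>\<mu>) \<le> ennreal C3" using 1 by simp
qed

text \<open>Jensen's inequality for the measures \<open>wker \<xi> z dA(z)\<close>, in the form of Hoelder's inequality, and Tonelli.\<close>

theorem schur:
  assumes p: "1 < p" and h: "h \<in> Lp p" and Hm [measurable]: "H \<in> borel_measurable \<mu>"
    and H: "\<And>\<xi>. \<xi> \<in> \<D> \<Longrightarrow> H \<xi> = pairing \<omega> h (ker \<xi>)"
  shows "H \<in> Lp p" "bergman_norm p \<omega> H \<le> C3 * bergman_norm p \<omega> h"
proof -
  define p' where "p' = p / (p - 1)"
  note c = conjugate_exponent[OF p p'_def]
  interpret pair_sigma_finite \<mu> \<mu> by (rule pair_sigma_finite_disk)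
  note hm [measurable] = LpD(1)[OF h]
  define a where "a z = cmod (h z) * sqrt (\<omega> z)" for z
  have a0: "0 \<le> a z" if "z \<in> \<D>" for z using omega_pos[OF that] by (simp add: a_def)
  have am [measurable]: "a \<in> borel_measurable \<mu>" unfolding a_def by measurable
  have ai: "integrable \<mu> (\<lambda>z. a z powr p)" unfolding a_def by (rule LpD(3)[OF h])
  define f where "f q = ennreal (C3 powr (p - 1) * (a (snd q) powr p * wker (fst q) (snd q)))" for q
  have [measurable]: "(\<lambda>q. a (snd q)) \<in> borel_measurable (\<mu> \<Otimes>\<^sub>M \<mu>)" by (rule measurable_compose[OF measurable_snd am])
  have fm: "f \<in> borel_measurable (\<mu> \<Otimes>\<^sub>M \<mu>)" unfolding f_def by measurable
  have pw: "ennreal ((cmod (H \<xi>) * sqrt (\<omega> \<xi>)) powr p) \<le> (\<integral>\<^sup>+z. f (\<xi>, z) \<partial>\<mu>)" if x: "\<xi> \<in> \<D>" for \<xi>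
  proof (cases "(\<integral>\<^sup>+z. f (\<xi>, z) \<partial>\<mu>) = \<infinity>")
    case True thus ?thesis by simp
  next
    case False
    note ki = wker_int[OF x]
    have [measurable]: "wker \<xi> \<in> borel_measurable \<mu>" using ki(1) by auto
    have k0: "0 \<le> wker \<xi> z" if "z \<in> space \<mu>" for z using wker_nonneg[OF x] that by simp
    have fi: "integrable \<mu> (\<lambda>z. C3 powr (p - 1) * (a z powr p * wker \<xi> z))"
      by (rule integrableI_nonneg) (use False k0 in \<open>auto simp: f_def less_top\<close>)
    hence i: "integrable \<mu> (\<lambda>z. a z powr p * wker \<xi> z)" using C3_pos by simp
    define j where "j = (\<integral>z. a z powr p * wker \<xi> z \<partial>\<mu>)"
    have j0: "j \<ge> 0" unfolding j_def by (rule integral_nonneg_AE, rule AE_I2) (simp add: k0)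
    \<comment> \<open>The kernel is distributed over the two factors with exponents
      \<open>1 / p\<close> and \<open>1 / p'\<close>, so that the second factor in Hoelder's
      inequality is bounded by a power of \<open>C3\<close>.\<close>
    define F where "F z = a z * wker \<xi> z powr (1 / p)" for z
    define G where "G z = wker \<xi> z powr (1 / p')" for z
    have Fm: "F \<in> borel_measurable \<mu>" "G \<in> borel_measurable \<mu>" unfolding F_def G_def by measurable
    have F0: "0 \<le> F z" "0 \<le> G z" if "z \<in> space \<mu>" for z using a0[of z] that by (auto simp: F_def G_def)
    have FG: "F z powr p = a z powr p * wker \<xi> z" "G z powr p' = wker \<xi> z" "F z * G z = a z * wker \<xi> z" if "z \<in> space \<mu>" for z
    proof -
      show "F z powr p = a z powr p * wker \<xi> z" using a0[of z] that k0[OF that] p by (simp add: F_def powr_mult powr_powr powr_one)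
      show "G z powr p' = wker \<xi> z" using k0[OF that] c(1) by (simp add: G_def powr_powr powr_one)
      show "F z * G z = a z * wker \<xi> z" using k0[OF that] c(2) by (simp add: F_def G_def powr_add[symmetric] mult.assoc powr_one)
    qed
    have Fi: "integrable \<mu> (\<lambda>z. F z powr p)"
      using i by (rule integrable_transfer) (simp_all only: FG)
    have Gi: "integrable \<mu> (\<lambda>z. G z powr p')"
      using ki(1) by (rule integrable_transfer) (simp_all only: FG)
    have "(\<integral>z. F z * G z \<partial>\<mu>) \<le> (\<integral>z. F z powr p \<partial>\<mu>) powr (1 / p) * (\<integral>z. G z powr p' \<partial>\<mu>) powr (1 / p')"
      by (rule Holder(2)[OF p p'_def Fm F0 Fi Gi])
    also have "(\<integral>z. F z * G z \<partial>\<mu>) = (\<integral>z. a z * wker \<xi> z \<partial>\<mu>)"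
      by (rule lint_cong[OF refl]) (simp only: FG)
    also have "(\<integral>z. F z powr p \<partial>\<mu>) = j"
      unfolding j_def by (rule lint_cong[OF refl]) (simp only: FG)
    also have "(\<integral>z. G z powr p' \<partial>\<mu>) = (\<integral>z. wker \<xi> z \<partial>\<mu>)"
      by (rule lint_cong[OF refl]) (simp only: FG)
    also have "j powr (1 / p) * (\<integral>z. wker \<xi> z \<partial>\<mu>) powr (1 / p') \<le> j powr (1 / p) * C3 powr (1 / p')"
      using ki(2) c(1) by (intro mult_left_mono powr_mono2 integral_nonneg_AE AE_I2 k0) auto
    finally have 1: "(\<integral>z. a z * wker \<xi> z \<partial>\<mu>) \<le> j powr (1 / p) * C3 powr (1 / p')" .
    have "cmod (H \<xi>) \<le> (\<integral>z. cmod (h z * cnj (ker \<xi> z) * of_real (\<omega> z)) \<partial>\<mu>)"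
      unfolding H[OF x] pairing_def by (rule integral_norm_bound)
    hence "cmod (H \<xi>) * sqrt (\<omega> \<xi>) \<le> (\<integral>z. cmod (h z * cnj (ker \<xi> z) * of_real (\<omega> z)) \<partial>\<mu>) * sqrt (\<omega> \<xi>)"
      using omega_pos[OF x] by (intro mult_right_mono) auto
    also have "\<dots> = (\<integral>z. cmod (h z * cnj (ker \<xi> z) * of_real (\<omega> z)) * sqrt (\<omega> \<xi>) \<partial>\<mu>)" by simp
    also have "\<dots> = (\<integral>z. a z * wker \<xi> z \<partial>\<mu>)"
    proof (rule lint_cong[OF refl])
      fix z assume "z \<in> space \<mu>"
      hence "\<omega> z = sqrt (\<omega> z) * sqrt (\<omega> z)" "\<omega> z > 0" using omega_pos[of z] by simp_all
      thus "cmod (h z * cnj (ker \<xi> z) * of_real (\<omega> z)) * sqrt (\<omega> \<xi>) = a z * wker \<xi> z"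
        by (simp add: a_def wker_def norm_mult)
    qed
    also note 1
    finally have "(cmod (H \<xi>) * sqrt (\<omega> \<xi>)) powr p \<le> (j powr (1 / p) * C3 powr (1 / p')) powr p"
      using p omega_pos[OF x] by (intro powr_mono2) auto
    also have "\<dots> = j * C3 powr (p - 1)"
    proof -
      have "1 / p' * p = p - 1" using p by (simp add: p'_def)
      thus ?thesis using p j0 by (simp add: powr_mult powr_powr powr_one)
    qed
    also have "\<dots> = (\<integral>z. C3 powr (p - 1) * (a z powr p * wker \<xi> z) \<partial>\<mu>)" by (simp add: j_def)
    finally have "ennreal ((cmod (H \<xi>) * sqrt (\<omega> \<xi>)) powr p) \<le> ennreal (\<integral>z. C3 powr (p - 1) * (a z powr p * wker \<xi> z) \<partial>\<mu>)"
      by (rule ennreal_leI)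
    also have "\<dots> = (\<integral>\<^sup>+z. f (\<xi>, z) \<partial>\<mu>)"
      unfolding f_def fst_conv snd_conv
      by (rule nn_integral_eq_integral[OF fi, symmetric], rule AE_I2) (simp add: k0)
    finally show ?thesis .
  qed
  define I where "I = (\<integral>z. a z powr p \<partial>\<mu>)"
  have I0: "I \<ge> 0" by (simp add: I_def integral_nonneg_AE)
  have "(\<integral>\<^sup>+\<xi>. ennreal ((cmod (H \<xi>) * sqrt (\<omega> \<xi>)) powr p) \<partial>\<mu>) \<le> (\<integral>\<^sup>+\<xi>. (\<integral>\<^sup>+z. f (\<xi>, z) \<partial>\<mu>) \<partial>\<mu>)"
    by (rule nn_integral_mono) (simp add: pw)
  also have "\<dots> = (\<integral>\<^sup>+z. (\<integral>\<^sup>+\<xi>. f (\<xi>, z) \<partial>\<mu>) \<partial>\<mu>)" by (rule Fubini[OF fm, symmetric])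
  also have "\<dots> \<le> (\<integral>\<^sup>+z. ennreal (C3 powr p) * ennreal (a z powr p) \<partial>\<mu>)"
  proof (rule nn_integral_mono)
    fix z assume "z \<in> space \<mu>"
    hence z: "z \<in> \<D>" by simp
    have [measurable]: "(\<lambda>\<xi>. wker \<xi> z) \<in> borel_measurable \<mu>"
      using wker_int(1)[OF z] by (subst measurable_cong[where g="wker z"]) (auto simp: wker_sym[OF _ z])
    have "(\<integral>\<^sup>+\<xi>. f (\<xi>, z) \<partial>\<mu>) = (\<integral>\<^sup>+\<xi>. ennreal (C3 powr (p - 1) * a z powr p) * ennreal (wker \<xi> z) \<partial>\<mu>)"
      by (rule nn_integral_cong) (simp add: f_def ennreal_mult[symmetric] wker_nonneg[OF _ z] mult.assoc)
    also have "\<dots> = ennreal (C3 powr (p - 1) * a z powr p) * (\<integral>\<^sup>+\<xi>. ennreal (wker \<xi> z) \<partial>\<mu>)"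
      by (rule nn_integral_cmult) measurable
    also have "\<dots> \<le> ennreal (C3 powr (p - 1) * a z powr p) * ennreal C3"
      by (rule mult_left_mono[OF wker_int(4)[OF z]]) simp
    also have "\<dots> = ennreal (C3 powr p) * ennreal (a z powr p)"
    proof -
      have "C3 powr p = C3 powr (p - 1) * C3" using C3_pos by (simp add: powr_diff)
      thus ?thesis using C3_pos by (simp add: ennreal_mult[symmetric] mult_ac)
    qed
    finally show "(\<integral>\<^sup>+\<xi>. f (\<xi>, z) \<partial>\<mu>) \<le> ennreal (C3 powr p) * ennreal (a z powr p)" .
  qed
  also have "\<dots> = ennreal (C3 powr p) * (\<integral>\<^sup>+z. ennreal (a z powr p) \<partial>\<mu>)" by (rule nn_integral_cmult) measurable
  also have "(\<integral>\<^sup>+z. ennreal (a z powr p) \<partial>\<mu>) = ennreal I" unfolding I_def by (rule nn_integral_eq_integral[OF ai]) simp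
  also have "ennreal (C3 powr p) * ennreal I = ennreal (C3 powr p * I)" using I0 by (simp add: ennreal_mult)
  finally have le: "(\<integral>\<^sup>+\<xi>. ennreal ((cmod (H \<xi>) * sqrt (\<omega> \<xi>)) powr p) \<partial>\<mu>) \<le> ennreal (C3 powr p * I)" .
  have Hi: "integrable \<mu> (\<lambda>\<xi>. (cmod (H \<xi>) * sqrt (\<omega> \<xi>)) powr p)"
    by (rule integrableI_nonneg) (use le_less_trans[OF le] in auto)
  have "integrable \<mu> (\<lambda>\<xi>. cmod (H \<xi>) powr p * \<omega> \<xi> powr (p / 2))"
    using Hi by (rule integrable_transfer) (auto simp: weighted_powr)
  thus "H \<in> Lp p" using Hm by (simp add: Lp_def)
  have "ennreal (\<integral>\<xi>. (cmod (H \<xi>) * sqrt (\<omega> \<xi>)) powr p \<partial>\<mu>) \<le> ennreal (C3 powr p * I)"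
    using le by (subst (asm) nn_integral_eq_integral[OF Hi]) auto
  hence "(\<integral>\<xi>. (cmod (H \<xi>) * sqrt (\<omega> \<xi>)) powr p \<partial>\<mu>) \<le> C3 powr p * I" using I0 by simp
  hence "(\<integral>\<xi>. (cmod (H \<xi>) * sqrt (\<omega> \<xi>)) powr p \<partial>\<mu>) powr (1 / p) \<le> (C3 powr p * I) powr (1 / p)"
    using p by (intro powr_mono2) (auto intro: integral_nonneg_AE)
  also have "\<dots> = C3 * I powr (1 / p)" using p C3_pos I0 by (simp add: powr_mult powr_powr)
  finally show "bergman_norm p \<omega> H \<le> C3 * bergman_norm p \<omega> h" unfolding bergman_norm_eq I_def a_def .
qed

lemma wker_product_integrable:
  assumes u: "integrable \<mu> u" and u0: "\<And>z. z \<in> \<D> \<Longrightarrow> 0 \<le> u z"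
  shows "integrable (\<mu> \<Otimes>\<^sub>M \<mu>) (\<lambda>q. u (fst q) * wker (fst q) (snd q))"
    "integrable (\<mu> \<Otimes>\<^sub>M \<mu>) (\<lambda>q. u (snd q) * wker (fst q) (snd q))"
proof -
  interpret pair_sigma_finite \<mu> \<mu> by (rule pair_sigma_finite_disk)
  have um [measurable]: "u \<in> borel_measurable \<mu>" using u by auto
  have [measurable]: "(\<lambda>q. u (fst q)) \<in> borel_measurable (\<mu> \<Otimes>\<^sub>M \<mu>)" "(\<lambda>q. u (snd q)) \<in> borel_measurable (\<mu> \<Otimes>\<^sub>M \<mu>)"
    by (rule measurable_compose[OF measurable_fst um], rule measurable_compose[OF measurable_snd um])
  have uf: "(\<integral>\<^sup>+z. ennreal C3 * ennreal (u z) \<partial>\<mu>) < \<infinity>"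
  proof -
    have "(\<integral>\<^sup>+z. ennreal C3 * ennreal (u z) \<partial>\<mu>) = ennreal C3 * (\<integral>\<^sup>+z. ennreal (u z) \<partial>\<mu>)" by (rule nn_integral_cmult) measurable
    also have "(\<integral>\<^sup>+z. ennreal (u z) \<partial>\<mu>) = ennreal (\<integral>z. u z \<partial>\<mu>)" by (rule nn_integral_eq_integral[OF u], rule AE_I2) (simp add: u0)
    finally show ?thesis by (simp add: ennreal_mult_less_top)
  qed
  have inner: "(\<integral>\<^sup>+x. ennreal (u z * kk' x) \<partial>\<mu>) \<le> ennreal C3 * ennreal (u z)"
    if z: "z \<in> \<D>" and k: "kk' \<in> borel_measurable \<mu>" "\<And>x. x \<in> \<D> \<Longrightarrow> 0 \<le> kk' x" "(\<integral>\<^sup>+x. ennreal (kk' x) \<partial>\<mu>) \<le> ennreal C3" for z kk'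
  proof -
    note k(1) [measurable]
    have "(\<integral>\<^sup>+x. ennreal (u z * kk' x) \<partial>\<mu>) = (\<integral>\<^sup>+x. ennreal (u z) * ennreal (kk' x) \<partial>\<mu>)"
      by (rule nn_integral_cong) (simp add: ennreal_mult u0[OF z] k)
    also have "\<dots> = ennreal (u z) * (\<integral>\<^sup>+x. ennreal (kk' x) \<partial>\<mu>)" by (rule nn_integral_cmult) measurable
    also have "\<dots> \<le> ennreal (u z) * ennreal C3" by (rule mult_left_mono[OF k(3)]) simp
    finally show ?thesis by (simp add: mult_ac)
  qed
  have m1: "wker z \<in> borel_measurable \<mu>" "(\<lambda>x. wker x z) \<in> borel_measurable \<mu>" if z: "z \<in> \<D>" for z
  proof -
    show k: "wker z \<in> borel_measurable \<mu>" using wker_int(1)[OF z] by auto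
    show "(\<lambda>x. wker x z) \<in> borel_measurable \<mu>"
      using k by (subst measurable_cong[where g="wker z"]) (auto simp: wker_sym[OF _ z])
  qed
  show "integrable (\<mu> \<Otimes>\<^sub>M \<mu>) (\<lambda>q. u (fst q) * wker (fst q) (snd q))"
  proof (rule integrableI_nonneg)
    show "AE q in \<mu> \<Otimes>\<^sub>M \<mu>. 0 \<le> u (fst q) * wker (fst q) (snd q)"
      by (rule AE_I2) (auto simp: space_pair_measure intro!: mult_nonneg_nonneg u0 wker_nonneg)
    have "(\<integral>\<^sup>+q. ennreal (u (fst q) * wker (fst q) (snd q)) \<partial>(\<mu> \<Otimes>\<^sub>M \<mu>)) = (\<integral>\<^sup>+z. (\<integral>\<^sup>+x. ennreal (u z * wker z x) \<partial>\<mu>) \<partial>\<mu>)"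
      using sigma_finite_measure.nn_integral_fst[OF sigma_finite_disk, of "\<lambda>q. ennreal (u (fst q) * wker (fst q) (snd q))" \<mu>] by simp
    also have "\<dots> \<le> (\<integral>\<^sup>+z. ennreal C3 * ennreal (u z) \<partial>\<mu>)"
      by (intro nn_integral_mono inner m1 wker_nonneg wker_int(3)) auto
    also note uf
    finally show "(\<integral>\<^sup>+q. ennreal (u (fst q) * wker (fst q) (snd q)) \<partial>(\<mu> \<Otimes>\<^sub>M \<mu>)) < \<infinity>" .
  qed measurable
  show "integrable (\<mu> \<Otimes>\<^sub>M \<mu>) (\<lambda>q. u (snd q) * wker (fst q) (snd q))"
  proof (rule integrableI_nonneg)
    show "AE q in \<mu> \<Otimes>\<^sub>M \<mu>. 0 \<le> u (snd q) * wker (fst q) (snd q)"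
      by (rule AE_I2) (auto simp: space_pair_measure intro!: mult_nonneg_nonneg u0 wker_nonneg)
    have "(\<integral>\<^sup>+q. ennreal (u (snd q) * wker (fst q) (snd q)) \<partial>(\<mu> \<Otimes>\<^sub>M \<mu>)) = (\<integral>\<^sup>+z. (\<integral>\<^sup>+x. ennreal (u z * wker x z) \<partial>\<mu>) \<partial>\<mu>)"
      using nn_integral_snd[of "\<lambda>q. ennreal (u (snd q) * wker (fst q) (snd q))"] by simp
    also have "\<dots> \<le> (\<integral>\<^sup>+z. ennreal C3 * ennreal (u z) \<partial>\<mu>)"
      by (intro nn_integral_mono inner m1 wker_nonneg wker_int(4)) auto
    also note uf
    finally show "(\<integral>\<^sup>+q. ennreal (u (snd q) * wker (fst q) (snd q)) \<partial>(\<mu> \<Otimes>\<^sub>M \<mu>)) < \<infinity>" .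
  qed measurable
qed

text \<open>The integral operator with kernel \<open>ker\<close> is self-adjoint for the pairing.
  Fubini's theorem applies because Young's inequality dominates the integrand by
  \<open>(a^p / p + b^p' / p') * wker\<close>, whose double integral is finite. In the applications
  \<open>G\<close> is \<open>g\<close> itself, by the reproducing formula.\<close>

theorem kernel_symmetric_pairing:
  assumes p: "1 < p" "p' = p / (p - 1)" and h: "h \<in> Lp p" and g: "g \<in> Lp p'"
    and H: "\<And>\<xi>. \<xi> \<in> \<D> \<Longrightarrow> H \<xi> = pairing \<omega> h (ker \<xi>)" and G: "\<And>\<xi>. \<xi> \<in> \<D> \<Longrightarrow> G \<xi> = pairing \<omega> g (ker \<xi>)"
  shows "pairing \<omega> h G = pairing \<omega> H g"
proof -
  note c = conjugate_exponent[OF p]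
  interpret pair_sigma_finite \<mu> \<mu> by (rule pair_sigma_finite_disk)
  note hm = LpD(1)[OF h] and gm = LpD(1)[OF g]
  have [measurable]: "(\<lambda>q. h (fst q)) \<in> borel_measurable (\<mu> \<Otimes>\<^sub>M \<mu>)" "(\<lambda>q. g (snd q)) \<in> borel_measurable (\<mu> \<Otimes>\<^sub>M \<mu>)"
    by (rule measurable_compose[OF measurable_fst hm], rule measurable_compose[OF measurable_snd gm])
  let ?P = "\<mu> \<Otimes>\<^sub>M \<mu>"
  define F where "F z x = h z * cnj (g x) * ker z x * of_real (\<omega> z * \<omega> x)" for z x
  define a where "a z = cmod (h z) * sqrt (\<omega> z)" for z
  define b where "b z = cmod (g z) * sqrt (\<omega> z)" for z
  have Fi: "integrable ?P (\<lambda>q. F (fst q) (snd q))"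
  proof (rule integrable_dominated)
    show "integrable ?P (\<lambda>q. a (fst q) powr p / p * wker (fst q) (snd q) + b (snd q) powr p' / p' * wker (fst q) (snd q))"
    proof (rule Bochner_Integration.integrable_add)
      show "integrable ?P (\<lambda>q. a (fst q) powr p / p * wker (fst q) (snd q))"
        by (rule wker_product_integrable(1)[of "\<lambda>z. a z powr p / p"]) (use LpD(3)[OF h] p in \<open>auto simp: a_def\<close>)
      show "integrable ?P (\<lambda>q. b (snd q) powr p' / p' * wker (fst q) (snd q))"
        by (rule wker_product_integrable(2)[of "\<lambda>z. b z powr p' / p'"]) (use LpD(3)[OF g] c(1) in \<open>auto simp: b_def\<close>)
    qed
    show "(\<lambda>q. F (fst q) (snd q)) \<in> borel_measurable ?P" unfolding F_def by measurable
    show "AE q in ?P. norm (F (fst q) (snd q)) \<le> norm (a (fst q) powr p / p * wker (fst q) (snd q) + b (snd q) powr p' / p' * wker (fst q) (snd q))"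
    proof (rule AE_I2)
      fix q assume "q \<in> space ?P"
      then obtain z x where q: "q = (z, x)" "z \<in> \<D>" "x \<in> \<D>" by (auto simp: space_pair_measure)
      have w: "\<omega> z > 0" "\<omega> x > 0" using omega_pos q by auto
      have ab: "0 \<le> a z" "0 \<le> b x" using w by (auto simp: a_def b_def)
      have "norm (F z x) = cmod (h z) * cmod (g x) * cmod (ker z x) * ((sqrt (\<omega> z) * sqrt (\<omega> z)) * (sqrt (\<omega> x) * sqrt (\<omega> x)))"
        using w by (simp add: F_def norm_mult)
      also have "\<dots> = a z * b x * wker z x" by (simp only: a_def b_def wker_def mult_ac)
      also have "\<dots> \<le> (a z powr p / p + b x powr p' / p') * wker z x"
        by (intro mult_right_mono Youngs_inequality[OF p(1) c(1,2) ab] wker_nonneg q)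
      finally have "norm (F z x) \<le> a z powr p / p * wker z x + b x powr p' / p' * wker z x" by (simp only: distrib_right)
      thus "norm (F (fst q) (snd q)) \<le> norm (a (fst q) powr p / p * wker (fst q) (snd q) + b (snd q) powr p' / p' * wker (fst q) (snd q))"
        unfolding q real_norm_def fst_conv snd_conv by (rule order_trans[OF _ abs_ge_self])
    qed
  qed
  have "pairing \<omega> h G = (\<integral>z. (\<integral>x. F z x \<partial>\<mu>) \<partial>\<mu>)"
    unfolding pairing_def
  proof (rule lint_cong[OF refl])
    fix z assume "z \<in> space \<mu>"
    hence z: "z \<in> \<D>" by simp
    have "cnj (G z) = (\<integral>x. cnj (g x * cnj (ker z x) * of_real (\<omega> x)) \<partial>\<mu>)"
      unfolding G[OF z] pairing_def by (rule Bochner_Integration.integral_cnj[symmetric])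
    hence "h z * cnj (G z) * of_real (\<omega> z) = (\<integral>x. h z * cnj (g x * cnj (ker z x) * of_real (\<omega> x)) * of_real (\<omega> z) \<partial>\<mu>)"
      by (simp only: integral_mult_left_zero integral_mult_right_zero)
    also have "\<dots> = (\<integral>x. F z x \<partial>\<mu>)" by (rule lint_cong[OF refl]) (simp add: F_def mult_ac)
    finally show "h z * cnj (G z) * of_real (\<omega> z) = (\<integral>x. F z x \<partial>\<mu>)" .
  qed
  also have "\<dots> = (\<integral>x. (\<integral>z. F z x \<partial>\<mu>) \<partial>\<mu>)"
    by (rule Fubini_integral[symmetric]) (use Fi in \<open>simp add: case_prod_unfold\<close>)
  also have "\<dots> = pairing \<omega> H g"
    unfolding pairing_def
  proof (rule lint_cong[OF refl])
    fix x assume "x \<in> space \<mu>"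
    hence x: "x \<in> \<D>" by simp
    have "(\<integral>z. F z x \<partial>\<mu>) = (\<integral>z. (h z * cnj (ker x z) * of_real (\<omega> z)) * (cnj (g x) * of_real (\<omega> x)) \<partial>\<mu>)"
      by (rule lint_cong[OF refl]) (simp add: F_def ker_sym[OF _ x] mult_ac)
    also have "\<dots> = H x * (cnj (g x) * of_real (\<omega> x))" unfolding H[OF x] pairing_def by simp
    finally show "(\<integral>z. F z x \<partial>\<mu>) = H x * cnj (g x) * of_real (\<omega> x)" by (simp only: mult.assoc)
  qed
  finally show ?thesis .
qed

end

section \<open>Duality\<close>

lemma exhausting_radius: "(\<lambda>n. 1 - 1 / (real n + 2)) \<longlonglongrightarrow> 1" "1 - 1 / (real n + 2) < (1::real)"
proof -
  have "(\<lambda>n. 1 / (real n + 2)) \<longlonglongrightarrow> 0" by real_asymp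
  from tendsto_diff[OF tendsto_const[of 1] this] show "(\<lambda>n. 1 - 1 / (real n + 2)) \<longlonglongrightarrow> 1" by simp
qed simp

lemma exhausting_indicator:
  assumes "cmod z < 1" shows "\<forall>\<^sub>F n in sequentially. z \<in> cball 0 (1 - 1 / (real n + 2))"
  using order_tendstoD(1)[OF exhausting_radius(1) assms] by eventually_elim simp

context regular_weight
begin

text \<open>Bounded functions supported in a smaller disc lie in \<open>L2 N\<close> and in every
  \<open>Lp q\<close> with \<open>q > 0\<close>, so the Hilbert space theory and Schur's test both
  apply to them. They are the test class for norms and for weak limits.\<close>

definition compact_bounded :: "real \<Rightarrow> (complex \<Rightarrow> complex) \<Rightarrow> bool" where
  "compact_bounded R h \<longleftrightarrow> h \<in> borel_measurable \<mu> \<and> (\<exists>B. \<forall>z\<in>\<D>. cmod (h z) \<le> B) \<and> (\<forall>z. R < cmod z \<longrightarrow> cmod z < 1 \<longrightarrow> h z = 0)"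

lemma compact_bounded_L2: "compact_bounded R h \<Longrightarrow> h \<in> L2 N"
  unfolding compact_bounded_def using L2_N_bounded by blast

lemma bounded_on_cball:
  fixes f :: "complex \<Rightarrow> 'b::real_normed_vector"
  assumes "continuous_on \<D> f" "R < 1" obtains B where "0 \<le> B" "\<And>z. z \<in> cball 0 R \<Longrightarrow> norm (f z) \<le> B"
proof -
  have "cball 0 R \<subseteq> \<D>" using assms(2) by auto
  from compact_continuous_bound[OF compact_cball continuous_on_subset[OF assms(1) this]] that show ?thesis by blast
qed

lemma compact_bounded_Lp:
  assumes h: "compact_bounded R h" and R: "R < 1" and q: "q > 0" shows "h \<in> Lp q"
proof -
  obtain B where B: "\<And>z. z \<in> \<D> \<Longrightarrow> cmod (h z) \<le> B" using h unfolding compact_bounded_def by blast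
  have [measurable]: "h \<in> borel_measurable \<mu>" using h by (simp add: compact_bounded_def)
  obtain W where W: "0 \<le> W" "\<And>z. z \<in> cball 0 R \<Longrightarrow> norm (\<omega> z) \<le> W" using bounded_on_cball[OF cont_omega R] by blast
  have "integrable \<mu> (\<lambda>z. cmod (h z) powr q * \<omega> z powr (q / 2))"
  proof (rule integrable_disk_bounded)
    fix z :: complex assume z: "z \<in> \<D>"
    show "norm (cmod (h z) powr q * \<omega> z powr (q / 2)) \<le> B powr q * W powr (q / 2)"
    proof (cases "z \<in> cball 0 R")
      case True
      have "cmod (h z) powr q * \<omega> z powr (q / 2) \<le> B powr q * W powr (q / 2)"
        using B[OF z] W(2)[OF True] omega_pos[OF z] q by (intro mult_mono powr_mono2) auto
      thus ?thesis by simp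
    next
      case False
      hence "h z = 0" using h z by (simp add: compact_bounded_def)
      thus ?thesis using q by simp
    qed
  qed measurable
  thus ?thesis by (simp add: Lp_def)
qed

lemma compact_bounded_indicator:
  assumes "continuous_on \<D> f" "R < 1" shows "compact_bounded R (\<lambda>z. indicator (cball 0 R) z * f z)"
proof -
  obtain B where B: "0 \<le> B" "\<And>z. z \<in> cball 0 R \<Longrightarrow> cmod (f z) \<le> B" using bounded_on_cball[OF assms] by blast
  have "(\<lambda>z. indicator (cball 0 R) z * f z) \<in> borel_measurable \<mu>"
    by (intro borel_measurable_times indicator_meas[OF closed_cball] disk_measurable assms)
  moreover have "\<forall>z\<in>\<D>. cmod (indicator (cball 0 R) z * f z) \<le> B" using B by (simp add: indicator_def)
  moreover have "\<forall>z. R < cmod z \<longrightarrow> cmod z < 1 \<longrightarrow> indicator (cball 0 R) z * f z = 0" by simp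
  ultimately show ?thesis unfolding compact_bounded_def by blast
qed

text \<open>The Bergman projection as an integral operator, set to zero off the disk so that its
  values can belong to \<open>bergman\<close>.\<close>

definition proj :: "(complex \<Rightarrow> complex) \<Rightarrow> complex \<Rightarrow> complex" where
  "proj h \<xi> = (if \<xi> \<in> \<D> then pairing \<omega> h (ker \<xi>) else 0)"

lemma proj_ip: "h \<in> L2 N \<Longrightarrow> \<xi> \<in> \<D> \<Longrightarrow> proj h \<xi> = ip N h (ker \<xi>)"
  using ip_N[of h "ker \<xi>"] A2_meas[OF ker(1)] by (simp add: proj_def L2_N_iff)

lemma proj_A2:
  assumes h: "h \<in> L2 N" shows "proj h \<in> A2" "f \<in> A2 \<Longrightarrow> ip N h f = ip N (proj h) f"
proof -
  obtain f0 s \<gamma> \<gamma>x \<gamma>y where f: "f0 \<in> A2" and t: "\<And>n::nat. testf (s n) (\<gamma> n) (\<gamma>x n) (\<gamma>y n)"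
    and lim: "(\<lambda>n. n2 N (\<lambda>x. TT (\<gamma>x n) (\<gamma>y n) x - (h x - f0 x))) \<longlonglongrightarrow> 0"
    using projection[OF h] by blast
  have eq: "f0 \<xi> = proj h \<xi>" if \<xi>: "\<xi> \<in> \<D>" for \<xi>
  proof -
    have "f0 \<xi> = ip N f0 (ker \<xi>)" by (rule ker(3)[OF \<xi> f])
    also have "\<dots> = ip N h (ker \<xi>)" by (rule ip_approx_A2[OF ker(1)[OF \<xi>] f h t lim, symmetric])
    finally show ?thesis using proj_ip[OF h \<xi>] by simp
  qed
  show "proj h \<in> A2" by (rule A2_cong[OF f eq])
  show "ip N h f = ip N (proj h) f" if fA: "f \<in> A2"
  proof -
    have "ip N h f = ip N f0 f" by (rule ip_approx_A2[OF fA f h t lim])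
    also have "\<dots> = ip N (proj h) f" by (rule ip_cong_disk[OF eq refl])
    finally show ?thesis .
  qed
qed

lemma proj_bergman:
  assumes h: "h \<in> L2 N" "h \<in> Lp p" and p: "1 < p"
  shows "proj h \<in> bergman p \<omega>" "bergman_norm p \<omega> (proj h) \<le> C3 * bergman_norm p \<omega> h"
proof -
  have A: "proj h \<in> A2" by (rule proj_A2(1)[OF h(1)])
  have eq: "proj h \<xi> = pairing \<omega> h (ker \<xi>)" if "\<xi> \<in> \<D>" for \<xi> using that by (simp add: proj_def)
  note s = schur[OF p h(2) A2_meas[OF A] eq]
  show "proj h \<in> bergman p \<omega>" unfolding bergman_def using A2D(2)[OF A] LpD(2)[OF s(1)] by (simp add: proj_def)
  show "bergman_norm p \<omega> (proj h) \<le> C3 * bergman_norm p \<omega> h" by (rule s(2))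
qed

lemma proj_add:
  assumes "f \<in> L2 N" "h \<in> L2 N" shows "proj (\<lambda>z. f z + h z) = (\<lambda>z. proj f z + proj h z)"
proof
  fix \<xi> show "proj (\<lambda>z. f z + h z) \<xi> = proj f \<xi> + proj h \<xi>"
  proof (cases "\<xi> \<in> \<D>")
    case True thus ?thesis
      unfolding proj_ip[OF L2_add[OF assms] True] proj_ip[OF assms(1) True] proj_ip[OF assms(2) True]
      by (intro ip_add_left assms A2D(1) ker(1))
  qed (simp add: proj_def)
qed

lemma proj_cmult: "proj (\<lambda>z. c * f z) = (\<lambda>z. c * proj f z)"
  by (rule ext) (simp add: proj_def pairing_def mult.assoc)

text \<open>Testing with the truncated extremal function gives
  \<open>I <= E * I powr (1 / p)\<close> for the truncated integral \<open>I\<close> of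
  \<open>|g|^p' * \<omega>^(p'/2)\<close>. The truncation makes \<open>I\<close> finite, so that a
  power of it may be cancelled; Fatou's lemma then removes the truncation.\<close>

lemma dual_bound:
  assumes p: "1 < p" "p' = p / (p - 1)" and g: "continuous_on \<D> g" and E: "0 \<le> E"
    and le: "\<And>R h. R < 1 \<Longrightarrow> compact_bounded R h \<Longrightarrow> cmod (pairing \<omega> h g) \<le> E * bergman_norm p \<omega> h"
  shows "g \<in> Lp p'" "bergman_norm p' \<omega> g \<le> E"
proof -
  note c = conjugate_exponent[OF p]
  have gm [measurable]: "g \<in> borel_measurable \<mu>" by (rule disk_measurable[OF g])
  define u where "u R z = indicator (cball 0 R) z * (cmod (g z) powr p' * \<omega> z powr (p' / 2))" for R z
  have ui: "integrable \<mu> (u R)" and uL: "(\<integral>z. u R z \<partial>\<mu>) \<le> E powr p'" if R: "R < 1" for R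
  proof -
    \<comment> \<open>The exponents are chosen so that, on the disc, both
      \<open>|h|^p * \<omega>^(p/2)\<close> and \<open>h * cnj g * \<omega>\<close> equal
      \<open>|g|^p' * \<omega>^(p'/2)\<close>.\<close>
    define h where "h z = of_real (indicator (cball 0 R) z * (cmod (g z) powr (p' - 2) * \<omega> z powr (p' / 2 - 1))) * g z" for z
    note indicator_meas[OF closed_cball, measurable]
    have hm: "h \<in> borel_measurable \<mu>" unfolding h_def by measurable
    have hn: "cmod (h z) = indicator (cball 0 R) z * (cmod (g z) powr (p' - 1) * \<omega> z powr (p' / 2 - 1))" for z
      using powr_add[of "cmod (g z)" "p' - 2" 1] by (cases "g z = 0") (simp_all add: h_def norm_mult abs_mult powr_one)
    obtain B where B: "0 \<le> B" "\<And>z. z \<in> cball 0 R \<Longrightarrow> norm (g z) \<le> B" using bounded_on_cball[OF g R] by blast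
    have cw: "continuous_on \<D> (\<lambda>z. \<omega> z powr (p' / 2 - 1))"
      by (intro continuous_on_powr cont_omega continuous_on_const ballI) (use omega_pos in fastforce)
    obtain W where W: "0 \<le> W" "\<And>z. z \<in> cball 0 R \<Longrightarrow> norm (\<omega> z powr (p' / 2 - 1)) \<le> W"
      using bounded_on_cball[OF cw R] by blast
    have hB: "cmod (h z) \<le> B powr (p' - 1) * W" for z
    proof (cases "z \<in> cball 0 R")
      case True
      have "cmod (g z) powr (p' - 1) * \<omega> z powr (p' / 2 - 1) \<le> B powr (p' - 1) * W"
        using B(2)[OF True] W(2)[OF True] c(1) by (intro mult_mono powr_mono2) auto
      thus ?thesis using True by (simp add: hn)
    qed (simp add: hn W)
    have compact_bounded: "compact_bounded R h" unfolding compact_bounded_def using hm hB by (auto simp: h_def)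
    have hp: "cmod (h z) powr p * \<omega> z powr (p / 2) = u R z" if z: "z \<in> \<D>" for z
    proof (cases "z \<in> cball 0 R")
      case True
      have w: "\<omega> z > 0" by (rule omega_pos[OF z])
      have e: "(p' / 2 - 1) * p + p / 2 = p' / 2" using c(4) by (simp add: field_simps)
      have "cmod (h z) powr p * \<omega> z powr (p / 2) = cmod (g z) powr ((p' - 1) * p) * \<omega> z powr ((p' / 2 - 1) * p + p / 2)"
        using True w by (simp add: hn powr_mult powr_powr powr_add)
      thus ?thesis using True unfolding e c(4) by (simp add: u_def)
    next
      case False thus ?thesis using p by (simp add: u_def hn)
    qed
    have hL: "h \<in> Lp p" by (rule compact_bounded_Lp[OF compact_bounded R]) (use p in simp)
    show ui: "integrable \<mu> (u R)"
      using LpD(2)[OF hL] by (rule integrable_transfer) (simp_all add: hp)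
    define I where "I = (\<integral>z. u R z \<partial>\<mu>)"
    have I0: "I \<ge> 0" unfolding I_def by (rule integral_nonneg_AE) (simp add: u_def)
    have "(\<integral>z. cmod (h z) powr p * \<omega> z powr (p / 2) \<partial>\<mu>) = I"
      unfolding I_def by (rule lint_cong) (simp_all add: hp)
    hence nh: "bergman_norm p \<omega> h = I powr (1 / p)" by (simp add: bergman_norm_def)
    have "pairing \<omega> h g = (\<integral>z. complex_of_real (u R z) \<partial>\<mu>)"
      unfolding pairing_def
    proof (rule lint_cong[OF refl])
      fix z assume "z \<in> space \<mu>"
      hence w: "\<omega> z > 0" using omega_pos by simp
      have 1: "\<omega> z powr (p' / 2 - 1) * \<omega> z = \<omega> z powr (p' / 2)" using w by (simp add: powr_diff)
      have 2: "cmod (g z) powr (p' - 2) * (cmod (g z))\<^sup>2 = cmod (g z) powr p'"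
      proof (cases "g z = 0")
        case False
        hence "(cmod (g z))\<^sup>2 = cmod (g z) powr 2" by (simp add: powr_numeral)
        thus ?thesis using powr_add[of "cmod (g z)" "p' - 2" 2] by simp
      qed simp
      have "h z * cnj (g z) * of_real (\<omega> z) = of_real (indicator (cball 0 R) z * (cmod (g z) powr (p' - 2) * \<omega> z powr (p' / 2 - 1))) * (g z * cnj (g z)) * of_real (\<omega> z)"
        by (simp add: h_def mult_ac)
      also have "g z * cnj (g z) = of_real ((cmod (g z))\<^sup>2)" by (rule complex_norm_square[symmetric])
      also have "of_real (indicator (cball 0 R) z * (cmod (g z) powr (p' - 2) * \<omega> z powr (p' / 2 - 1))) * complex_of_real ((cmod (g z))\<^sup>2) * of_real (\<omega> z)
        = of_real (indicator (cball 0 R) z * ((cmod (g z) powr (p' - 2) * (cmod (g z))\<^sup>2) * (\<omega> z powr (p' / 2 - 1) * \<omega> z)))"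
        by (simp only: of_real_mult mult_ac)
      finally show "h z * cnj (g z) * of_real (\<omega> z) = complex_of_real (u R z)" unfolding 1 2 u_def .
    qed
    also have "\<dots> = of_real I" unfolding I_def by (rule integral_complex_of_real)
    finally have "cmod (pairing \<omega> h g) = I" using I0 by simp
    hence IL: "I \<le> E * I powr (1 / p)" using le[OF R compact_bounded] unfolding nh by simp
    have "I \<le> E powr p'"
    proof (cases "I = 0")
      case False
      hence I: "I > 0" using I0 by simp
      have "I powr (1 / p') * I powr (1 / p) = I" using c(2) I by (simp add: powr_add[symmetric] add.commute powr_one)
      hence "I powr (1 / p') * I powr (1 / p) \<le> E * I powr (1 / p)" using IL by simp
      hence "I powr (1 / p') \<le> E" using I by (simp only: mult_le_cancel_right_pos powr_gt_zero less_imp_neq[THEN not_sym] not_False_eq_True)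
      hence "(I powr (1 / p')) powr p' \<le> E powr p'" using c(1) by (intro powr_mono2) auto
      thus ?thesis using I c(1) by (simp add: powr_powr powr_one)
    qed simp
    thus "(\<integral>z. u R z \<partial>\<mu>) \<le> E powr p'" by (simp add: I_def)
  qed
  have le: "(\<integral>\<^sup>+z. ennreal (cmod (g z) powr p' * \<omega> z powr (p' / 2)) \<partial>\<mu>) \<le> ennreal (E powr p')"
  proof (rule Fatou_bound[of "\<lambda>n. u (1 - 1 / (real n + 2))"])
    note R = exhausting_radius(2)
    show "u (1 - 1 / (real n + 2)) \<in> borel_measurable \<mu>" for n using ui[OF R] by auto
    have "(\<integral>\<^sup>+z. ennreal (u (1 - 1 / (real n + 2)) z) \<partial>\<mu>) = ennreal (\<integral>z. u (1 - 1 / (real n + 2)) z \<partial>\<mu>)" for n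
      by (rule nn_integral_eq_integral[OF ui[OF R]]) (simp add: u_def)
    thus "\<forall>\<^sub>F n in sequentially. (\<integral>\<^sup>+z. ennreal (u (1 - 1 / (real n + 2)) z) \<partial>\<mu>) \<le> ennreal (E powr p')"
      using ennreal_leI[OF uL[OF R]] by simp
    show "AE z in \<mu>. (\<lambda>n. u (1 - 1 / (real n + 2)) z) \<longlonglongrightarrow> cmod (g z) powr p' * \<omega> z powr (p' / 2)"
    proof (rule AE_I2)
      fix z assume "z \<in> space \<mu>"
      hence "\<forall>\<^sub>F n in sequentially. u (1 - 1 / (real n + 2)) z = cmod (g z) powr p' * \<omega> z powr (p' / 2)"
        using eventually_mono[OF exhausting_indicator[of z]] by (simp add: u_def)
      thus "(\<lambda>n. u (1 - 1 / (real n + 2)) z) \<longlonglongrightarrow> cmod (g z) powr p' * \<omega> z powr (p' / 2)" by (rule tendsto_eventually)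
    qed
  qed
  have gi: "integrable \<mu> (\<lambda>z. cmod (g z) powr p' * \<omega> z powr (p' / 2))"
    by (rule integrableI_nonneg) (use le_less_trans[OF le] in auto)
  show "g \<in> Lp p'" using gm gi by (simp add: Lp_def)
  have "ennreal (\<integral>z. cmod (g z) powr p' * \<omega> z powr (p' / 2) \<partial>\<mu>) \<le> ennreal (E powr p')"
    using le by (subst (asm) nn_integral_eq_integral[OF gi]) auto
  hence "(\<integral>z. cmod (g z) powr p' * \<omega> z powr (p' / 2) \<partial>\<mu>) \<le> E powr p'" by simp
  hence "bergman_norm p' \<omega> g \<le> (E powr p') powr (1 / p')"
    unfolding bergman_norm_def using c(1) by (intro powr_mono2) (auto intro: integral_nonneg_AE)
  thus "bergman_norm p' \<omega> g \<le> E" using E c(1) by (simp add: powr_powr powr_one)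
qed

section \<open>Truncation followed by projection\<close>

definition cut :: "nat \<Rightarrow> (complex \<Rightarrow> complex) \<Rightarrow> complex \<Rightarrow> complex" where
  "cut n f z = indicator (cball 0 (1 - 1 / (real n + 2))) z * f z"

lemma cut_compact_bounded: "continuous_on \<D> f \<Longrightarrow> compact_bounded (1 - 1 / (real n + 2)) (cut n f)"
  unfolding cut_def[abs_def] by (rule compact_bounded_indicator[OF _ exhausting_radius(2)])

lemma cut_L2: "continuous_on \<D> f \<Longrightarrow> cut n f \<in> L2 N"
  by (rule compact_bounded_L2[OF cut_compact_bounded])

lemma cut_Lp: "continuous_on \<D> f \<Longrightarrow> q > 0 \<Longrightarrow> cut n f \<in> Lp q"
  by (rule compact_bounded_Lp[OF cut_compact_bounded exhausting_radius(2)])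

lemma cut_add: "cut n (\<lambda>z. f z + g z) = (\<lambda>z. cut n f z + cut n g z)"
  by (simp add: cut_def[abs_def] algebra_simps)

lemma cut_cmult: "cut n (\<lambda>z. c * f z) = (\<lambda>z. c * cut n f z)"
  by (simp add: cut_def[abs_def] algebra_simps)

lemma cut_le: "cmod (cut n f z) \<le> cmod (f z)"
  by (simp add: cut_def indicator_def)

lemma bergman_cont: "f \<in> bergman q \<omega> \<Longrightarrow> continuous_on \<D> f"
  by (auto simp: bergman_def intro: holomorphic_on_imp_continuous_on)

lemma A2_cont: "f \<in> A2 \<Longrightarrow> continuous_on \<D> f"
  by (rule holomorphic_on_imp_continuous_on[OF A2D(2)])

lemma bergman_diff:
  assumes "f \<in> bergman q \<omega>" "g \<in> bergman q \<omega>" "q > 0" shows "(\<lambda>z. f z - g z) \<in> bergman q \<omega>"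
  using LpD(2)[OF Lp_diff[OF bergman_Lp[OF assms(1)] bergman_Lp[OF assms(2)] assms(3)]] assms
  by (auto simp: bergman_def intro: holomorphic_intros)

lemma proj_cut:
  assumes f: "continuous_on \<D> f" and p: "1 < p"
  shows "proj (cut n f) \<in> A2" "proj (cut n f) \<in> bergman p \<omega>" "bergman_norm p \<omega> (proj (cut n f)) \<le> C3 * bergman_norm p \<omega> (cut n f)"
  using proj_A2(1)[OF cut_L2[OF f]] proj_bergman[OF cut_L2[OF f] cut_Lp[OF f] p] p by auto

lemma cut_norm_le:
  assumes f: "continuous_on \<D> f" "f \<in> Lp q" and q: "q > 0"
  shows "bergman_norm q \<omega> (cut n f) \<le> bergman_norm q \<omega> f"
  by (rule Lp_bound(2)[OF LpD(1)[OF cut_Lp[OF f(1) q]] f(2) q cut_le])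

text \<open>By the reproducing formula \<open>f\<close> is its own projection, so the difference is
  the projection of \<open>cut n f - f\<close>. Schur's test bounds it by the norm of that
  truncation error, which tends to zero. This approximates \<open>f\<close> by members of
  \<open>A2\<close> without assuming density.\<close>

theorem proj_cut_tendsto:
  assumes f: "f \<in> bergman p \<omega>" and p: "1 < p"
  shows "(\<lambda>n. bergman_norm p \<omega> (\<lambda>z. proj (cut n f) z - f z)) \<longlonglongrightarrow> 0"
proof -
  have p0: "p > 0" using p by simp
  note fc = bergman_cont[OF f] and fL = bergman_Lp[OF f]
  define h where "h n z = cut n f z - f z" for n z
  have hL: "h n \<in> Lp p" for n unfolding h_def[abs_def] by (rule Lp_diff[OF cut_Lp[OF fc p0] fL p0])
  have le: "bergman_norm p \<omega> (\<lambda>z. proj (cut n f) z - f z) \<le> C3 * bergman_norm p \<omega> (h n)" for n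
  proof (rule schur(2)[OF p hL])
    show "(\<lambda>z. proj (cut n f) z - f z) \<in> borel_measurable \<mu>"
      using A2_meas[OF proj_cut(1)[OF fc p]] LpD(1)[OF fL] by measurable
    fix \<xi> :: complex assume \<xi>: "\<xi> \<in> \<D>"
    note r = bergman_reproducing[OF f p \<xi>]
    have i: "integrable \<mu> (\<lambda>z. cut n f z * cnj (ker \<xi> z) * of_real (\<omega> z))"
    proof (rule integrable_dominated[OF r(1)])
      have [measurable]: "cut n f \<in> borel_measurable \<mu>" "ker \<xi> \<in> borel_measurable \<mu>"
        by (rule LpD(1)[OF cut_Lp[OF fc p0]], rule A2_meas[OF ker(1)[OF \<xi>]])
      show "(\<lambda>z. cut n f z * cnj (ker \<xi> z) * of_real (\<omega> z)) \<in> borel_measurable \<mu>" by measurable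
      show "AE z in \<mu>. norm (cut n f z * cnj (ker \<xi> z) * of_real (\<omega> z)) \<le> norm (f z * cnj (ker \<xi> z) * of_real (\<omega> z))"
        unfolding norm_mult by (intro AE_I2 mult_right_mono cut_le) auto
    qed
    have "proj (cut n f) \<xi> - f \<xi> = pairing \<omega> (cut n f) (ker \<xi>) - pairing \<omega> f (ker \<xi>)" using \<xi> r(2) by (simp add: proj_def)
    also have "\<dots> = pairing \<omega> (h n) (ker \<xi>)"
      unfolding pairing_def h_def left_diff_distrib by (rule Bochner_Integration.integral_diff[OF i r(1), symmetric])
    finally show "proj (cut n f) \<xi> - f \<xi> = pairing \<omega> (h n) (ker \<xi>)" .
  qed
  have "(\<lambda>n. \<integral>z. cmod (h n z) powr p * \<omega> z powr (p / 2) \<partial>\<mu>) \<longlonglongrightarrow> (\<integral>z. 0 \<partial>\<mu>)"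
  proof (rule integral_dominated_convergence[where w="\<lambda>z. cmod (f z) powr p * \<omega> z powr (p / 2)"])
    show "(\<lambda>z. cmod (h n z) powr p * \<omega> z powr (p / 2)) \<in> borel_measurable \<mu>" for n using LpD(2)[OF hL[of n]] by auto
    show "AE z in \<mu>. (\<lambda>n. cmod (h n z) powr p * \<omega> z powr (p / 2)) \<longlonglongrightarrow> 0"
    proof (rule AE_I2)
      fix z assume "z \<in> space \<mu>"
      hence "\<forall>\<^sub>F n in sequentially. cmod (h n z) powr p * \<omega> z powr (p / 2) = 0"
        using eventually_mono[OF exhausting_indicator[of z]] p by (simp add: h_def cut_def)
      thus "(\<lambda>n. cmod (h n z) powr p * \<omega> z powr (p / 2)) \<longlonglongrightarrow> 0" by (rule tendsto_eventually)
    qed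
    show "AE z in \<mu>. norm (cmod (h n z) powr p * \<omega> z powr (p / 2)) \<le> cmod (f z) powr p * \<omega> z powr (p / 2)" for n
      using p by (intro AE_I2) (auto simp: h_def cut_def indicator_def)
  qed (use LpD(2)[OF fL] in simp_all)
  hence "(\<lambda>n. bergman_norm p \<omega> (h n)) \<longlonglongrightarrow> 0"
    unfolding bergman_norm_def using p by (intro tendsto_zero_powrI[of _ _ _ "1 / p"]) (simp_all add: integral_nonneg_AE)
  hence "(\<lambda>n. C3 * bergman_norm p \<omega> (h n)) \<longlonglongrightarrow> C3 * 0" by (intro tendsto_intros)
  hence l: "(\<lambda>n. C3 * bergman_norm p \<omega> (h n)) \<longlonglongrightarrow> 0" by simp
  show ?thesis
    by (rule tendsto_sandwich[OF _ _ tendsto_const l]) (simp_all add: bergman_norm_nonneg le)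
qed

lemma bergman_dual_diff:
  assumes "\<Lambda> \<in> bergman_dual q \<omega>" "f \<in> bergman q \<omega>" "g \<in> bergman q \<omega>" "q > 0"
  shows "\<Lambda> (\<lambda>z. f z - g z) = \<Lambda> f - \<Lambda> g"
proof -
  note d = bergman_diff[OF assms(2,3,4)]
  have a: "\<forall>f\<in>bergman q \<omega>. \<forall>h\<in>bergman q \<omega>. \<Lambda> (\<lambda>z. f z + h z) = \<Lambda> f + \<Lambda> h"
    using assms(1) unfolding bergman_dual_def by simp
  have "\<Lambda> (\<lambda>z. (f z - g z) + g z) = \<Lambda> (\<lambda>z. f z - g z) + \<Lambda> g"
    by (rule bspec[OF bspec[OF a d] assms(3)])
  thus ?thesis by simp
qed

lemma bergman_dual_tendsto:
  assumes \<Lambda>: "\<Lambda> \<in> bergman_dual p \<omega>" and f: "f \<in> bergman p \<omega>" and p: "1 < p"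
  shows "(\<lambda>n. \<Lambda> (proj (cut n f))) \<longlonglongrightarrow> \<Lambda> f"
proof -
  have p0: "p > 0" using p by simp
  obtain C where C: "\<And>f. f \<in> bergman p \<omega> \<Longrightarrow> cmod (\<Lambda> f) \<le> C * bergman_norm p \<omega> f"
    using \<Lambda> unfolding bergman_dual_def by blast
  note P = proj_cut(2)[OF bergman_cont[OF f] p]
  have "(\<lambda>n. \<Lambda> (proj (cut n f)) - \<Lambda> f) \<longlonglongrightarrow> 0"
  proof (rule Lim_null_comparison)
    show "\<forall>\<^sub>F n in sequentially. norm (\<Lambda> (proj (cut n f)) - \<Lambda> f) \<le> C * bergman_norm p \<omega> (\<lambda>z. proj (cut n f) z - f z)"
      using C[OF bergman_diff[OF P f p0]] by (simp add: bergman_dual_diff[OF \<Lambda> P f p0])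
    show "(\<lambda>n. C * bergman_norm p \<omega> (\<lambda>z. proj (cut n f) z - f z)) \<longlonglongrightarrow> 0"
      using tendsto_mult_left[OF proj_cut_tendsto[OF f p], of C] by simp
  qed
  thus ?thesis by (rule LIM_zero_cancel)
qed

section \<open>Representation of functionals and comparison of norms\<close>

theorem pairing_dual:
  assumes p: "1 < p" "p' = p / (p - 1)" and g: "g \<in> bergman p' \<omega>"
  shows "(\<lambda>f. pairing \<omega> f g) \<in> bergman_dual p \<omega>"
proof -
  note H = Holder_pairing[OF p bergman_Lp bergman_Lp[OF g]]
  have "pairing \<omega> (\<lambda>z. f z + h z) g = pairing \<omega> f g + pairing \<omega> h g" if "f \<in> bergman p \<omega>" "h \<in> bergman p \<omega>" for f h
    unfolding pairing_def distrib_right by (rule Bochner_Integration.integral_add[OF H(1)[OF that(1)] H(1)[OF that(2)]])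
  moreover have "pairing \<omega> (\<lambda>z. c * f z) g = c * pairing \<omega> f g" for c f
    by (simp add: pairing_def mult.assoc)
  moreover have "cmod (pairing \<omega> f g) \<le> bergman_norm p' \<omega> g * bergman_norm p \<omega> f" if "f \<in> bergman p \<omega>" for f
    using H(2)[OF that] by (simp add: mult.commute)
  ultimately show ?thesis unfolding bergman_dual_def by blast
qed

text \<open>In the pairing with the holomorphic \<open>g\<close> a compactly supported
  \<open>h\<close> may be replaced by its projection. The hypothesis applies to the projection,
  whose norm costs the factor \<open>C3\<close>.\<close>

theorem lower_bound:
  assumes p: "1 < p" "p' = p / (p - 1)" and g: "g \<in> bergman p' \<omega>" and E: "0 \<le> E"
    and le: "\<And>f. f \<in> bergman p \<omega> \<Longrightarrow> cmod (pairing \<omega> f g) \<le> E * bergman_norm p \<omega> f"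
  shows "bergman_norm p' \<omega> g \<le> E * C3"
proof (rule dual_bound(2)[OF p bergman_cont[OF g]])
  show "0 \<le> E * C3" using E C3_pos by simp
  fix R h assume R: "R < 1" and h: "compact_bounded R h"
  note c = conjugate_exponent[OF p]
  have hL: "h \<in> Lp p" by (rule compact_bounded_Lp[OF h R]) (use p in simp)
  note P = proj_bergman[OF compact_bounded_L2[OF h] hL p(1)]
  have "pairing \<omega> h g = pairing \<omega> (proj h) g"
    by (rule kernel_symmetric_pairing[OF p hL bergman_Lp[OF g]])
      (simp add: proj_def, simp add: bergman_reproducing(2)[OF g c(1)])
  hence "cmod (pairing \<omega> h g) \<le> E * bergman_norm p \<omega> (proj h)" using le[OF P(1)] by simp
  also have "\<dots> \<le> E * (C3 * bergman_norm p \<omega> h)" by (rule mult_left_mono[OF P(2) E])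
  finally show "cmod (pairing \<omega> h g) \<le> E * C3 * bergman_norm p \<omega> h" by (simp add: mult.assoc)
qed

text \<open>\<open>lower_bound\<close> with \<open>E = 0\<close> shows that the difference has norm
  zero; \<open>bergman_pointwise\<close> makes it vanish at every point.\<close>

lemma pairing_unique:
  assumes p: "1 < p" "p' = p / (p - 1)" and g: "g \<in> bergman p' \<omega>" "h \<in> bergman p' \<omega>"
    and eq: "\<And>f. f \<in> bergman p \<omega> \<Longrightarrow> pairing \<omega> f g = pairing \<omega> f h"
  shows "g = h"
proof
  note c = conjugate_exponent[OF p]
  have p'0: "p' > 0" using c(1) by simp
  note d = bergman_diff[OF g p'0]
  have "cmod (pairing \<omega> f (\<lambda>z. g z - h z)) \<le> 0 * bergman_norm p \<omega> f" if f: "f \<in> bergman p \<omega>" for f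
  proof -
    note H = Holder_pairing(1)[OF p bergman_Lp[OF f] bergman_Lp]
    have "pairing \<omega> f (\<lambda>z. g z - h z) = pairing \<omega> f g - pairing \<omega> f h"
      unfolding pairing_def complex_cnj_diff right_diff_distrib left_diff_distrib
      by (rule Bochner_Integration.integral_diff[OF H[OF g(1)] H[OF g(2)]])
    thus ?thesis using eq[OF f] by simp
  qed
  from lower_bound[OF p d order_refl this] have n: "bergman_norm p' \<omega> (\<lambda>z. g z - h z) \<le> 0" by simp
  fix z show "g z = h z"
  proof (cases "z \<in> \<D>")
    case True
    have "cmod (g z - h z) * sqrt (\<omega> z) \<le> C1 / (\<tau> z)\<^sup>2 * bergman_norm p' \<omega> (\<lambda>z. g z - h z)"
      by (rule bergman_pointwise[OF d c(1) True])
    also have "\<dots> \<le> C1 / (\<tau> z)\<^sup>2 * 0" using C1_pos by (intro mult_left_mono n) auto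
    finally have "cmod (g z - h z) * sqrt (\<omega> z) \<le> 0" by simp
    hence "cmod (g z - h z) \<le> 0" using omega_pos[OF True] by (simp add: mult_le_0_iff)
    thus ?thesis by simp
  qed (use g in \<open>simp add: bergman_def\<close>)
qed

text \<open>\<open>A2\<close> need not lie in the domain of the functional. Truncating first and
  projecting afterwards gives a member of \<open>bergman p \<omega>\<close>, bounded by the
  \<open>A2\<close> norm because point evaluations are uniformly bounded on the compact disc of the
  truncation. So \<open>A2_Riesz\<close> applies for each fixed \<open>n\<close>.\<close>

lemma functional_cut_representation:
  assumes p: "1 < p" and \<Lambda>: "\<Lambda> \<in> bergman_dual p \<omega>"
  shows "\<exists>g. g \<in> A2 \<and> (\<forall>f\<in>A2. \<Lambda> (proj (cut n f)) = ip N f g)"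
proof -
  have p0: "p > 0" using p by simp
  have add: "\<forall>f\<in>bergman p \<omega>. \<forall>h\<in>bergman p \<omega>. \<Lambda> (\<lambda>z. f z + h z) = \<Lambda> f + \<Lambda> h"
    and cm: "\<forall>c. \<forall>f\<in>bergman p \<omega>. \<Lambda> (\<lambda>z. c * f z) = c * \<Lambda> f"
    and bd: "\<exists>C. \<forall>f\<in>bergman p \<omega>. cmod (\<Lambda> f) \<le> C * bergman_norm p \<omega> f"
    using \<Lambda> unfolding bergman_dual_def by simp_all
  obtain C0 where C0: "\<forall>f\<in>bergman p \<omega>. cmod (\<Lambda> f) \<le> C0 * bergman_norm p \<omega> f" using bd by (rule exE)
  define R where "R = 1 - 1 / (real n + 2)"
  have R: "R < 1" unfolding R_def by (rule exhausting_radius(2))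
  obtain E where E: "0 \<le> E" "\<And>z. z \<in> cball 0 R \<Longrightarrow> norm (ev z) \<le> E" using bounded_on_cball[OF ev_cont R] by blast
  have c1: "continuous_on \<D> (\<lambda>_. 1 :: complex)" by (rule continuous_on_const)
  define D where "D = \<bar>C0\<bar> * (C3 * (E * bergman_norm p \<omega> (cut n (\<lambda>_. 1))))"
  have bound: "cmod (\<Lambda> (proj (cut n f))) \<le> D * n2 N f" if f: "f \<in> A2" for f
  proof -
    note P = proj_cut[OF A2_cont[OF f] p]
    have "cmod (\<Lambda> (proj (cut n f))) \<le> C0 * bergman_norm p \<omega> (proj (cut n f))" by (rule bspec[OF C0 P(2)])
    also have "\<dots> \<le> \<bar>C0\<bar> * (C3 * bergman_norm p \<omega> (cut n f))"
      by (intro mult_mono P(3)) (simp_all add: bergman_norm_nonneg)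
    also have "\<dots> \<le> \<bar>C0\<bar> * (C3 * (E * n2 N f * bergman_norm p \<omega> (cut n (\<lambda>_. 1))))"
    proof (intro mult_left_mono)
      let ?c = "complex_of_real (E * n2 N f)"
      have "bergman_norm p \<omega> (cut n f) \<le> bergman_norm p \<omega> (cut n (\<lambda>_. ?c))"
      proof (rule Lp_bound(2)[OF _ cut_Lp p0])
        show "cut n f \<in> borel_measurable \<mu>" by (rule LpD(1)[OF cut_Lp[OF A2_cont[OF f] p0]])
        fix z assume z: "z \<in> \<D>"
        show "cmod (cut n f z) \<le> cmod (cut n (\<lambda>_. ?c) z)"
        proof (cases "z \<in> cball 0 R")
          case True
          have "cmod (f z) \<le> ev z * n2 N f" by (rule evaluation_bound[OF f z])
          also have "\<dots> \<le> E * n2 N f" using E(2)[OF True] by (intro mult_right_mono) auto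
          finally have "cmod (f z) \<le> E * n2 N f" .
          hence "cmod (f z) \<le> cmod ?c" unfolding norm_of_real by linarith
          thus ?thesis by (simp only: cut_def norm_mult mult_left_mono norm_ge_zero)
        next
          case False thus ?thesis by (simp add: cut_def R_def)
        qed
      qed (use p0 in simp_all)
      also have "cut n (\<lambda>_. ?c) = (\<lambda>z. ?c * cut n (\<lambda>_. 1) z)" by (simp add: cut_def[abs_def] mult.commute)
      also have "bergman_norm p \<omega> \<dots> = E * n2 N f * bergman_norm p \<omega> (cut n (\<lambda>_. 1))"
        unfolding bergman_norm_cmult[OF p0] norm_of_real using E by simp
      finally show "bergman_norm p \<omega> (cut n f) \<le> E * n2 N f * bergman_norm p \<omega> (cut n (\<lambda>_. 1))" .
    qed (use C3_pos in simp_all)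
    also have "\<dots> = D * n2 N f" by (simp only: D_def mult_ac)
    finally show ?thesis .
  qed
  have add': "\<Lambda> (proj (cut n (\<lambda>z. f z + h z))) = \<Lambda> (proj (cut n f)) + \<Lambda> (proj (cut n h))" if f: "f \<in> A2" and h: "h \<in> A2" for f h
    unfolding cut_add proj_add[OF cut_L2[OF A2_cont[OF f]] cut_L2[OF A2_cont[OF h]]]
    by (rule bspec[OF bspec[OF add proj_cut(2)[OF A2_cont[OF f] p]] proj_cut(2)[OF A2_cont[OF h] p]])
  have cm': "\<Lambda> (proj (cut n (\<lambda>z. c * f z))) = c * \<Lambda> (proj (cut n f))" if f: "f \<in> A2" for c f
    unfolding cut_cmult proj_cmult by (rule bspec[OF spec[OF cm] proj_cut(2)[OF A2_cont[OF f] p]])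
  show ?thesis
  proof (rule A2_Riesz[where \<Lambda>="\<lambda>f. \<Lambda> (proj (cut n f))", OF add' cm' bound])
    fix g assume "g \<in> A2" "\<And>f. f \<in> A2 \<Longrightarrow> \<Lambda> (proj (cut n f)) = ip N f g"
    thus ?thesis by (intro exI[of _ g] conjI ballI)
  qed
qed

text \<open>The representers \<open>G n\<close> are bounded in \<open>Lp p'\<close> uniformly in
  \<open>n\<close> by \<open>dual_bound\<close>, although their construction in \<open>A2\<close> is
  not uniform. Montel's theorem yields a limit \<open>g\<close>. It represents the functional on
  projections of truncations, and these approximate every \<open>f\<close> by
  \<open>proj_cut_tendsto\<close>.\<close>

theorem functional_representation:
  assumes p: "1 < p" "p' = p / (p - 1)" and \<Lambda>: "\<Lambda> \<in> bergman_dual p \<omega>"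
  shows "\<exists>g\<in>bergman p' \<omega>. \<forall>f\<in>bergman p \<omega>. \<Lambda> f = pairing \<omega> f g"
proof -
  note c = conjugate_exponent[OF p]
  have p0: "p > 0" "p' > 0" using p(1) c(1) by simp_all
  obtain C0 where C0: "\<forall>f\<in>bergman p \<omega>. cmod (\<Lambda> f) \<le> C0 * bergman_norm p \<omega> f"
    using \<Lambda> unfolding bergman_dual_def mem_Collect_eq by (elim conjE exE)
  define C where "C = \<bar>C0\<bar>"
  have C: "cmod (\<Lambda> f) \<le> C * bergman_norm p \<omega> f" if "f \<in> bergman p \<omega>" for f
    by (rule order_trans[OF bspec[OF C0 that]]) (simp add: C_def mult_right_mono bergman_norm_nonneg)
  have Cn: "C \<ge> 0" by (simp add: C_def)
  obtain G where G0: "\<forall>n. G n \<in> A2 \<and> (\<forall>f\<in>A2. \<Lambda> (proj (cut n f)) = ip N f (G n))"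
    by (rule exE[OF choice[OF allI[OF functional_cut_representation[OF p(1) \<Lambda>]]]])
  have GA: "G n \<in> A2" for n using G0 by simp
  have Gip: "\<Lambda> (proj (cut n f)) = ip N f (G n)" if "f \<in> A2" for f n using G0 that by blast
  \<comment> \<open>Two projections occur in \<open>\<Lambda> (proj (cut n (proj h)))\<close>; each
    costs a factor \<open>C3\<close>.\<close>
  define M where "M = C * (C3 * C3)"
  have M0: "M \<ge> 0" using Cn C3_pos by (simp add: M_def)
  have GM: "G n \<in> Lp p'" "bergman_norm p' \<omega> (G n) \<le> M" for n
  proof -
    have le: "cmod (pairing \<omega> h (G n)) \<le> M * bergman_norm p \<omega> h" if R: "R < 1" and h: "compact_bounded R h" for R h
    proof -
      have hL: "h \<in> L2 N" "h \<in> Lp p" by (rule compact_bounded_L2[OF h], rule compact_bounded_Lp[OF h R p0(1)])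
      note P = proj_bergman[OF hL p(1)] and A = proj_A2(1)[OF hL(1)]
      note P' = proj_cut[OF A2_cont[OF A] p(1)]
      have "pairing \<omega> h (G n) = ip N h (G n)" by (rule ip_N[OF LpD(1)[OF hL(2)] A2_meas[OF GA], symmetric])
      also have "\<dots> = ip N (proj h) (G n)" by (rule proj_A2(2)[OF hL(1) GA])
      also have "\<dots> = \<Lambda> (proj (cut n (proj h)))" by (rule Gip[OF A, symmetric])
      finally have "cmod (pairing \<omega> h (G n)) \<le> C * bergman_norm p \<omega> (proj (cut n (proj h)))" using C[OF P'(2)] by simp
      also have "\<dots> \<le> C * (C3 * (C3 * bergman_norm p \<omega> h))"
      proof (rule mult_left_mono[OF _ Cn])
        have "bergman_norm p \<omega> (proj (cut n (proj h))) \<le> C3 * bergman_norm p \<omega> (cut n (proj h))" by (rule P'(3))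
        also have "\<dots> \<le> C3 * bergman_norm p \<omega> (proj h)"
          using C3_pos by (intro mult_left_mono cut_norm_le[OF A2_cont[OF A] bergman_Lp[OF P(1)] p0(1)]) simp
        also have "\<dots> \<le> C3 * (C3 * bergman_norm p \<omega> h)" using C3_pos by (intro mult_left_mono P(2)) simp
        finally show "bergman_norm p \<omega> (proj (cut n (proj h))) \<le> C3 * (C3 * bergman_norm p \<omega> h)" .
      qed
      finally show ?thesis by (simp only: M_def mult_ac)
    qed
    show "G n \<in> Lp p'" "bergman_norm p' \<omega> (G n) \<le> M" by (rule dual_bound[OF p A2_cont[OF GA] M0 le]; assumption)+
  qed
  \<comment> \<open>The representers are set to zero off the disk, as membership in
    \<open>bergman\<close> demands.\<close>
  define H where "H n z = (if z \<in> \<D> then G n z else 0)" for n z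
  have HG: "H n z = G n z" if "z \<in> \<D>" for n z using that by (simp add: H_def)
  have Hh: "H n holomorphic_on \<D>" for n by (rule iffD2[OF holomorphic_cong[OF refl HG] A2D(2)[OF GA]])
  have HL: "H n \<in> Lp p'" "bergman_norm p' \<omega> (H n) \<le> M" for n
  proof -
    have 1: "cmod (H n z) \<le> cmod (G n z)" for z by (simp add: H_def)
    note b = Lp_bound[OF holomorphic_meas[OF Hh] GM(1) p0(2) 1]
    show "H n \<in> Lp p'" by (rule b(1))
    show "bergman_norm p' \<omega> (H n) \<le> M" by (rule order_trans[OF b(2) GM(2)])
  qed
  have HB: "H n \<in> bergman p' \<omega>" for n unfolding bergman_def using Hh LpD(2)[OF HL(1)] by (simp add: H_def)
  \<comment> \<open>A continuous pointwise bound valid for all \<open>n\<close>: it provides local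
    boundedness for Montel's theorem and the majorant in \<open>weak\<close>.\<close>
  define b where "b z = C1 / ((\<tau> z)\<^sup>2 * sqrt (\<omega> z)) * M" for z
  have bc: "continuous_on \<D> b" unfolding b_def
  proof (intro continuous_intros tau_cont cont_omega ballI)
    fix z assume z: "z \<in> \<D>" show "(\<tau> z)\<^sup>2 * sqrt (\<omega> z) \<noteq> 0" using tau_pos[OF z] omega_pos[OF z] by simp
  qed
  have Hb: "cmod (H n z) \<le> b z" if z: "z \<in> \<D>" for n z
  proof -
    have w: "sqrt (\<omega> z) > 0" using omega_pos[OF z] by simp
    have "cmod (H n z) * sqrt (\<omega> z) \<le> C1 / (\<tau> z)\<^sup>2 * bergman_norm p' \<omega> (H n)" by (rule bergman_pointwise[OF HB c(1) z])
    also have "\<dots> \<le> C1 / (\<tau> z)\<^sup>2 * M" using C1_pos by (intro mult_left_mono HL(2)) simp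
    finally have "cmod (H n z) \<le> C1 / (\<tau> z)\<^sup>2 * M / sqrt (\<omega> z)" using w by (simp only: pos_le_divide_eq)
    thus ?thesis by (simp add: b_def)
  qed
  obtain g0 r where g0: "g0 holomorphic_on \<D>" and r: "strict_mono (r :: nat \<Rightarrow> nat)"
    and lim: "\<And>x. x \<in> \<D> \<Longrightarrow> (\<lambda>n. H (r n) x) \<longlonglongrightarrow> g0 x"
  proof (rule Montel[OF open_ball, of "range H" 0 1 H])
    show "h holomorphic_on \<D>" if "h \<in> range H" for h using that Hh by auto
    show "\<exists>B. \<forall>h\<in>range H. \<forall>z\<in>K. norm (h z) \<le> B" if K: "compact K" "K \<subseteq> \<D>" for K
    proof -
      obtain B where B: "\<And>z. z \<in> K \<Longrightarrow> norm (b z) \<le> B"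
        using compact_continuous_bound[OF K(1) continuous_on_subset[OF bc K(2)]] by blast
      have "norm (H n z) \<le> B" if "z \<in> K" for n z
        using Hb[of z n] K(2) B[OF that] that by (intro order_trans[OF Hb]) auto
      thus ?thesis by blast
    qed
  qed auto
  define g where "g z = (if z \<in> \<D> then g0 z else 0)" for z
  have gh: "g holomorphic_on \<D>"
    by (rule iffD2[OF holomorphic_cong[OF refl] g0]) (simp add: g_def)
  have lg: "(\<lambda>n. H (r n) z) \<longlonglongrightarrow> g z" if "z \<in> \<D>" for z using lim[OF that] that by (simp add: g_def)
  have "(\<integral>\<^sup>+z. ennreal ((cmod (g z) * sqrt (\<omega> z)) powr p') \<partial>\<mu>) \<le> ennreal (M powr p')"
  proof (rule Fatou_bound[of "\<lambda>n z. (cmod (H (r n) z) * sqrt (\<omega> z)) powr p'"])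
    show "(\<lambda>z. (cmod (H (r n) z) * sqrt (\<omega> z)) powr p') \<in> borel_measurable \<mu>" for n using LpD(3)[OF HL(1)[of "r n"]] by auto
    have "(\<lambda>n. (cmod (H (r n) z) * sqrt (\<omega> z)) powr p') \<longlonglongrightarrow> (cmod (g z) * sqrt (\<omega> z)) powr p'" if "z \<in> space \<mu>" for z
      using that p0 omega_pos[of z] by (intro tendsto_powr2 tendsto_intros lg) auto
    thus "AE z in \<mu>. (\<lambda>n. (cmod (H (r n) z) * sqrt (\<omega> z)) powr p') \<longlonglongrightarrow> (cmod (g z) * sqrt (\<omega> z)) powr p'" by (rule AE_I2)
    have "bergman_norm p' \<omega> (H (r n)) powr p' \<le> M powr p'" for n using p0 by (intro powr_mono2 HL(2) bergman_norm_nonneg) simp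
    hence "(\<integral>z. (cmod (H (r n) z) * sqrt (\<omega> z)) powr p' \<partial>\<mu>) \<le> M powr p'" for n
      unfolding bergman_norm_eq powr_powr using p0 by (simp add: powr_one integral_nonneg_AE)
    thus "\<forall>\<^sub>F n in sequentially. (\<integral>\<^sup>+z. ennreal ((cmod (H (r n) z) * sqrt (\<omega> z)) powr p') \<partial>\<mu>) \<le> ennreal (M powr p')"
      by (subst nn_integral_eq_integral[OF LpD(3)[OF HL(1)]]) (simp_all add: ennreal_leI)
  qed
  moreover have [measurable]: "g \<in> borel_measurable \<mu>" by (rule holomorphic_meas[OF gh])
  ultimately have gi: "integrable \<mu> (\<lambda>z. (cmod (g z) * sqrt (\<omega> z)) powr p')"
    by (intro integrableI_nonneg) (auto intro: le_less_trans)
  have "integrable \<mu> (\<lambda>z. cmod (g z) powr p' * \<omega> z powr (p' / 2))"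
    using gi by (rule integrable_transfer) (auto simp: weighted_powr)
  hence gB: "g \<in> bergman p' \<omega>" unfolding bergman_def using gh by (simp add: g_def)
  \<comment> \<open>Pointwise convergence suffices, because \<open>h\<close> lives on a compact
    disc, where the functions \<open>H n\<close> are uniformly bounded.\<close>
  have weak: "(\<lambda>n. pairing \<omega> h (H (r n))) \<longlonglongrightarrow> pairing \<omega> h g" if R: "R < 1" and h: "compact_bounded R h" for R h
  proof -
    have hm [measurable]: "h \<in> borel_measurable \<mu>" using h by (simp add: compact_bounded_def)
    obtain B where B: "\<forall>z\<in>\<D>. cmod (h z) \<le> B" using h unfolding compact_bounded_def by (elim conjE exE)
    obtain W where W: "0 \<le> W" "\<And>z. z \<in> cball 0 R \<Longrightarrow> norm (b z) \<le> W" using bounded_on_cball[OF bc R] by blast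
    have [measurable]: "H n \<in> borel_measurable \<mu>" for n by (rule holomorphic_meas[OF Hh])
    show ?thesis unfolding pairing_def
    proof (rule integral_dominated_convergence[where w="\<lambda>z. \<bar>B\<bar> * W * \<omega> z"])
      show "integrable \<mu> (\<lambda>z. \<bar>B\<bar> * W * \<omega> z)" using omega_int by simp
      show "AE z in \<mu>. (\<lambda>n. h z * cnj (H (r n) z) * of_real (\<omega> z)) \<longlonglongrightarrow> h z * cnj (g z) * of_real (\<omega> z)"
        by (intro AE_I2 tendsto_intros lg) simp
      show "AE z in \<mu>. norm (h z * cnj (H (r n) z) * of_real (\<omega> z)) \<le> \<bar>B\<bar> * W * \<omega> z" for n
      proof (rule AE_I2)
        fix z assume "z \<in> space \<mu>"
        hence z: "z \<in> \<D>" by simp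
        show "norm (h z * cnj (H (r n) z) * of_real (\<omega> z)) \<le> \<bar>B\<bar> * W * \<omega> z"
        proof (cases "z \<in> cball 0 R")
          case True
          have "cmod (h z) \<le> \<bar>B\<bar>" using bspec[OF B z] by linarith
          moreover have "cmod (H (r n) z) \<le> W" using Hb[OF z, of "r n"] W(2)[OF True] by simp
          ultimately have "cmod (h z) * cmod (H (r n) z) * \<omega> z \<le> \<bar>B\<bar> * W * \<omega> z"
            using omega_pos[OF z] by (intro mult_right_mono mult_mono) auto
          thus ?thesis using omega_pos[OF z] by (simp add: norm_mult)
        next
          case False
          hence "h z = 0" using h z by (simp add: compact_bounded_def)
          thus ?thesis using W omega_pos[OF z] by simp
        qed
      qed
    qed measurable
  qed
  note gD = pairing_dual[OF p gB]
  have "\<Lambda> f = pairing \<omega> f g" if f: "f \<in> bergman p \<omega>" for f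
  proof -
    note fc = bergman_cont[OF f]
    \<comment> \<open>With \<open>h = cut m f\<close>, the value \<open>\<Lambda> (proj h)\<close>
      is the limit of \<open>\<Lambda> (proj (cut (r n) (proj h)))\<close>, which by the choice of
      the representers is the pairing of \<open>h\<close> with \<open>H (r n)\<close>;
      \<open>weak\<close> gives the limit of the latter.\<close>
    have eq: "\<Lambda> (proj (cut m f)) = pairing \<omega> (proj (cut m f)) g" for m
    proof -
      define h where "h = cut m f"
      have h: "compact_bounded (1 - 1 / (real m + 2)) h" unfolding h_def by (rule cut_compact_bounded[OF fc])
      have hL: "h \<in> L2 N" "h \<in> Lp p" unfolding h_def by (rule cut_L2[OF fc], rule cut_Lp[OF fc p0(1)])
      note P = proj_bergman(1)[OF hL p(1)] and A = proj_A2[OF hL(1)]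
      have "(\<lambda>n. \<Lambda> (proj (cut (r n) (proj h)))) \<longlonglongrightarrow> \<Lambda> (proj h)"
        using LIMSEQ_subseq_LIMSEQ[OF bergman_dual_tendsto[OF \<Lambda> P p(1)] r] by (simp add: comp_def)
      moreover have "\<Lambda> (proj (cut (r n) (proj h))) = pairing \<omega> h (H (r n))" for n
      proof -
        have "\<Lambda> (proj (cut (r n) (proj h))) = ip N (proj h) (G (r n))" by (rule Gip[OF A(1)])
        also have "\<dots> = ip N h (G (r n))" by (rule A(2)[OF GA, symmetric])
        also have "\<dots> = ip N h (H (r n))" by (rule ip_cong_disk) (simp_all add: H_def)
        also have "\<dots> = pairing \<omega> h (H (r n))" by (rule ip_N[OF LpD(1)[OF hL(2)] LpD(1)[OF HL(1)]])
        finally show ?thesis .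
      qed
      ultimately have "(\<lambda>n. pairing \<omega> h (H (r n))) \<longlonglongrightarrow> \<Lambda> (proj h)" by simp
      hence "\<Lambda> (proj h) = pairing \<omega> h g" using weak[OF exhausting_radius(2) h] by (rule LIMSEQ_unique)
      also have "\<dots> = pairing \<omega> (proj h) g"
        by (rule kernel_symmetric_pairing[OF p hL(2) bergman_Lp[OF gB]])
          (simp add: proj_def, simp add: bergman_reproducing(2)[OF gB c(1)])
      finally show ?thesis unfolding h_def .
    qed
    have "(\<lambda>m. \<Lambda> (proj (cut m f))) \<longlonglongrightarrow> \<Lambda> f" by (rule bergman_dual_tendsto[OF \<Lambda> f p(1)])
    moreover have "(\<lambda>m. \<Lambda> (proj (cut m f))) \<longlonglongrightarrow> pairing \<omega> f g"
      unfolding eq by (rule bergman_dual_tendsto[OF gD f p(1)])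
    ultimately show ?thesis by (rule LIMSEQ_unique)
  qed
  thus ?thesis using gB by (intro bexI[of _ g] ballI)
qed

lemma bergman_cmult: "f \<in> bergman q \<omega> \<Longrightarrow> (\<lambda>z. c * f z) \<in> bergman q \<omega>"
  by (auto simp: bergman_def norm_mult powr_mult mult.assoc intro!: holomorphic_intros)

theorem dual_norm_comparable:
  assumes p: "1 < p" "p' = p / (p - 1)"
  shows "comparable_on (bergman p' \<omega>) (\<lambda>g. dual_norm p \<omega> (\<lambda>f. pairing \<omega> f g)) (\<lambda>g. bergman_norm p' \<omega> g)"
  unfolding comparable_on_def
\<comment> \<open>One constant must serve both inequalities: \<open>C3\<close> for the lower bound
  and 1 for Hoelder's inequality, hence their sum.\<close>
proof (intro exI[of _ "C3 + 1"] conjI ballI)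
  show "C3 + 1 > 0" using C3_pos by simp
  have p0: "p > 0" using p by simp
  fix g assume g: "g \<in> bergman p' \<omega>"
  note H = Holder_pairing(2)[OF p bergman_Lp bergman_Lp[OF g]]
  let ?B = "{f \<in> bergman p \<omega>. bergman_norm p \<omega> f \<le> 1}"
  let ?n = "dual_norm p \<omega> (\<lambda>f. pairing \<omega> f g)"
  have z: "(\<lambda>_. 0) \<in> ?B" using p by (simp add: bergman_def bergman_norm_def)
  have le: "cmod (pairing \<omega> f g) \<le> bergman_norm p' \<omega> g" if f: "f \<in> ?B" for f
  proof -
    have "cmod (pairing \<omega> f g) \<le> bergman_norm p \<omega> f * bergman_norm p' \<omega> g" using f by (intro H) simp
    also have "\<dots> \<le> 1 * bergman_norm p' \<omega> g" using f by (intro mult_right_mono bergman_norm_nonneg) simp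
    finally show ?thesis by simp
  qed
  have bdd: "bdd_above ((\<lambda>f. cmod (pairing \<omega> f g)) ` ?B)" using le by (intro bdd_aboveI2)
  have up: "?n \<le> bergman_norm p' \<omega> g" unfolding dual_norm_def by (rule cSUP_least) (use z le in auto)
  have sup: "cmod (pairing \<omega> f g) \<le> ?n" if "f \<in> ?B" for f unfolding dual_norm_def by (rule cSUP_upper[OF that bdd])
  have n0: "0 \<le> ?n" by (rule order_trans[OF norm_ge_zero sup[OF z]])
  have "cmod (pairing \<omega> f g) \<le> ?n * bergman_norm p \<omega> f" if f: "f \<in> bergman p \<omega>" for f
  proof (cases "bergman_norm p \<omega> f = 0")
    case True thus ?thesis using H[OF f] by simp
  next
    case False
    define a where "a = bergman_norm p \<omega> f"
    have a: "a > 0" using False bergman_norm_nonneg[of p \<omega> f] by (simp add: a_def)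
    have "(\<lambda>z. of_real (1 / a) * f z) \<in> bergman p \<omega>"
      by (rule bergman_cmult[OF f])
    moreover have "bergman_norm p \<omega> (\<lambda>z. of_real (1 / a) * f z) = 1"
      unfolding bergman_norm_cmult[OF p0] norm_of_real using a by (simp add: a_def[symmetric])
    ultimately have "cmod (pairing \<omega> (\<lambda>z. of_real (1 / a) * f z) g) \<le> ?n" by (intro sup) simp
    also have "pairing \<omega> (\<lambda>z. of_real (1 / a) * f z) g = of_real (1 / a) * pairing \<omega> f g"
      unfolding pairing_def mult.assoc by (rule integral_mult_right_zero)
    finally have "cmod (pairing \<omega> f g) / a \<le> ?n" using a by (simp add: norm_mult norm_divide)
    thus ?thesis using a by (simp add: a_def[symmetric] pos_divide_le_eq)
  qed
  from lower_bound[OF p g n0 this] have low: "bergman_norm p' \<omega> g \<le> ?n * C3" .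
  also have "\<dots> \<le> ?n * (C3 + 1)" using n0 by (intro mult_left_mono) auto
  finally have "bergman_norm p' \<omega> g / (C3 + 1) \<le> ?n" using C3_pos by (simp add: pos_divide_le_eq)
  thus "inverse (C3 + 1) * bergman_norm p' \<omega> g \<le> ?n" by (simp add: inverse_eq_divide)
  have "1 * bergman_norm p' \<omega> g \<le> (C3 + 1) * bergman_norm p' \<omega> g" using C3_pos by (intro mult_right_mono bergman_norm_nonneg) simp
  thus "?n \<le> (C3 + 1) * bergman_norm p' \<omega> g" using up by simp
qed

theorem bergman_duality:
  assumes p: "1 < p" "p' = p / (p - 1)"
  shows "(\<forall>g \<in> bergman p' \<omega>.
            (\<forall>f \<in> bergman p \<omega>. integrable \<mu> (\<lambda>z. f z * cnj (g z) * of_real (\<omega> z))) \<and>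
            (\<lambda>f. pairing \<omega> f g) \<in> bergman_dual p \<omega>) \<and>
         (\<forall>\<Lambda> \<in> bergman_dual p \<omega>.
            \<exists>!g. g \<in> bergman p' \<omega> \<and> (\<forall>f \<in> bergman p \<omega>. \<Lambda> f = pairing \<omega> f g)) \<and>
         comparable_on (bergman p' \<omega>)
           (\<lambda>g. dual_norm p \<omega> (\<lambda>f. pairing \<omega> f g)) (\<lambda>g. bergman_norm p' \<omega> g)"
proof (intro conjI ballI)
  fix \<Lambda> assume "\<Lambda> \<in> bergman_dual p \<omega>"
  from functional_representation[OF p this] obtain g where g: "g \<in> bergman p' \<omega>" "\<forall>f\<in>bergman p \<omega>. \<Lambda> f = pairing \<omega> f g" by (elim bexE)
  show "\<exists>!g. g \<in> bergman p' \<omega> \<and> (\<forall>f \<in> bergman p \<omega>. \<Lambda> f = pairing \<omega> f g)"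
  proof (rule ex1I[of _ g])
    fix h assume h: "h \<in> bergman p' \<omega> \<and> (\<forall>f \<in> bergman p \<omega>. \<Lambda> f = pairing \<omega> f h)"
    show "h = g" by (rule pairing_unique[OF p conjunct1[OF h] g(1)]) (use h g(2) in simp)
  qed (use g in simp)
next
  show "integrable \<mu> (\<lambda>z. f z * cnj (g z) * of_real (\<omega> z))" if "g \<in> bergman p' \<omega>" "f \<in> bergman p \<omega>" for f g
    by (rule Holder_pairing(1)[OF p bergman_Lp[OF that(2)] bergman_Lp[OF that(1)]])
qed (rule pairing_dual[OF p], assumption, rule dual_norm_comparable[OF p])

end

section \<open>Weights of class \<open>\<E>\<close>\<close>

lemma C1_on_pd:
  assumes "C1_on S u" "b \<in> Basis" shows "pd b S u (partial_deriv b u)"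
  unfolding pd_def
proof (intro conjI ballI)
  show "continuous_on S u" "continuous_on S (partial_deriv b u)" using assms by (auto simp: C1_on_def)
  fix z assume "z \<in> S"
  hence "(\<lambda>t::real. u (z + t *\<^sub>R b)) differentiable (at 0)" using assms by (auto simp: C1_on_def)
  hence "DERIV (\<lambda>t::real. u (z + t *\<^sub>R b)) 0 :> deriv (\<lambda>t. u (z + t *\<^sub>R b)) 0"
    by (simp only: DERIV_deriv_iff_real_differentiable)
  thus "((\<lambda>t::real. u (z + t *\<^sub>R b)) has_vector_derivative partial_deriv b u z) (at 0)"
    unfolding partial_deriv_def has_real_derivative_iff_has_vector_derivative .
qed

text \<open>The work lies in the choice of constants: \<open>\<delta>\<close> comes from the two
  conditions of class L, \<open>K\<close> from the comparability with the Laplacian, and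
  \<open>L\<close> from the growth condition, used for a single \<open>m\<close> that is large in
  terms of \<open>K\<close>.\<close>

lemma class_E_regular_weight:
  assumes "\<omega> \<in> class_E"
  shows "\<exists>\<phi> px py pxx pyy \<tau> \<delta> K L. regular_weight \<omega> \<phi> px py pxx pyy \<tau> \<delta> K L"
proof -
  obtain \<tau> where w: "weight \<omega>" and as: "associated_function \<omega> \<tau>"
    and far: "\<forall>m::nat. 1 \<le> m \<longrightarrow> (\<exists>b>0. \<exists>t>0. t < 1 / real m \<and>
              (\<forall>z\<in>\<D>. \<forall>\<xi>\<in>\<D>. b * \<tau> \<xi> < cmod (z - \<xi>) \<longrightarrow> \<tau> z \<le> \<tau> \<xi> + t * cmod (z - \<xi>)))"
    using assms unfolding class_E_def class_L_star_def by blast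
  obtain \<phi> where tL: "\<tau> \<in> class_L" and C2: "C2_on \<D> \<phi>" and om: "\<forall>z\<in>\<D>. \<omega> z = exp (- 2 * \<phi> z)"
    and lp: "\<forall>z\<in>\<D>. laplacian \<phi> z > 0" and cmp: "comparable_on \<D> (\<lambda>z. laplacian \<phi> z powr (- 1 / 2)) \<tau>"
    using as unfolding associated_function_def by blast
  obtain c1 c2 where t0: "\<And>z. z \<in> \<D> \<Longrightarrow> \<tau> z > 0" and c1: "\<forall>z\<in>\<D>. \<tau> z \<le> c1 * (1 - cmod z)"
    and c2: "\<forall>z\<in>\<D>. \<forall>\<zeta>\<in>\<D>. \<bar>\<tau> z - \<tau> \<zeta>\<bar> \<le> c2 * cmod (z - \<zeta>)"
    using tL unfolding class_L_def by blast
  obtain C where C: "C > 0" "\<forall>z\<in>\<D>. inverse C * \<tau> z \<le> laplacian \<phi> z powr (- 1 / 2) \<and> laplacian \<phi> z powr (- 1 / 2) \<le> C * \<tau> z"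
    using cmp unfolding comparable_on_def by blast
  define d1 where "d1 = max 1 c1"
  define d2 where "d2 = max 1 c2"
  have d: "d1 \<ge> 1" "d2 \<ge> 1" by (simp_all add: d1_def d2_def)
  have le1: "\<tau> z \<le> d1 * (1 - cmod z)" if z: "z \<in> \<D>" for z
  proof -
    have "c1 * (1 - cmod z) \<le> d1 * (1 - cmod z)" using z by (intro mult_right_mono) (simp_all add: d1_def)
    thus ?thesis using bspec[OF c1 z] by linarith
  qed
  have le2: "\<bar>\<tau> z - \<tau> w\<bar> \<le> d2 * cmod (z - w)" if z: "z \<in> \<D>" and w: "w \<in> \<D>" for z w
  proof -
    have "c2 * cmod (z - w) \<le> d2 * cmod (z - w)" by (intro mult_right_mono) (simp_all add: d2_def)
    thus ?thesis using bspec[OF bspec[OF c2 z] w] by linarith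
  qed
  \<comment> \<open>The products of \<open>\<delta>\<close> with \<open>d1\<close> and
    \<open>d2\<close> are at most 1/4: the first keeps discs of radius
    \<open>2 * \<delta> * \<tau> z\<close> inside the disk, the second limits the change of
    \<open>\<tau>\<close> on discs of radius \<open>\<delta> * \<tau> z\<close> to a
    quarter.\<close>
  define \<delta> where "\<delta> = 1 / (4 * (d1 + d2))"
  have \<delta>: "\<delta> > 0" "\<delta> \<le> 1" "4 * (\<delta> * d1) \<le> 1" "4 * (\<delta> * d2) \<le> 1"
    using d by (simp_all add: \<delta>_def divide_simps)
  \<comment> \<open>Comparability is stated for the power -1/2 of the Laplacian, so its constant
    gets squared.\<close>
  define K where "K = C\<^sup>2"
  have lap: "1 / (K * (\<tau> z)\<^sup>2) \<le> laplacian \<phi> z \<and> laplacian \<phi> z \<le> K / (\<tau> z)\<^sup>2 \<and> 1 \<le> K" if z: "z \<in> \<D>" for z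
  proof -
    define l where "l = laplacian \<phi> z"
    have l: "l > 0" using lp z by (simp add: l_def)
    note t = t0[OF z]
    define s where "s = sqrt l"
    have s: "s > 0" "l = s\<^sup>2" using l by (simp_all add: s_def)
    have "l powr (- 1 / 2) = 1 / s" using l by (simp add: s_def powr_minus_divide powr_half_sqrt)
    hence b: "inverse C * \<tau> z \<le> 1 / s" "1 / s \<le> C * \<tau> z" using bspec[OF C(2) z] by (simp_all add: l_def)
    have 1: "s * \<tau> z \<le> C" using b(1) C(1) s(1) by (simp add: field_simps)
    have 2: "1 \<le> C * (s * \<tau> z)" using b(2) s(1) by (simp add: divide_le_eq mult_ac)
    have "(s * \<tau> z)\<^sup>2 \<le> C\<^sup>2" using 1 s t by (intro power_mono) auto
    hence a1: "l \<le> K / (\<tau> z)\<^sup>2" using t by (simp add: K_def s(2) power_mult_distrib pos_le_divide_eq)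
    have "1\<^sup>2 \<le> (C * (s * \<tau> z))\<^sup>2" using 2 by (intro power_mono) auto
    hence a2: "1 / (K * (\<tau> z)\<^sup>2) \<le> l" using t C(1) by (simp add: K_def s(2) power_mult_distrib pos_divide_le_eq mult_ac)
    have "C * (s * \<tau> z) \<le> C * C" using 1 C(1) by (intro mult_left_mono) auto
    hence "1 \<le> K" using 2 by (simp add: K_def power2_eq_square)
    thus ?thesis using a1 a2 by (simp add: l_def)
  qed
  have K1: "1 \<le> K" using lap[of 0] by simp
  \<comment> \<open>The slope \<open>t < 1 / m\<close> then satisfies
    \<open>128 * K * t^2 <= 1\<close>, so that the linear growth of \<open>\<tau>\<close> is
    absorbed by \<open>(cmod (z - w))^2\<close>. 128 is twice 64, because of the estimate
    \<open>(x + y)^2 <= 2 * x^2 + 2 * y^2\<close>.\<close>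
  define m where "m = nat \<lceil>128 * K\<rceil>"
  have m: "128 * K \<le> real m" "1 \<le> m" using K1 by (auto simp: m_def le_nat_iff)
  obtain b t where b: "b > 0" and t: "t > 0" "t < 1 / real m"
    and bt: "\<forall>z\<in>\<D>. \<forall>\<xi>\<in>\<D>. b * \<tau> \<xi> < cmod (z - \<xi>) \<longrightarrow> \<tau> z \<le> \<tau> \<xi> + t * cmod (z - \<xi>)"
    using far[rule_format, OF m(2)] by blast
  have t1: "128 * K * t\<^sup>2 \<le> 1"
  proof -
    have "t * real m \<le> 1" using t m(2) by (simp add: field_simps)
    hence "(t * real m)\<^sup>2 \<le> 1" using t by (intro power_le_one) auto
    moreover have "128 * K * 1 \<le> real m * real m" using m by (intro mult_mono) auto
    hence "t\<^sup>2 * (128 * K * 1) \<le> t\<^sup>2 * (real m * real m)" by (rule mult_left_mono) simp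
    ultimately show ?thesis by (simp add: power2_eq_square mult_ac)
  qed
  \<comment> \<open>This accounts for points with \<open>cmod (z - w) <= b * \<tau> w\<close>, about
    which the growth condition says nothing: there the Lipschitz condition gives
    \<open>\<tau> z <= (1 + d2 * b) * \<tau> w\<close>.\<close>
  define B where "B = 1 + d2 * b"
  have B: "B \<ge> 1" using d b by (simp add: B_def)
  define L where "L = B * (128 * K)"
  have L1: "1 \<le> L"
  proof -
    have "1 * 1 \<le> B * (128 * K)" using B K1 by (intro mult_mono) auto
    thus ?thesis by (simp add: L_def)
  qed
  have slow: "64 * K * (\<tau> z)\<^sup>2 \<le> L\<^sup>2 * (\<tau> w)\<^sup>2 + (cmod (z - w))\<^sup>2" if z: "z \<in> \<D>" and w: "w \<in> \<D>" for z w
  proof -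
    let ?r = "cmod (z - w)"
    have "\<tau> z \<le> B * \<tau> w + t * ?r"
    proof (cases "b * \<tau> w < ?r")
      case True
      have "1 * \<tau> w \<le> B * \<tau> w" using B t0[OF w] by (intro mult_right_mono) auto
      thus ?thesis using bspec[OF bspec[OF bt z] w] True by simp
    next
      case False
      hence "d2 * ?r \<le> d2 * (b * \<tau> w)" using d by (intro mult_left_mono) auto
      moreover have "0 \<le> t * ?r" using t by simp
      ultimately show ?thesis using le2[OF z w] by (simp add: B_def algebra_simps)
    qed
    hence "(\<tau> z)\<^sup>2 \<le> (B * \<tau> w + t * ?r)\<^sup>2" using t0[OF z] by (intro power_mono) auto
    also have "\<dots> \<le> 2 * (B * \<tau> w)\<^sup>2 + 2 * (t * ?r)\<^sup>2"
      using sum_squares_bound[of "B * \<tau> w" "t * ?r"] unfolding power2_sum by linarith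
    finally have "64 * K * (\<tau> z)\<^sup>2 \<le> 64 * K * (2 * (B * \<tau> w)\<^sup>2 + 2 * (t * ?r)\<^sup>2)" using K1 by (intro mult_left_mono) auto
    also have "\<dots> = (128 * K * B\<^sup>2) * (\<tau> w)\<^sup>2 + (128 * K * t\<^sup>2) * ?r\<^sup>2" by (simp add: power_mult_distrib algebra_simps)
    also have "\<dots> \<le> L\<^sup>2 * (\<tau> w)\<^sup>2 + 1 * ?r\<^sup>2"
    proof (intro add_mono mult_right_mono t1)
      have "128 * K * 1 \<le> 128 * K * (128 * K)" using K1 by (intro mult_left_mono) auto
      hence "B\<^sup>2 * (128 * K * 1) \<le> B\<^sup>2 * (128 * K * (128 * K))" by (rule mult_left_mono) simp
      thus "128 * K * B\<^sup>2 \<le> L\<^sup>2" by (simp add: L_def power2_eq_square mult_ac)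
    qed auto
    finally show ?thesis by simp
  qed
  have B1: "(1::complex) \<in> Basis" "\<i> \<in> Basis" by (simp_all add: Basis_complex_def)
  have C1: "C1_on \<D> \<phi>" "\<And>b. b \<in> Basis \<Longrightarrow> C1_on \<D> (partial_deriv b \<phi>)" using C2 by (auto simp: C2_on_def)
  have lapl: "laplacian \<phi> z = partial_deriv 1 (partial_deriv 1 \<phi>) z + partial_deriv \<i> (partial_deriv \<i> \<phi>) z" for z
    by (simp add: laplacian_def Basis_complex_def)
  interpret disk_weight \<omega> \<phi> "partial_deriv 1 \<phi>" "partial_deriv \<i> \<phi>" "partial_deriv 1 (partial_deriv 1 \<phi>)" "partial_deriv \<i> (partial_deriv \<i> \<phi>)"
  proof
    show "partial_deriv 1 (partial_deriv 1 \<phi>) z + partial_deriv \<i> (partial_deriv \<i> \<phi>) z > 0" if "z \<in> \<D>" for z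
      using bspec[OF lp that] unfolding lapl .
    show "integrable \<mu> \<omega>" using w by (simp add: weight_def)
  qed (use C1_on_pd[OF C1(1)] C1_on_pd[OF C1(2)] B1 om in auto)
  have "regular_weight \<omega> \<phi> (partial_deriv 1 \<phi>) (partial_deriv \<i> \<phi>) (partial_deriv 1 (partial_deriv 1 \<phi>)) (partial_deriv \<i> (partial_deriv \<i> \<phi>)) \<tau> \<delta> K L"
  proof
    show "\<tau> z > 0" if "z \<in> \<D>" for z by (rule t0[OF that])
    show "continuous_on \<D> \<tau>"
    proof (rule continuous_on_iff[THEN iffD2], intro ballI allI impI)
      fix z :: complex and e :: real assume z: "z \<in> \<D>" and e: "e > 0"
      show "\<exists>d>0. \<forall>x'\<in>\<D>. dist x' z < d \<longrightarrow> dist (\<tau> x') (\<tau> z) < e"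
      proof (intro exI[of _ "e / d2"] conjI ballI impI)
        show "e / d2 > 0" using e d by simp
        fix x assume x: "x \<in> \<D>" "dist x z < e / d2"
        hence "d2 * cmod (x - z) < e" using d by (simp add: dist_norm pos_less_divide_eq mult.commute)
        thus "dist (\<tau> x) (\<tau> z) < e" using le2[OF x(1) z] by (simp add: dist_real_def)
      qed
    qed
    show "0 < \<delta>" "\<delta> \<le> 1" by (fact \<delta>)+
    show "cmod z + 2 * \<delta> * \<tau> z < 1" if z: "z \<in> \<D>" for z
    proof -
      have "2 * \<delta> * \<tau> z \<le> 2 * \<delta> * (d1 * (1 - cmod z))" using \<delta> by (intro mult_left_mono le1[OF z]) auto
      also have "\<dots> = (2 * (\<delta> * d1)) * (1 - cmod z)" by (simp add: mult_ac)
      also have "\<dots> \<le> 1 / 2 * (1 - cmod z)" using \<delta>(3) z by (intro mult_right_mono) auto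
      finally show ?thesis using z by simp
    qed
    show "\<tau> z \<le> 2 * \<tau> \<xi> \<and> \<tau> \<xi> \<le> 2 * \<tau> z" if z: "z \<in> \<D>" and x: "\<xi> \<in> \<D>" and n: "cmod (\<xi> - z) \<le> \<delta> * \<tau> z" for z \<xi>
    proof -
      have "d2 * cmod (\<xi> - z) \<le> d2 * (\<delta> * \<tau> z)" using d by (intro mult_left_mono n) auto
      also have "\<dots> = (\<delta> * d2) * \<tau> z" by (simp add: mult_ac)
      also have "\<dots> \<le> 1 / 4 * \<tau> z" using \<delta>(4) t0[OF z] by (intro mult_right_mono) auto
      finally have "\<bar>\<tau> \<xi> - \<tau> z\<bar> \<le> 1 / 4 * \<tau> z" using le2[OF x z] by linarith
      thus ?thesis using t0[OF z] by linarith
    qed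
    show "1 \<le> K" "1 \<le> L" by (fact K1, fact L1)
    show "lap z \<le> K / (\<tau> z)\<^sup>2" "1 / (K * (\<tau> z)\<^sup>2) \<le> lap z" if z: "z \<in> \<D>" for z
      using lap[OF z] unfolding lap_def lapl by simp_all
    show "64 * K * (\<tau> z)\<^sup>2 \<le> L\<^sup>2 * (\<tau> w)\<^sup>2 + (cmod (z - w))\<^sup>2" if "z \<in> \<D>" "w \<in> \<D>" for z w
      by (rule slow[OF that])
  qed
  thus ?thesis by blast
qed

theorem theorem6p2:
  fixes \<omega> :: "complex \<Rightarrow> real" and p p' :: real
  assumes "\<omega> \<in> class_E" and "1 < p" and "p' = p / (p - 1)"
  shows "(\<forall>g \<in> bergman p' \<omega>.
            (\<forall>f \<in> bergman p \<omega>. integrable disk_area (\<lambda>z. f z * cnj (g z) * of_real (\<omega> z))) \<and>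
            (\<lambda>f. pairing \<omega> f g) \<in> bergman_dual p \<omega>) \<and>
         (\<forall>\<Lambda> \<in> bergman_dual p \<omega>.
            \<exists>!g. g \<in> bergman p' \<omega> \<and> (\<forall>f \<in> bergman p \<omega>. \<Lambda> f = pairing \<omega> f g)) \<and>
         comparable_on (bergman p' \<omega>)
           (\<lambda>g. dual_norm p \<omega> (\<lambda>f. pairing \<omega> f g)) (\<lambda>g. bergman_norm p' \<omega> g)"
proof -
  obtain \<phi> px py pxx pyy \<tau> \<delta> K L where "regular_weight \<omega> \<phi> px py pxx pyy \<tau> \<delta> K L"
    using class_E_regular_weight[OF assms(1)] by blast
  then interpret regular_weight \<omega> \<phi> px py pxx pyy \<tau> \<delta> K L .
  show ?thesis by (rule bergman_duality[OF assms(2,3)])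
qed

end
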